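(* For every integer $k\geq 1$, the group $\mathrm{Sp}(4k,\mathbb{Z})$ contains a subgroup that is isomorphic to the fundamental group of a closed connected orientable surface of genus at least $2$ and that is Zariski-dense in $\mathrm{Sp}(4k,\mathbb{R})$.
   Context: $\mathrm{Sp}(2n,\mathbb{R})$ is the group of real $2n\times 2n$ matrices preserving the standard symplectic form on $\mathbb{R}^{2n}$, and $\mathrm{Sp}(2n,\mathbb{Z})$ is its subgroup of matrices with integer entries. A surface subgroup is a subgroup isomorphic to the fundamental group of a closed (connected) orientable surface of genus at least $2$. *)

theory Defs
  imports
    "HOL-Analysis.Analysis"
    "HOL-Homology.Homology"
    "Jordan_Normal_Form.Matrix"
begin

section \<open>Symplectic groups\<close>

definition symplectic_form :: "nat \<Rightarrow> real Matrix.vec \<Rightarrow> real Matrix.vec \<Rightarrow> real" where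
  "symplectic_form n x y =
     (\<Sum>i<n. vec_index x i * vec_index y (n + i) - vec_index x (n + i) * vec_index y i)"

definition Sp_real :: "nat \<Rightarrow> real mat monoid" where
  "Sp_real n =
     \<lparr>carrier = {A \<in> carrier_mat (2 * n) (2 * n).
         \<forall>x \<in> carrier_vec (2 * n). \<forall>y \<in> carrier_vec (2 * n).
           symplectic_form n (A *\<^sub>v x) (A *\<^sub>v y) = symplectic_form n x y},
      monoid.mult = (\<lambda>A B. A * B),
      one = 1\<^sub>m (2 * n)\<rparr>"

definition Sp_int :: "nat \<Rightarrow> real mat monoid" where
  "Sp_int n = (Sp_real n)\<lparr>carrier := {A \<in> carrier (Sp_real n). elements_mat A \<subseteq> \<int>}\<rparr>"


section \<open>The Zariski topology on square matrices\<close>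

inductive_set polynomial_functions :: "nat \<Rightarrow> (real mat \<Rightarrow> real) set" for m :: nat where
  const: "(\<lambda>A. c) \<in> polynomial_functions m"
| entry: "i < m \<Longrightarrow> j < m \<Longrightarrow> (\<lambda>A. A $$ (i, j)) \<in> polynomial_functions m"
| add: "p \<in> polynomial_functions m \<Longrightarrow> q \<in> polynomial_functions m \<Longrightarrow>
          (\<lambda>A. p A + q A) \<in> polynomial_functions m"
| mult: "p \<in> polynomial_functions m \<Longrightarrow> q \<in> polynomial_functions m \<Longrightarrow>
          (\<lambda>A. p A * q A) \<in> polynomial_functions m"

definition zero_locus :: "nat \<Rightarrow> (real mat \<Rightarrow> real) set \<Rightarrow> real mat set" where
  "zero_locus m P = {A \<in> carrier_mat m m. \<forall>p \<in> P. p A = 0}"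

definition zariski_topology :: "nat \<Rightarrow> real mat topology" where
  "zariski_topology m =
     topology (\<lambda>U. \<exists>P \<subseteq> polynomial_functions m. U = carrier_mat m m - zero_locus m P)"

lemma openin_zariski_topology:
  "openin (zariski_topology m) U \<longleftrightarrow>
     (\<exists>P \<subseteq> polynomial_functions m. U = carrier_mat m m - zero_locus m P)"
proof -
  let ?O = "\<lambda>U. \<exists>P \<subseteq> polynomial_functions m. U = carrier_mat m m - zero_locus m P"
  have "istopology ?O"
    unfolding istopology_def
  proof (intro conjI allI impI)
    fix S T assume "?O S" "?O T"
    then obtain P Q where P: "P \<subseteq> polynomial_functions m" "S = carrier_mat m m - zero_locus m P"
      and Q: "Q \<subseteq> polynomial_functions m" "T = carrier_mat m m - zero_locus m Q"
      by blast
    define R where "R = (\<lambda>(p, q) A. p A * q A) ` (P \<times> Q)"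
    have "R \<subseteq> polynomial_functions m"
      unfolding R_def
    proof (rule image_subsetI)
      fix pq assume "pq \<in> P \<times> Q"
      then have "fst pq \<in> polynomial_functions m" "snd pq \<in> polynomial_functions m"
        using P(1) Q(1) by auto
      then show "(\<lambda>(p, q) A. p A * q A) pq \<in> polynomial_functions m"
        by (simp add: case_prod_beta polynomial_functions.mult)
    qed
    moreover have "(\<forall>r\<in>R. r A = 0) \<longleftrightarrow> (\<forall>p\<in>P. p A = 0) \<or> (\<forall>q\<in>Q. q A = 0)" for A
      unfolding R_def by (simp add: split_paired_Ball_Sigma)
    then have "S \<inter> T = carrier_mat m m - zero_locus m R"
      unfolding P(2) Q(2) zero_locus_def by blast
    ultimately show "?O (S \<inter> T)"
      by blast
  next
    fix \<U> assume "\<forall>U\<in>\<U>. ?O U"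
    then have "\<exists>P. \<forall>U\<in>\<U>. P U \<subseteq> polynomial_functions m \<and>
        U = carrier_mat m m - zero_locus m (P U)"
      by (intro bchoice) blast
    then obtain P where P: "\<And>U. U \<in> \<U> \<Longrightarrow> P U \<subseteq> polynomial_functions m"
      "\<And>U. U \<in> \<U> \<Longrightarrow> U = carrier_mat m m - zero_locus m (P U)"
      by blast
    have "(\<Union>U\<in>\<U>. P U) \<subseteq> polynomial_functions m"
      using P(1) by blast
    moreover have "\<Union>\<U> = (\<Union>U\<in>\<U>. U)"
      by simp
    then have "\<Union>\<U> = (\<Union>U\<in>\<U>. carrier_mat m m - zero_locus m (P U))"
      using SUP_cong[OF refl P(2), of \<U>] by (rule trans)
    then have "\<Union>\<U> = carrier_mat m m - zero_locus m (\<Union>U\<in>\<U>. P U)"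
      unfolding zero_locus_def by blast
    ultimately show "?O (\<Union>\<U>)"
      by blast
  qed
  then show ?thesis
    by (simp add: zariski_topology_def)
qed

definition zariski_dense_in :: "nat \<Rightarrow> real mat set \<Rightarrow> real mat set \<Rightarrow> bool" where
  "zariski_dense_in m H G \<longleftrightarrow>
     H \<subseteq> G \<and> subtopology (zariski_topology m) G closure_of H = G"


section \<open>Closed orientable surfaces\<close>

definition closed_connected_surface :: "'a topology \<Rightarrow> bool" where
  "closed_connected_surface X \<longleftrightarrow>
     topspace X \<noteq> {} \<and> Hausdorff_space X \<and> second_countable X \<and>
     compact_space X \<and> connected_space X \<and>
     (\<forall>x \<in> topspace X. \<exists>U. openin X U \<and> x \<in> U \<and>
        subtopology X U homeomorphic_space Euclidean_space 2)"

text \<open>An orientation is a choice of a generator \<open>\<mu> x\<close> of the local homology group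
  \<open>H\<^sub>2(X, X - {x})\<close> (integer coefficients) at every point \<open>x\<close>, such that locally all \<open>\<mu> y\<close> are
  restrictions of a single class in \<open>H\<^sub>2(X, X - U)\<close>.\<close>

definition orientable_surface :: "'a topology \<Rightarrow> bool" where
  "orientable_surface X \<longleftrightarrow>
     (\<exists>\<mu>. (\<forall>x \<in> topspace X.
            let L = relative_homology_group 2 X (topspace X - {x})
            in carrier L = generate L {\<mu> x}) \<and>
          (\<forall>x \<in> topspace X. \<exists>U. openin X U \<and> x \<in> U \<and>
            (\<exists>\<alpha> \<in> carrier (relative_homology_group 2 X (topspace X - U)).
               \<forall>y \<in> U. hom_induced 2 X (topspace X - U) X (topspace X - {y}) id \<alpha> = \<mu> y)))"

definition simple_closed_curve_in :: "'a topology \<Rightarrow> 'a set \<Rightarrow> bool" where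
  "simple_closed_curve_in X C \<longleftrightarrow>
     C \<subseteq> topspace X \<and> subtopology X C homeomorphic_space nsphere 1"

text \<open>The genus is the largest number of pairwise disjoint simple closed curves along which the
  surface can be cut without becoming disconnected. This is the genus of closed connected
  \<^emph>\<open>orientable\<close> surfaces only.\<close>

definition surface_genus :: "'a topology \<Rightarrow> enat" where
  "surface_genus X =
     (SUP \<C> \<in> {\<C>. finite \<C> \<and> disjoint \<C> \<and> (\<forall>C \<in> \<C>. simple_closed_curve_in X C) \<and>
                   connected_space (subtopology X (topspace X - \<Union>\<C>))}. enat (card \<C>))"


section \<open>The fundamental group\<close>

text \<open>Loops are functions on all of \<^typ>\<open>real\<close>, of which only the restriction to \<open>{0..1}\<close>
  matters: \<^const>\<open>homotopic_with\<close> ignores the values elsewhere.\<close>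

definition loops_at :: "'a topology \<Rightarrow> 'a \<Rightarrow> (real \<Rightarrow> 'a) set" where
  "loops_at X a = {p. pathin X p \<and> p 0 = a \<and> p 1 = a}"

definition loop_class :: "'a topology \<Rightarrow> 'a \<Rightarrow> (real \<Rightarrow> 'a) \<Rightarrow> (real \<Rightarrow> 'a) set" where
  "loop_class X a p =
     {q. homotopic_with (\<lambda>r. r 0 = a \<and> r 1 = a) (top_of_set {0..1}) X p q}"

definition concat_loop :: "(real \<Rightarrow> 'a) \<Rightarrow> (real \<Rightarrow> 'a) \<Rightarrow> real \<Rightarrow> 'a" where
  "concat_loop p q = (\<lambda>t. if t \<le> 1/2 then p (2 * t) else q (2 * t - 1))"

definition fundamental_group :: "'a topology \<Rightarrow> 'a \<Rightarrow> (real \<Rightarrow> 'a) set monoid" where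
  "fundamental_group X a =
     \<lparr>carrier = loop_class X a ` loops_at X a,
      monoid.mult = (\<lambda>A B. \<Union>p\<in>A. \<Union>q\<in>B. loop_class X a (concat_loop p q)),
      one = loop_class X a (\<lambda>_. a)\<rparr>"

text \<open>Nonempty surfaces have the cardinality of the continuum, so every one of them is homeomorphic
  to a space whose points are real numbers. The type \<^typ>\<open>real topology\<close> serves only as a
  sufficiently large supply of points; the topology is unrelated to that of the real line.\<close>

definition surface_group :: "('g, 'b) monoid_scheme \<Rightarrow> bool" where
  "surface_group G \<longleftrightarrow>
     (\<exists>(X :: real topology) a.
        closed_connected_surface X \<and> orientable_surface X \<and> surface_genus X \<ge> 2 \<and>
        a \<in> topspace X \<and> G \<cong> fundamental_group X a)"

end

theory Submission
  imports Defs
begin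

text \<open>The reflection group of the right-angled hexagon acts on the surface of genus 17 that is
  tiled by 64 hexagons, one for every sign vector in \<open>{1, -1}\<^sup>6\<close>, and the fundamental group of this
  surface is the group of closed words in the six reflections. Words in the reflections are
  represented by \<open>4k \<times> 4k\<close> matrices obtained by bending: the reflection group is the amalgam of
  the groups generated by the sides 0, 1, 2, 3 and 3, 4, 5, 0 over the infinite dihedral group of the
  opposite sides 0 and 3. Each of the two acts, through \<open>2 \<times> 2\<close> matrices over \<open>\<rat>(sqrt 2)\<close>, as the
  reflection group of a Lambert quadrilateral with an ideal vertex, and the second action is conjugated
  by a unipotent symplectic matrix compatible with the dihedral group of the ideal vertex. The bent
  matrices of closed words are integral symplectic. A ping-pong argument for the amalgam of the
  two pieces gives faithfulness. For density, unipotent elements of the Zariski closure are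
  combined until they contain all symplectic transvections.\<close>

text \<open>In the upper half plane the quadrilateral is bounded by the lines Re z = 0 and Re z = 2
  and by the orthogonal circles of radius sqrt 2 about 0 and 2. Its group of 2 x 2 matrices is far
  too small to be dense. Conjugating one copy by an upper unipotent matrix with block B is
  compatible with the vertex group because the reflections in the two lines turn B into -B. The
  price is a sign of B that depends on the tile, so that \<open>hexrep\<close> is a cocycle on pairs
  of a tile and a word; on closed words it is a homomorphism. For ping-pong, B must not be
  compensated by a translation, whose block is a multiple of q: this is what \<open>tau\<close>
  achieves, since \<open>tau y\<close> is orthogonal to \<open>q y\<close>. Then q tau is skew and
  invertible, which forces even blocks and a dimension divisible by 4. Closed words meet every side
  an even number of times; this removes the determinants -1 and the factors sqrt 2 and restores the
  sign of B. The coefficient of \<open>tau\<close> has to be even for integrality and at least 3 for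
  the ping-pong estimate, hence 4.\<close>

no_notation Matrix.vec_index (infixl "$" 100)

section \<open>Words in the hexagon reflections\<close>

datatype side = S0 | S1 | S2 | S3 | S4 | S5

fun nx :: "side \<Rightarrow> side" where
  "nx S0 = S1" | "nx S1 = S2" | "nx S2 = S3" | "nx S3 = S4" | "nx S4 = S5" | "nx S5 = S0"

lemma UNIV_side: "UNIV = {S0, S1, S2, S3, S4, S5}"
  by (auto intro: side.exhaust)

instance side :: finite
  by standard (simp add: UNIV_side)

lemma all_side: "(\<forall>i. P i) \<longleftrightarrow> P S0 \<and> P S1 \<and> P S2 \<and> P S3 \<and> P S4 \<and> P S5"
  by (metis side.exhaust)

lemma nx_neq [simp]: "nx i \<noteq> i" "i \<noteq> nx i"
  by (cases i; simp)+

text \<open>A state is a sign vector, i.e. a tile; crossing the side \<open>i\<close> flips the sign \<open>i\<close>.\<close>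

definition flip :: "(side \<Rightarrow> bool) \<Rightarrow> side \<Rightarrow> side \<Rightarrow> bool" where
  "flip c i = c(i := \<not> c i)"

fun run :: "(side \<Rightarrow> bool) \<Rightarrow> side list \<Rightarrow> side \<Rightarrow> bool" where
  "run c [] = c"
| "run c (i # w) = run (flip c i) w"

lemma flip_apply: "flip c i j = (if j = i then \<not> c i else c j)"
  by (simp add: flip_def)

lemma run_append: "run c (u @ v) = run (run c u) v"
  by (induction u arbitrary: c) auto

lemma run_apply: "run c w j \<longleftrightarrow> (c j \<noteq> odd (count_list w j))"
  by (induction w arbitrary: c) (auto simp: flip_apply)

text \<open>Equality in the reflection group of the right-angled hexagon.\<close>

inductive weq :: "side list \<Rightarrow> side list \<Rightarrow> bool" where
  refl [simp]: "weq w w"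
| sym: "weq u v \<Longrightarrow> weq v u"
| trans [trans]: "weq u v \<Longrightarrow> weq v w \<Longrightarrow> weq u w"
| cancel: "weq [i, i] []"
| swap: "weq [i, nx i] [nx i, i]"
| app: "weq u u' \<Longrightarrow> weq v v' \<Longrightarrow> weq (u @ v) (u' @ v')"

lemma weq_odd: "weq u v \<Longrightarrow> odd (count_list u j) = odd (count_list v j)"
  by (induction rule: weq.induct) auto

lemma weq_run: "weq u v \<Longrightarrow> run c u = run c v"
  by (rule ext) (simp add: run_apply weq_odd)

lemma weq_Cons: "weq u v \<Longrightarrow> weq (i # u) (i # v)"
  using weq.app[of "[i]" "[i]" u v] by simp

lemma weq_cancel_Cons: "weq (i # i # u) u"
  using weq.app[OF weq.cancel[of i] weq.refl, of u] by simp

lemma weq_rev_append: "weq (rev w @ w) []"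
proof (induction w)
  case (Cons i w)
  have "weq (rev w @ (i # i # w)) (rev w @ w)"
    by (intro weq.app weq.refl weq_cancel_Cons)
  then show ?case
    using Cons weq.trans by fastforce
qed simp

lemma weq_append_rev: "weq (w @ rev w) []"
  using weq_rev_append[of "rev w"] by simp

definition pair_nf :: "side \<Rightarrow> side list \<Rightarrow> side list" where
  "pair_nf i w = (if odd (count_list w i) then [i] else []) @
     (if odd (count_list w (nx i)) then [nx i] else [])"

lemma weq_pair_nf:
  assumes "set w \<subseteq> {i, nx i}"
  shows "weq w (pair_nf i w)"
  using assms
proof (induction w)
  case Nil
  then show ?case by (simp add: pair_nf_def)
next
  case (Cons j w)
  then have "weq (j # w) (j # pair_nf i w)"
    by (intro weq_Cons) auto
  also have "weq (j # pair_nf i w) (pair_nf i (j # w))"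
  proof (cases "j = i")
    case True
    then show ?thesis
      by (auto simp: pair_nf_def weq.cancel weq_cancel_Cons)
  next
    case False
    then have j: "j = nx i" using Cons.prems by auto
    have "weq [nx i, i, nx i] [i, nx i, nx i]"
      using weq.app[OF weq.sym[OF weq.swap[of i]] weq.refl[of "[nx i]"]] by simp
    also have "weq [i, nx i, nx i] [i]"
      by (intro weq_Cons weq.cancel)
    finally show ?thesis
      using j by (auto simp: pair_nf_def weq.cancel intro: weq.sym weq.swap)
  qed
  finally show ?case .
qed

text \<open>Two neighbouring reflections generate a Klein four-group, on which the parities of the
  letters, hence the effect on one tile, are a complete invariant. This makes words inside a vertex
  chart well defined.\<close>

lemma weq_pair:
  assumes "set u \<subseteq> {i, nx i}" "set v \<subseteq> {i, nx i}" "run c u = run c v"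
  shows "weq u v"
proof -
  have "odd (count_list u j) = odd (count_list v j)" for j
    using assms(3) run_apply[of c u j] run_apply[of c v j] by auto
  then have "pair_nf i u = pair_nf i v"
    by (simp add: pair_nf_def)
  then show ?thesis
    by (metis assms(1,2) weq.sym weq.trans weq_pair_nf)
qed

text \<open>Every side at which the signs differ is crossed once, in a fixed order. Around a common
  vertex the order is immaterial up to \<open>weq\<close>; for distant tiles the word is merely one
  way from \<open>c\<close> to \<open>c'\<close>.\<close>

definition dw :: "(side \<Rightarrow> bool) \<Rightarrow> (side \<Rightarrow> bool) \<Rightarrow> side list" where
  "dw c c' = filter (\<lambda>j. c j \<noteq> c' j) [S0, S1, S2, S3, S4, S5]"

lemma run_dw [simp]: "run c (dw c c') = c'"
proof
  fix j
  show "run c (dw c c') j = c' j"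
    unfolding run_apply by (cases j) (auto simp: dw_def)
qed

lemma set_dw: "set (dw c c') = {j. c j \<noteq> c' j}"
proof -
  have "j \<in> set [S0, S1, S2, S3, S4, S5]" for j by (cases j) auto
  then show ?thesis
    unfolding dw_def set_filter by blast
qed

lemma dw_same [simp]: "dw c c = []"
  by (simp add: dw_def)

section \<open>The hexagonal surface\<close>

text \<open>The squares \<open>a\<^sub>i = x\<^sub>i\<^sup>2\<close> of the coordinates satisfy \<open>a\<^sub>i + a\<^bsub>i+2\<^esub> = 1 + a\<^bsub>i+1\<^esub>\<close>. This linear
  system has a plane of solutions, in which \<open>a\<^sub>i \<ge> 0\<close> cuts out a hexagon.\<close>

definition hexsurf :: "(real^side) set" where
  "hexsurf = {x. \<forall>i. (x $ i)\<^sup>2 + (x $ nx (nx i))\<^sup>2 = 1 + (x $ nx i)\<^sup>2}"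

definition sg :: "bool \<Rightarrow> real" where
  "sg b = (if b then 1 else -1)"

lemma sg_simps [simp]: "sg True = 1" "sg False = -1" "(sg b)\<^sup>2 = 1" "sg b * sg b = 1" "\<bar>sg b\<bar> = 1"
  "sg (\<not> b) = - sg b" "sg b \<noteq> 0" "sg b * (sg b * r) = r"
  by (auto simp: sg_def)

text \<open>An affine parametrization of the solution plane, centred at the point where all squares
  are 1. The hexagon consists of the points with \<open>u\<close>, \<open>v\<close> and
  \<open>u - v\<close> in [-1, 1].\<close>

fun lin :: "side \<Rightarrow> real \<Rightarrow> real \<Rightarrow> real" where
  "lin S0 u v = 1 - u"
| "lin S1 u v = 1 - v"
| "lin S2 u v = 1 - v + u"
| "lin S3 u v = 1 + u"
| "lin S4 u v = 1 + v"
| "lin S5 u v = 1 - u + v"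

definition pos :: "(side \<Rightarrow> bool) \<Rightarrow> real \<Rightarrow> real \<Rightarrow> real^side" where
  "pos c u v = (\<chi> i. sg (c i) * sqrt (lin i u v))"

definition sigma :: "real^side \<Rightarrow> side \<Rightarrow> bool" where
  "sigma x = (\<lambda>i. x $ i \<ge> 0)"

definition xu :: "real^side \<Rightarrow> real" where "xu x = 1 - (x $ S0)\<^sup>2"
definition xv :: "real^side \<Rightarrow> real" where "xv x = 1 - (x $ S1)\<^sup>2"

lemma hexsurf_iff: "x \<in> hexsurf \<longleftrightarrow> (\<forall>i. (x $ i)\<^sup>2 = lin i (xu x) (xv x))"
  unfolding hexsurf_def all_side mem_Collect_eq nx.simps lin.simps xu_def xv_def
  by (intro iffI conjI; elim conjE; linarith)

lemma hexsurf_lin: "x \<in> hexsurf \<Longrightarrow> lin i (xu x) (xv x) = (x $ i)\<^sup>2"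
  by (simp add: hexsurf_iff)

lemma lin_rec: "lin i u v + lin (nx (nx i)) u v = 1 + lin (nx i) u v"
  by (cases i) auto

lemma lin_0 [simp]: "lin i 0 0 = 1"
  by (cases i) auto

lemma lin_scale: "lin i (t * u) (t * v) = (1 - t) + t * lin i u v"
  by (cases i) (auto simp: algebra_simps)

lemma hexsurf_sqrtI:
  assumes "\<And>i. 0 \<le> a i" "\<And>i. a i + a (nx (nx i)) = 1 + a (nx i)" "\<And>i. (x $ i)\<^sup>2 = a i"
  shows "x \<in> hexsurf"
  using assms by (simp add: hexsurf_def)

lemma pos_in_hexsurf: "(\<And>i. 0 \<le> lin i u v) \<Longrightarrow> pos c u v \<in> hexsurf"
  by (rule hexsurf_sqrtI[where a = "\<lambda>i. lin i u v"])
     (auto simp: pos_def power_mult_distrib lin_rec)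

lemma pos_sigma: "x \<in> hexsurf \<Longrightarrow> pos (sigma x) (xu x) (xv x) = x"
  unfolding Finite_Cartesian_Product.vec_eq_iff by (auto simp: pos_def hexsurf_lin sigma_def sg_def)

lemma compact_hexsurf: "compact hexsurf"
proof -
  have "closed {x::real^side. (x $ i)\<^sup>2 + (x $ nx (nx i))\<^sup>2 = 1 + (x $ nx i)\<^sup>2}" for i
    by (intro closed_Collect_eq continuous_intros)
  then have "closed (\<Inter>i. {x::real^side. (x $ i)\<^sup>2 + (x $ nx (nx i))\<^sup>2 = 1 + (x $ nx i)\<^sup>2})"
    by (intro closed_INT ballI)
  moreover have "hexsurf = (\<Inter>i. {x. (x $ i)\<^sup>2 + (x $ nx (nx i))\<^sup>2 = 1 + (x $ nx i)\<^sup>2})"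
    by (auto simp: hexsurf_def)
  ultimately have "closed hexsurf"
    by simp
  moreover have "bounded hexsurf"
  proof -
    have "\<bar>x $ i\<bar> \<le> 2" if "x \<in> hexsurf" for x i
    proof -
      have "lin j (xu x) (xv x) \<ge> 0" for j
        using that by (simp add: hexsurf_lin)
      from this[of S0] this[of S1] this[of S2] this[of S3] this[of S4] this[of S5]
      \<comment> \<open>Opposite values of \<open>lin\<close> add up to 2, so 2 is already a bound;
        the square is taken for the comparison of absolute values that follows.\<close>
      have "lin i (xu x) (xv x) \<le> 2\<^sup>2"
        by (cases i) auto
      then show ?thesis
        using that by (simp add: hexsurf_lin abs_le_square_iff[of _ 2, simplified])
    qed
    then have "norm x \<le> (\<Sum>i\<in>(UNIV::side set). 2)" if "x \<in> hexsurf" for x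
      using that by (intro order_trans[OF norm_le_l1_cart] sum_mono)
    then show ?thesis
      unfolding bounded_iff by blast
  qed
  ultimately show ?thesis
    by (simp add: compact_eq_bounded_closed)
qed

text \<open>The chart around the vertex between the sides \<open>i\<close> and \<open>nx i\<close>.\<close>

definition chart_nbhd :: "side \<Rightarrow> (side \<Rightarrow> bool) \<Rightarrow> (real^side) set" where
  "chart_nbhd i c = {x. \<forall>j. j \<noteq> i \<and> j \<noteq> nx i \<longrightarrow> 0 < x $ j * sg (c j)}"

definition chart :: "side \<Rightarrow> (side \<Rightarrow> bool) \<Rightarrow> (real^side) set" where
  "chart i c = hexsurf \<inter> chart_nbhd i c"

lemma open_chart_nbhd: "open (chart_nbhd i c)"
proof -
  have "open {x::real^side. (j \<noteq> i \<and> j \<noteq> nx i) \<longrightarrow> 0 < x $ j * sg (c j)}" for j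
    by (cases "j \<noteq> i \<and> j \<noteq> nx i") (auto intro!: open_Collect_less continuous_intros)
  moreover have "chart_nbhd i c = (\<Inter>j\<in>UNIV. {x. j \<noteq> i \<and> j \<noteq> nx i \<longrightarrow> 0 < x $ j * sg (c j)})"
    by (auto simp: chart_nbhd_def)
  ultimately show ?thesis
    by (simp add: open_INT)
qed

lemma chart_cong: "(\<And>j. j \<noteq> i \<Longrightarrow> j \<noteq> nx i \<Longrightarrow> c j = c' j) \<Longrightarrow> chart i c = chart i c'"
  by (auto simp: chart_def chart_nbhd_def)

lemma chart_flip [simp]: "chart i (flip c i) = chart i c" "chart i (flip c (nx i)) = chart i c"
  by (auto intro!: chart_cong simp: flip_apply)

lemma sigma_chart: "x \<in> chart i c \<Longrightarrow> j \<noteq> i \<Longrightarrow> j \<noteq> nx i \<Longrightarrow> sigma x j = c j"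
  by (auto simp: chart_def chart_nbhd_def sigma_def sg_def zero_less_mult_iff split: if_splits)

lemma chart_sigma: "x \<in> chart i c \<Longrightarrow> chart i (sigma x) = chart i c"
  by (rule chart_cong) (rule sigma_chart)

lemma set_dw_chart: "x \<in> chart i c \<Longrightarrow> y \<in> chart i c \<Longrightarrow> set (dw (sigma x) (sigma y)) \<subseteq> {i, nx i}"
  using sigma_chart unfolding set_dw by blast

lemma dw_cocycle:
  assumes "x \<in> chart i c" "y \<in> chart i c" "z \<in> chart i c"
  shows "weq (dw (sigma x) (sigma y) @ dw (sigma y) (sigma z)) (dw (sigma x) (sigma z))"
  by (rule weq_pair[of _ i _ "sigma x"])
     (use assms set_dw_chart in \<open>auto simp: run_append\<close>)

text \<open>Only neighbouring sides of the hexagon meet: the values of \<open>lin\<close> at sides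
  two apart have sum at least 1, those at opposite sides have sum 2.\<close>

lemma hexsurf_adjacent_zeros:
  assumes "x \<in> hexsurf" "x $ i = 0" "j \<noteq> i" "j \<noteq> nx i" "nx j \<noteq> i"
  shows "x $ j \<noteq> 0"
proof
  assume "x $ j = 0"
  then have "lin j (xu x) (xv x) = 0" "lin i (xu x) (xv x) = 0" "\<And>k. lin k (xu x) (xv x) \<ge> 0"
    using assms by (auto simp: hexsurf_lin)
  from this(1,2) this(3)[of S0] this(3)[of S1] this(3)[of S2] this(3)[of S3] this(3)[of S4] this(3)[of S5]
  show False
    using assms(3-) by (cases i; cases j; simp)
qed

lemma ex_chart:
  assumes "x \<in> hexsurf"
  obtains i where "x \<in> chart i (sigma x)"
proof -
  have *: "x \<in> chart i (sigma x)" if "\<And>j. j \<noteq> i \<Longrightarrow> j \<noteq> nx i \<Longrightarrow> x $ j \<noteq> 0" for i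
    using that assms by (force simp: chart_def chart_nbhd_def sigma_def sg_def less_le)
  show ?thesis
  proof (cases "\<exists>i. x $ i = 0")
    case True
    then obtain i where i: "x $ i = 0" by blast
    obtain k where k: "nx k = i" by (cases i) (use nx.simps in blast)+
    show ?thesis
    proof (cases "x $ nx i = 0")
      case True
      have "x $ j \<noteq> 0" if "j \<noteq> i" "j \<noteq> nx i" for j
      proof (cases "nx j = i")
        case False
        then show ?thesis using hexsurf_adjacent_zeros[OF assms i that(1,2)] by simp
      next
        case nj: True
        have "j \<noteq> nx (nx i)" "nx j \<noteq> nx i" using nj by (cases i; cases j; simp)+
        then show ?thesis using hexsurf_adjacent_zeros[OF assms True that(2)] by simp
      qed
      then show ?thesis using * that by blast
    next
      case False
      \<comment> \<open>The side \<open>k\<close> before \<open>i\<close> may vanish at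
        \<open>x\<close> as well, so the vertex between \<open>k\<close> and \<open>i\<close> is the
        safe choice.\<close>
      have "x $ j \<noteq> 0" if "j \<noteq> k" "j \<noteq> nx k" for j
      proof -
        have "nx j \<noteq> i" using k that by (cases j; cases k; auto)
        then show ?thesis
          using hexsurf_adjacent_zeros[OF assms i] that k False by (cases "j = nx i") auto
      qed
      then show ?thesis using * that by blast
    qed
  next
    case False
    then show ?thesis using * that by blast
  qed
qed

text \<open>The coordinates \<open>u\<close>, \<open>v\<close> of the vertex where the sides
  \<open>i\<close> and \<open>nx i\<close> meet; \<open>al i\<close> below collects the squares
  there.\<close>

fun vtu :: "side \<Rightarrow> real" where
  "vtu S0 = 1" | "vtu S1 = 0" | "vtu S2 = -1" | "vtu S3 = -1" | "vtu S4 = 0" | "vtu S5 = 1"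
fun vtv :: "side \<Rightarrow> real" where
  "vtv S0 = 1" | "vtv S1 = 1" | "vtv S2 = 0" | "vtv S3 = -1" | "vtv S4 = -1" | "vtv S5 = 0"

definition al :: "side \<Rightarrow> side \<Rightarrow> real" where
  "al i j = lin j (vtu i) (vtv i)"

lemma al_simps [simp]: "al i i = 0" "al i (nx i) = 0" "al (nx i) i = 1" "al i j \<ge> 0"
  by (cases i; cases j; simp add: al_def)+

lemma al_pos: "j \<noteq> i \<Longrightarrow> j \<noteq> nx i \<Longrightarrow> al i j > 0"
  by (cases i; cases j; simp add: al_def)

lemma al_rec: "al i j + al i (nx (nx j)) = 1 + al i (nx j)"
  by (simp add: al_def lin_rec)

text \<open>In the squares of the coordinates the homotopy is the linear contraction of the hexagon
  to its vertex, with parameter \<open>t^2\<close>. The two coordinates that vanish at the vertex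
  are then simply multiplied by \<open>t\<close>, which is continuous across their zeros.\<close>

lemma contractible_chart: "contractible (chart i c)"
proof -
  define h :: "real \<Rightarrow> real^side \<Rightarrow> real^side" where
    "h t x = (\<chi> j. if j = i \<or> j = nx i then t * x $ j
        else sg (c j) * sqrt ((1 - t\<^sup>2) * al i j + t\<^sup>2 * (x $ j)\<^sup>2))" for t x
  have h0: "h 0 x = h 0 y" for x y
    by (auto simp: h_def fun_eq_iff)
  have h1: "h 1 x = x" if "x \<in> chart i c" for x
    using that by (auto simp: h_def Finite_Cartesian_Product.vec_eq_iff chart_def chart_nbhd_def sg_def zero_less_mult_iff)
  have hin: "h t x \<in> chart i c" if x: "x \<in> chart i c" and t: "t \<in> {0..1}" for t x
  proof -
    have t2: "t\<^sup>2 \<le> 1" using t by (simp add: power_le_one)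
    let ?a = "\<lambda>j. (1 - t\<^sup>2) * al i j + t\<^sup>2 * (x $ j)\<^sup>2"
    have nn: "?a j \<ge> 0" for j using t2 by simp
    have "?a j + ?a (nx (nx j)) = 1 + ?a (nx j)" for j
    proof -
      have "(x $ j)\<^sup>2 + (x $ nx (nx j))\<^sup>2 = 1 + (x $ nx j)\<^sup>2"
        using x by (simp add: chart_def hexsurf_def)
      then have "(1 - t\<^sup>2) * (al i j + al i (nx (nx j))) + t\<^sup>2 * ((x $ j)\<^sup>2 + (x $ nx (nx j))\<^sup>2)
         = (1 - t\<^sup>2) * (1 + al i (nx j)) + t\<^sup>2 * (1 + (x $ nx j)\<^sup>2)"
        by (simp only: al_rec)
      then show ?thesis by (simp add: algebra_simps)
    qed
    then have "h t x \<in> hexsurf"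
      by (intro hexsurf_sqrtI[where a = ?a] nn) (auto simp: h_def power_mult_distrib nn)
    moreover have "0 < h t x $ j * sg (c j)" if j: "j \<noteq> i" "j \<noteq> nx i" for j
    proof -
      have "x $ j \<noteq> 0" using x j by (auto simp: chart_def chart_nbhd_def)
      then have "?a j > 0"
        using t2 al_pos[OF j] by (cases "t = 0") (auto intro!: add_nonneg_pos)
      then show ?thesis
        using j by (simp add: h_def mult.assoc mult.commute)
    qed
    ultimately show ?thesis by (simp add: chart_def chart_nbhd_def)
  qed
  have cont: "continuous_on ({0..1} \<times> chart i c) (\<lambda>z. h (fst z) (snd z))"
    unfolding h_def
  proof (rule continuous_on_vec_lambda)
    show "continuous_on ({0..1} \<times> chart i c) (\<lambda>z. if j = i \<or> j = nx i then fst z * snd z $ j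
        else sg (c j) * sqrt ((1 - (fst z)\<^sup>2) * al i j + (fst z)\<^sup>2 * (snd z $ j)\<^sup>2))" for j
      by (cases "j = i \<or> j = nx i") (simp_all, auto intro!: continuous_intros)
  qed
  have "homotopic_with_canon (\<lambda>x. True) (chart i c) (chart i c) (\<lambda>x. h 0 0) id"
    by (subst homotopic_with, simp, rule exI[of _ "\<lambda>z. h (fst z) (snd z)"])
       (use cont hin h0 h1 in \<open>auto simp: prod_topology_subtopology_eu\<close>)
  then show ?thesis
    unfolding contractible_def using homotopic_with_symD by blast
qed

section \<open>Generation of the symplectic group by transvections\<close>

lemma sf_add:
  assumes "x \<in> carrier_vec (2 * n)" "y \<in> carrier_vec (2 * n)" "z \<in> carrier_vec (2 * n)"
  shows "symplectic_form n (x + y) z = symplectic_form n x z + symplectic_form n y z"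
    "symplectic_form n z (x + y) = symplectic_form n z x + symplectic_form n z y"
  using assms unfolding symplectic_form_def sum.distrib[symmetric]
  by (auto intro!: sum.cong simp: algebra_simps)

lemma sf_diff:
  assumes "x \<in> carrier_vec (2 * n)" "y \<in> carrier_vec (2 * n)" "z \<in> carrier_vec (2 * n)"
  shows "symplectic_form n (x - y) z = symplectic_form n x z - symplectic_form n y z"
    "symplectic_form n z (x - y) = symplectic_form n z x - symplectic_form n z y"
  using assms unfolding symplectic_form_def sum_subtractf[symmetric]
  by (auto intro!: sum.cong simp: algebra_simps)

lemma sf_smult:
  assumes "x \<in> carrier_vec (2 * n)" "z \<in> carrier_vec (2 * n)"
  shows "symplectic_form n (r \<cdot>\<^sub>v x) z = r * symplectic_form n x z"
    "symplectic_form n z (r \<cdot>\<^sub>v x) = r * symplectic_form n z x"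
  using assms unfolding symplectic_form_def sum_distrib_left
  by (auto intro!: sum.cong simp: algebra_simps)

lemma sf_swap: "symplectic_form n x y = - symplectic_form n y x"
  unfolding symplectic_form_def sum_negf[symmetric] by (intro sum.cong) auto

lemma sf_self [simp]: "symplectic_form n x x = 0"
  using sf_swap[of n x x] by simp

lemma sf_unit:
  assumes "j < n"
  shows "symplectic_form n (unit_vec (2 * n) j) y = vec_index y (n + j)"
    "symplectic_form n (unit_vec (2 * n) (n + j)) y = - vec_index y j"
proof -
  have "symplectic_form n (unit_vec (2 * n) j) y = (\<Sum>i<n. if i = j then vec_index y (n + j) else 0)"
    unfolding symplectic_form_def using assms by (intro sum.cong) (auto simp: unit_vec_def)
  then show "symplectic_form n (unit_vec (2 * n) j) y = vec_index y (n + j)"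
    using assms by (simp add: sum.delta)
  have "symplectic_form n (unit_vec (2 * n) (n + j)) y = (\<Sum>i<n. if i = j then - vec_index y j else 0)"
    unfolding symplectic_form_def using assms by (intro sum.cong) (auto simp: unit_vec_def)
  then show "symplectic_form n (unit_vec (2 * n) (n + j)) y = - vec_index y j"
    using assms by (simp add: sum.delta)
qed

lemma mat_eq_by_vec:
  fixes A B :: "real mat"
  assumes "A \<in> carrier_mat m n" "B \<in> carrier_mat m n"
    "\<And>v. v \<in> carrier_vec n \<Longrightarrow> A *\<^sub>v v = B *\<^sub>v v"
  shows "A = B"
proof (rule eq_matI)
  fix i j assume ij: "i < dim_row B" "j < dim_col B"
  have "X $$ (i, j) = vec_index (X *\<^sub>v unit_vec n j) i" if "X \<in> carrier_mat m n" for X :: "real mat"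
    using that ij assms(2) by (auto simp: scalar_prod_right_unit)
  then show "A $$ (i, j) = B $$ (i, j)"
    using assms by (metis unit_vec_carrier)
qed (use assms in auto)

text \<open>The matrix of the map sending \<open>u\<close> to \<open>u + c * omega(v, u) v\<close>,
  where omega is the symplectic form.\<close>

definition transvection :: "nat \<Rightarrow> real Matrix.vec \<Rightarrow> real \<Rightarrow> real mat" where
  "transvection n v c = Matrix.mat (2 * n) (2 * n)
     (\<lambda>(i, j). (if i = j then 1 else 0) + c * vec_index v i * symplectic_form n v (unit_vec (2 * n) j))"

lemma transvection_carrier [simp]: "transvection n v c \<in> carrier_mat (2 * n) (2 * n)"
  by (simp add: transvection_def)

lemma sf_expand:
  assumes "u \<in> carrier_vec (2 * n)"
  shows "(\<Sum>j\<in>{0..<2*n}. symplectic_form n v (unit_vec (2 * n) j) * vec_index u j) = symplectic_form n v u"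
proof -
  have "(\<Sum>j\<in>{0..<2*n}. symplectic_form n v (unit_vec (2 * n) j) * vec_index u j)
     = (\<Sum>j\<in>{0..<n}. symplectic_form n v (unit_vec (2 * n) j) * vec_index u j)
      + (\<Sum>j\<in>{n..<n+n}. symplectic_form n v (unit_vec (2 * n) j) * vec_index u j)"
    by (simp add: sum.atLeastLessThan_concat mult_2)
  also have "(\<Sum>j\<in>{n..<n+n}. symplectic_form n v (unit_vec (2 * n) j) * vec_index u j)
     = (\<Sum>j\<in>{0..<n}. symplectic_form n v (unit_vec (2 * n) (n + j)) * vec_index u (n + j))"
    using sum.shift_bounds_nat_ivl[of "\<lambda>j. symplectic_form n v (unit_vec (2 * n) j) * vec_index u j" 0 n n]
    by (simp add: add.commute)
  also have "(\<Sum>j\<in>{0..<n}. symplectic_form n v (unit_vec (2 * n) j) * vec_index u j) + \<dots> = symplectic_form n v u"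
    unfolding sf_swap[of n v] sum.distrib[symmetric]
    by (subst (3) symplectic_form_def, subst sum_negf[symmetric])
       (auto intro!: sum.cong simp: sf_unit lessThan_atLeast0)
  finally show ?thesis .
qed

lemma transvection_vec:
  assumes "v \<in> carrier_vec (2 * n)" "u \<in> carrier_vec (2 * n)"
  shows "transvection n v c *\<^sub>v u = u + (c * symplectic_form n v u) \<cdot>\<^sub>v v"
proof (rule eq_vecI)
  fix i assume "i < dim_vec (u + (c * symplectic_form n v u) \<cdot>\<^sub>v v)"
  then have i: "i < 2 * n" using assms by simp
  have "vec_index (transvection n v c *\<^sub>v u) i = (\<Sum>j\<in>{0..<2*n}. (if j = i then vec_index u i else 0)
      + (c * vec_index v i) * (symplectic_form n v (unit_vec (2 * n) j) * vec_index u j))"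
    using i assms by (auto simp: transvection_def scalar_prod_def algebra_simps intro!: sum.cong)
  also have "\<dots> = vec_index u i + (c * vec_index v i) * symplectic_form n v u"
    using i unfolding sum.distrib sum_distrib_left[symmetric] sf_expand[OF assms(2)] by (simp add: sum.delta)
  finally show "vec_index (transvection n v c *\<^sub>v u) i = vec_index (u + (c * symplectic_form n v u) \<cdot>\<^sub>v v) i"
    using i assms by simp
qed (use assms in \<open>auto simp: transvection_def\<close>)

lemma transvection_inverse:
  assumes "v \<in> carrier_vec (2 * n)"
  shows "transvection n v (- c) * transvection n v c = 1\<^sub>m (2 * n)"
proof (rule mat_eq_by_vec)
  fix u :: "real Matrix.vec" assume u: "u \<in> carrier_vec (2 * n)"
  have "transvection n v (- c) * transvection n v c *\<^sub>v u = transvection n v (- c) *\<^sub>v (u + (c * symplectic_form n v u) \<cdot>\<^sub>v v)"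
    using assoc_mult_mat_vec[OF transvection_carrier transvection_carrier u] transvection_vec[OF assms u] by simp
  also have "\<dots> = u + (c * symplectic_form n v u) \<cdot>\<^sub>v v + (- c * symplectic_form n v u) \<cdot>\<^sub>v v"
    using u assms by (subst transvection_vec) (auto simp: sf_add[OF u _ assms] sf_smult[OF assms assms])
  also have "\<dots> = 1\<^sub>m (2 * n) *\<^sub>v u"
    using u assms by (auto intro!: eq_vecI)
  finally show "transvection n v (- c) * transvection n v c *\<^sub>v u = 1\<^sub>m (2 * n) *\<^sub>v u" .
qed (auto intro!: mult_carrier_mat[of _ "2*n" "2*n"])

definition is_sp :: "nat \<Rightarrow> real mat \<Rightarrow> bool" where
  "is_sp n A \<longleftrightarrow> A \<in> carrier_mat (2 * n) (2 * n) \<and>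
     (\<forall>x \<in> carrier_vec (2 * n). \<forall>y \<in> carrier_vec (2 * n).
        symplectic_form n (A *\<^sub>v x) (A *\<^sub>v y) = symplectic_form n x y)"

lemma is_sp_mult: "is_sp n A \<Longrightarrow> is_sp n B \<Longrightarrow> is_sp n (A * B)"
  unfolding is_sp_def by (auto simp: assoc_mult_mat_vec[of _ "2*n" "2*n" _ "2*n"])

lemma is_sp_transvection:
  assumes "v \<in> carrier_vec (2 * n)"
  shows "is_sp n (transvection n v c)"
  unfolding is_sp_def
proof (intro conjI ballI)
  fix x y :: "real Matrix.vec" assume x: "x \<in> carrier_vec (2 * n)" and y: "y \<in> carrier_vec (2 * n)"
  have "symplectic_form n (transvection n v c *\<^sub>v x) (transvection n v c *\<^sub>v y) = symplectic_form n x y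
      + c * symplectic_form n v y * symplectic_form n x v + c * symplectic_form n v x * symplectic_form n v y"
    using x y assms by (simp add: transvection_vec sf_add sf_smult)
  then show "symplectic_form n (transvection n v c *\<^sub>v x) (transvection n v c *\<^sub>v y) = symplectic_form n x y"
    unfolding sf_swap[of n x v] by simp
qed simp

context
  fixes n :: nat and G :: "real mat set"
  assumes G_mult: "\<And>A B. A \<in> G \<Longrightarrow> B \<in> G \<Longrightarrow> A * B \<in> G"
    and G_transvection: "\<And>v c. v \<in> carrier_vec (2 * n) \<Longrightarrow> transvection n v c \<in> G"
begin

text \<open>\<open>G\<close> is not assumed to contain inverses. The cancellation property of
  \<open>g\<close> replaces the membership of its inverse; it holds for transvections because
  changing the sign of \<open>c\<close> inverts them. The vectors in \<open>Z\<close> have been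
  dealt with before and must stay fixed.\<close>

definition moves :: "real Matrix.vec set \<Rightarrow> real Matrix.vec \<Rightarrow> real Matrix.vec \<Rightarrow> bool" where
  "moves Z x y \<longleftrightarrow> (\<exists>g. is_sp n g \<and> (\<forall>B \<in> carrier_mat (2 * n) (2 * n). g * B \<in> G \<longrightarrow> B \<in> G) \<and>
     g *\<^sub>v x = y \<and> (\<forall>z \<in> Z. g *\<^sub>v z = z))"

lemma moves_trans:
  assumes "moves Z x y" "moves Z y z" "Z \<subseteq> carrier_vec (2 * n)" "x \<in> carrier_vec (2 * n)"
  shows "moves Z x z"
proof -
  obtain g where g: "is_sp n g" "\<forall>B \<in> carrier_mat (2 * n) (2 * n). g * B \<in> G \<longrightarrow> B \<in> G"
    "g *\<^sub>v x = y" "\<forall>z \<in> Z. g *\<^sub>v z = z" using assms(1) unfolding moves_def by blast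
  obtain h where h: "is_sp n h" "\<forall>B \<in> carrier_mat (2 * n) (2 * n). h * B \<in> G \<longrightarrow> B \<in> G"
    "h *\<^sub>v y = z" "\<forall>z \<in> Z. h *\<^sub>v z = z" using assms(2) unfolding moves_def by blast
  have c: "g \<in> carrier_mat (2 * n) (2 * n)" "h \<in> carrier_mat (2 * n) (2 * n)"
    using g(1) h(1) by (auto simp: is_sp_def)
  show ?thesis unfolding moves_def
  proof (intro exI[of _ "h * g"] conjI ballI impI)
    show "is_sp n (h * g)" using g h by (intro is_sp_mult)
    show "h * g *\<^sub>v x = z" using assoc_mult_mat_vec[OF c(2,1) assms(4)] g h by simp
    fix B assume B: "B \<in> carrier_mat (2 * n) (2 * n)" "h * g * B \<in> G"
    have "h * (g * B) \<in> G" using B assoc_mult_mat[OF c(2,1) B(1)] by simp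
    then show "B \<in> G" using g(2) h(2) B(1) mult_carrier_mat[OF c(1) B(1)] by blast
  next
    fix z assume "z \<in> Z"
    then show "h * g *\<^sub>v z = z"
      using assoc_mult_mat_vec[OF c(2,1), of z] g(4) h(4) assms(3) by auto
  qed
qed

lemma moves_transvection:
  assumes x: "x \<in> carrier_vec (2 * n)" and y: "y \<in> carrier_vec (2 * n)"
    and xy: "symplectic_form n x y \<noteq> 0"
    and Z: "Z \<subseteq> carrier_vec (2 * n)" "\<And>z. z \<in> Z \<Longrightarrow> symplectic_form n z x = symplectic_form n z y"
  shows "moves Z x y"
proof -
  \<comment> \<open>With this coefficient the transvection along \<open>y - x\<close> adds exactly
    \<open>y - x\<close> to \<open>x\<close>, and it fixes every vector that pairs equally with
    \<open>x\<close> and \<open>y\<close>.\<close>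
  let ?d = "y - x" and ?c = "1 / symplectic_form n y x"
  have yx: "symplectic_form n y x \<noteq> 0" using xy sf_swap[of n y x] by simp
  have d: "?d \<in> carrier_vec (2 * n)" using x y by simp
  show ?thesis unfolding moves_def
  proof (intro exI[of _ "transvection n ?d ?c"] conjI ballI impI)
    show "is_sp n (transvection n ?d ?c)" by (rule is_sp_transvection[OF d])
    have "transvection n ?d ?c *\<^sub>v x = x + 1 \<cdot>\<^sub>v ?d"
      using yx x y d by (simp add: transvection_vec sf_diff)
    then show "transvection n ?d ?c *\<^sub>v x = y" using x y by (auto intro!: eq_vecI)
    fix B assume B: "B \<in> carrier_mat (2 * n) (2 * n)" "transvection n ?d ?c * B \<in> G"
    have "transvection n ?d (- ?c) * (transvection n ?d ?c * B) \<in> G" using G_mult[OF G_transvection[OF d] B(2)] .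
    moreover have "transvection n ?d (- ?c) * (transvection n ?d ?c * B) = B"
      using assoc_mult_mat[OF transvection_carrier transvection_carrier B(1), of ?d "- ?c" ?d ?c] transvection_inverse[OF d, of ?c] B(1) by simp
    ultimately show "B \<in> G" by simp
  next
    fix z assume z: "z \<in> Z"
    then have zc: "z \<in> carrier_vec (2 * n)" using Z(1) by blast
    have "symplectic_form n ?d z = 0"
      using Z(2)[OF z] sf_diff(2)[OF y x zc] sf_swap[of n ?d z] by simp
    then show "transvection n ?d ?c *\<^sub>v z = z" using zc d x y by (auto simp: transvection_vec intro!: eq_vecI)
  qed
qed

abbreviation "ev j \<equiv> unit_vec (2 * n) j :: real Matrix.vec"

definition fixed :: "nat \<Rightarrow> real Matrix.vec set" where
  "fixed j = ev ` {..<j} \<union> (\<lambda>i. ev (n + i)) ` {..<j}"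

lemma fixed_carrier: "fixed j \<subseteq> carrier_vec (2 * n)"
  by (auto simp: fixed_def)

lemma sf_fixed:
  assumes "j < n" "z \<in> fixed j"
  shows "symplectic_form n z (ev j) = 0" "symplectic_form n z (ev (n + j)) = 0"
  using assms by (auto simp: fixed_def sf_unit)

text \<open>Downward induction from \<open>n\<close>, where \<open>j\<close> counts the hyperbolic
  pairs of basis vectors fixed by \<open>A\<close>. Left multiplication makes \<open>A\<close> fix
  \<open>ev j\<close> and then, without disturbing it, \<open>ev (n + j)\<close>.\<close>

lemma sp_in_G_aux:
  assumes "j \<le> n" "is_sp n A" "\<And>z. z \<in> fixed j \<Longrightarrow> A *\<^sub>v z = z" "1\<^sub>m (2 * n) \<in> G"
  shows "A \<in> G"
  using assms
proof (induction j arbitrary: A rule: inc_induct)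
  case base
  have A: "A \<in> carrier_mat (2 * n) (2 * n)" using base by (simp add: is_sp_def)
  have "A = 1\<^sub>m (2 * n)"
  proof (rule eq_matI)
    fix i j assume ij: "i < dim_row (1\<^sub>m (2 * n) :: real mat)" "j < dim_col (1\<^sub>m (2 * n) :: real mat)"
    have "ev j \<in> fixed n"
    proof (cases "j < n")
      case False
      then have "ev j = ev (n + (j - n))" "j - n < n" using ij by auto
      then show ?thesis unfolding fixed_def by (metis UnI2 imageI lessThan_iff)
    qed (auto simp: fixed_def)
    then have "A *\<^sub>v ev j = ev j" using base by blast
    moreover have "A $$ (i, j) = vec_index (A *\<^sub>v ev j) i"
      using A ij by (auto simp: scalar_prod_right_unit)
    ultimately show "A $$ (i, j) = (1\<^sub>m (2 * n) :: real mat) $$ (i, j)"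
      using ij by auto
  qed (use A in auto)
  then show ?case using base by simp
next
  case (step j)
  have jn: "j < n" using step.hyps by simp
  have A: "A \<in> carrier_mat (2 * n) (2 * n)" "\<And>x y. x \<in> carrier_vec (2 * n) \<Longrightarrow> y \<in> carrier_vec (2 * n) \<Longrightarrow>
      symplectic_form n (A *\<^sub>v x) (A *\<^sub>v y) = symplectic_form n x y"
    using step.prems(1) by (auto simp: is_sp_def)
  let ?e = "ev j" and ?f = "ev (n + j)"
  have c: "?e \<in> carrier_vec (2 * n)" "?f \<in> carrier_vec (2 * n)" by auto
  have Ac: "A *\<^sub>v ?e \<in> carrier_vec (2 * n)" "A *\<^sub>v ?f \<in> carrier_vec (2 * n)"
    using A(1) by (auto intro: mult_mat_vec_carrier)
  have ef: "symplectic_form n ?e ?f = 1" "symplectic_form n ?f ?e = -1"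
    using jn by (auto simp: sf_unit)
  have zA: "symplectic_form n z (A *\<^sub>v ?e) = 0" "symplectic_form n z (A *\<^sub>v ?f) = 0" if "z \<in> fixed j" for z
  proof -
    have zc: "z \<in> carrier_vec (2 * n)" using that fixed_carrier by blast
    show "symplectic_form n z (A *\<^sub>v ?e) = 0" "symplectic_form n z (A *\<^sub>v ?f) = 0"
      using A(2)[OF zc c(1)] A(2)[OF zc c(2)] sf_fixed[OF jn that] step.prems(2)[OF that] by simp_all
  qed
  have AA: "symplectic_form n (A *\<^sub>v ?e) (A *\<^sub>v ?f) = 1" using A(2)[OF c] ef by simp
  have mv: "moves (fixed j) x y"
    if "x \<in> carrier_vec (2 * n)" "y \<in> carrier_vec (2 * n)" "symplectic_form n x y \<noteq> 0"
      "\<And>z. z \<in> fixed j \<Longrightarrow> symplectic_form n z x = 0" "\<And>z. z \<in> fixed j \<Longrightarrow> symplectic_form n z y = 0" for x y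
    using that fixed_carrier by (intro moves_transvection) auto
  have "moves (fixed j) (A *\<^sub>v ?e) ?e"
  proof (cases "symplectic_form n (A *\<^sub>v ?e) ?e = 0")
    case False
    then show ?thesis using Ac c zA sf_fixed[OF jn] by (intro mv) auto
  next
    case True
    \<comment> \<open>When \<open>A e\<close> and \<open>e\<close> are orthogonal, the move is made
      through a vector \<open>t\<close> that pairs nontrivially with both. If neither
      \<open>f\<close> nor \<open>A f\<close> serves, their sum does.\<close>
    obtain t where t: "t \<in> carrier_vec (2 * n)" "symplectic_form n (A *\<^sub>v ?e) t \<noteq> 0" "symplectic_form n t ?e \<noteq> 0"
      "\<And>z. z \<in> fixed j \<Longrightarrow> symplectic_form n z t = 0"
    proof (cases "symplectic_form n (A *\<^sub>v ?e) ?f = 0")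
      case False
      then show thesis using c ef sf_fixed[OF jn] by (intro that[of ?f]) auto
    next
      case 1: True
      show thesis
      proof (cases "symplectic_form n (A *\<^sub>v ?f) ?e = 0")
        case False
        then show thesis using Ac zA AA by (intro that[of "A *\<^sub>v ?f"]) auto
      next
        case True
        show thesis
        proof (rule that[of "?f + A *\<^sub>v ?f"])
          show "symplectic_form n (A *\<^sub>v ?e) (?f + A *\<^sub>v ?f) \<noteq> 0"
            using sf_add(2)[OF c(2) Ac(2) Ac(1)] 1 AA by simp
          show "symplectic_form n (?f + A *\<^sub>v ?f) ?e \<noteq> 0"
            using sf_add(1)[OF c(2) Ac(2) c(1)] True ef by simp
          show "symplectic_form n z (?f + A *\<^sub>v ?f) = 0" if "z \<in> fixed j" for z
            using sf_add(2)[OF c(2) Ac(2), of z] fixed_carrier that zA sf_fixed[OF jn] by auto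
        qed (use c Ac in auto)
      qed
    qed
    have "moves (fixed j) (A *\<^sub>v ?e) t" using Ac t zA by (intro mv) auto
    moreover have "moves (fixed j) t ?e" using c t sf_fixed[OF jn] by (intro mv) auto
    ultimately show ?thesis using fixed_carrier Ac(1) by (rule moves_trans)
  qed
  then obtain g where g: "is_sp n g" "\<forall>B \<in> carrier_mat (2 * n) (2 * n). g * B \<in> G \<longrightarrow> B \<in> G"
    "g *\<^sub>v (A *\<^sub>v ?e) = ?e" "\<forall>z \<in> fixed j. g *\<^sub>v z = z" unfolding moves_def by blast
  define B where "B = g * A"
  have gc: "g \<in> carrier_mat (2 * n) (2 * n)" using g(1) by (simp add: is_sp_def)
  have Bsp: "is_sp n B" unfolding B_def using g(1) step.prems(1) by (rule is_sp_mult)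
  have Bv: "B *\<^sub>v x = g *\<^sub>v (A *\<^sub>v x)" if "x \<in> carrier_vec (2 * n)" for x
    unfolding B_def by (rule assoc_mult_mat_vec[OF gc A(1) that])
  have Be: "B *\<^sub>v ?e = ?e" using Bv[OF c(1)] g(3) by simp
  have Bz: "B *\<^sub>v z = z" if "z \<in> fixed j" for z
    using Bv[of z] g(4) step.prems(2)[OF that] that fixed_carrier by auto
  have B: "B \<in> carrier_mat (2 * n) (2 * n)" "\<And>x y. x \<in> carrier_vec (2 * n) \<Longrightarrow> y \<in> carrier_vec (2 * n) \<Longrightarrow>
      symplectic_form n (B *\<^sub>v x) (B *\<^sub>v y) = symplectic_form n x y"
    using Bsp by (auto simp: is_sp_def)
  have Bc: "B *\<^sub>v ?f \<in> carrier_vec (2 * n)" using B(1) by (auto intro: mult_mat_vec_carrier)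
  let ?Z = "insert ?e (fixed j)"
  have Zc: "?Z \<subseteq> carrier_vec (2 * n)" using fixed_carrier by auto
  have zB: "symplectic_form n z (B *\<^sub>v ?f) = symplectic_form n z ?f" if "z \<in> ?Z" for z
    using B(2)[of z ?f] that Zc Be Bz by auto
  have "moves ?Z (B *\<^sub>v ?f) ?f"
  proof (cases "symplectic_form n (B *\<^sub>v ?f) ?f = 0")
    case False
    then show ?thesis using Bc c zB Zc by (intro moves_transvection) auto
  next
    case True
    \<comment> \<open>The detour must leave \<open>e\<close> fixed, so \<open>t\<close> has to pair
      with \<open>e\<close> exactly as \<open>f\<close> does; adding \<open>e\<close> to
      \<open>f\<close> preserves this pairing.\<close>
    let ?t = "?e + ?f"
    have t: "?t \<in> carrier_vec (2 * n)" by simp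
    have zt: "symplectic_form n z ?t = symplectic_form n z ?f" if "z \<in> ?Z" for z
      using sf_add(2)[OF c, of z] that Zc sf_fixed[OF jn] by auto
    have "symplectic_form n (B *\<^sub>v ?f) ?e = -1"
      using zB[of ?e] ef sf_swap[of n "B *\<^sub>v ?f" ?e] by simp
    then have "symplectic_form n (B *\<^sub>v ?f) ?t \<noteq> 0"
      using sf_add(2)[OF c Bc] True by simp
    then have 1: "moves ?Z (B *\<^sub>v ?f) ?t" using Bc t zB zt Zc by (intro moves_transvection) auto
    have "symplectic_form n ?t ?f \<noteq> 0" using sf_add(1)[OF c c(2)] ef by simp
    then have "moves ?Z ?t ?f" using c t zt Zc by (intro moves_transvection) auto
    with 1 show ?thesis using Zc Bc by (rule moves_trans)
  qed
  then obtain h where h: "is_sp n h" "\<forall>B \<in> carrier_mat (2 * n) (2 * n). h * B \<in> G \<longrightarrow> B \<in> G"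
    "h *\<^sub>v (B *\<^sub>v ?f) = ?f" "\<forall>z \<in> ?Z. h *\<^sub>v z = z" unfolding moves_def by blast
  have hc: "h \<in> carrier_mat (2 * n) (2 * n)" using h(1) by (simp add: is_sp_def)
  have hBv: "h * B *\<^sub>v x = h *\<^sub>v (B *\<^sub>v x)" if "x \<in> carrier_vec (2 * n)" for x
    by (rule assoc_mult_mat_vec[OF hc B(1) that])
  have "h * B *\<^sub>v z = z" if "z \<in> fixed (Suc j)" for z
  proof -
    have "z \<in> fixed j \<or> z = ?e \<or> z = ?f"
      using that by (auto simp: fixed_def lessThan_Suc)
    moreover have "z \<in> carrier_vec (2 * n)" using that fixed_carrier[of "Suc j"] by blast
    ultimately show ?thesis
      using hBv[of z] h(3,4) Be Bz by auto
  qed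
  then have "h * B \<in> G"
    using step.IH[of "h * B"] is_sp_mult[OF h(1) Bsp] step.prems(3) by blast
  then have "B \<in> G" using h(2) B(1) by blast
  then show ?case using g(2) A(1) unfolding B_def by blast
qed

lemma sp_in_G: "is_sp n A \<Longrightarrow> 1\<^sub>m (2 * n) \<in> G \<Longrightarrow> A \<in> G"
  by (rule sp_in_G_aux[of 0]) (auto simp: fixed_def)

end

section \<open>Zariski closures\<close>

definition zclosure :: "nat \<Rightarrow> real mat set \<Rightarrow> real mat set" where
  "zclosure m H = {A \<in> carrier_mat m m. \<forall>p \<in> polynomial_functions m. (\<forall>h\<in>H. p h = 0) \<longrightarrow> p A = 0}"

lemma zclosure_carrier: "A \<in> zclosure m H \<Longrightarrow> A \<in> carrier_mat m m"
  by (simp add: zclosure_def)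

lemma zclosure_superset: "H \<subseteq> carrier_mat m m \<Longrightarrow> H \<subseteq> zclosure m H"
  by (auto simp: zclosure_def)

lemma zariski_dense_inI:
  assumes "H \<subseteq> G" "G \<subseteq> zclosure m H"
  shows "zariski_dense_in m H G"
proof -
  let ?Z = "zariski_topology m"
  have "(\<lambda>A. 1) \<in> polynomial_functions m" by (rule polynomial_functions.const)
  then have "openin ?Z (carrier_mat m m)"
    unfolding openin_zariski_topology by (intro exI[of _ "{\<lambda>A. 1}"]) (auto simp: zero_locus_def)
  then have "carrier_mat m m \<subseteq> topspace ?Z" by (rule openin_subset)
  then have t: "topspace (subtopology ?Z G) = G"
    using assms(2) by (auto simp: zclosure_def)
  have "A \<in> subtopology ?Z G closure_of H" if A: "A \<in> G" for A
    unfolding in_closure_of t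
  proof (intro conjI A allI impI)
    fix T assume "A \<in> T \<and> openin (subtopology ?Z G) T"
    then obtain P where P: "P \<subseteq> polynomial_functions m" "T = (carrier_mat m m - zero_locus m P) \<inter> G" "A \<in> T"
      unfolding openin_subtopology openin_zariski_topology by blast
    then obtain p where p: "p \<in> P" "p A \<noteq> 0" unfolding zero_locus_def by auto
    have "A \<in> zclosure m H" using A assms(2) by blast
    then obtain h where h: "h \<in> H" "p h \<noteq> 0" using p P(1) unfolding zclosure_def by blast
    have "h \<in> G" using h(1) assms(1) by blast
    moreover then have "h \<in> carrier_mat m m" using assms(2) by (auto simp: zclosure_def)
    ultimately show "\<exists>y. y \<in> H \<and> y \<in> T" using h p(1) P(2) by (auto simp: zero_locus_def)
  qed
  then show ?thesis
    unfolding zariski_dense_in_def using assms(1) closure_of_subset_topspace[of "subtopology ?Z G" H] t by blast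
qed

lemma polynomial_functions_sum:
  "(\<And>l. l \<in> L \<Longrightarrow> f l \<in> polynomial_functions m) \<Longrightarrow> (\<lambda>A. \<Sum>l\<in>L. f l A) \<in> polynomial_functions m"
  by (induction L rule: infinite_finite_induct) (auto intro: polynomial_functions.intros)

text \<open>Translations are polynomial maps. Agreement is asserted on the
  \<open>m\<close>-by-\<open>m\<close> matrices, where the formula for the entries of a product
  holds.\<close>

lemma polynomial_functions_left:
  assumes "p \<in> polynomial_functions m" "B \<in> carrier_mat m m"
  shows "\<exists>q\<in>polynomial_functions m. \<forall>A\<in>carrier_mat m m. q A = p (B * A)"
  using assms(1)
proof induction
  case (const c)
  then show ?case by (intro bexI[of _ "\<lambda>_. c"]) (auto intro: polynomial_functions.const)
next
  case (entry i j)
  show ?case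
  proof (intro bexI ballI)
    show "(\<lambda>A. \<Sum>l\<in>{0..<m}. B $$ (i, l) * A $$ (l, j)) \<in> polynomial_functions m"
      using entry by (intro polynomial_functions_sum polynomial_functions.intros) auto
  qed (use entry assms(2) in \<open>auto simp: scalar_prod_def intro!: sum.cong\<close>)
next
  case (add p q)
  then obtain p' q' where "p' \<in> polynomial_functions m" "\<forall>A\<in>carrier_mat m m. p' A = p (B * A)"
    "q' \<in> polynomial_functions m" "\<forall>A\<in>carrier_mat m m. q' A = q (B * A)" by blast
  then show ?case by (intro bexI[of _ "\<lambda>A. p' A + q' A"]) (auto intro: polynomial_functions.add)
next
  case (mult p q)
  then obtain p' q' where "p' \<in> polynomial_functions m" "\<forall>A\<in>carrier_mat m m. p' A = p (B * A)"
    "q' \<in> polynomial_functions m" "\<forall>A\<in>carrier_mat m m. q' A = q (B * A)" by blast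
  then show ?case by (intro bexI[of _ "\<lambda>A. p' A * q' A"]) (auto intro: polynomial_functions.mult)
qed

lemma polynomial_functions_right:
  assumes "p \<in> polynomial_functions m" "B \<in> carrier_mat m m"
  shows "\<exists>q\<in>polynomial_functions m. \<forall>A\<in>carrier_mat m m. q A = p (A * B)"
  using assms(1)
proof induction
  case (const c)
  then show ?case by (intro bexI[of _ "\<lambda>_. c"]) (auto intro: polynomial_functions.const)
next
  case (entry i j)
  show ?case
  proof (intro bexI ballI)
    show "(\<lambda>A. \<Sum>l\<in>{0..<m}. A $$ (i, l) * B $$ (l, j)) \<in> polynomial_functions m"
      using entry by (intro polynomial_functions_sum polynomial_functions.intros) auto
  qed (use entry assms(2) in \<open>auto simp: scalar_prod_def intro!: sum.cong\<close>)
next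
  case (add p q)
  then obtain p' q' where "p' \<in> polynomial_functions m" "\<forall>A\<in>carrier_mat m m. p' A = p (A * B)"
    "q' \<in> polynomial_functions m" "\<forall>A\<in>carrier_mat m m. q' A = q (A * B)" by blast
  then show ?case by (intro bexI[of _ "\<lambda>A. p' A + q' A"]) (auto intro: polynomial_functions.add)
next
  case (mult p q)
  then obtain p' q' where "p' \<in> polynomial_functions m" "\<forall>A\<in>carrier_mat m m. p' A = p (A * B)"
    "q' \<in> polynomial_functions m" "\<forall>A\<in>carrier_mat m m. q' A = q (A * B)" by blast
  then show ?case by (intro bexI[of _ "\<lambda>A. p' A * q' A"]) (auto intro: polynomial_functions.mult)
qed

text \<open>Two translations are used. Pulling back along left multiplication by \<open>h\<close> in
  \<open>H\<close> shows that \<open>h\<close> preserves the closure; pulling back along right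
  multiplication by a fixed \<open>B\<close> in the closure then extends this from \<open>H\<close>
  to its closure.\<close>

lemma zclosure_mult:
  assumes H: "H \<subseteq> carrier_mat m m" "\<And>A B. A \<in> H \<Longrightarrow> B \<in> H \<Longrightarrow> A * B \<in> H"
    and AB: "A \<in> zclosure m H" "B \<in> zclosure m H"
  shows "A * B \<in> zclosure m H"
proof -
  have 1: "h * X \<in> zclosure m H" if h: "h \<in> H" and X: "X \<in> zclosure m H" for h X
    unfolding zclosure_def
  proof (intro CollectI conjI ballI impI)
    have hc: "h \<in> carrier_mat m m" using h H(1) by blast
    then show "h * X \<in> carrier_mat m m" using X by (auto simp: zclosure_def)
    fix p assume p: "p \<in> polynomial_functions m" "\<forall>h\<in>H. p h = 0"
    obtain q where q: "q \<in> polynomial_functions m" "\<forall>A\<in>carrier_mat m m. q A = p (h * A)"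
      using polynomial_functions_left[OF p(1) hc] by blast
    have "\<forall>h'\<in>H. q h' = 0" using q(2) p(2) H h by auto
    then have "q X = 0" using X q(1) by (simp add: zclosure_def)
    then show "p (h * X) = 0" using q(2) zclosure_carrier[OF X] by simp
  qed
  show ?thesis
    unfolding zclosure_def
  proof (intro CollectI conjI ballI impI)
    show "A * B \<in> carrier_mat m m" using AB by (auto simp: zclosure_def)
    fix p assume p: "p \<in> polynomial_functions m" "\<forall>h\<in>H. p h = 0"
    obtain q where q: "q \<in> polynomial_functions m" "\<forall>A\<in>carrier_mat m m. q A = p (A * B)"
      using polynomial_functions_right[OF p(1) zclosure_carrier[OF AB(2)]] by blast
    have "q h = 0" if "h \<in> H" for h
      using q(2) p 1[OF that AB(2)] H(1) that by (auto simp: zclosure_def)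
    then have "q A = 0" using AB(1) q(1) by (simp add: zclosure_def)
    then show "p (A * B) = 0" using q(2) zclosure_carrier[OF AB(1)] by simp
  qed
qed

text \<open>On a polynomial curve, membership in a Zariski closed set is decided by polynomials in
  one variable, hence by infinitely many parameters. Quadratic curves are enough because conjugation
  by \<open>1 + r P\<close> with \<open>P^2 = 0\<close> is quadratic in \<open>r\<close>.\<close>

lemma polynomial_on_curve:
  assumes "p \<in> polynomial_functions m" "A \<in> carrier_mat m m" "B \<in> carrier_mat m m" "C \<in> carrier_mat m m"
  shows "\<exists>P::real poly. \<forall>t. p (A + t \<cdot>\<^sub>m B + (t\<^sup>2) \<cdot>\<^sub>m C) = poly P t"
  using assms(1)
proof induction
  case (const c)
  then show ?case by (intro exI[of _ "[:c:]"]) simp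
next
  case (entry i j)
  then show ?case
    using assms(2-4)
    by (intro exI[of _ "[:A $$ (i, j), B $$ (i, j), C $$ (i, j):]"]) (auto simp: power2_eq_square algebra_simps)
next
  case (add p q)
  then show ?case by (metis poly_add)
next
  case (mult p q)
  then show ?case by (metis poly_mult)
qed

lemma poly_zero_infinite:
  fixes P :: "real poly"
  assumes "infinite S" "\<And>t. t \<in> S \<Longrightarrow> poly P t = 0"
  shows "poly P t = 0"
proof -
  have "infinite {x. poly P x = 0}"
    using assms(1) by (rule infinite_super[rotated]) (use assms(2) in auto)
  then have "P = 0" using poly_roots_finite by blast
  then show ?thesis by simp
qed

text \<open>For \<open>N\<^sup>2 = 0\<close> these are the directions of one-parameter unipotent groups in the Zariski closure.\<close>

definition nilp :: "nat \<Rightarrow> real mat set \<Rightarrow> real mat set" where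
  "nilp m H = {N \<in> carrier_mat m m. \<forall>r. 1\<^sub>m m + r \<cdot>\<^sub>m N \<in> zclosure m H}"

text \<open>The powers of \<open>1 + N\<close> are \<open>1 + i N\<close>, and a polynomial that
  vanishes at all natural numbers \<open>i\<close> vanishes identically.\<close>

lemma nilp_unipotent:
  assumes H: "H \<subseteq> carrier_mat m m" "\<And>A B. A \<in> H \<Longrightarrow> B \<in> H \<Longrightarrow> A * B \<in> H" "1\<^sub>m m \<in> H"
    and N: "N \<in> carrier_mat m m" "N * N = 0\<^sub>m m m" "1\<^sub>m m + N \<in> H"
  shows "N \<in> nilp m H"
proof -
  have n: "1\<^sub>m m + real i \<cdot>\<^sub>m N \<in> H" for i
  proof (induction i)
    case 0
    have "1\<^sub>m m + real 0 \<cdot>\<^sub>m N = 1\<^sub>m m" using N(1) by (auto intro!: eq_matI)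
    then show ?case using H(3) by simp
  next
    case (Suc i)
    have c: "real i \<cdot>\<^sub>m N \<in> carrier_mat m m" using N(1) by simp
    have "(1\<^sub>m m + real i \<cdot>\<^sub>m N) * (1\<^sub>m m + N) = 1\<^sub>m m + real i \<cdot>\<^sub>m N + (N + (real i \<cdot>\<^sub>m N) * N)"
      using N(1) c by (simp add: mult_add_distrib_mat[of _ m m _ m] add_mult_distrib_mat[of _ m m _ _ m])
    also have "(real i \<cdot>\<^sub>m N) * N = 0\<^sub>m m m"
      using mult_smult_assoc_mat[OF N(1) N(1), of "real i"] N(2) by (auto intro!: eq_matI)
    also have "1\<^sub>m m + real i \<cdot>\<^sub>m N + (N + 0\<^sub>m m m) = 1\<^sub>m m + real (Suc i) \<cdot>\<^sub>m N"
      using N(1) by (auto intro!: eq_matI simp: algebra_simps)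
    finally show ?case using H(2)[OF Suc N(3)] by simp
  qed
  have "p (1\<^sub>m m + r \<cdot>\<^sub>m N) = 0" if p: "p \<in> polynomial_functions m" "\<forall>h\<in>H. p h = 0" for p r
  proof -
    obtain P where P: "\<forall>t. p (1\<^sub>m m + t \<cdot>\<^sub>m N + (t\<^sup>2) \<cdot>\<^sub>m 0\<^sub>m m m) = poly P t"
      using polynomial_on_curve[OF p(1) one_carrier_mat N(1) zero_carrier_mat] by blast
    have e: "1\<^sub>m m + t \<cdot>\<^sub>m N + (t\<^sup>2) \<cdot>\<^sub>m 0\<^sub>m m m = 1\<^sub>m m + t \<cdot>\<^sub>m N" for t
      using N(1) by (auto intro!: eq_matI)
    have "poly P r = 0"
    proof (rule poly_zero_infinite)
      show "infinite (range real)" using infinite_UNIV_nat by (simp add: finite_image_iff inj_of_nat)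
      show "poly P t = 0" if tr: "t \<in> range real" for t
      proof -
        obtain i where "t = real i" using tr by blast
        then show ?thesis using P[rule_format, of t] p(2) n[of i] unfolding e by simp
      qed
    qed
    then show ?thesis using P unfolding e by simp
  qed
  then show ?thesis
    unfolding nilp_def zclosure_def using N(1) by auto
qed

lemma nilp_smult: "N \<in> nilp m H \<Longrightarrow> s \<cdot>\<^sub>m N \<in> nilp m H"
proof -
  have "r \<cdot>\<^sub>m (s \<cdot>\<^sub>m N) = (r * s) \<cdot>\<^sub>m N" for r by (auto intro!: eq_matI)
  then show "N \<in> nilp m H \<Longrightarrow> s \<cdot>\<^sub>m N \<in> nilp m H" unfolding nilp_def by auto
qed

text \<open>The algebraic form of a limit as \<open>t\<close> tends to 0: a polynomial in
  \<open>t\<close> that vanishes at all nonzero parameters vanishes at 0.\<close>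

lemma nilp_limit:
  assumes c: "A \<in> carrier_mat m m" "B \<in> carrier_mat m m" "C \<in> carrier_mat m m"
    and "\<And>t. t \<noteq> 0 \<Longrightarrow> A + t \<cdot>\<^sub>m B + (t\<^sup>2) \<cdot>\<^sub>m C \<in> nilp m H"
  shows "A \<in> nilp m H"
proof -
  have "p (1\<^sub>m m + r \<cdot>\<^sub>m A) = 0" if p: "p \<in> polynomial_functions m" "\<forall>h\<in>H. p h = 0" for p r
  proof -
    obtain P where P: "\<forall>t. p ((1\<^sub>m m + r \<cdot>\<^sub>m A) + t \<cdot>\<^sub>m (r \<cdot>\<^sub>m B) + (t\<^sup>2) \<cdot>\<^sub>m (r \<cdot>\<^sub>m C)) = poly P t"
      using polynomial_on_curve[OF p(1), of "1\<^sub>m m + r \<cdot>\<^sub>m A" "r \<cdot>\<^sub>m B" "r \<cdot>\<^sub>m C"] c by auto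
    have e: "(1\<^sub>m m + r \<cdot>\<^sub>m A) + t \<cdot>\<^sub>m (r \<cdot>\<^sub>m B) + (t\<^sup>2) \<cdot>\<^sub>m (r \<cdot>\<^sub>m C)
        = 1\<^sub>m m + r \<cdot>\<^sub>m (A + t \<cdot>\<^sub>m B + (t\<^sup>2) \<cdot>\<^sub>m C)" for t
      using c by (auto intro!: eq_matI simp: algebra_simps)
    have "poly P 0 = 0"
    proof (rule poly_zero_infinite)
      show "infinite (UNIV - {0::real})" using infinite_UNIV_char_0 by simp
      show "poly P t = 0" if "t \<in> UNIV - {0}" for t
      proof -
        have "1\<^sub>m m + r \<cdot>\<^sub>m (A + t \<cdot>\<^sub>m B + (t\<^sup>2) \<cdot>\<^sub>m C) \<in> zclosure m H"
          using assms(4)[of t] that by (simp add: nilp_def)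
        then have "p (1\<^sub>m m + r \<cdot>\<^sub>m (A + t \<cdot>\<^sub>m B + (t\<^sup>2) \<cdot>\<^sub>m C)) = 0"
          using p unfolding zclosure_def by blast
        then show ?thesis using P[rule_format, of t] unfolding e by simp
      qed
    qed
    moreover have "(1\<^sub>m m + r \<cdot>\<^sub>m A) + 0 \<cdot>\<^sub>m (r \<cdot>\<^sub>m B) + (0\<^sup>2) \<cdot>\<^sub>m (r \<cdot>\<^sub>m C) = 1\<^sub>m m + r \<cdot>\<^sub>m A"
      using c by (auto intro!: eq_matI)
    ultimately show ?thesis using P[rule_format, of 0] by simp
  qed
  then show ?thesis unfolding nilp_def zclosure_def using c by auto
qed

lemma conj_one_plus:
  assumes "U \<in> carrier_mat m m" "V \<in> carrier_mat m m" "N \<in> carrier_mat m m" "U * V = 1\<^sub>m m"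
  shows "U * (1\<^sub>m m + (r::real) \<cdot>\<^sub>m N) * V = 1\<^sub>m m + r \<cdot>\<^sub>m (U * N * V)"
proof -
  have UN: "U * N \<in> carrier_mat m m" using assms by auto
  have "U * (1\<^sub>m m + r \<cdot>\<^sub>m N) = U + r \<cdot>\<^sub>m (U * N)"
    using assms by (simp add: mult_add_distrib_mat[of _ m m _ m] mult_smult_distrib[of _ m m _ m])
  also have "\<dots> * V = U * V + r \<cdot>\<^sub>m (U * N * V)"
    using assms UN by (simp add: add_mult_distrib_mat[of _ m m _ _ m] mult_smult_assoc_mat[of _ m m _ m])
  finally show ?thesis using assms by simp
qed

context
  fixes m :: nat and H :: "real mat set"
  assumes H: "H \<subseteq> carrier_mat m m" "\<And>A B. A \<in> H \<Longrightarrow> B \<in> H \<Longrightarrow> A * B \<in> H"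
begin

lemma nilp_conj:
  assumes "U \<in> zclosure m H" "V \<in> zclosure m H" "U * V = 1\<^sub>m m" "N \<in> nilp m H"
  shows "U * N * V \<in> nilp m H"
proof -
  have c: "U \<in> carrier_mat m m" "V \<in> carrier_mat m m" "N \<in> carrier_mat m m"
    using assms by (auto simp: zclosure_def nilp_def)
  have "U * (1\<^sub>m m + r \<cdot>\<^sub>m N) * V \<in> zclosure m H" for r
    using assms by (intro zclosure_mult[OF H]) (auto simp: nilp_def)
  then show ?thesis
    unfolding nilp_def conj_one_plus[OF c assms(3)] using c by auto
qed

lemma one_plus_inverse:
  assumes "P \<in> carrier_mat m m" "P * P = 0\<^sub>m m m"
  shows "(1\<^sub>m m + (r::real) \<cdot>\<^sub>m P) * (1\<^sub>m m + (- r) \<cdot>\<^sub>m P) = 1\<^sub>m m"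
proof -
  have c: "r \<cdot>\<^sub>m P \<in> carrier_mat m m" "(- r) \<cdot>\<^sub>m P \<in> carrier_mat m m" using assms by auto
  have "(1\<^sub>m m + r \<cdot>\<^sub>m P) * (1\<^sub>m m + (- r) \<cdot>\<^sub>m P) = 1\<^sub>m m + (- r) \<cdot>\<^sub>m P + (r \<cdot>\<^sub>m P + (r \<cdot>\<^sub>m P) * ((- r) \<cdot>\<^sub>m P))"
    using c by (simp add: mult_add_distrib_mat[of _ m m _ m] add_mult_distrib_mat[of _ m m _ _ m])
      (use c assms in \<open>auto intro!: eq_matI\<close>)
  also have "(r \<cdot>\<^sub>m P) * ((- r) \<cdot>\<^sub>m P) = 0\<^sub>m m m"
    using mult_smult_assoc_mat[OF assms(1) c(2), of r] mult_smult_distrib[OF assms(1) assms(1), of "- r"] assms(2)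
    by (auto intro!: eq_matI)
  also have "1\<^sub>m m + (- r) \<cdot>\<^sub>m P + (r \<cdot>\<^sub>m P + 0\<^sub>m m m) = 1\<^sub>m m"
    using assms by (auto intro!: eq_matI)
  finally show ?thesis .
qed

text \<open>The leading term, as \<open>r\<close> tends to infinity, of the conjugate of \<open>N\<close> by \<open>1 + r P\<close>.\<close>

lemma nilp_sandwich:
  assumes P: "P \<in> nilp m H" "P * P = 0\<^sub>m m m" and N: "N \<in> nilp m H"
  shows "P * N * P \<in> nilp m H"
proof -
  have c: "P \<in> carrier_mat m m" "N \<in> carrier_mat m m" using P N by (auto simp: nilp_def)
  have d: "P * N \<in> carrier_mat m m" "N * P \<in> carrier_mat m m" "P * N * P \<in> carrier_mat m m" using c by auto
  have conj: "(1\<^sub>m m + r \<cdot>\<^sub>m P) * N * (1\<^sub>m m + (- r) \<cdot>\<^sub>m P) \<in> nilp m H" for r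
    using P N by (intro nilp_conj one_plus_inverse c) (auto simp: nilp_def)
  have expand: "(1\<^sub>m m + r \<cdot>\<^sub>m P) * N * (1\<^sub>m m + (- r) \<cdot>\<^sub>m P)
     = N + r \<cdot>\<^sub>m (P * N - N * P) + (- (r\<^sup>2)) \<cdot>\<^sub>m (P * N * P)" for r
  proof -
    have rP: "r \<cdot>\<^sub>m P \<in> carrier_mat m m" "(- r) \<cdot>\<^sub>m P \<in> carrier_mat m m" using c by auto
    have 1: "(1\<^sub>m m + r \<cdot>\<^sub>m P) * N = N + r \<cdot>\<^sub>m (P * N)"
      using c rP by (simp add: add_mult_distrib_mat[of _ m m _ _ m] mult_smult_assoc_mat[of _ m m _ m])
    have 2: "N + r \<cdot>\<^sub>m (P * N) \<in> carrier_mat m m" using c d by auto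
    have "(N + r \<cdot>\<^sub>m (P * N)) * (1\<^sub>m m + (- r) \<cdot>\<^sub>m P)
       = (N + r \<cdot>\<^sub>m (P * N)) + (- r) \<cdot>\<^sub>m ((N + r \<cdot>\<^sub>m (P * N)) * P)"
      using 2 rP c by (simp add: mult_add_distrib_mat[of _ m m _ m] mult_smult_distrib[of _ m m _ m])
    also have "(N + r \<cdot>\<^sub>m (P * N)) * P = N * P + r \<cdot>\<^sub>m (P * N * P)"
      using c d by (simp add: add_mult_distrib_mat[of _ m m _ _ m] mult_smult_assoc_mat[of _ m m _ m])
    finally show ?thesis
      unfolding 1 using c d carrier_matD[OF d(1)] carrier_matD[OF d(2)] carrier_matD[OF d(3)]
      by (auto intro!: eq_matI simp: algebra_simps power2_eq_square simp del: index_mult_mat)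
  qed
  have "(-1) \<cdot>\<^sub>m (P * N * P) \<in> nilp m H"
  proof (rule nilp_limit[of _ _ "P * N - N * P" N])
    fix t :: real assume t: "t \<noteq> 0"
    \<comment> \<open>This is the conjugate at \<open>r = 1/t\<close> multiplied by
      \<open>t^2\<close>, which turns the leading coefficient into the value at 0.\<close>
    have "(-1) \<cdot>\<^sub>m (P * N * P) + t \<cdot>\<^sub>m (P * N - N * P) + t\<^sup>2 \<cdot>\<^sub>m N
       = t\<^sup>2 \<cdot>\<^sub>m ((1\<^sub>m m + (1/t) \<cdot>\<^sub>m P) * N * (1\<^sub>m m + (- (1/t)) \<cdot>\<^sub>m P))"
      unfolding expand using t c d carrier_matD[OF d(1)] carrier_matD[OF d(2)] carrier_matD[OF d(3)]
      by (auto intro!: eq_matI simp: field_simps power2_eq_square simp del: index_mult_mat)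
    then show "(-1) \<cdot>\<^sub>m (P * N * P) + t \<cdot>\<^sub>m (P * N - N * P) + t\<^sup>2 \<cdot>\<^sub>m N \<in> nilp m H"
      using nilp_smult[OF conj] by simp
  qed (use c d in auto)
  then have "(-1) \<cdot>\<^sub>m ((-1) \<cdot>\<^sub>m (P * N * P)) \<in> nilp m H" by (rule nilp_smult)
  moreover have "(-1) \<cdot>\<^sub>m ((-1) \<cdot>\<^sub>m (P * N * P)) = P * N * P"
    by (auto intro!: eq_matI)
  ultimately show ?thesis by simp
qed

end

section \<open>The representation\<close>

lemma smult_smult_mat: "a \<cdot>\<^sub>m (b \<cdot>\<^sub>m A) = (a * b) \<cdot>\<^sub>m (A :: real mat)"
  by (auto intro!: eq_matI)

lemma smult_mult_smult:
  assumes "X \<in> carrier_mat n m" "Y \<in> carrier_mat m l"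
  shows "(s \<cdot>\<^sub>m X) * (t \<cdot>\<^sub>m Y) = (s * t) \<cdot>\<^sub>m (X * Y :: real mat)"
  using assms by (auto intro!: eq_matI)

definition qm :: "nat \<Rightarrow> real mat" where
  "qm k = Matrix.mat (2 * k) (2 * k) (\<lambda>(i, j). if i + j + 1 = 2 * k then 1 else 0)"

definition tau :: "nat \<Rightarrow> real mat" where
  "tau k = Matrix.mat (2 * k) (2 * k) (\<lambda>(i, j). if i = j then (if i < k then -1 else 1) else 0)"

text \<open>Ones on the antidiagonal next to that of \<open>qm\<close>, so that
  \<open>dm k * qm k\<close> is the nilpotent shift of the coordinates.\<close>

definition dm :: "nat \<Rightarrow> real mat" where
  "dm k = Matrix.mat (2 * k) (2 * k) (\<lambda>(i, j). if i + j = 2 * k then 1 else 0)"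

text \<open>The term \<open>4 tau\<close> is responsible for faithfulness, the term \<open>2 dm\<close> for Zariski density.\<close>

definition bend :: "nat \<Rightarrow> bool \<Rightarrow> real mat" where
  "bend k b = 4 \<cdot>\<^sub>m tau k + (if b then 0 else 2) \<cdot>\<^sub>m dm k"

text \<open>Conjugation by the reflections in \<open>S0\<close> and \<open>S3\<close> inverts upper
  unipotent matrices, hence the two signs. The sign of \<open>S1\<close> selects one of two bends;
  it is constant along words in the sides of the second piece, and it brings both bends into one
  group.\<close>

definition bd :: "nat \<Rightarrow> (side \<Rightarrow> bool) \<Rightarrow> real mat" where
  "bd k c = (sg (c S0) * sg (c S3)) \<cdot>\<^sub>m bend k (c S1)"

lemma block_carrier [simp, intro]:
  "qm k \<in> carrier_mat (2 * k) (2 * k)" "tau k \<in> carrier_mat (2 * k) (2 * k)"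
  "dm k \<in> carrier_mat (2 * k) (2 * k)" "bend k b \<in> carrier_mat (2 * k) (2 * k)"
  "bd k c \<in> carrier_mat (2 * k) (2 * k)"
  by (auto simp: qm_def tau_def dm_def bend_def bd_def)

lemma block_sym:
  "transpose_mat (qm k) = qm k" "transpose_mat (tau k) = tau k" "transpose_mat (dm k) = dm k"
  by (auto simp: qm_def tau_def dm_def add.commute intro!: eq_matI)

lemma bend_sym: "transpose_mat (bend k b) = bend k b" "transpose_mat (bd k c) = bd k c"
proof -
  have *: "transpose_mat (r \<cdot>\<^sub>m A) = r \<cdot>\<^sub>m transpose_mat A" for r :: real and A
    by (auto intro!: eq_matI)
  have "transpose_mat (4 \<cdot>\<^sub>m tau k + r \<cdot>\<^sub>m dm k) = 4 \<cdot>\<^sub>m tau k + r \<cdot>\<^sub>m dm k" for r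
    by (subst transpose_add[of _ "2*k" "2*k"]) (simp_all add: * block_sym)
  then show "transpose_mat (bend k b) = bend k b" "transpose_mat (bd k c) = bd k c"
    by (simp_all add: bend_def bd_def *)
qed

lemma qm_sq: "qm k * qm k = 1\<^sub>m (2 * k)"
proof (rule eq_matI)
  fix i j assume ij: "i < dim_row (1\<^sub>m (2 * k) :: real mat)" "j < dim_col (1\<^sub>m (2 * k) :: real mat)"
  then have "(qm k * qm k) $$ (i, j) = (\<Sum>l\<in>{0..<2*k}.
      (if i + l + 1 = 2 * k then 1 else 0) * (if l + j + 1 = 2 * k then 1 else 0))"
    by (simp add: qm_def scalar_prod_def)
  also have "\<dots> = (\<Sum>l\<in>{0..<2*k}. if l = 2 * k - 1 - i then (if i = j then 1 else 0) else 0)"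
    using ij by (intro sum.cong) auto
  also have "\<dots> = (1\<^sub>m (2 * k) :: real mat) $$ (i, j)"
    using ij by (auto simp: sum.delta)
  finally show "(qm k * qm k) $$ (i, j) = (1\<^sub>m (2 * k) :: real mat) $$ (i, j)" .
qed (auto simp: qm_def)

text \<open>The quadruple \<open>(a, b, c, d)\<close> stands for the block matrix with rows \<open>(a, b q)\<close> and \<open>(c q, d)\<close>, where
  \<open>q = qm k\<close>; since \<open>q\<^sup>2 = 1\<close>, this embeds the \<open>2 \<times> 2\<close> matrices.\<close>

type_synonym quad = "real \<times> real \<times> real \<times> real"

fun qmul :: "quad \<Rightarrow> quad \<Rightarrow> quad" where
  "qmul (a, b, c, d) (a', b', c', d') = (a * a' + b * c', a * b' + b * d', c * a' + d * c', c * b' + d * d')"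

fun Th :: "nat \<Rightarrow> quad \<Rightarrow> real mat" where
  "Th k (a, b, c, d) = four_block_mat (a \<cdot>\<^sub>m 1\<^sub>m (2 * k)) (b \<cdot>\<^sub>m qm k) (c \<cdot>\<^sub>m qm k) (d \<cdot>\<^sub>m 1\<^sub>m (2 * k))"

definition upper_unip :: "nat \<Rightarrow> real mat \<Rightarrow> real mat" where
  "upper_unip k B = four_block_mat (1\<^sub>m (2 * k)) B (0\<^sub>m (2 * k) (2 * k)) (1\<^sub>m (2 * k))"

lemma Th_carrier [simp, intro]: "Th k x \<in> carrier_mat (4 * k) (4 * k)"
  by (cases x) (auto intro!: carrier_matI)

lemma upper_unip_carrier [simp, intro]: "upper_unip k B \<in> carrier_mat (4 * k) (4 * k)"
  using four_block_carrier_mat[of "1\<^sub>m (2 * k)" "2 * k" "2 * k" "1\<^sub>m (2 * k)" "2 * k" "2 * k"] by (simp add: upper_unip_def)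

lemma Th_one: "Th k (1, 0, 0, 1) = 1\<^sub>m (4 * k)"
proof -
  have "0 \<cdot>\<^sub>m qm k = 0\<^sub>m (2 * k) (2 * k)" "1 \<cdot>\<^sub>m 1\<^sub>m (2 * k) = (1\<^sub>m (2 * k) :: real mat)"
    by (auto simp: qm_def intro!: eq_matI)
  then show ?thesis
    by (simp add: four_block_one_mat)
qed

lemma Th_mult: "Th k x * Th k y = Th k (qmul x y)"
proof -
  obtain a b c d a' b' c' d' where xy: "x = (a, b, c, d)" "y = (a', b', c', d')"
    by (cases x, cases y) auto
  have q: "qm k \<in> carrier_mat (2 * k) (2 * k)" by simp
  have o: "(1\<^sub>m (2 * k) :: real mat) \<in> carrier_mat (2 * k) (2 * k)" by simp
  note * = smult_mult_smult[of _ "2*k" "2*k" _ "2*k"]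
  have **: "s \<cdot>\<^sub>m X + t \<cdot>\<^sub>m X = (s + t) \<cdot>\<^sub>m X" for s t :: real and X :: "real mat"
    by (auto simp: algebra_simps intro!: eq_matI)
  show ?thesis
    unfolding xy Th.simps qmul.simps
    by (subst mult_four_block_mat[of _ "2*k" "2*k" _ "2*k" _ "2*k"])
       (auto simp: * qm_sq ** left_mult_one_mat[OF q] right_mult_one_mat[OF q])
qed

lemma upper_unip_mult:
  assumes "A \<in> carrier_mat (2 * k) (2 * k)" "B \<in> carrier_mat (2 * k) (2 * k)"
  shows "upper_unip k A * upper_unip k B = upper_unip k (A + B)"
  unfolding upper_unip_def
  by (subst mult_four_block_mat[of _ "2*k" "2*k" _ "2*k" _ "2*k"])
     (use assms in \<open>auto simp: comm_add_mat\<close>)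

lemma upper_unip_zero: "upper_unip k (0\<^sub>m (2 * k) (2 * k)) = 1\<^sub>m (4 * k)"
  by (simp add: upper_unip_def four_block_one_mat)

lemma upper_unip_inverse:
  assumes "B \<in> carrier_mat (2 * k) (2 * k)"
  shows "upper_unip k B * upper_unip k (- B) = 1\<^sub>m (4 * k)" "upper_unip k (- B) * upper_unip k B = 1\<^sub>m (4 * k)"
proof -
  have "B + - B = 0\<^sub>m (2 * k) (2 * k)" "- B + B = 0\<^sub>m (2 * k) (2 * k)"
    using assms by (auto intro!: eq_matI)
  then show "upper_unip k B * upper_unip k (- B) = 1\<^sub>m (4 * k)" "upper_unip k (- B) * upper_unip k B = 1\<^sub>m (4 * k)"
    using assms by (simp_all add: upper_unip_mult upper_unip_zero)
qed

text \<open>The reflections of a Lambert quadrilateral with an ideal vertex at infinity; the sides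
  \<open>S4\<close> and \<open>S5\<close> belong to a second copy that is bent along the ideal vertex.\<close>

fun side_quad :: "side \<Rightarrow> quad" where
  "side_quad S0 = (-1, 0, 0, 1)"
| "side_quad S1 = (0, sqrt 2, 1 / sqrt 2, 0)"
| "side_quad S2 = (sqrt 2, - sqrt 2, 1 / sqrt 2, - sqrt 2)"
| "side_quad S3 = (-1, 4, 0, 1)"
| "side_quad S4 = (sqrt 2, - sqrt 2, 1 / sqrt 2, - sqrt 2)"
| "side_quad S5 = (0, sqrt 2, 1 / sqrt 2, 0)"

fun piece :: "bool \<Rightarrow> side set" where
  "piece True = {S0, S1, S2, S3}"
| "piece False = {S3, S4, S5, S0}"

text \<open>The change of basis that bends the second piece. It depends on the tile, and its inverse
  is kept separately as \<open>frame'\<close>; along a word within one piece the intermediate frames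
  cancel.\<close>

definition frame :: "nat \<Rightarrow> bool \<Rightarrow> (side \<Rightarrow> bool) \<Rightarrow> real mat" where
  "frame k p c = (if p then 1\<^sub>m (4 * k) else upper_unip k (bd k c))"

definition frame' :: "nat \<Rightarrow> bool \<Rightarrow> (side \<Rightarrow> bool) \<Rightarrow> real mat" where
  "frame' k p c = (if p then 1\<^sub>m (4 * k) else upper_unip k (- bd k c))"

lemma frame_carrier [simp, intro]:
  "frame k p c \<in> carrier_mat (4 * k) (4 * k)" "frame' k p c \<in> carrier_mat (4 * k) (4 * k)"
  by (auto simp: frame_def frame'_def)

lemma frame_inverse: "frame k p c * frame' k p c = 1\<^sub>m (4 * k)" "frame' k p c * frame k p c = 1\<^sub>m (4 * k)"
  by (auto simp: frame_def frame'_def upper_unip_inverse)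

definition hexrep_step :: "nat \<Rightarrow> (side \<Rightarrow> bool) \<Rightarrow> side \<Rightarrow> real mat" where
  "hexrep_step k c i = frame k (i \<in> piece True) c * Th k (side_quad i) * frame' k (i \<in> piece True) (flip c i)"

lemma bd_flip: "i = S0 \<or> i = S3 \<Longrightarrow> bd k (flip c i) = - bd k c"
proof -
  have *: "bd k c \<in> carrier_mat (2 * k) (2 * k)" "bd k (flip c i) \<in> carrier_mat (2 * k) (2 * k)" by simp_all
  assume "i = S0 \<or> i = S3"
  then show ?thesis
    by (intro eq_matI) (auto simp: bd_def flip_apply)
qed

text \<open>The reflection conjugates the block \<open>B\<close> into \<open>-B\<close>, so the
  twist cancels: bending is compatible with the group of the ideal vertex.\<close>

lemma upper_unip_Th_upper_unip:
  assumes "B \<in> carrier_mat (2 * k) (2 * k)"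
  shows "upper_unip k B * Th k (-1, b, 0, 1) * upper_unip k B = Th k (-1, b, 0, 1)"
proof -
  have o: "(0 \<cdot>\<^sub>m qm k) = 0\<^sub>m (2 * k) (2 * k)" "-1 \<cdot>\<^sub>m (1\<^sub>m (2 * k) :: real mat) = - 1\<^sub>m (2 * k)"
    "1 \<cdot>\<^sub>m (1\<^sub>m (2 * k) :: real mat) = 1\<^sub>m (2 * k)"
    by (auto simp: qm_def intro!: eq_matI)
  have q: "b \<cdot>\<^sub>m qm k \<in> carrier_mat (2 * k) (2 * k)" by simp
  note z = left_mult_one_mat[OF q] left_mult_zero_mat[OF q] left_add_zero_mat[of _ "2*k" "2*k"]
    left_mult_zero_mat[OF assms] left_mult_one_mat[OF assms]
  have z0: "- 0\<^sub>m (2*k) (2*k) = (0\<^sub>m (2*k) (2*k) :: real mat)" by (auto intro!: eq_matI)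
  have 1: "upper_unip k B * Th k (-1, b, 0, 1) = four_block_mat (- 1\<^sub>m (2 * k)) (b \<cdot>\<^sub>m qm k + B) (0\<^sub>m (2 * k) (2 * k)) (1\<^sub>m (2 * k))"
    unfolding upper_unip_def Th.simps o
    by (subst mult_four_block_mat[of _ "2*k" "2*k" _ "2*k" _ "2*k"]) (use assms q in \<open>auto simp: z z0\<close>)
  have "- B + (b \<cdot>\<^sub>m qm k + B) = b \<cdot>\<^sub>m qm k"
    using assms q carrier_matD[OF block_carrier(1)[of k]] by (intro eq_matI) auto
  then show ?thesis
    unfolding 1 unfolding upper_unip_def Th.simps o
    by (subst mult_four_block_mat[of _ "2*k" "2*k" _ "2*k" _ "2*k"]) (use assms q in auto)
qed

text \<open>The sides common to both pieces are \<open>S0\<close> and \<open>S3\<close>. Crossing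
  them negates \<open>bd\<close>, and by the preceding cancellation their matrices are the same in
  either frame.\<close>

lemma hexrep_step_frame: "i \<in> piece p \<Longrightarrow> hexrep_step k c i = frame k p c * Th k (side_quad i) * frame' k p (flip c i)"
proof -
  assume i: "i \<in> piece p"
  show ?thesis
  proof (cases "p = (i \<in> piece True)")
    case True
    then show ?thesis by (simp add: hexrep_step_def)
  next
    case False
    then have p: "\<not> p" "i = S0 \<or> i = S3" using i by (cases p; auto)+
    have c: "Th k (side_quad i) \<in> carrier_mat (4 * k) (4 * k)" by simp
    obtain b where b: "side_quad i = (-1, b, 0, 1)" using p(2) by auto
    have "- (- bd k c) = bd k c" by (auto intro!: eq_matI)
    then have "frame k p c * Th k (side_quad i) * frame' k p (flip c i) = Th k (side_quad i)"
      using p upper_unip_Th_upper_unip[of "bd k c" k b] by (simp add: frame_def frame'_def bd_flip b)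
    moreover have "hexrep_step k c i = Th k (side_quad i)"
      using p(2) c by (auto simp: hexrep_step_def frame_def frame'_def)
    ultimately show ?thesis by simp
  qed
qed

fun hexrep :: "nat \<Rightarrow> (side \<Rightarrow> bool) \<Rightarrow> side list \<Rightarrow> real mat" where
  "hexrep k c [] = 1\<^sub>m (4 * k)"
| "hexrep k c (i # w) = (sg (c (nx i)) \<cdot>\<^sub>m hexrep_step k c i) * hexrep k (flip c i) w"

text \<open>Adjacent reflections anticommute; the signs \<open>sg (c (nx i))\<close> turn this into commutation.\<close>

fun sn :: "(side \<Rightarrow> bool) \<Rightarrow> side list \<Rightarrow> real" where
  "sn c [] = 1"
| "sn c (i # w) = sg (c (nx i)) * sn (flip c i) w"

fun quad_of :: "side list \<Rightarrow> quad" where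
  "quad_of [] = (1, 0, 0, 1)"
| "quad_of (i # w) = qmul (side_quad i) (quad_of w)"

lemma hexrep_step_carrier [simp, intro]: "hexrep_step k c i \<in> carrier_mat (4 * k) (4 * k)"
  unfolding hexrep_step_def by (intro mult_carrier_mat) auto

lemma hexrep_carrier [simp, intro]: "hexrep k c w \<in> carrier_mat (4 * k) (4 * k)"
  by (induction w arbitrary: c) (auto intro!: mult_carrier_mat[of _ "4*k" "4*k"])

lemma hexrep_append: "hexrep k c (u @ v) = hexrep k c u * hexrep k (run c u) v"
proof (induction u arbitrary: c)
  case Nil
  then show ?case by (simp add: left_mult_one_mat[OF hexrep_carrier])
next
  case (Cons i u)
  then show ?case
    using assoc_mult_mat[of "sg (c (nx i)) \<cdot>\<^sub>m hexrep_step k c i" "4*k" "4*k" "hexrep k (flip c i) u" "4*k" "hexrep k (run (flip c i) u) v" "4*k"]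
    by simp
qed

lemma hexrep_piece:
  assumes "set w \<subseteq> piece p"
  shows "hexrep k c w = sn c w \<cdot>\<^sub>m (frame k p c * Th k (quad_of w) * frame' k p (run c w))"
  using assms
proof (induction w arbitrary: c)
  case Nil
  have "1 \<cdot>\<^sub>m (1\<^sub>m (4 * k)) = (1\<^sub>m (4 * k) :: real mat)" by (auto intro!: eq_matI)
  then show ?case by (simp add: Th_one frame_inverse right_mult_one_mat[OF frame_carrier(1)] del: Th.simps)
next
  case (Cons i w)
  let ?N = "4 * k"
  let ?F = "frame k p" and ?F' = "frame' k p" and ?c = "flip c i"
  have C: "?F c \<in> carrier_mat ?N ?N" "?F' c \<in> carrier_mat ?N ?N" "Th k x \<in> carrier_mat ?N ?N" for c x
    by auto
  have "(sg (c (nx i)) \<cdot>\<^sub>m (?F c * Th k (side_quad i) * ?F' ?c)) * (sn ?c w \<cdot>\<^sub>m (?F ?c * Th k (quad_of w) * ?F' (run ?c w)))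
     = (sg (c (nx i)) * sn ?c w) \<cdot>\<^sub>m ((?F c * Th k (side_quad i) * ?F' ?c) * (?F ?c * Th k (quad_of w) * ?F' (run ?c w)))"
    by (rule smult_mult_smult[of _ ?N ?N _ ?N]) (intro mult_carrier_mat[of _ ?N ?N] C)+
  also have "(?F c * Th k (side_quad i) * ?F' ?c) * (?F ?c * Th k (quad_of w) * ?F' (run ?c w))
      = ?F c * Th k (side_quad i) * (?F' ?c * ?F ?c) * Th k (quad_of w) * ?F' (run ?c w)"
    using C by (simp add: assoc_mult_mat[of _ ?N ?N _ ?N _ ?N] mult_carrier_mat[of _ ?N ?N _ ?N])
  also have "\<dots> = ?F c * (Th k (side_quad i) * Th k (quad_of w)) * ?F' (run ?c w)"
    using C by (simp add: frame_inverse right_mult_one_mat[of _ ?N ?N] assoc_mult_mat[of _ ?N ?N _ ?N _ ?N] mult_carrier_mat[of _ ?N ?N _ ?N])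
  finally show ?case
    using Cons by (simp add: hexrep_step_frame[of i p] Th_mult del: Th.simps)
qed

text \<open>Each defining relation involves the sides of a single piece, where the frames cancel and
  a computation with 2 x 2 matrices remains.\<close>

lemma hexrep_weq: "weq u v \<Longrightarrow> hexrep k c u = hexrep k c v"
proof (induction arbitrary: c rule: weq.induct)
  case (cancel i)
  obtain p where p: "i \<in> piece p" by (cases i) (auto intro: that[of True] that[of False])
  have "quad_of [i, i] = quad_of []" by (cases i) auto
  then have "hexrep k c [i, i] = sn c [i, i] \<cdot>\<^sub>m (frame k p c * Th k (quad_of []) * frame' k p c)"
    using p hexrep_piece[of "[i, i]" p k c] weq_run[OF weq.cancel, of c i] by simp
  also have "sn c [i, i] = sn c []" by (simp add: flip_apply)
  also have "\<dots> \<cdot>\<^sub>m (frame k p c * Th k (quad_of []) * frame' k p c) = hexrep k c []"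
    using hexrep_piece[of "[]" p k c] by simp
  finally show ?case .
next
  case (swap i)
  obtain p where p: "i \<in> piece p" "nx i \<in> piece p" by (cases i) (auto intro: that[of True] that[of False])
  let ?u = "[i, nx i]" and ?v = "[nx i, i]"
  have "4 / sqrt 2 = 2 * sqrt 2" by (simp add: field_simps)
  then have r: "quad_of ?u = qmul (-1, 0, 0, -1) (quad_of ?v)" by (cases i) auto
  \<comment> \<open>The letter \<open>i\<close> reads the sign at \<open>nx i\<close>, which in the
    other order has already been flipped; the sign at \<open>nx (nx i)\<close> is the same in both
    orders. The resulting factor -1 offsets the anticommutation.\<close>
  have s: "sn c ?u = - sn c ?v" by (cases i) (auto simp: flip_apply)
  have m: "Th k (qmul (-1, 0, 0, -1) x) = (-1) \<cdot>\<^sub>m Th k x" for x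
    by (cases x) (simp add: smult_four_block_mat[of _ "2*k" "2*k" _ "2*k" _ "2*k"] smult_smult_mat)
  have "hexrep k c ?u = sn c ?u \<cdot>\<^sub>m (frame k p c * Th k (quad_of ?u) * frame' k p (run c ?u))"
    by (rule hexrep_piece) (use p in auto)
  also have "\<dots> = (- sn c ?v) \<cdot>\<^sub>m (frame k p c * ((-1) \<cdot>\<^sub>m Th k (quad_of ?v)) * frame' k p (run c ?v))"
    unfolding r s m weq_run[OF weq.swap] ..
  also have "\<dots> = sn c ?v \<cdot>\<^sub>m (frame k p c * Th k (quad_of ?v) * frame' k p (run c ?v))"
  proof -
    have "frame k p c * ((-1) \<cdot>\<^sub>m Th k (quad_of ?v)) * frame' k p (run c ?v) =
        (-1) \<cdot>\<^sub>m (frame k p c * Th k (quad_of ?v) * frame' k p (run c ?v))"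
      by (subst mult_smult_distrib[of _ "4*k" "4*k" _ "4*k"], (auto)[2], subst mult_smult_assoc_mat[of _ "4*k" "4*k" _ "4*k"])
         (auto intro!: mult_carrier_mat)
    then show ?thesis by (simp only: smult_smult_mat) simp
  qed
  also have "\<dots> = hexrep k c ?v"
    by (rule hexrep_piece[symmetric]) (use p in auto)
  finally show ?case .
next
  case (app u u' v v')
  then show ?case by (simp add: hexrep_append weq_run)
qed auto

section \<open>Action on block vectors and multipliers of the symplectic form\<close>

lemma four_block_mat_vec:
  assumes "A \<in> carrier_mat n n" "B \<in> carrier_mat n n" "C \<in> carrier_mat n n" "D \<in> carrier_mat n n"
    "x \<in> carrier_vec n" "y \<in> carrier_vec n"
  shows "four_block_mat A B C D *\<^sub>v (x @\<^sub>v y) = (A *\<^sub>v x + B *\<^sub>v y) @\<^sub>v (C *\<^sub>v x + D *\<^sub>v y)"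
proof (rule eq_vecI)
  fix i assume i: "i < dim_vec ((A *\<^sub>v x + B *\<^sub>v y) @\<^sub>v (C *\<^sub>v x + D *\<^sub>v y))"
  have "i < n + n" using i assms by simp
  then have "\<not> i < n \<Longrightarrow> i - n < n" by linarith
  then have "\<not> i < n \<Longrightarrow> Matrix.row C (i - n) \<in> carrier_vec n \<and> Matrix.row D (i - n) \<in> carrier_vec n"
    using assms by auto
  with \<open>i < n + n\<close>
  show "vec_index (four_block_mat A B C D *\<^sub>v (x @\<^sub>v y)) i = vec_index ((A *\<^sub>v x + B *\<^sub>v y) @\<^sub>v (C *\<^sub>v x + D *\<^sub>v y)) i"
    using assms row_four_block_mat[OF assms(1-4)]
    by (cases "i < n") (auto simp: scalar_prod_append[of _ n _ n])
qed (use assms in auto)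

lemma act_Th:
  assumes "x \<in> carrier_vec (2 * k)" "y \<in> carrier_vec (2 * k)"
  shows "Th k (a, b, c, d) *\<^sub>v (x @\<^sub>v y) =
     (a \<cdot>\<^sub>v x + b \<cdot>\<^sub>v (qm k *\<^sub>v y)) @\<^sub>v (c \<cdot>\<^sub>v (qm k *\<^sub>v x) + d \<cdot>\<^sub>v y)"
proof -
  have *: "(r \<cdot>\<^sub>m A) *\<^sub>v v = r \<cdot>\<^sub>v (A *\<^sub>v v)"
    if "A \<in> carrier_mat (2 * k) (2 * k)" "v \<in> carrier_vec (2 * k)" for r :: real and A v
    using that by (auto intro!: eq_vecI)
  show ?thesis
    unfolding Th.simps
    by (subst four_block_mat_vec[of _ "2 * k"]) (use assms in \<open>auto simp: *\<close>)
qed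

lemma act_upper_unip:
  assumes "B \<in> carrier_mat (2 * k) (2 * k)" "x \<in> carrier_vec (2 * k)" "y \<in> carrier_vec (2 * k)"
  shows "upper_unip k B *\<^sub>v (x @\<^sub>v y) = (x + B *\<^sub>v y) @\<^sub>v y"
proof -
  have "0\<^sub>m (2 * k) (2 * k) *\<^sub>v x = 0\<^sub>v (2 * k)"
    using assms by (auto intro!: eq_vecI)
  then show ?thesis
    unfolding upper_unip_def
    by (subst four_block_mat_vec[of _ "2 * k"]) (use assms in auto)
qed

lemma vec4k_cases:
  assumes "v \<in> carrier_vec (4 * k)"
  obtains x y where "v = x @\<^sub>v y" "x \<in> carrier_vec (2 * k)" "y \<in> carrier_vec (2 * k)"
proof -
  have "v \<in> carrier_vec (2 * k + 2 * k)" using assms by simp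
  then have "vec_first v (2 * k) @\<^sub>v vec_last v (2 * k) = v" by (rule vec_first_last_append)
  then show thesis by (intro that[of "vec_first v (2 * k)" "vec_last v (2 * k)"]) auto
qed

lemma symplectic_form_append:
  assumes "x \<in> carrier_vec n" "y \<in> carrier_vec n" "x' \<in> carrier_vec n" "y' \<in> carrier_vec n"
  shows "symplectic_form n (x @\<^sub>v y) (x' @\<^sub>v y') = x \<bullet> y' - y \<bullet> x'"
proof -
  have "symplectic_form n (x @\<^sub>v y) (x' @\<^sub>v y') =
      (\<Sum>i<n. vec_index x i * vec_index y' i - vec_index y i * vec_index x' i)"
    unfolding symplectic_form_def using assms by (intro sum.cong) auto
  then show ?thesis
    using assms by (simp add: scalar_prod_def sum_subtractf lessThan_atLeast0)
qed

lemma sym_scalar_prod: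
  fixes A :: "real mat"
  assumes "A \<in> carrier_mat n n" "transpose_mat A = A" "x \<in> carrier_vec n" "y \<in> carrier_vec n"
  shows "(A *\<^sub>v x) \<bullet> y = x \<bullet> (A *\<^sub>v y)"
  using transpose_vec_mult_scalar[of A n n y x] assms by simp

lemma qm_vec [simp, intro]: "x \<in> carrier_vec (2 * k) \<Longrightarrow> qm k *\<^sub>v x \<in> carrier_vec (2 * k)"
  by (rule mult_mat_vec_carrier[OF block_carrier(1)])

lemma qm_qm_vec: "x \<in> carrier_vec (2 * k) \<Longrightarrow> qm k *\<^sub>v (qm k *\<^sub>v x) = x"
  using assoc_mult_mat_vec[OF block_carrier(1) block_carrier(1), of x k] by (simp add: qm_sq)

lemma qm_scalar_prod:
  assumes "x \<in> carrier_vec (2 * k)" "y \<in> carrier_vec (2 * k)"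
  shows "(qm k *\<^sub>v x) \<bullet> y = x \<bullet> (qm k *\<^sub>v y)" "(qm k *\<^sub>v x) \<bullet> (qm k *\<^sub>v y) = x \<bullet> y"
  using assms by (simp_all add: sym_scalar_prod[OF block_carrier(1) block_sym(1)] qm_qm_vec)

lemmas sp_distrib = add_scalar_prod_distrib[of _ "2 * k" for k] scalar_prod_add_distrib[of _ "2 * k" for k]
  smult_scalar_prod_distrib[of _ "2 * k" for k] scalar_prod_smult_distrib[of _ "2 * k" for k]

text \<open>Similitudes of the symplectic form with multiplier \<open>m\<close>. A single reflection
  has multiplier -1, so letters have to be treated outside the symplectic group.\<close>

definition scales :: "nat \<Rightarrow> real mat \<Rightarrow> real \<Rightarrow> bool" where
  "scales k A m \<longleftrightarrow> A \<in> carrier_mat (4 * k) (4 * k) \<and>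
     (\<forall>x \<in> carrier_vec (4 * k). \<forall>y \<in> carrier_vec (4 * k).
        symplectic_form (2 * k) (A *\<^sub>v x) (A *\<^sub>v y) = m * symplectic_form (2 * k) x y)"

lemma scales_mult: "scales k A m \<Longrightarrow> scales k B m' \<Longrightarrow> scales k (A * B) (m * m')"
  unfolding scales_def by (auto simp: assoc_mult_mat_vec[of _ "4*k" "4*k" _ "4*k"])

lemma scales_one: "scales k (1\<^sub>m (4 * k)) 1"
  by (simp add: scales_def)

lemma scales_sg:
  assumes "scales k A m"
  shows "scales k (sg b \<cdot>\<^sub>m A) m"
proof -
  have A: "A \<in> carrier_mat (4 * k) (4 * k)" using assms by (simp add: scales_def)
  have "symplectic_form (2 * k) (sg b \<cdot>\<^sub>v u) (sg b \<cdot>\<^sub>v v) = symplectic_form (2 * k) u v"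
    if "u \<in> carrier_vec (4 * k)" "v \<in> carrier_vec (4 * k)" for u v
    using that unfolding symplectic_form_def by (intro sum.cong) (auto simp: sg_def)
  moreover have "(sg b \<cdot>\<^sub>m A) *\<^sub>v u = sg b \<cdot>\<^sub>v (A *\<^sub>v u)" if "u \<in> carrier_vec (4 * k)" for u
    using A that by (auto intro!: eq_vecI)
  ultimately show ?thesis
    using assms A by (auto simp: scales_def)
qed

text \<open>After \<open>y\<close> is replaced by \<open>q y\<close>, the form is the tensor product
  of the area form of the plane with a symmetric form, and the quadruple acts on the plane only. The
  multiplier is therefore its determinant.\<close>

lemma scales_Th: "scales k (Th k (a, b, c, d)) (a * d - b * c)"
  unfolding scales_def
proof (intro conjI ballI)
  fix u v :: "real Matrix.vec" assume "u \<in> carrier_vec (4 * k)" "v \<in> carrier_vec (4 * k)"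
  then obtain x y x' y' where uv: "u = x @\<^sub>v y" "v = x' @\<^sub>v y'"
    and [simp]: "x \<in> carrier_vec (2 * k)" "y \<in> carrier_vec (2 * k)" "x' \<in> carrier_vec (2 * k)" "y' \<in> carrier_vec (2 * k)"
    by (meson vec4k_cases)
  show "symplectic_form (2 * k) (Th k (a, b, c, d) *\<^sub>v u) (Th k (a, b, c, d) *\<^sub>v v)
      = (a * d - b * c) * symplectic_form (2 * k) u v"
    unfolding uv by (simp add: act_Th symplectic_form_append sp_distrib[of _ k] qm_scalar_prod qm_qm_vec
        del: Th.simps scalar_prod_smult_left scalar_prod_smult_right)
      (simp add: algebra_simps)
qed (rule Th_carrier)

lemma scales_upper_unip:
  assumes B: "B \<in> carrier_mat (2 * k) (2 * k)" "transpose_mat B = B"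
  shows "scales k (upper_unip k B) 1"
  unfolding scales_def
proof (intro conjI ballI)
  fix u v :: "real Matrix.vec" assume "u \<in> carrier_vec (4 * k)" "v \<in> carrier_vec (4 * k)"
  then obtain x y x' y' where uv: "u = x @\<^sub>v y" "v = x' @\<^sub>v y'"
    and xy [simp]: "x \<in> carrier_vec (2 * k)" "y \<in> carrier_vec (2 * k)" "x' \<in> carrier_vec (2 * k)" "y' \<in> carrier_vec (2 * k)"
    by (meson vec4k_cases)
  have [simp]: "B *\<^sub>v y \<in> carrier_vec (2 * k)" "B *\<^sub>v y' \<in> carrier_vec (2 * k)"
    using B(1) by auto
  show "symplectic_form (2 * k) (upper_unip k B *\<^sub>v u) (upper_unip k B *\<^sub>v v) = 1 * symplectic_form (2 * k) u v"
    unfolding uv using sym_scalar_prod[OF B xy(2,4)]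
    by (simp add: act_upper_unip[OF B(1)] symplectic_form_append sp_distrib[of _ k])
qed (rule upper_unip_carrier)

lemma scales_frame: "scales k (frame k p c) 1" "scales k (frame' k p c) 1"
proof -
  have "transpose_mat (- bd k c) = - bd k c"
    using bend_sym(2)[of k c] by (metis transpose_uminus)
  then show "scales k (frame k p c) 1" "scales k (frame' k p c) 1"
    by (auto simp: frame_def frame'_def bend_sym intro!: scales_one scales_upper_unip)
qed

lemma scales_hexrep: "scales k (hexrep k c w) ((-1) ^ length w)"
proof (induction w arbitrary: c)
  case Nil
  then show ?case by (simp add: scales_one)
next
  case (Cons i w)
  obtain a b e d where abed: "side_quad i = (a, b, e, d)" "a * d - b * e = -1"
    by (cases i) auto
  have "scales k (Th k (side_quad i)) (-1)"
    using scales_Th[of k a b e d] unfolding abed .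
  then have "scales k (hexrep_step k c i) (-1)"
    unfolding hexrep_step_def using scales_mult[OF scales_mult[OF scales_frame(1)] scales_frame(2)] by fastforce
  from scales_mult[OF scales_sg[OF this] Cons[of "flip c i"]] show ?case
    by simp
qed

lemma closed_even_length:
  assumes "run c w = c"
  shows "even (length w)"
proof -
  have "even (count_list w i)" for i
    using run_apply[of c w i] assms by auto
  moreover have "length w = (\<Sum>i\<in>UNIV. count_list w i)"
    by (rule sum_count_set[symmetric]) auto
  ultimately show ?thesis by (simp add: dvd_sum)
qed

lemma hexrep_Sp_real:
  assumes "run c w = c"
  shows "hexrep k c w \<in> carrier (Sp_real (2 * k))"
  using scales_hexrep[of k c w] closed_even_length[OF assms]
  by (simp add: Sp_real_def scales_def)

text \<open>Conjugating by \<open>diag(1, sqrt 2)\<close> makes all matrices \<open>hexrep\<close> homogeneous elements of a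
  \<open>Z/2\<close>-graded ring of matrices over \<open>Z[sqrt 2]\<close>.\<close>

definition gr :: "bool \<Rightarrow> real set" where
  "gr p = (if p then (\<lambda>x. sqrt 2 * x) ` \<int> else \<int>)"

lemma gr_add: "x \<in> gr p \<Longrightarrow> y \<in> gr p \<Longrightarrow> x + y \<in> gr p"
  by (auto simp: gr_def image_iff distrib_left[symmetric] intro: Ints_add)

lemma gr_0 [simp]: "0 \<in> gr p"
  by (auto simp: gr_def image_iff)

lemma gr_sum: "(\<And>i. i \<in> A \<Longrightarrow> f i \<in> gr p) \<Longrightarrow> sum f A \<in> gr p"
  by (induction A rule: infinite_finite_induct) (auto intro: gr_add)

lemma gr_mult:
  assumes "x \<in> gr p" "y \<in> gr p'"
  shows "x * y \<in> gr (p \<noteq> p')"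
proof -
  obtain a where a: "a \<in> \<int>" "x = (if p then sqrt 2 else 1) * a"
    using assms(1) by (auto simp: gr_def split: if_splits)
  obtain b where b: "b \<in> \<int>" "y = (if p' then sqrt 2 else 1) * b"
    using assms(2) by (auto simp: gr_def split: if_splits)
  have "a * b \<in> \<int>" "2 * (a * b) \<in> \<int>" using a(1) b(1) by auto
  then show ?thesis
    unfolding a(2) b(2) gr_def
    by (cases p; cases p') (auto simp: image_iff mult_ac real_sqrt_mult_self intro!: bexI[of _ "a * b"])
qed

definition wt :: "nat \<Rightarrow> nat \<Rightarrow> real" where
  "wt k i = (if i < 2 * k then 1 else sqrt 2)"

text \<open>Homogeneity of degree \<open>p\<close>: after the conjugation the diagonal blocks have
  degree \<open>p\<close> and the off-diagonal blocks the opposite degree.\<close>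

definition graded :: "nat \<Rightarrow> bool \<Rightarrow> real mat \<Rightarrow> bool" where
  "graded k p A \<longleftrightarrow> A \<in> carrier_mat (4 * k) (4 * k) \<and> (\<forall>i<4*k. \<forall>j<4*k.
     A $$ (i, j) * wt k i / wt k j \<in> gr (p \<noteq> ((i < 2 * k) \<noteq> (j < 2 * k))))"

lemma graded_mult:
  assumes "graded k p A" "graded k p' B"
  shows "graded k (p \<noteq> p') (A * B)"
  unfolding graded_def
proof (intro conjI allI impI)
  show "A * B \<in> carrier_mat (4 * k) (4 * k)"
    using assms by (auto simp: graded_def)
  fix i j assume ij: "i < 4 * k" "j < 4 * k"
  have "(A * B) $$ (i, j) * wt k i / wt k j =
      (\<Sum>l\<in>{0..<4*k}. (A $$ (i, l) * wt k i / wt k l) * (B $$ (l, j) * wt k l / wt k j))"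
    using assms ij by (auto simp: graded_def scalar_prod_def sum_distrib_right sum_divide_distrib wt_def intro!: sum.cong)
  also have "\<dots> \<in> gr ((p \<noteq> p') \<noteq> ((i < 2 * k) \<noteq> (j < 2 * k)))"
  proof (rule gr_sum)
    fix l assume "l \<in> {0..<4*k}"
    then have "(A $$ (i, l) * wt k i / wt k l) * (B $$ (l, j) * wt k l / wt k j)
      \<in> gr ((p \<noteq> ((i < 2 * k) \<noteq> (l < 2 * k))) \<noteq> (p' \<noteq> ((l < 2 * k) \<noteq> (j < 2 * k))))"
      using assms ij by (intro gr_mult) (auto simp: graded_def)
    then show "(A $$ (i, l) * wt k i / wt k l) * (B $$ (l, j) * wt k l / wt k j)
        \<in> gr ((p \<noteq> p') \<noteq> ((i < 2 * k) \<noteq> (j < 2 * k)))"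
      by (auto split: if_splits elim!: back_subst[of "\<lambda>b. _ \<in> gr b"])
  qed
  finally show "(A * B) $$ (i, j) * wt k i / wt k j \<in> gr ((p \<noteq> p') \<noteq> ((i < 2 * k) \<noteq> (j < 2 * k)))" .
qed

lemma graded_one: "graded k False (1\<^sub>m (4 * k))"
  by (auto simp: graded_def gr_def wt_def)

lemma graded_sg: "graded k p A \<Longrightarrow> graded k p (sg b \<cdot>\<^sub>m A)"
proof -
  have "- x \<in> gr q" if "x \<in> gr q" for x q
    using that by (auto simp: gr_def image_iff) (metis Ints_minus mult_minus_right)
  then show "graded k p A \<Longrightarrow> graded k p (sg b \<cdot>\<^sub>m A)"
    by (auto simp: graded_def sg_def)
qed

lemma graded_Th: "graded k (i \<noteq> S0 \<and> i \<noteq> S3) (Th k (side_quad i))"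
proof -
  have "2 / sqrt 2 = sqrt 2" "4 / sqrt 2 = 2 * sqrt 2" by (auto simp: field_simps)
  moreover have "\<exists>x\<in>\<int>. - sqrt 2 = sqrt 2 * x" by (intro bexI[of _ "-1"]) auto
  ultimately show ?thesis
    by (cases i) (auto simp: graded_def qm_def wt_def gr_def image_iff Ints_numeral)
qed

text \<open>The conjugation divides the upper right block by \<open>sqrt 2\<close>, and the quotient
  has to be an integral multiple of \<open>sqrt 2\<close>. This is why the bends have even
  entries.\<close>

lemma graded_upper_unip:
  assumes "B \<in> carrier_mat (2 * k) (2 * k)" "\<And>i j. i < 2 * k \<Longrightarrow> j < 2 * k \<Longrightarrow> B $$ (i, j) / 2 \<in> \<int>"
  shows "graded k False (upper_unip k B)"
proof -
  have "B $$ (i, j) / sqrt 2 \<in> gr True" if "i < 2 * k" "j < 2 * k" for i j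
    using assms(2)[OF that] by (auto simp: gr_def image_iff field_simps intro!: bexI[of _ "B $$ (i, j) / 2"])
  then show ?thesis
    using assms(1) by (auto simp: graded_def upper_unip_def wt_def) (auto simp: gr_def)
qed

lemma bd_even: "i < 2 * k \<Longrightarrow> j < 2 * k \<Longrightarrow> bd k c $$ (i, j) / 2 \<in> \<int>"
proof -
  assume ij: "i < 2 * k" "j < 2 * k"
  have "bd k c $$ (i, j) / 2 = sg (c S0) * sg (c S3) * (2 * (tau k $$ (i, j)) + (if c S1 then 0 else dm k $$ (i, j)))"
    using ij carrier_matD[OF block_carrier(2)[of k]] carrier_matD[OF block_carrier(3)[of k]]
    by (simp add: bd_def bend_def)
  also have "\<dots> \<in> \<int>"
    using ij by (intro Ints_mult Ints_add) (auto simp: sg_def tau_def dm_def)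
  finally show ?thesis .
qed

lemma graded_frame: "graded k False (frame k p c)" "graded k False (frame' k p c)"
  using bd_even[of _ k _ c] carrier_matD[OF block_carrier(5)[of k c]] by (auto simp: frame_def frame'_def intro!: graded_one graded_upper_unip)

lemma graded_hexrep: "graded k (odd (length (filter (\<lambda>i. i \<noteq> S0 \<and> i \<noteq> S3) w))) (hexrep k c w)"
proof (induction w arbitrary: c)
  case Nil
  then show ?case by (simp add: graded_one)
next
  case (Cons i w)
  have "graded k (i \<noteq> S0 \<and> i \<noteq> S3) (hexrep_step k c i)"
    unfolding hexrep_step_def using graded_mult[OF graded_mult[OF graded_frame(1) graded_Th] graded_frame(2)] by fastforce
  from graded_mult[OF graded_sg[OF this] Cons[of "flip c i"]] show ?case
    by (auto elim!: back_subst[of "\<lambda>b. graded k b _"])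
qed

lemma closed_even_filter:
  assumes "run c w = c"
  shows "even (length (filter P w))"
proof -
  have "even (count_list w i)" for i
    using run_apply[of c w i] assms by auto
  moreover have "count_list (filter P w) i = (if P i then count_list w i else 0)" for i
    by (induction w) auto
  ultimately have "even (count_list (filter P w) i)" for i
    by simp
  moreover have "length (filter P w) = (\<Sum>i\<in>UNIV. count_list (filter P w) i)"
    by (rule sum_count_set[symmetric]) auto
  ultimately show ?thesis by (simp add: dvd_sum)
qed

text \<open>A closed word contains an even number of letters of odd degree. In degree 0 the
  off-diagonal entries lie in \<open>sqrt 2\<close> times the integers, which the weights turn back
  into integers.\<close>

lemma hexrep_Sp_int:
  assumes "run c w = c"
  shows "hexrep k c w \<in> carrier (Sp_int (2 * k))"
proof -
  have g: "graded k False (hexrep k c w)"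
    using graded_hexrep[of k w c] closed_even_filter[OF assms] by simp
  have "hexrep k c w $$ (i, j) \<in> \<int>" if ij: "i < 4 * k" "j < 4 * k" for i j
  proof -
    have *: "hexrep k c w $$ (i, j) * wt k i / wt k j \<in> gr ((i < 2 * k) \<noteq> (j < 2 * k))"
      using g ij by (simp add: graded_def)
    show ?thesis
    proof (cases "i < 2 * k"; cases "j < 2 * k")
      assume **: "i < 2 * k" "\<not> j < 2 * k"
      then obtain a where "a \<in> \<int>" "hexrep k c w $$ (i, j) / sqrt 2 = sqrt 2 * a"
        using * by (auto simp: gr_def wt_def)
      then have "hexrep k c w $$ (i, j) = 2 * a" by (simp add: field_simps)
      then show ?thesis using \<open>a \<in> \<int>\<close> by auto
    qed (use * in \<open>auto simp: gr_def wt_def\<close>)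
  qed
  then have "elements_mat (hexrep k c w) \<subseteq> \<int>"
    unfolding elements_mat_def using carrier_matD[OF hexrep_carrier[of k c w]] by auto
  then show ?thesis
    using hexrep_Sp_real[OF assms, of k] by (simp add: Sp_int_def)
qed

subsection \<open>Faithfulness\<close>

text \<open>It vanishes exactly when the matrix fixes the ideal vertex at infinity.\<close>

fun lower_left :: "quad \<Rightarrow> real" where "lower_left (a, b, c, d) = c"
fun qdet :: "quad \<Rightarrow> real" where "qdet (a, b, c, d) = a * d - b * c"
fun qneg :: "quad \<Rightarrow> quad" where "qneg (a, b, c, d) = (- a, - b, - c, - d)"

lemma qmul_assoc: "qmul (qmul x y) z = qmul x (qmul y z)"
  by (cases x; cases y; cases z) (simp add: algebra_simps)

lemma qmul_one [simp]: "qmul (1, 0, 0, 1) x = x" "qmul x (1, 0, 0, 1) = x"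
  by (cases x; simp)+

lemma qdet_mul: "qdet (qmul x y) = qdet x * qdet y"
  by (cases x; cases y) (simp add: algebra_simps)

lemma qneg_mul: "qmul (qneg x) y = qneg (qmul x y)" "qmul x (qneg y) = qneg (qmul x y)" "qneg (qneg x) = x"
  by (cases x; cases y; simp add: algebra_simps)+

lemma quad_of_append: "quad_of (u @ v) = qmul (quad_of u) (quad_of v)"
  by (induction u) (simp_all add: qmul_assoc)

lemma qdet_quad_of: "(qdet (quad_of w))\<^sup>2 = 1"
proof (induction w)
  case (Cons i w)
  have "qdet (side_quad i) = -1" by (cases i) auto
  then show ?case using Cons by (simp add: qdet_mul)
qed simp

lemma quad_of_weq: "weq u v \<Longrightarrow> quad_of u = quad_of v \<or> quad_of u = qneg (quad_of v)"
proof (induction rule: weq.induct)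
  case (cancel i)
  then show ?case by (cases i) auto
next
  case (swap i)
  have "4 / sqrt 2 = 2 * sqrt 2" by (simp add: field_simps)
  then show ?case by (cases i) auto
next
  case (app u u' v v')
  then show ?case by (auto simp: quad_of_append qneg_mul)
qed (auto simp: qneg_mul)

lemma lower_left_qneg: "lower_left (qneg x) = - lower_left x"
  by (cases x) auto

lemma lower_left_weq: "weq u v \<Longrightarrow> lower_left (quad_of u) = 0 \<longleftrightarrow> lower_left (quad_of v) = 0"
  using quad_of_weq[of u v] by (auto simp: lower_left_qneg)

text \<open>The orbit of the vector \<open>(1, 0)\<close> and the half planes bounded by the sides.\<close>

fun orbit_vec :: "side list \<Rightarrow> real \<times> real" where
  "orbit_vec [] = (1, 0)"
| "orbit_vec (i # w) = (case side_quad i of (a, b, c, d) \<Rightarrow> case orbit_vec w of (x, y) \<Rightarrow> (a * x + b * y, c * x + d * y))"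

fun side_form :: "side \<Rightarrow> real \<times> real \<Rightarrow> real" where
  "side_form S0 (x, y) = x * y"
| "side_form S3 (x, y) = (2 * y - x) * y"
| "side_form S1 (x, y) = x\<^sup>2 - 2 * y\<^sup>2"
| "side_form S2 (x, y) = (x - 2 * y)\<^sup>2 - 2 * y\<^sup>2"
| "side_form _ _ = 0"

lemma orbit_vec_quad_of: "quad_of w = (a, b, c, d) \<Longrightarrow> orbit_vec w = (a, c)"
proof (induction w arbitrary: a b c d)
  case (Cons i w)
  then show ?case by (cases "quad_of w"; cases i) auto
qed auto

definition act :: "side \<Rightarrow> real \<times> real \<Rightarrow> real \<times> real" where
  "act i v = (case side_quad i of (a, b, c, d) \<Rightarrow> case v of (x, y) \<Rightarrow> (a * x + b * y, c * x + d * y))"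

lemma orbit_vec_Cons: "orbit_vec (i # w) = act i (orbit_vec w)"
  by (simp add: act_def)

lemma sqrt2_simps: "(sqrt 2 * y)\<^sup>2 = 2 * y\<^sup>2" "(x / sqrt 2)\<^sup>2 = x\<^sup>2 / 2"
  "x / sqrt 2 = x * sqrt 2 / 2"
  by (auto simp: power_mult_distrib power_divide field_simps)

lemma sqrt2_sq: "sqrt 2 * sqrt 2 = 2" "sqrt 2 * (sqrt 2 * r) = 2 * r"
  by (simp_all add: mult.assoc[symmetric])

lemma side_form_act_same: "j \<in> piece True \<Longrightarrow> side_form j (act j v) = - side_form j v"
  by (cases v; cases j) (auto simp: act_def sqrt2_simps(3) power2_eq_square sqrt2_sq algebra_simps)

lemma side_form_act_adjacent:
  "i \<in> piece True \<Longrightarrow> j \<in> piece True \<Longrightarrow> i = nx j \<or> j = nx i \<Longrightarrow> side_form i (act j v) = side_form i v"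
  by (cases v; cases j; cases i) (auto simp: act_def sqrt2_simps(3) power2_eq_square sqrt2_sq algebra_simps)

text \<open>For nonadjacent sides some positive combination of the two forms is a sum of squares, so
  that they are never both negative.\<close>

lemma side_form_disjoint:
  assumes "i \<in> piece True" "j \<in> piece True" "i \<noteq> j" "i \<noteq> nx j" "j \<noteq> nx i" "side_form j v \<le> 0"
  shows "side_form i v \<ge> 0"
proof (cases v)
  case (Pair x y)
  have *: "side_form S0 v + side_form S3 v = 2 * y\<^sup>2" "side_form S2 v + 4 * side_form S0 v = x\<^sup>2 + 2 * y\<^sup>2"
    "side_form S1 v + 4 * side_form S3 v = (x - 2 * y)\<^sup>2 + 2 * y\<^sup>2"
    unfolding Pair by (simp_all add: power2_eq_square algebra_simps)
  have "side_form S0 v + side_form S3 v \<ge> 0" "side_form S2 v + 4 * side_form S0 v \<ge> 0" "side_form S1 v + 4 * side_form S3 v \<ge> 0"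
    unfolding * by simp_all
  then show ?thesis
    using assms by (cases i; cases j) auto
qed

definition shortest :: "side list \<Rightarrow> bool" where
  "shortest w \<longleftrightarrow> set w \<subseteq> piece True \<and>
     (\<forall>w'. weq w w' \<longrightarrow> set w' \<subseteq> piece True \<longrightarrow> length w \<le> length w')"

lemma shortest_Cons: "shortest (j # u) \<Longrightarrow> shortest u"
  unfolding shortest_def
proof (intro conjI allI impI)
  fix u' assume *: "set (j # u) \<subseteq> piece True \<and> (\<forall>w'. weq (j # u) w' \<longrightarrow> set w' \<subseteq> piece True \<longrightarrow> length (j # u) \<le> length w')"
    "weq u u'" "set u' \<subseteq> piece True"
  have "set (j # u') \<subseteq> piece True" using * by (auto simp del: piece.simps)
  then have "length (j # u) \<le> length (j # u')"
    using *(1) weq_Cons[OF *(2), of j] by blast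
  then show "length u \<le> length u'" by simp
qed auto

lemma shortest_reduce:
  assumes "shortest (j # u)" "weq u (j # u')" "set u' \<subseteq> piece True" "length u = Suc (length u')"
  shows False
proof -
  have "weq (j # u) (j # j # u')" by (rule weq_Cons) fact
  then have "weq (j # u) u'" by (rule weq.trans[OF _ weq_cancel_Cons])
  then show False
    using assms unfolding shortest_def by fastforce
qed

text \<open>Tits' argument: a shortest word either keeps the orbit in the half plane of \<open>i\<close> or can be
  rewritten to start with \<open>i\<close>.\<close>

lemma tits:
  assumes "shortest w" "i \<in> piece True"
  shows "side_form i (orbit_vec w) \<ge> 0 \<or> (\<exists>w'. set w' \<subseteq> piece True \<and> weq w (i # w') \<and> length w = Suc (length w'))"
  using assms
proof (induction w arbitrary: i)
  case Nil
  then show ?case by auto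
next
  case (Cons j u)
  have u: "shortest u" by (rule shortest_Cons) fact
  have j: "j \<in> piece True" "set u \<subseteq> piece True"
    using Cons.prems(1) by (auto simp: shortest_def simp del: piece.simps)
  \<comment> \<open>If \<open>u\<close> could be rewritten to start with \<open>j\<close>, the first
    two letters of \<open>j # u\<close> would cancel, against minimality.\<close>
  have hj: "side_form j (orbit_vec u) \<ge> 0"
    using Cons.IH[OF u j(1)] shortest_reduce[OF Cons.prems(1)] by blast
  consider "i = j" | "i \<noteq> j" "i = nx j \<or> j = nx i" | "i \<noteq> j" "i \<noteq> nx j" "j \<noteq> nx i" by blast
  then show ?case
  proof cases
    case 1
    then show ?thesis using j(2) by auto
  next
    case 2
    show ?thesis
    proof (cases "side_form i (orbit_vec u) \<ge> 0")
      case True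
      then show ?thesis
        using side_form_act_adjacent[OF Cons.prems(2) j(1) 2(2), of "orbit_vec u"] unfolding orbit_vec_Cons by simp
    next
      case False
      then obtain u' where u': "set u' \<subseteq> piece True" "weq u (i # u')" "length u = Suc (length u')"
        using Cons.IH[OF u Cons.prems(2)] by blast
      \<comment> \<open>The letters \<open>j\<close> and \<open>i\<close> commute, so the initial
        \<open>i\<close> of \<open>u\<close> can be brought to the front.\<close>
      have "weq (j # u) (j # i # u')" by (rule weq_Cons) fact
      also have "weq [j, i] [i, j]" using 2(2) weq.swap weq.sym by blast
      then have "weq (j # i # u') (i # j # u')"
        using weq.app[of "[j, i]" "[i, j]" u' u'] by simp
      finally show ?thesis
        using u' j(1) by (intro disjI2 exI[of _ "j # u'"]) (auto simp del: piece.simps)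
    qed
  next
    case 3
    have "side_form j (orbit_vec (j # u)) \<le> 0"
      using side_form_act_same[OF j(1), of "orbit_vec u"] hj unfolding orbit_vec_Cons by simp
    then show ?thesis
      using side_form_disjoint[OF Cons.prems(2) j(1) 3] by blast
  qed
qed

lemma ex_shortest:
  assumes "set w \<subseteq> piece True"
  obtains w' where "weq w w'" "shortest w'"
proof -
  define P where "P n \<longleftrightarrow> (\<exists>w'. weq w w' \<and> set w' \<subseteq> piece True \<and> length w' = n)" for n
  have "P (length w)" unfolding P_def by (intro exI[of _ w] conjI assms) simp_all
  then have "P (LEAST n. P n)" by (rule LeastI)
  then obtain w' where w': "weq w w'" "set w' \<subseteq> piece True" "length w' = (LEAST n. P n)"
    unfolding P_def by blast
  have "length w' \<le> length v" if "weq w' v" "set v \<subseteq> piece True" for v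
  proof -
    have "P (length v)"
      unfolding P_def by (intro exI[of _ v] conjI weq.trans[OF w'(1) that(1)] that(2)) simp
    then show ?thesis unfolding w'(3) by (rule Least_le)
  qed
  then show thesis
    using that w' unfolding shortest_def by blast
qed

lemma orbit_vec_nonzero: "orbit_vec w \<noteq> (0, 0)"
proof -
  obtain a b c d where r: "quad_of w = (a, b, c, d)" by (cases "quad_of w")
  have "(qdet (quad_of w))\<^sup>2 = 1" by (rule qdet_quad_of)
  then show ?thesis using orbit_vec_quad_of[OF r] r by auto
qed

text \<open>At infinity, that is at \<open>(x, 0)\<close>, the forms of \<open>S1\<close> and
  \<open>S2\<close> are \<open>x^2 > 0\<close>, while by Tits' argument the form of the first letter
  is not positive there. Thus the word starts with \<open>S0\<close> or \<open>S3\<close>; these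
  preserve infinity, and the induction continues.\<close>

lemma shortest_upper:
  assumes "shortest w" "snd (orbit_vec w) = 0"
  shows "set w \<subseteq> {S0, S3}"
  using assms
proof (induction w)
  case (Cons j u)
  have u: "shortest u" by (rule shortest_Cons) fact
  have j: "j \<in> piece True"
    using Cons.prems(1) by (auto simp: shortest_def simp del: piece.simps)
  have hj: "side_form j (orbit_vec u) \<ge> 0"
    using tits[OF u j] shortest_reduce[OF Cons.prems(1)] by blast
  then have hj': "side_form j (orbit_vec (j # u)) \<le> 0"
    using side_form_act_same[OF j, of "orbit_vec u"] unfolding orbit_vec_Cons by simp
  obtain x where x: "orbit_vec (j # u) = (x, 0)" using Cons.prems(2) by (metis prod.collapse)
  then have "x \<noteq> 0" using orbit_vec_nonzero[of "j # u"] by simp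
  then have "j \<noteq> S1" "j \<noteq> S2"
    using hj' unfolding x by (auto simp: power2_less_0 not_le)
  then have j03: "j = S0 \<or> j = S3" using j by auto
  then have "snd (orbit_vec u) = 0"
    using Cons.prems(2) unfolding orbit_vec_Cons by (cases "orbit_vec u") (auto simp: act_def)
  then show ?case using Cons.IH[OF u] j03 by auto
qed auto

lemma lower_left_orbit_vec: "lower_left (quad_of w) = snd (orbit_vec w)"
  by (cases "quad_of w") (simp add: orbit_vec_quad_of)

lemma upper_piece_True:
  assumes "set w \<subseteq> piece True" "lower_left (quad_of w) = 0"
  obtains d where "weq w d" "set d \<subseteq> {S0, S3}"
proof -
  obtain w' where w': "weq w w'" "shortest w'" using ex_shortest[OF assms(1)] .
  then have "set w' \<subseteq> {S0, S3}"
    using lower_left_weq[OF w'(1)] assms(2) by (intro shortest_upper) (auto simp: lower_left_orbit_vec)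
  then show thesis using that w'(1) by blast
qed

text \<open>The symmetry of the hexagon that fixes \<open>S0\<close> and \<open>S3\<close> and
  exchanges the two pieces. The 2 x 2 matrices are invariant under it, so results about one piece
  carry over to the other.\<close>

fun mirror :: "side \<Rightarrow> side" where
  "mirror S0 = S0" | "mirror S1 = S5" | "mirror S2 = S4" | "mirror S3 = S3" | "mirror S4 = S2" | "mirror S5 = S1"

lemma mirror_mirror [simp]: "mirror (mirror i) = i"
  by (cases i) auto

lemma weq_mirror: "weq u v \<Longrightarrow> weq (map mirror u) (map mirror v)"
proof (induction rule: weq.induct)
  case (swap i)
  show ?case
    using weq.sym[OF weq.swap[of "mirror (nx i)"]] by (cases i) auto
qed (auto intro: weq.intros)

lemma quad_of_mirror: "quad_of (map mirror w) = quad_of w"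
proof (induction w)
  case (Cons i w)
  have "side_quad (mirror i) = side_quad i" by (cases i) auto
  then show ?case using Cons by simp
qed auto

lemma upper_piece:
  assumes "set w \<subseteq> piece p" "lower_left (quad_of w) = 0"
  obtains d where "weq w d" "set d \<subseteq> {S0, S3}"
proof (cases p)
  case True
  then show thesis using upper_piece_True assms that by metis
next
  case False
  have "set (map mirror w) \<subseteq> piece True" using assms(1) False by auto
  then obtain d where d: "weq (map mirror w) d" "set d \<subseteq> {S0, S3}"
    using assms(2) by (metis upper_piece_True quad_of_mirror)
  have "weq (map mirror (map mirror w)) (map mirror d)" by (rule weq_mirror) fact
  moreover have "map mirror (map mirror w) = w" by (simp add: comp_def)
  moreover have "set (map mirror d) \<subseteq> {S0, S3}" using d(2) by auto
  ultimately show thesis using that by metis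
qed

text \<open>Alternating normal forms with respect to the amalgam of the two pieces over the ideal vertex
  group generated by \<open>S0\<close> and \<open>S3\<close>.\<close>

inductive good :: "bool \<Rightarrow> side list \<Rightarrow> bool" where
  one: "set u \<subseteq> piece p \<Longrightarrow> lower_left (quad_of u) \<noteq> 0 \<Longrightarrow> weq w u \<Longrightarrow> good p w"
| more: "set u \<subseteq> piece p \<Longrightarrow> lower_left (quad_of u) \<noteq> 0 \<Longrightarrow> good (\<not> p) w2 \<Longrightarrow> weq w (u @ w2) \<Longrightarrow> good p w"

lemma lower_left_upper_mul: "lower_left x = 0 \<Longrightarrow> (qdet x)\<^sup>2 = 1 \<Longrightarrow> lower_left y \<noteq> 0 \<Longrightarrow> lower_left (qmul x y) \<noteq> 0"
  by (cases x; cases y) auto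

lemma quad_of_diag_lower_left: "set d \<subseteq> {S0, S3} \<Longrightarrow> lower_left (quad_of d) = 0"
proof (induction d)
  case (Cons i d)
  then show ?case by (cases "quad_of d") auto
qed auto

text \<open>Factors from the vertex group are absorbed into the first syllable: multiplying by an
  invertible upper triangular matrix on the left does not make a nonzero lower left entry
  vanish.\<close>

lemma good_prepend:
  assumes "good p w" "set d \<subseteq> {S0, S3}" "weq v (d @ w)"
  shows "good p v"
  using assms(1)
proof cases
  case (one u)
  have "set (d @ u) \<subseteq> piece p" using one assms(2) by (cases p) auto
  moreover have "lower_left (quad_of (d @ u)) \<noteq> 0"
    unfolding quad_of_append using one assms(2) by (intro lower_left_upper_mul quad_of_diag_lower_left qdet_quad_of)
  moreover have "weq v (d @ u)"
    using assms(3) weq.app[OF weq.refl one(3)] by (rule weq.trans)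
  ultimately show ?thesis by (rule good.one)
next
  case (more u w2)
  have "set (d @ u) \<subseteq> piece p" using more assms(2) by (cases p) auto
  moreover have "lower_left (quad_of (d @ u)) \<noteq> 0"
    unfolding quad_of_append using more assms(2) by (intro lower_left_upper_mul quad_of_diag_lower_left qdet_quad_of)
  moreover have "weq v ((d @ u) @ w2)"
    using weq.trans[OF assms(3) weq.app[OF weq.refl more(4)]] by simp
  ultimately show ?thesis using more(3) good.more by blast
qed

lemma good_Cons:
  assumes "good p w" "i \<in> piece p"
  shows "(\<exists>d. set d \<subseteq> {S0, S3} \<and> weq (i # w) d) \<or> good True (i # w) \<or> good False (i # w)"
  using assms(1)
proof cases
  case (one u)
  have s: "set (i # u) \<subseteq> piece p" using one assms(2) by auto
  have w: "weq (i # w) (i # u)" using one by (intro weq_Cons)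
  show ?thesis
  proof (cases "lower_left (quad_of (i # u)) = 0")
    case True
    then obtain d where "weq (i # u) d" "set d \<subseteq> {S0, S3}" using upper_piece[OF s] by blast
    then show ?thesis using w weq.trans by blast
  next
    case False
    then show ?thesis using good.one[OF s False w] by (cases p) auto
  qed
next
  case (more u w2)
  have s: "set (i # u) \<subseteq> piece p" using more assms(2) by auto
  have w: "weq (i # w) ((i # u) @ w2)" using weq_Cons[OF more(4)] by simp
  show ?thesis
  proof (cases "lower_left (quad_of (i # u)) = 0")
    case True
    then obtain d where d: "weq (i # u) d" "set d \<subseteq> {S0, S3}" using upper_piece[OF s] by blast
    have "weq (i # w) (d @ w2)" using w weq.app[OF d(1) weq.refl] by (rule weq.trans)
    then have "good (\<not> p) (i # w)" using good_prepend[OF more(3) d(2)] by blast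
    then show ?thesis by (cases p) auto
  next
    case False
    then show ?thesis using good.more[OF s False more(3) w] by (cases p) auto
  qed
qed

text \<open>Existence of normal forms in the amalgam, by adding letters in front. A first syllable
  that falls into the vertex group is passed on to the next one, which changes the piece in which
  the normal form begins.\<close>

lemma classify: "(\<exists>d. set d \<subseteq> {S0, S3} \<and> weq w d) \<or> good True w \<or> good False w"
proof (induction w)
  case Nil
  have "weq [] []" by simp
  then show ?case by (intro disjI1 exI[of _ "[]"]) auto
next
  case (Cons i w)
  from Cons consider d where "set d \<subseteq> {S0, S3}" "weq w d" | p where "good p w" by blast
  then show ?case
  proof cases
    case 1
    obtain p where p: "i \<in> piece p" by (cases i) (auto intro: that[of True] that[of False])
    have s: "set (i # d) \<subseteq> piece p" using p 1 by (cases p) auto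
    have w: "weq (i # w) (i # d)" using 1 by (intro weq_Cons)
    show ?thesis
    proof (cases "lower_left (quad_of (i # d)) = 0")
      case True
      then obtain d' where "weq (i # d) d'" "set d' \<subseteq> {S0, S3}" using upper_piece[OF s] by blast
      then show ?thesis using w weq.trans by blast
    next
      case False
      then show ?thesis using good.one[OF s False w] by (cases p) auto
    qed
  next
    case 2
    show ?thesis
    proof (cases "i \<in> piece p")
      case True
      then show ?thesis using good_Cons 2 by blast
    next
      case False
      then have "i \<in> piece (\<not> p)" "lower_left (quad_of [i]) \<noteq> 0" by (cases i; cases p; auto)+
      then have "good (\<not> p) (i # w)"
        using 2 by (intro good.more[of "[i]" "\<not> p" w]) auto
      then show ?thesis by (cases p) auto
    qed
  qed
qed

text \<open>By the grading, \<open>c * sqrt 2\<close> is an integer or \<open>sqrt 2\<close> times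
  an integer, so \<open>2 c^2\<close> is a positive integer. This is the discreteness behind
  ping-pong.\<close>

lemma lower_left_bound:
  assumes "lower_left (quad_of w) \<noteq> 0"
  shows "2 * (lower_left (quad_of w))\<^sup>2 \<ge> 1"
proof -
  obtain a b c d where r: "quad_of w = (a, b, c, d)" by (cases "quad_of w")
  define p where "p = odd (length (filter (\<lambda>i. i \<noteq> S0 \<and> i \<noteq> S3) w))"
  have "graded 1 p (Th 1 (quad_of w))" unfolding p_def
  proof (induction w)
    case Nil
    have "graded 1 False (Th 1 (quad_of []))" unfolding quad_of.simps Th_one by (rule graded_one)
    then show ?case by (simp del: Th.simps quad_of.simps)
  next
    case (Cons i w)
    have "graded 1 ((i \<noteq> S0 \<and> i \<noteq> S3) \<noteq> odd (length (filter (\<lambda>i. i \<noteq> S0 \<and> i \<noteq> S3) w))) (Th 1 (quad_of (i # w)))"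
      using graded_mult[OF graded_Th Cons] by (simp add: Th_mult del: Th.simps)
    then show ?case by (auto elim!: back_subst[of "\<lambda>b. graded 1 b _"])
  qed
  then have *: "\<forall>i<4 * 1. \<forall>j<4 * 1. Th 1 (quad_of w) $$ (i, j) * wt 1 i / wt 1 j
      \<in> gr (p \<noteq> ((i < 2 * 1) \<noteq> (j < 2 * 1)))"
    unfolding graded_def by blast
  \<comment> \<open>With blocks of size 2 this entry is \<open>c\<close> times an entry 1 of
    \<open>qm 1\<close>, and the weights contribute the factor \<open>sqrt 2\<close>.\<close>
  have "Th 1 (quad_of w) $$ (2, 1) * wt 1 2 / wt 1 1 \<in> gr (\<not> p)"
    using *[rule_format, of 2 1] by (simp del: Th.simps)
  then have "c * sqrt 2 \<in> gr (\<not> p)"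
    by (simp add: r wt_def qm_def)
  then have "(c * sqrt 2) * (c * sqrt 2) \<in> gr False"
    using gr_mult[of "c * sqrt 2" "\<not> p" "c * sqrt 2" "\<not> p"] by simp
  then have "2 * c\<^sup>2 \<in> \<int>" by (simp add: gr_def power2_eq_square mult_ac sqrt2_sq)
  moreover have "2 * c\<^sup>2 > 0" using assms r by simp
  ultimately obtain z where z: "2 * c\<^sup>2 = real_of_int z" "0 < real_of_int z"
    by (metis Ints_cases)
  then have "1 \<le> z" by simp
  then show ?thesis using r z(1) by simp
qed

text \<open>The upper part lies within distance \<open>|y|\<close> of the line through
  \<open>q y\<close>. On that line are the images of vectors at infinity under unbent matrices; the
  freedom in \<open>r\<close> accounts for the translations of the vertex group.\<close>

definition ping_cone :: "nat \<Rightarrow> real Matrix.vec set" where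
  "ping_cone k = {x @\<^sub>v y | x y. x \<in> carrier_vec (2 * k) \<and> y \<in> carrier_vec (2 * k) \<and> y \<noteq> 0\<^sub>v (2 * k) \<and>
     (\<exists>r. (x - r \<cdot>\<^sub>v (qm k *\<^sub>v y)) \<bullet> (x - r \<cdot>\<^sub>v (qm k *\<^sub>v y)) \<le> y \<bullet> y)}"

lemma NsI:
  assumes "x \<in> carrier_vec (2 * k)" "y \<in> carrier_vec (2 * k)" "y \<noteq> 0\<^sub>v (2 * k)"
    "(x - r \<cdot>\<^sub>v (qm k *\<^sub>v y)) \<bullet> (x - r \<cdot>\<^sub>v (qm k *\<^sub>v y)) \<le> y \<bullet> y"
  shows "x @\<^sub>v y \<in> ping_cone k"
  unfolding ping_cone_def using assms by blast

section \<open>Inner product estimates for the blocks\<close>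

lemma smult_mat_vec:
  assumes "A \<in> carrier_mat n m" "v \<in> carrier_vec m"
  shows "(r \<cdot>\<^sub>m A) *\<^sub>v v = (r::real) \<cdot>\<^sub>v (A *\<^sub>v v)"
  using assms by (auto intro!: eq_vecI)

lemma mat_zero_vec:
  assumes "A \<in> carrier_mat n m"
  shows "A *\<^sub>v 0\<^sub>v m = (0\<^sub>v n :: real Matrix.vec)"
  using assms by (auto intro!: eq_vecI)

lemma smult_zero_vec': "(r::real) \<cdot>\<^sub>v 0\<^sub>v n = 0\<^sub>v n"
  by (auto intro!: eq_vecI)

lemma vec_CS:
  fixes x y :: "real Matrix.vec"
  assumes "x \<in> carrier_vec n" "y \<in> carrier_vec n"
  shows "(x \<bullet> y)\<^sup>2 \<le> (x \<bullet> x) * (y \<bullet> y)"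
  using Cauchy_Schwarz_ineq_sum[of "vec_index x" "vec_index y" "{0..<n}"] assms
  by (simp add: scalar_prod_def power2_eq_square)

lemma vec_sq_nonneg:
  fixes x :: "real Matrix.vec"
  shows "x \<bullet> x \<ge> 0"
  by (simp add: scalar_prod_def sum_nonneg)

lemma vec_sq_pos:
  fixes x :: "real Matrix.vec"
  assumes "x \<in> carrier_vec n" "x \<noteq> 0\<^sub>v n"
  shows "x \<bullet> x > 0"
proof (rule ccontr)
  assume "\<not> x \<bullet> x > 0"
  then have "(\<Sum>i\<in>{0..<n}. vec_index x i * vec_index x i) = 0"
    using vec_sq_nonneg[of x] assms(1) by (simp add: scalar_prod_def)
  then have "\<forall>i\<in>{0..<n}. vec_index x i * vec_index x i = 0"
    by (subst (asm) sum_nonneg_eq_0_iff) auto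
  then have "x = 0\<^sub>v n" using assms(1) by (intro eq_vecI) auto
  then show False using assms(2) by simp
qed

lemma tau_vec: "y \<in> carrier_vec (2 * k) \<Longrightarrow> i < 2 * k \<Longrightarrow>
   vec_index (tau k *\<^sub>v y) i = (if i < k then -1 else 1) * vec_index y i"
proof -
  assume y: "y \<in> carrier_vec (2 * k)" "i < 2 * k"
  have "vec_index (tau k *\<^sub>v y) i = (\<Sum>j\<in>{0..<2*k}. (if i = j then (if i < k then -1 else 1) else 0) * vec_index y j)"
    using y by (simp add: tau_def scalar_prod_def)
  also have "\<dots> = (\<Sum>j\<in>{0..<2*k}. if j = i then (if i < k then -1 else 1) * vec_index y i else 0)"
    using y by (intro sum.cong) auto
  finally have "vec_index (tau k *\<^sub>v y) i = (\<Sum>j\<in>{0..<2*k}. if j = i then (if i < k then -1 else 1) * vec_index y i else 0)" .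
  then show ?thesis using y by (simp add: sum.delta)
qed

lemma tau_tau: "y \<in> carrier_vec (2 * k) \<Longrightarrow> (tau k *\<^sub>v y) \<bullet> (tau k *\<^sub>v y) = y \<bullet> y"
  using carrier_matD[OF block_carrier(2)[of k]]
  by (auto simp: scalar_prod_def tau_vec intro!: sum.cong simp del: index_mult_mat_vec)

lemma qm_vec_index: "y \<in> carrier_vec (2 * k) \<Longrightarrow> i < 2 * k \<Longrightarrow>
   vec_index (qm k *\<^sub>v y) i = vec_index y (2 * k - 1 - i)"
proof -
  assume y: "y \<in> carrier_vec (2 * k)" "i < 2 * k"
  have "vec_index (qm k *\<^sub>v y) i = (\<Sum>j\<in>{0..<2*k}. (if i + j + 1 = 2 * k then 1 else 0) * vec_index y j)"
    using y by (simp add: qm_def scalar_prod_def)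
  also have "\<dots> = (\<Sum>j\<in>{0..<2*k}. if j = 2 * k - 1 - i then vec_index y (2 * k - 1 - i) else 0)"
    using y by (intro sum.cong) auto
  finally have "vec_index (qm k *\<^sub>v y) i = (\<Sum>j\<in>{0..<2*k}. if j = 2 * k - 1 - i then vec_index y (2 * k - 1 - i) else 0)" .
  then show ?thesis using y by (simp add: sum.delta)
qed

lemma dm_vec_index: "y \<in> carrier_vec (2 * k) \<Longrightarrow> i < 2 * k \<Longrightarrow>
   vec_index (dm k *\<^sub>v y) i = (if i = 0 then 0 else vec_index y (2 * k - i))"
proof -
  assume y: "y \<in> carrier_vec (2 * k)" "i < 2 * k"
  have "vec_index (dm k *\<^sub>v y) i = (\<Sum>j\<in>{0..<2*k}. (if i + j = 2 * k then 1 else 0) * vec_index y j)"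
    using y by (simp add: dm_def scalar_prod_def)
  also have "\<dots> = (\<Sum>j\<in>{0..<2*k}. if j = 2 * k - i then (if i = 0 then 0 else vec_index y (2 * k - i)) else 0)"
    using y by (intro sum.cong) auto
  finally have "vec_index (dm k *\<^sub>v y) i = (\<Sum>j\<in>{0..<2*k}. if j = 2 * k - i then (if i = 0 then 0 else vec_index y (2 * k - i)) else 0)" .
  then show ?thesis using y by (auto simp: sum.delta)
qed

lemma tau_dm_vec [simp, intro]:
  "x \<in> carrier_vec (2 * k) \<Longrightarrow> tau k *\<^sub>v x \<in> carrier_vec (2 * k)"
  "x \<in> carrier_vec (2 * k) \<Longrightarrow> dm k *\<^sub>v x \<in> carrier_vec (2 * k)"
  by (rule mult_mat_vec_carrier[OF block_carrier(2)], assumption)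
     (rule mult_mat_vec_carrier[OF block_carrier(3)], assumption)

text \<open>Reversal exchanges the two halves of the coordinates, on which \<open>tau\<close> has
  opposite signs.\<close>

lemma q_tau:
  assumes y: "y \<in> carrier_vec (2 * k)"
  shows "(qm k *\<^sub>v y) \<bullet> (tau k *\<^sub>v y) = 0"
proof -
  define f where "f i = vec_index y (2 * k - 1 - i) * ((if i < k then -1 else 1) * vec_index y i)" for i
  have "(qm k *\<^sub>v y) \<bullet> (tau k *\<^sub>v y) = (\<Sum>i\<in>{0..<2*k}. f i)"
    using y carrier_matD[OF block_carrier(2)[of k]]
    by (auto simp: scalar_prod_def tau_vec qm_vec_index f_def intro!: sum.cong simp del: index_mult_mat_vec)
  moreover have "(\<Sum>i\<in>{0..<2*k}. f i) = (\<Sum>i\<in>{0..<2*k}. f (2 * k - 1 - i))"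
    by (rule sum.reindex_bij_witness[of _ "\<lambda>i. 2 * k - 1 - i" "\<lambda>i. 2 * k - 1 - i"]) auto
  moreover have "(\<Sum>i\<in>{0..<2*k}. f (2 * k - 1 - i)) = - (\<Sum>i\<in>{0..<2*k}. f i)"
    unfolding sum_negf[symmetric] by (rule sum.cong) (auto simp: f_def)
  ultimately show ?thesis by simp
qed

text \<open>The indices \<open>i\<close> and \<open>2 * k - i\<close> carry opposite signs of
  \<open>tau\<close> and cancel, except for the middle index \<open>k\<close>, which contributes a
  square because \<open>tau\<close> is +1 there. The index 0 has no partner, but
  \<open>dm k *\<^sub>v y\<close> is 0 at it.\<close>

lemma d_tau:
  assumes y: "y \<in> carrier_vec (2 * k)"
  shows "(dm k *\<^sub>v y) \<bullet> (tau k *\<^sub>v y) \<ge> 0"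
proof (cases "k = 0")
  case False
  define f where "f i = vec_index y (2 * k - i) * ((if i < k then -1 else 1) * vec_index y i)" for i
  have "(dm k *\<^sub>v y) \<bullet> (tau k *\<^sub>v y) = (\<Sum>i\<in>{0..<2*k}. if i = 0 then 0 else f i)"
    using y carrier_matD[OF block_carrier(2)[of k]]
    by (auto simp: scalar_prod_def tau_vec dm_vec_index f_def intro!: sum.cong simp del: index_mult_mat_vec)
  also have "\<dots> = (\<Sum>i\<in>{1..<2*k}. f i)"
    using False by (subst sum.atLeast_Suc_lessThan) auto
  finally have 1: "(dm k *\<^sub>v y) \<bullet> (tau k *\<^sub>v y) = (\<Sum>i\<in>{1..<2*k}. f i)" .
  have "(\<Sum>i\<in>{1..<2*k}. f i) = (\<Sum>i\<in>{1..<2*k}. f (2 * k - i))"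
    by (rule sum.reindex_bij_witness[of _ "\<lambda>i. 2 * k - i" "\<lambda>i. 2 * k - i"]) auto
  then have "2 * (\<Sum>i\<in>{1..<2*k}. f i) = (\<Sum>i\<in>{1..<2*k}. f i + f (2 * k - i))"
    by (simp add: sum.distrib)
  also have "\<dots> \<ge> 0"
  proof (rule sum_nonneg)
    fix i assume i: "i \<in> {1..<2*k}"
    show "f i + f (2 * k - i) \<ge> 0"
    proof (cases "i = k")
      case True
      then show ?thesis using i by (simp add: f_def)
    next
      case False
      then have "f i + f (2 * k - i) = 0" using i by (auto simp: f_def)
      then show ?thesis by simp
    qed
  qed
  finally show ?thesis using 1 by simp
qed (use y in \<open>auto simp: scalar_prod_def\<close>)

lemma bend_lower:
  assumes y: "y \<in> carrier_vec (2 * k)" and s: "s = 1 \<or> s = -1"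
  shows "s * (((s \<cdot>\<^sub>m bend k b) *\<^sub>v y + r \<cdot>\<^sub>v (qm k *\<^sub>v y)) \<bullet> (tau k *\<^sub>v y)) \<ge> 4 * (y \<bullet> y)"
proof -
  have c: "tau k *\<^sub>v y \<in> carrier_vec (2 * k)" "dm k *\<^sub>v y \<in> carrier_vec (2 * k)" "qm k *\<^sub>v y \<in> carrier_vec (2 * k)"
    using y by auto
  have *: "(t \<cdot>\<^sub>m A) *\<^sub>v y = t \<cdot>\<^sub>v (A *\<^sub>v y)" if "A \<in> carrier_mat (2 * k) (2 * k)" for t :: real and A
    using that y by (auto intro!: eq_vecI)
  have "(s \<cdot>\<^sub>m bend k b) *\<^sub>v y = s \<cdot>\<^sub>v (4 \<cdot>\<^sub>v (tau k *\<^sub>v y) + (if b then 0 else 2) \<cdot>\<^sub>v (dm k *\<^sub>v y))"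
    using y by (simp add: * bend_def add_mult_distrib_mat_vec[of _ "2*k" "2*k"] del: if_distrib)
  then have "((s \<cdot>\<^sub>m bend k b) *\<^sub>v y + r \<cdot>\<^sub>v (qm k *\<^sub>v y)) \<bullet> (tau k *\<^sub>v y)
     = s * (4 * (y \<bullet> y) + (if b then 0 else 2) * ((dm k *\<^sub>v y) \<bullet> (tau k *\<^sub>v y)))"
    using c by (simp add: sp_distrib[of _ k] q_tau[OF y] tau_tau[OF y] del: scalar_prod_smult_left scalar_prod_smult_right)
  then show ?thesis using s d_tau[OF y] by auto
qed

text \<open>The bend dominates: the inner product of \<open>(B + r q) y\<close> with \<open>tau y\<close> is, up to sign, at least
  \<open>4 |y|\<^sup>2\<close> whatever \<open>r\<close> is.\<close>

lemma ping_pong: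
  assumes v: "v \<in> ping_cone k" and B: "B = s \<cdot>\<^sub>m bend k t" "s = 1 \<or> s = -1"
    and c: "2 * c\<^sup>2 \<ge> 1" and det: "(a * d - b * c)\<^sup>2 = 1"
  shows "Th k (a, b, c, d) *\<^sub>v (upper_unip k B *\<^sub>v v) \<in> ping_cone k"
proof -
  obtain x y r where xy: "v = x @\<^sub>v y" "x \<in> carrier_vec (2 * k)" "y \<in> carrier_vec (2 * k)" "y \<noteq> 0\<^sub>v (2 * k)"
    and r: "(x - r \<cdot>\<^sub>v (qm k *\<^sub>v y)) \<bullet> (x - r \<cdot>\<^sub>v (qm k *\<^sub>v y)) \<le> y \<bullet> y"
    using v unfolding ping_cone_def by blast
  have Bc: "B \<in> carrier_mat (2 * k) (2 * k)" using B by auto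
  let ?n = "2 * k"
  define e where "e = x - r \<cdot>\<^sub>v (qm k *\<^sub>v y)"
  define x1 where "x1 = x + B *\<^sub>v y"
  \<comment> \<open>Chosen so that \<open>q\<close> applied to the new lower part is
    \<open>c\<close> times \<open>u\<close>.\<close>
  define u where "u = x1 + (d / c) \<cdot>\<^sub>v (qm k *\<^sub>v y)"
  have C: "qm k *\<^sub>v y \<in> carrier_vec ?n" "B *\<^sub>v y \<in> carrier_vec ?n" "tau k *\<^sub>v y \<in> carrier_vec ?n"
    "e \<in> carrier_vec ?n" "x1 \<in> carrier_vec ?n" "u \<in> carrier_vec ?n"
    using xy Bc by (auto simp: e_def x1_def u_def)
  note D = carrier_vecD[OF C(5)] carrier_vecD[OF C(1)] carrier_vecD[OF C(6)] carrier_matD[OF block_carrier(1)[of k]]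
  have c0: "c \<noteq> 0" using c by auto
  have ypos: "y \<bullet> y > 0" using vec_sq_pos xy by blast
  have ue: "u = e + (B *\<^sub>v y + (r + d / c) \<cdot>\<^sub>v (qm k *\<^sub>v y))"
    using C xy by (intro eq_vecI) (auto simp: u_def x1_def e_def algebra_simps simp del: index_mult_mat_vec)
  have "s * (u \<bullet> (tau k *\<^sub>v y)) = s * (e \<bullet> (tau k *\<^sub>v y))
      + s * ((B *\<^sub>v y + (r + d / c) \<cdot>\<^sub>v (qm k *\<^sub>v y)) \<bullet> (tau k *\<^sub>v y))"
    unfolding ue using C by (subst add_scalar_prod_distrib[of _ ?n]) (auto simp: distrib_left)
  moreover have "s * ((B *\<^sub>v y + (r + d / c) \<cdot>\<^sub>v (qm k *\<^sub>v y)) \<bullet> (tau k *\<^sub>v y)) \<ge> 4 * (y \<bullet> y)"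
    unfolding B(1) by (rule bend_lower[OF xy(3) B(2)])
  moreover have "\<bar>e \<bullet> (tau k *\<^sub>v y)\<bar> \<le> y \<bullet> y"
  proof -
    have "(e \<bullet> (tau k *\<^sub>v y))\<^sup>2 \<le> (e \<bullet> e) * (y \<bullet> y)"
      using vec_CS[OF C(4,3)] by (simp add: tau_tau[OF xy(3)])
    also have "\<dots> \<le> (y \<bullet> y)\<^sup>2"
      using r ypos unfolding e_def power2_eq_square by (intro mult_right_mono) auto
    finally show ?thesis using ypos by (simp add: abs_le_square_iff[symmetric])
  qed
  \<comment> \<open>In units of \<open>|y|^2\<close>, the bend contributes at least 4 and the
    deviation \<open>e\<close> allowed by the cone at most 1 in absolute value.\<close>
  ultimately have su: "s * (u \<bullet> (tau k *\<^sub>v y)) \<ge> 3 * (y \<bullet> y)"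
    using B(2) by auto
  have "9 * (y \<bullet> y) * (y \<bullet> y) \<le> (s * (u \<bullet> (tau k *\<^sub>v y)))\<^sup>2"
    using power_mono[OF su, of 2] ypos by (simp add: power2_eq_square mult_ac)
  also have "\<dots> = (u \<bullet> (tau k *\<^sub>v y))\<^sup>2" using B(2) by auto
  also have "\<dots> \<le> (u \<bullet> u) * (y \<bullet> y)"
    using vec_CS[OF C(6,3)] by (simp add: tau_tau[OF xy(3)])
  finally have uu: "9 * (y \<bullet> y) \<le> u \<bullet> u" using ypos by simp
  define X where "X = a \<cdot>\<^sub>v x1 + b \<cdot>\<^sub>v (qm k *\<^sub>v y)"
  define Y where "Y = c \<cdot>\<^sub>v (qm k *\<^sub>v x1) + d \<cdot>\<^sub>v y"
  have XY: "Th k (a, b, c, d) *\<^sub>v (upper_unip k B *\<^sub>v v) = X @\<^sub>v Y"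
    unfolding xy(1) X_def Y_def x1_def by (subst act_upper_unip[OF Bc xy(2,3)], subst act_Th) (use xy C in auto)
  have XYc: "X \<in> carrier_vec ?n" "Y \<in> carrier_vec ?n"
    using xy C by (auto simp: X_def Y_def)
  have qY: "qm k *\<^sub>v Y = c \<cdot>\<^sub>v u"
  proof -
    have "qm k *\<^sub>v Y = c \<cdot>\<^sub>v (qm k *\<^sub>v (qm k *\<^sub>v x1)) + d \<cdot>\<^sub>v (qm k *\<^sub>v y)"
      unfolding Y_def using C xy qm_vec[OF C(5)]
      by (subst mult_add_distrib_mat_vec[OF block_carrier(1)]) (auto simp: mult_mat_vec[OF block_carrier(1)])
    then show ?thesis
      using C c0 xy D by (intro eq_vecI) (auto simp: qm_qm_vec u_def distrib_left simp del: index_mult_mat_vec)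
  qed
  have YY: "Y \<bullet> Y = c\<^sup>2 * (u \<bullet> u)"
    using qm_scalar_prod(2)[OF XYc(2,2)] C unfolding qY by (simp add: power2_eq_square)
  define t where "t = - (a * d - b * c) / c"
  \<comment> \<open>The witness for the new cone is \<open>a / c\<close>: it eliminates
    \<open>x1\<close>, and the coefficient of \<open>q y\<close> that is left is minus the
    determinant divided by \<open>c\<close>.\<close>
  have "X - (a / c) \<cdot>\<^sub>v (qm k *\<^sub>v Y) = t \<cdot>\<^sub>v (qm k *\<^sub>v y)"
    unfolding qY t_def using C c0 xy D by (intro eq_vecI) (auto simp: X_def u_def field_simps simp del: index_mult_mat_vec)
  moreover have "(t \<cdot>\<^sub>v (qm k *\<^sub>v y)) \<bullet> (t \<cdot>\<^sub>v (qm k *\<^sub>v y)) = t\<^sup>2 * (y \<bullet> y)"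
    using qm_scalar_prod(2)[OF xy(3,3)] C(1) by (simp add: power2_eq_square)
  moreover have "t\<^sup>2 = 1 / c\<^sup>2"
    unfolding t_def using det by (simp add: power_divide power2_commute)
  ultimately have "(X - (a / c) \<cdot>\<^sub>v (qm k *\<^sub>v Y)) \<bullet> (X - (a / c) \<cdot>\<^sub>v (qm k *\<^sub>v Y)) = (y \<bullet> y) / c\<^sup>2"
    by simp
  also have "\<dots> \<le> Y \<bullet> Y"
  proof -
    \<comment> \<open>The bound on \<open>c\<close> gives \<open>4 c^4 \<ge> 1\<close>; together
      with \<open>|u|^2 \<ge> 9 |y|^2\<close> the new deviation is at most the new lower
      part.\<close>
    have "1 \<le> (2 * c\<^sup>2) * (2 * c\<^sup>2)" using mult_mono[OF c c] by simp
    then have "1 \<le> 4 * (c\<^sup>2 * c\<^sup>2)" by simp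
    then have "(y \<bullet> y) * 1 \<le> (y \<bullet> y) * (4 * (c\<^sup>2 * c\<^sup>2))" using ypos by (intro mult_left_mono) auto
    also have "\<dots> \<le> (u \<bullet> u) * (c\<^sup>2 * c\<^sup>2)" using uu ypos by (simp add: mult_right_mono mult.assoc[symmetric])
    finally show ?thesis unfolding YY using c0 by (simp add: field_simps)
  qed
  finally have 1: "(X - (a / c) \<cdot>\<^sub>v (qm k *\<^sub>v Y)) \<bullet> (X - (a / c) \<cdot>\<^sub>v (qm k *\<^sub>v Y)) \<le> Y \<bullet> Y" .
  have "Y \<bullet> Y > 0" unfolding YY using c0 uu ypos by (intro mult_pos_pos) auto
  then have "Y \<noteq> 0\<^sub>v ?n" by auto
  then show ?thesis
    unfolding XY using 1 XYc by (intro NsI)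
qed

lemma ping_cone_carrier: "v \<in> ping_cone k \<Longrightarrow> v \<in> carrier_vec (4 * k)"
  unfolding ping_cone_def using append_carrier_vec[of _ "2*k" _ "2*k"] by auto

lemma smult_append_vec: "(s::real) \<cdot>\<^sub>v (x @\<^sub>v y) = (s \<cdot>\<^sub>v x) @\<^sub>v (s \<cdot>\<^sub>v y)"
  by (intro eq_vecI) auto

lemma ping_cone_sign:
  assumes "v \<in> ping_cone k" "s = 1 \<or> s = -1"
  shows "s \<cdot>\<^sub>v v \<in> ping_cone k"
proof -
  obtain x y r where xy: "v = x @\<^sub>v y" "x \<in> carrier_vec (2 * k)" "y \<in> carrier_vec (2 * k)" "y \<noteq> 0\<^sub>v (2 * k)"
    and r: "(x - r \<cdot>\<^sub>v (qm k *\<^sub>v y)) \<bullet> (x - r \<cdot>\<^sub>v (qm k *\<^sub>v y)) \<le> y \<bullet> y"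
    using assms(1) unfolding ping_cone_def by blast
  have q: "qm k *\<^sub>v y \<in> carrier_vec (2 * k)" using xy by simp
  have 1: "s \<cdot>\<^sub>v x - r \<cdot>\<^sub>v (qm k *\<^sub>v (s \<cdot>\<^sub>v y)) = s \<cdot>\<^sub>v (x - r \<cdot>\<^sub>v (qm k *\<^sub>v y))"
    unfolding mult_mat_vec[OF block_carrier(1) xy(3)]
    using xy q carrier_vecD[OF xy(2)] carrier_matD[OF block_carrier(1)[of k]]
    by (intro eq_vecI) (auto simp: algebra_simps simp del: index_mult_mat_vec)
  have 2: "(s \<cdot>\<^sub>v z) \<bullet> (s \<cdot>\<^sub>v z) = z \<bullet> z" for z :: "real Matrix.vec"
    using assms(2) by auto
  have "s \<cdot>\<^sub>v y \<noteq> 0\<^sub>v (2 * k)"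
  proof
    assume "s \<cdot>\<^sub>v y = 0\<^sub>v (2 * k)"
    then have "s \<cdot>\<^sub>v (s \<cdot>\<^sub>v y) = 0\<^sub>v (2 * k)" by (auto intro!: eq_vecI)
    then show False using assms(2) xy(4) by (auto simp: smult_smult_assoc)
  qed
  then show ?thesis
    unfolding xy(1) smult_append_vec using xy r by (intro NsI[of _ _ _ r]) (simp_all only: 1 2, auto)
qed

lemma sn_sign: "sn c w = 1 \<or> sn c w = -1"
  by (induction w arbitrary: c) (auto simp: sg_def)

lemma hexrep_piece_vec:
  assumes "set u \<subseteq> piece p" "v \<in> carrier_vec (4 * k)"
  shows "hexrep k c u *\<^sub>v v = frame k p c *\<^sub>v (sn c u \<cdot>\<^sub>v (Th k (quad_of u) *\<^sub>v (frame' k p (run c u) *\<^sub>v v)))"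
proof -
  let ?N = "4 * k"
  let ?F = "frame k p c" and ?T = "Th k (quad_of u)" and ?F' = "frame' k p (run c u)"
  have C: "?F \<in> carrier_mat ?N ?N" "?T \<in> carrier_mat ?N ?N" "?F' \<in> carrier_mat ?N ?N" by auto
  then have FT: "?F * ?T \<in> carrier_mat ?N ?N" "?F * ?T * ?F' \<in> carrier_mat ?N ?N"
    by (auto intro: mult_carrier_mat[of _ ?N ?N])
  have v: "?F' *\<^sub>v v \<in> carrier_vec ?N" "?T *\<^sub>v (?F' *\<^sub>v v) \<in> carrier_vec ?N"
    using C assms(2) by (auto intro: mult_mat_vec_carrier[of _ ?N ?N])
  have "hexrep k c u *\<^sub>v v = sn c u \<cdot>\<^sub>v ((?F * ?T * ?F') *\<^sub>v v)"
    unfolding hexrep_piece[OF assms(1)] by (rule smult_mat_vec[OF FT(2) assms(2)])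
  also have "(?F * ?T * ?F') *\<^sub>v v = ?F *\<^sub>v (?T *\<^sub>v (?F' *\<^sub>v v))"
    using assoc_mult_mat_vec[OF FT(1) C(3) assms(2)] assoc_mult_mat_vec[OF C(1,2) v(1)] by simp
  also have "sn c u \<cdot>\<^sub>v \<dots> = ?F *\<^sub>v (sn c u \<cdot>\<^sub>v (?T *\<^sub>v (?F' *\<^sub>v v)))"
    using mult_mat_vec[OF C(1) v(2)] by simp
  finally show ?thesis .
qed

lemma frame_infinity:
  assumes "x \<in> carrier_vec (2 * k)"
  shows "frame' k p c *\<^sub>v (x @\<^sub>v 0\<^sub>v (2 * k)) = x @\<^sub>v 0\<^sub>v (2 * k)"
proof -
  have x0: "x @\<^sub>v 0\<^sub>v (2 * k) \<in> carrier_vec (4 * k)"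
    using append_carrier_vec[OF assms, of "0\<^sub>v (2 * k)" "2 * k"] by simp
  have B: "- bd k c \<in> carrier_mat (2 * k) (2 * k)" by auto
  have "(- bd k c) *\<^sub>v 0\<^sub>v (2 * k) = 0\<^sub>v (2 * k)"
    by (rule mat_zero_vec[OF B])
  then show ?thesis
    using assms x0 by (simp add: frame'_def act_upper_unip[OF B assms])
qed

text \<open>Ping-pong that starts at infinity. A vector with zero lower part is fixed by every
  frame, and the last syllable carries it into the cone. Each change of piece inserts exactly one
  bend, which \<open>ping_pong\<close> absorbs together with the next syllable.\<close>

lemma good_vec:
  assumes "good p w" "x \<in> carrier_vec (2 * k)" "x \<noteq> 0\<^sub>v (2 * k)"
  shows "\<exists>n\<in>ping_cone k. hexrep k c w *\<^sub>v (x @\<^sub>v 0\<^sub>v (2 * k)) = frame k p c *\<^sub>v n"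
  using assms(1)
proof (induction arbitrary: c rule: good.induct)
  case (one u p w)
  let ?x = "x @\<^sub>v 0\<^sub>v (2 * k)"
  have x0: "?x \<in> carrier_vec (4 * k)"
    using append_carrier_vec[OF assms(2), of "0\<^sub>v (2 * k)" "2 * k"] by simp
  obtain a b c' d where r: "quad_of u = (a, b, c', d)" by (cases "quad_of u")
  have c': "c' \<noteq> 0" using one r by simp
  have q: "qm k *\<^sub>v x \<in> carrier_vec (2 * k)" using assms by simp
  note q0 = mat_zero_vec[OF block_carrier(1)[of k]]
  then have T: "Th k (quad_of u) *\<^sub>v ?x = (a \<cdot>\<^sub>v x) @\<^sub>v (c' \<cdot>\<^sub>v (qm k *\<^sub>v x))"
    unfolding r act_Th[OF assms(2) zero_carrier_vec] q0 smult_zero_vec' using assms q by simp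
  have qq: "qm k *\<^sub>v (c' \<cdot>\<^sub>v (qm k *\<^sub>v x)) = c' \<cdot>\<^sub>v x"
    using mult_mat_vec[OF block_carrier(1) q] qm_qm_vec[OF assms(2)] by simp
  have "c' \<cdot>\<^sub>v (qm k *\<^sub>v x) \<noteq> 0\<^sub>v (2 * k)"
  proof
    assume *: "c' \<cdot>\<^sub>v (qm k *\<^sub>v x) = 0\<^sub>v (2 * k)"
    have "c' \<cdot>\<^sub>v x = 0\<^sub>v (2 * k)"
      unfolding qq[symmetric] * by (rule q0)
    then have "(1 / c') \<cdot>\<^sub>v (c' \<cdot>\<^sub>v x) = 0\<^sub>v (2 * k)" by (simp add: smult_zero_vec')
    then show False using c' assms(3) by (simp add: smult_smult_assoc)
  qed
  moreover have "a \<cdot>\<^sub>v x - (a / c') \<cdot>\<^sub>v (qm k *\<^sub>v (c' \<cdot>\<^sub>v (qm k *\<^sub>v x))) = 0\<^sub>v (2 * k)"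
    unfolding qq using c' assms by (intro eq_vecI) auto
  ultimately have "Th k (quad_of u) *\<^sub>v ?x \<in> ping_cone k"
    unfolding T using assms q by (intro NsI[of _ _ _ "a / c'"])
      (simp_all add: vec_sq_nonneg del: smult_scalar_prod_distrib scalar_prod_smult_distrib scalar_prod_smult_left scalar_prod_smult_right)
  then have "sn c u \<cdot>\<^sub>v (Th k (quad_of u) *\<^sub>v ?x) \<in> ping_cone k" by (rule ping_cone_sign[OF _ sn_sign])
  then show ?case
    using hexrep_piece_vec[OF one(1) x0, of c] frame_infinity[OF assms(2)] hexrep_weq[OF one(3)] by auto
next
  case (more u p w2 w)
  let ?x = "x @\<^sub>v 0\<^sub>v (2 * k)"
  let ?c = "run c u"
  have x0: "?x \<in> carrier_vec (4 * k)"
    using append_carrier_vec[OF assms(2), of "0\<^sub>v (2 * k)" "2 * k"] by simp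
  obtain n where n: "n \<in> ping_cone k" "hexrep k ?c w2 *\<^sub>v ?x = frame k (\<not> p) ?c *\<^sub>v n"
    using more.IH by blast
  have nc: "n \<in> carrier_vec (4 * k)" using n(1) by (rule ping_cone_carrier)
  obtain a b c' d where r: "quad_of u = (a, b, c', d)" by (cases "quad_of u")
  have "2 * c'\<^sup>2 \<ge> 1" "(a * d - b * c')\<^sup>2 = 1"
    using lower_left_bound[OF more(2)] qdet_quad_of[of u] r by auto
  note pp = ping_pong[OF n(1) _ _ this]
  \<comment> \<open>One of the two pieces has the trivial frame, so a single bend appears: with the
    sign of \<open>bd\<close> when the second piece is left, with the opposite sign when it is
    entered.\<close>
  define s where "s = (if p then sg (?c S0) * sg (?c S3) else - (sg (?c S0) * sg (?c S3)))"
  have s: "s = 1 \<or> s = -1" by (auto simp: s_def sg_def)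
  have "frame' k p ?c *\<^sub>v (frame k (\<not> p) ?c *\<^sub>v n) = upper_unip k (s \<cdot>\<^sub>m bend k (?c S1)) *\<^sub>v n"
  proof (cases p)
    case True
    then show ?thesis
      using nc mult_mat_vec_carrier[OF upper_unip_carrier nc] by (simp add: frame_def frame'_def s_def bd_def)
  next
    case False
    have "- bd k ?c = s \<cdot>\<^sub>m bend k (?c S1)"
      using False by (auto simp: s_def bd_def intro!: eq_matI)
    then show ?thesis using False nc by (simp add: frame_def frame'_def)
  qed
  then have "Th k (quad_of u) *\<^sub>v (frame' k p ?c *\<^sub>v (hexrep k ?c w2 *\<^sub>v ?x)) \<in> ping_cone k"
    unfolding n(2) r using pp[OF _ s] by simp
  then have N: "sn c u \<cdot>\<^sub>v (Th k (quad_of u) *\<^sub>v (frame' k p ?c *\<^sub>v (hexrep k ?c w2 *\<^sub>v ?x))) \<in> ping_cone k"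
    by (rule ping_cone_sign[OF _ sn_sign])
  have "hexrep k c w *\<^sub>v ?x = hexrep k c u *\<^sub>v (hexrep k ?c w2 *\<^sub>v ?x)"
    unfolding hexrep_weq[OF more(4)] hexrep_append by (rule assoc_mult_mat_vec[OF hexrep_carrier hexrep_carrier x0])
  also have "\<dots> = frame k p c *\<^sub>v (sn c u \<cdot>\<^sub>v (Th k (quad_of u) *\<^sub>v (frame' k p ?c *\<^sub>v (hexrep k ?c w2 *\<^sub>v ?x))))"
    by (rule hexrep_piece_vec[OF more(1) mult_mat_vec_carrier[OF hexrep_carrier x0]])
  finally show ?case using N by blast
qed

section \<open>The infinite dihedral group of the ideal vertex\<close>

fun alt :: "side list \<Rightarrow> bool" where
  "alt [] = True"
| "alt [i] = True"
| "alt (i # j # w) = (i \<noteq> j \<and> alt (j # w))"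

lemma ex_alt:
  assumes "set d \<subseteq> {S0, S3}"
  shows "\<exists>d'. weq d d' \<and> alt d' \<and> set d' \<subseteq> {S0, S3}"
  using assms
proof (induction d)
  case Nil
  then show ?case by (intro exI[of _ "[]"]) simp
next
  case (Cons j d)
  then obtain d' where d': "weq d d'" "alt d'" "set d' \<subseteq> {S0, S3}" by auto
  have w: "weq (j # d) (j # d')" by (rule weq_Cons) fact
  show ?case
  proof (cases d')
    case Nil
    then show ?thesis using w Cons.prems by (intro exI[of _ "[j]"]) auto
  next
    case (Cons i e)
    show ?thesis
    proof (cases "i = j")
      case True
      have "weq (j # d) e" using weq.trans[OF w] weq_cancel_Cons[of j e] Cons True by simp
      moreover have "alt e" using d'(2) Cons by (cases e) auto
      ultimately show ?thesis using d'(3) Cons by (intro exI[of _ e]) auto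
    next
      case False
      then show ?thesis using w d' Cons \<open>set (j # d) \<subseteq> {S0, S3}\<close> by (intro exI[of _ "j # d'"]) auto
    qed
  qed
qed

fun qact :: "quad \<Rightarrow> real \<times> real \<Rightarrow> real \<times> real" where
  "qact (a, b, c, d) (x, y) = (a * x + b * y, c * x + d * y)"

lemma qact_mul: "qact (qmul g h) v = qact g (qact h v)"
  by (cases g; cases h; cases v) (simp add: algebra_simps)

text \<open>Ping-pong in the dihedral group: the point z = 1, given by \<open>(1, 1)\<close>, lies
  between the lines Re z = 0 and Re z = 2, and the reflection applied last has moved it beyond its
  own line.\<close>

lemma alt_half_plane:
  "alt (j # d) \<Longrightarrow> set (j # d) \<subseteq> {S0, S3} \<Longrightarrow> side_form j (qact (quad_of (j # d)) (1, 1)) < 0"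
proof (induction d arbitrary: j)
  case Nil
  then show ?case by auto
next
  case (Cons i d)
  have ih: "side_form i (qact (quad_of (i # d)) (1, 1)) < 0" using Cons by auto
  let ?v = "qact (quad_of (i # d)) (1, 1)"
  have a: "qact (side_quad j) v = act j v" for v by (cases v; cases j) (auto simp: act_def)
  have ij: "i \<in> piece True" "j \<in> piece True" "i \<noteq> j" "j \<noteq> nx i" "i \<noteq> nx j" using Cons.prems by auto
  have "side_form i v + side_form j v \<ge> 0" for v
    using Cons.prems ij(3) by (cases v) (auto simp: algebra_simps power2_eq_square[symmetric])
  then have "side_form j ?v > 0" using ih by (smt (verit))
  then show ?case
    using side_form_act_same[OF ij(2), of ?v] by (simp only: quad_of.simps(2)[of j] qact_mul a)
qed

theorem hexrep_faithful:
  assumes "k \<ge> 1" "hexrep k c w = 1\<^sub>m (4 * k)"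
  shows "weq w []"
proof -
  define x where "x = (unit_vec (2 * k) 0 :: real Matrix.vec)"
  have x: "x \<in> carrier_vec (2 * k)" "x \<noteq> 0\<^sub>v (2 * k)"
    using assms(1) unit_vec_nonzero[of "2 * k" 0] by (auto simp: x_def)
  have x0: "x @\<^sub>v 0\<^sub>v (2 * k) \<in> carrier_vec (4 * k)"
    using append_carrier_vec[OF x(1), of "0\<^sub>v (2 * k)" "2 * k"] by simp
  have "\<not> good p w" for p
  proof
    assume "good p w"
    then obtain n where n: "n \<in> ping_cone k" "x @\<^sub>v 0\<^sub>v (2 * k) = frame k p c *\<^sub>v n"
      using good_vec[OF _ x, of p w c] assms(2) x0 by auto
    obtain x' y' where xy: "n = x' @\<^sub>v y'" "x' \<in> carrier_vec (2 * k)" "y' \<in> carrier_vec (2 * k)" "y' \<noteq> 0\<^sub>v (2 * k)"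
      using n(1) unfolding ping_cone_def by blast
    have "\<exists>x''\<in>carrier_vec (2 * k). frame k p c *\<^sub>v n = x'' @\<^sub>v y'"
    proof (cases p)
      case True
      then show ?thesis using xy ping_cone_carrier[OF n(1)] by (auto simp: frame_def)
    next
      case False
      then show ?thesis
        using xy act_upper_unip[OF block_carrier(5) xy(2,3), of c]
          mult_mat_vec_carrier[OF block_carrier(5) xy(3), of c] by (auto simp: frame_def)
    qed
    then obtain x'' where "x'' \<in> carrier_vec (2 * k)" "x @\<^sub>v 0\<^sub>v (2 * k) = x'' @\<^sub>v y'"
      using n(2) by auto
    then have "0\<^sub>v (2 * k) = y'" using x(1) by (metis append_vec_eq)
    then show False using xy(4) by simp
  qed
  \<comment> \<open>What remains is the vertex group, treated in the unbent piece. A nonempty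
    alternating word with trivial image would act as a scalar and fix the point z = 1.\<close>
  then obtain d where d: "set d \<subseteq> {S0, S3}" "weq w d" using classify[of w] by blast
  obtain d' where d': "weq d d'" "alt d'" "set d' \<subseteq> {S0, S3}" using ex_alt[OF d(1)] by blast
  have wd: "weq w d'" by (rule weq.trans[OF d(2) d'(1)])
  have "d' = []"
  proof (rule ccontr)
    assume "d' \<noteq> []"
    then obtain j e where je: "d' = j # e" by (cases d') auto
    obtain a b c' e' where r: "quad_of d' = (a, b, c', e')" by (cases "quad_of d'")
    have s: "set d' \<subseteq> piece True" using d'(3) by auto
    have "1\<^sub>m (4 * k) = sn c d' \<cdot>\<^sub>m Th k (quad_of d')"
      using hexrep_piece[OF s, of k c] hexrep_weq[OF wd, of k c] assms(2)
        left_mult_one_mat[OF Th_carrier[of k "quad_of d'"]] right_mult_one_mat[OF Th_carrier[of k "quad_of d'"]]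
      by (simp add: frame_def frame'_def del: Th.simps)
    then have *: "(1\<^sub>m (4 * k) :: real mat) $$ (i, i') = sn c d' * Th k (quad_of d') $$ (i, i')" if "i < 4 * k" "i' < 4 * k" for i i'
      using that carrier_matD[OF Th_carrier[of k "quad_of d'"]] by (simp del: Th.simps)
    \<comment> \<open>The corner of the upper right block, where the antidiagonal matrix
      \<open>qm k\<close> has an entry 1.\<close>
    have "Th k (quad_of d') $$ (0, 4 * k - 1) = b"
      unfolding r Th.simps by (subst index_mat_four_block) (use assms(1) in \<open>auto simp: qm_def\<close>)
    then have "1 = sn c d' * a" "1 = sn c d' * e'" "0 = sn c d' * b"
      using *[of 0 0] *[of "2 * k" "2 * k"] *[of 0 "4 * k - 1"] assms(1) unfolding r by (auto simp del: Th.simps) (auto simp: qm_def)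
    then have ab: "a = sn c d'" "e' = sn c d'" "b = 0"
      using sn_sign[of c d'] by auto
    have "c' = 0" using lower_left_orbit_vec[of d'] quad_of_diag_lower_left[OF d'(3)] r by simp
    then have q: "qact (quad_of d') (1, 1) = (sn c d', sn c d')" unfolding r by (simp add: ab)
    have "side_form j (qact (quad_of d') (1, 1)) < 0"
      using alt_half_plane d' unfolding je by blast
    moreover have "j = S0 \<or> j = S3" using d'(3) je by auto
    ultimately show False unfolding q using sn_sign[of c d'] by auto
  qed
  then show ?thesis using wd by simp
qed

section \<open>Zariski density\<close>

definition base_tile :: "side \<Rightarrow> bool" where "base_tile = (\<lambda>_. True)"

definition hexrep_group :: "nat \<Rightarrow> real mat set" where
  "hexrep_group k = {hexrep k base_tile w | w. run base_tile w = base_tile}"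

lemma hexrep_group_carrier: "hexrep_group k \<subseteq> carrier_mat (4 * k) (4 * k)"
  by (auto simp: hexrep_group_def)

lemma hexrep_group_mult: "A \<in> hexrep_group k \<Longrightarrow> B \<in> hexrep_group k \<Longrightarrow> A * B \<in> hexrep_group k"
proof -
  assume "A \<in> hexrep_group k" "B \<in> hexrep_group k"
  then obtain u v where uv: "A = hexrep k base_tile u" "run base_tile u = base_tile" "B = hexrep k base_tile v" "run base_tile v = base_tile"
    by (auto simp: hexrep_group_def)
  then have "A * B = hexrep k base_tile (u @ v)" "run base_tile (u @ v) = base_tile"
    by (simp_all add: hexrep_append run_append)
  then show "A * B \<in> hexrep_group k" by (auto simp: hexrep_group_def)
qed

lemma hexrep_group_one: "1\<^sub>m (4 * k) \<in> hexrep_group k"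
  unfolding hexrep_group_def by (intro CollectI exI[of _ "[]"]) simp

section \<open>Directions of block unipotent elements in the closure\<close>

definition upper_nil :: "nat \<Rightarrow> real mat \<Rightarrow> real mat" where
  "upper_nil k X = four_block_mat (0\<^sub>m (2 * k) (2 * k)) X (0\<^sub>m (2 * k) (2 * k)) (0\<^sub>m (2 * k) (2 * k))"

definition lower_nil :: "nat \<Rightarrow> real mat \<Rightarrow> real mat" where
  "lower_nil k Y = four_block_mat (0\<^sub>m (2 * k) (2 * k)) (0\<^sub>m (2 * k) (2 * k)) Y (0\<^sub>m (2 * k) (2 * k))"

definition lower_unip :: "nat \<Rightarrow> real mat \<Rightarrow> real mat" where
  "lower_unip k Y = four_block_mat (1\<^sub>m (2 * k)) (0\<^sub>m (2 * k) (2 * k)) Y (1\<^sub>m (2 * k))"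

lemma upper_nil_lower_nil_carrier [simp, intro]: "upper_nil k X \<in> carrier_mat (4 * k) (4 * k)" "lower_nil k X \<in> carrier_mat (4 * k) (4 * k)"
    "lower_unip k X \<in> carrier_mat (4 * k) (4 * k)"
  by (auto simp: upper_nil_def lower_nil_def lower_unip_def intro!: carrier_matI)

abbreviation "sqm k \<equiv> carrier_mat (2 * k) (2 * k) :: real mat set"

lemma fb_mult:
  assumes "a \<in> sqm k" "b \<in> sqm k" "c \<in> sqm k" "d \<in> sqm k" "a' \<in> sqm k" "b' \<in> sqm k" "c' \<in> sqm k" "d' \<in> sqm k"
  shows "four_block_mat a b c d * four_block_mat a' b' c' d' =
    four_block_mat (a * a' + b * c') (a * b' + b * d') (c * a' + d * c') (c * b' + d * d')"
  by (rule mult_four_block_mat) (rule assms)+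

lemma zero_mult_simps:
  assumes "(a::real mat) \<in> sqm k"
  shows "0\<^sub>m (2 * k) (2 * k) * a = 0\<^sub>m (2 * k) (2 * k)" "a * 0\<^sub>m (2 * k) (2 * k) = 0\<^sub>m (2 * k) (2 * k)"
    "0\<^sub>m (2 * k) (2 * k) + a = a" "a + 0\<^sub>m (2 * k) (2 * k) = a" "1\<^sub>m (2 * k) * a = a" "a * 1\<^sub>m (2 * k) = a"
  using assms by auto

lemma mult_sqm: "a \<in> sqm k \<Longrightarrow> b \<in> sqm k \<Longrightarrow> a * b \<in> sqm k"
  by (rule mult_carrier_mat)

lemma upper_nil_fb_upper_nil:
  assumes "X \<in> sqm k" "Y \<in> sqm k" "a \<in> sqm k" "b \<in> sqm k" "c \<in> sqm k" "d \<in> sqm k"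
  shows "upper_nil k X * four_block_mat a b c d * upper_nil k Y = upper_nil k (X * c * Y)"
    "lower_nil k X * four_block_mat a b c d * lower_nil k Y = lower_nil k (X * b * Y)"
  unfolding upper_nil_def lower_nil_def
  by (simp_all add: fb_mult[of _ k] assms zero_mult_simps[of _ k] mult_sqm)

lemma upper_nil_nilpotent:
  assumes "X \<in> sqm k"
  shows "upper_nil k X * upper_nil k X = 0\<^sub>m (4 * k) (4 * k)" "lower_nil k X * lower_nil k X = 0\<^sub>m (4 * k) (4 * k)"
proof -
  have "four_block_mat (0\<^sub>m (2*k) (2*k)) (0\<^sub>m (2*k) (2*k)) (0\<^sub>m (2*k) (2*k)) (0\<^sub>m (2*k) (2*k)) = (0\<^sub>m (4 * k) (4 * k) :: real mat)"
    by (auto intro!: eq_matI)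
  then show "upper_nil k X * upper_nil k X = 0\<^sub>m (4 * k) (4 * k)" "lower_nil k X * lower_nil k X = 0\<^sub>m (4 * k) (4 * k)"
    unfolding upper_nil_def lower_nil_def by (simp_all add: fb_mult[of _ k] assms zero_mult_simps[of _ k] mult_sqm)
qed

lemma one_plus_upper_nil:
  assumes "X \<in> sqm k"
  shows "1\<^sub>m (4 * k) + r \<cdot>\<^sub>m upper_nil k X = upper_unip k (r \<cdot>\<^sub>m X)" "1\<^sub>m (4 * k) + r \<cdot>\<^sub>m lower_nil k X = lower_unip k (r \<cdot>\<^sub>m X)"
  using assms by (auto simp: upper_nil_def lower_nil_def upper_unip_def lower_unip_def intro!: eq_matI)

lemma upper_nil_smult:
  assumes "X \<in> sqm k"
  shows "upper_nil k (r \<cdot>\<^sub>m X) = r \<cdot>\<^sub>m upper_nil k X" "lower_nil k (r \<cdot>\<^sub>m X) = r \<cdot>\<^sub>m lower_nil k X"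
  using assms by (auto simp: upper_nil_def lower_nil_def intro!: eq_matI)

lemma lower_unip_mult:
  assumes "A \<in> sqm k" "B \<in> sqm k"
  shows "lower_unip k A * lower_unip k B = lower_unip k (A + B)"
  unfolding lower_unip_def by (simp add: fb_mult[of _ k] assms zero_mult_simps[of _ k] comm_add_mat[OF assms])

definition upper_dirs :: "nat \<Rightarrow> real mat set" where
  "upper_dirs k = {X \<in> sqm k. upper_nil k X \<in> nilp (4 * k) (hexrep_group k)}"

definition lower_dirs :: "nat \<Rightarrow> real mat set" where
  "lower_dirs k = {X \<in> sqm k. lower_nil k X \<in> nilp (4 * k) (hexrep_group k)}"

lemma upper_dirs_upper_unip: "X \<in> upper_dirs k \<Longrightarrow> upper_unip k (r \<cdot>\<^sub>m X) \<in> zclosure (4 * k) (hexrep_group k)"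
  unfolding upper_dirs_def nilp_def using one_plus_upper_nil(1)[of X k] by auto

lemma lower_dirs_lower_unip: "X \<in> lower_dirs k \<Longrightarrow> lower_unip k (r \<cdot>\<^sub>m X) \<in> zclosure (4 * k) (hexrep_group k)"
  unfolding lower_dirs_def nilp_def using one_plus_upper_nil(2)[of X k] by auto

lemma upper_dirs_smult: "X \<in> upper_dirs k \<Longrightarrow> r \<cdot>\<^sub>m X \<in> upper_dirs k"
  unfolding upper_dirs_def using nilp_smult[of "upper_nil k X"] upper_nil_smult(1)[of X k] by auto

lemma lower_dirs_smult: "X \<in> lower_dirs k \<Longrightarrow> r \<cdot>\<^sub>m X \<in> lower_dirs k"
  unfolding lower_dirs_def using nilp_smult[of "lower_nil k X"] upper_nil_smult(2)[of X k] by auto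

lemma upper_dirs_add:
  assumes "X \<in> upper_dirs k" "Y \<in> upper_dirs k"
  shows "X + Y \<in> upper_dirs k"
proof -
  have c: "X \<in> sqm k" "Y \<in> sqm k" "X + Y \<in> sqm k" using assms by (auto simp: upper_dirs_def)
  have "1\<^sub>m (4 * k) + r \<cdot>\<^sub>m upper_nil k (X + Y) \<in> zclosure (4 * k) (hexrep_group k)" for r
  proof -
    have "upper_unip k (r \<cdot>\<^sub>m X) * upper_unip k (r \<cdot>\<^sub>m Y) = upper_unip k (r \<cdot>\<^sub>m (X + Y))"
      using c by (simp add: upper_unip_mult add_smult_distrib_left_mat[of _ "2*k" "2*k"])
    then show ?thesis
      using zclosure_mult[OF hexrep_group_carrier hexrep_group_mult upper_dirs_upper_unip[OF assms(1), of r] upper_dirs_upper_unip[OF assms(2), of r]] one_plus_upper_nil(1)[OF c(3)] by simp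
  qed
  then show ?thesis using c by (auto simp: upper_dirs_def nilp_def)
qed

lemma lower_dirs_add:
  assumes "X \<in> lower_dirs k" "Y \<in> lower_dirs k"
  shows "X + Y \<in> lower_dirs k"
proof -
  have c: "X \<in> sqm k" "Y \<in> sqm k" "X + Y \<in> sqm k" using assms by (auto simp: lower_dirs_def)
  have "1\<^sub>m (4 * k) + r \<cdot>\<^sub>m lower_nil k (X + Y) \<in> zclosure (4 * k) (hexrep_group k)" for r
  proof -
    have "lower_unip k (r \<cdot>\<^sub>m X) * lower_unip k (r \<cdot>\<^sub>m Y) = lower_unip k (r \<cdot>\<^sub>m (X + Y))"
      using c by (simp add: lower_unip_mult add_smult_distrib_left_mat[of _ "2*k" "2*k"])
    then show ?thesis
      using zclosure_mult[OF hexrep_group_carrier hexrep_group_mult lower_dirs_lower_unip[OF assms(1), of r] lower_dirs_lower_unip[OF assms(2), of r]] one_plus_upper_nil(2)[OF c(3)] by simp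
  qed
  then show ?thesis using c by (auto simp: lower_dirs_def nilp_def)
qed

lemma upper_dirs_carrier: "X \<in> upper_dirs k \<Longrightarrow> X \<in> sqm k" and lower_dirs_carrier: "X \<in> lower_dirs k \<Longrightarrow> X \<in> sqm k"
  by (auto simp: upper_dirs_def lower_dirs_def)

text \<open>With \<open>P\<close> the nilpotent block matrix of \<open>X\<close>, the product
  \<open>P N P\<close> sees the lower left block of \<open>N\<close> only. This is how the direction
  of a bent unipotent element is brought into block form.\<close>

lemma upper_dirs_sandwich:
  assumes "X \<in> upper_dirs k" "four_block_mat a b c d \<in> nilp (4 * k) (hexrep_group k)"
    "a \<in> sqm k" "b \<in> sqm k" "c \<in> sqm k" "d \<in> sqm k"
  shows "X * c * X \<in> upper_dirs k"
proof -
  have X: "X \<in> sqm k" "upper_nil k X \<in> nilp (4 * k) (hexrep_group k)" using assms(1) by (auto simp: upper_dirs_def)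
  show ?thesis
    using nilp_sandwich[OF hexrep_group_carrier hexrep_group_mult X(2) upper_nil_nilpotent(1)[OF X(1)] assms(2)]
    unfolding upper_nil_fb_upper_nil(1)[OF X(1,1) assms(3-6)] using X(1) assms(5) by (simp add: upper_dirs_def mult_sqm)
qed

lemma lower_dirs_sandwich:
  assumes "X \<in> lower_dirs k" "four_block_mat a b c d \<in> nilp (4 * k) (hexrep_group k)"
    "a \<in> sqm k" "b \<in> sqm k" "c \<in> sqm k" "d \<in> sqm k"
  shows "X * b * X \<in> lower_dirs k"
proof -
  have X: "X \<in> sqm k" "lower_nil k X \<in> nilp (4 * k) (hexrep_group k)" using assms(1) by (auto simp: lower_dirs_def)
  show ?thesis
    using nilp_sandwich[OF hexrep_group_carrier hexrep_group_mult X(2) upper_nil_nilpotent(2)[OF X(1)] assms(2)]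
    unfolding upper_nil_fb_upper_nil(2)[OF X(1,1) assms(3-6)] using X(1) assms(4) by (simp add: lower_dirs_def mult_sqm)
qed

lemma lower_dirs_upper_dirs: "X \<in> lower_dirs k \<Longrightarrow> Y \<in> upper_dirs k \<Longrightarrow> X * Y * X \<in> lower_dirs k"
  by (rule lower_dirs_sandwich[of _ _ "0\<^sub>m (2*k) (2*k)" _ "0\<^sub>m (2*k) (2*k)" "0\<^sub>m (2*k) (2*k)"])
     (auto simp: upper_dirs_def upper_nil_def)

lemma upper_dirs_lower_dirs: "X \<in> upper_dirs k \<Longrightarrow> Y \<in> lower_dirs k \<Longrightarrow> X * Y * X \<in> upper_dirs k"
  by (rule upper_dirs_sandwich[of _ _ "0\<^sub>m (2*k) (2*k)" "0\<^sub>m (2*k) (2*k)" _ "0\<^sub>m (2*k) (2*k)"])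
     (auto simp: lower_dirs_def lower_nil_def)

section \<open>Parabolic loops and their bent conjugates\<close>

lemma Th_unipotent:
  "Th k (1, b, 0, 1) = 1\<^sub>m (4 * k) + upper_nil k (b \<cdot>\<^sub>m qm k)"
  "Th k (1, 0, c, 1) = 1\<^sub>m (4 * k) + lower_nil k (c \<cdot>\<^sub>m qm k)"
  by (auto simp: upper_nil_def lower_nil_def qm_def intro!: eq_matI)

lemma hexrep_base_tile: "run base_tile w = base_tile \<Longrightarrow> hexrep k base_tile w \<in> hexrep_group k"
  by (auto simp: hexrep_group_def)

abbreviation "loop03 \<equiv> [S0, S3, S0, S3]"

lemma run_even: "(\<And>i. even (count_list w i)) \<Longrightarrow> run c w = c"
  by (rule ext) (simp add: run_apply)

text \<open>The product of the reflections in \<open>S0\<close> and \<open>S3\<close> is a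
  horizontal translation of length 4, and its square is a closed word. Conjugation by
  \<open>S1\<close> or \<open>S5\<close> yields the opposite parabolic.\<close>

lemma quad_of_loops: "quad_of loop03 = (1, -8, 0, 1)" "quad_of (S1 # loop03 @ [S1]) = (1, 0, -4, 1)"
    "quad_of (S5 # loop03 @ [S5]) = (1, 0, -4, 1)"
  by (simp_all add: field_simps)

lemma sn_loops: "c S1 \<and> c S2 \<and> c S4 \<or> \<not> c S1 \<and> c S2 \<and> c S4 \<Longrightarrow> sn c loop03 = 1"
    "sn base_tile (S1 # loop03 @ [S1]) = 1" "sn c (S5 # loop03 @ [S5]) = 1"
proof -
  show "sn c (S5 # loop03 @ [S5]) = 1" by (cases "c S0"; cases "c S1"; cases "c S4") (simp_all add: flip_apply)
qed (auto simp: flip_apply base_tile_def)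

lemma smult_one [simp]: "1 \<cdot>\<^sub>m A = (A :: real mat)"
  by (auto intro!: eq_matI)

lemma q_in_upper_dirs: "qm k \<in> upper_dirs k"
proof -
  have r: "run base_tile loop03 = base_tile" by (rule run_even) simp
  have "hexrep k base_tile loop03 = Th k (1, -8, 0, 1)"
    using hexrep_piece[of loop03 True k base_tile] left_mult_one_mat[OF Th_carrier[of k "(1,-8,0,1)"]]
      right_mult_one_mat[OF Th_carrier[of k "(1,-8,0,1)"]] sn_loops(1)[of base_tile]
    unfolding quad_of_loops by (simp add: frame_def frame'_def base_tile_def del: hexrep.simps Th.simps sn.simps)
  then have "1\<^sub>m (4 * k) + upper_nil k ((-8) \<cdot>\<^sub>m qm k) \<in> hexrep_group k"
    using hexrep_base_tile[OF r, of k] by (simp add: Th_unipotent del: hexrep.simps Th.simps)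
  then have "upper_nil k ((-8) \<cdot>\<^sub>m qm k) \<in> nilp (4 * k) (hexrep_group k)"
    by (intro nilp_unipotent hexrep_group_carrier hexrep_group_mult hexrep_group_one upper_nil_nilpotent) auto
  then have "(-8) \<cdot>\<^sub>m qm k \<in> upper_dirs k" by (simp add: upper_dirs_def)
  from upper_dirs_smult[OF this, of "-1/8"] show ?thesis by (simp add: smult_smult_mat)
qed

lemma q_in_lower_dirs: "qm k \<in> lower_dirs k"
proof -
  let ?w = "S1 # loop03 @ [S1]"
  have r: "run base_tile ?w = base_tile" by (rule run_even) simp
  have "hexrep k base_tile ?w = Th k (1, 0, -4, 1)"
    using hexrep_piece[of ?w True k base_tile] left_mult_one_mat[OF Th_carrier[of k "(1,0,-4,1)"]]
      right_mult_one_mat[OF Th_carrier[of k "(1,0,-4,1)"]]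
    unfolding quad_of_loops sn_loops by (simp add: frame_def frame'_def del: hexrep.simps Th.simps sn.simps)
  then have "1\<^sub>m (4 * k) + lower_nil k ((-4) \<cdot>\<^sub>m qm k) \<in> hexrep_group k"
    using hexrep_base_tile[OF r, of k] by (simp add: Th_unipotent del: hexrep.simps Th.simps)
  then have "lower_nil k ((-4) \<cdot>\<^sub>m qm k) \<in> nilp (4 * k) (hexrep_group k)"
    by (intro nilp_unipotent hexrep_group_carrier hexrep_group_mult hexrep_group_one upper_nil_nilpotent) auto
  then have "(-4) \<cdot>\<^sub>m qm k \<in> lower_dirs k" by (simp add: lower_dirs_def)
  from lower_dirs_smult[OF this, of "-1/4"] show ?thesis by (simp add: smult_smult_mat)
qed

text \<open>The bend enters the upper right block quadratically; the term linear in \<open>B\<close>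
  is recovered later by polarization.\<close>

lemma bent_blocks:
  assumes "B \<in> sqm k" "Y \<in> sqm k"
  shows "upper_unip k B * lower_nil k Y * upper_unip k (- B) = four_block_mat (B * Y) (- (B * Y * B)) Y (- (Y * B))"
proof -
  have nB: "- B \<in> sqm k" using assms by simp
  have "upper_unip k B * lower_nil k Y = four_block_mat (B * Y) (0\<^sub>m (2*k) (2*k)) Y (0\<^sub>m (2*k) (2*k))"
    unfolding upper_unip_def lower_nil_def by (simp add: fb_mult[of _ k] assms zero_mult_simps[of _ k] mult_sqm)
  then show ?thesis
    unfolding upper_unip_def using assms nB
    by (simp add: fb_mult[of _ k] zero_mult_simps[of _ k] mult_sqm)
qed

lemma conj_square_zero:
  assumes "U \<in> carrier_mat m m" "V \<in> carrier_mat m m" "V * U = 1\<^sub>m m" "N \<in> carrier_mat m m" "N * N = 0\<^sub>m m m"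
  shows "U * N * V * (U * N * V) = (0\<^sub>m m m :: real mat)"
proof -
  have c: "U * N \<in> carrier_mat m m" "N * V \<in> carrier_mat m m" "U * N * V \<in> carrier_mat m m"
    using assms by auto
  have "U * N * V * (U * N * V) = U * N * (V * (U * N * V))"
    using c assms by (intro assoc_mult_mat[of _ m m _ m _ m])
  also have "V * (U * N * V) = V * (U * N) * V"
    using c assms by (intro assoc_mult_mat[symmetric, of _ m m _ m _ m])
  also have "V * (U * N) = V * U * N"
    using assms by (intro assoc_mult_mat[symmetric, of _ m m _ m _ m])
  also have "\<dots> * V = N * V" using assms by simp
  also have "U * N * (N * V) = U * (N * (N * V))"
    using c assms by (intro assoc_mult_mat[of _ m m _ m _ m])
  also have "N * (N * V) = N * N * V"
    using assms by (intro assoc_mult_mat[symmetric, of _ m m _ m _ m])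
  finally show ?thesis using assms by simp
qed

lemma bent_shift:
  assumes "B \<in> sqm k" "C \<in> sqm k" "Y \<in> sqm k"
  shows "upper_unip k C * (upper_unip k B * lower_nil k Y * upper_unip k (- B)) * upper_unip k (- C) = upper_unip k (B + C) * lower_nil k Y * upper_unip k (- (B + C))"
proof -
  let ?m = "4 * k"
  have c: "upper_unip k X \<in> carrier_mat ?m ?m" "lower_nil k Y \<in> carrier_mat ?m ?m" for X by auto
  have "upper_unip k C * (upper_unip k B * lower_nil k Y * upper_unip k (- B)) * upper_unip k (- C) = (upper_unip k C * upper_unip k B) * lower_nil k Y * (upper_unip k (- B) * upper_unip k (- C))"
    using c by (simp add: assoc_mult_mat[of _ ?m ?m _ ?m _ ?m] mult_carrier_mat[of _ ?m ?m _ ?m])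
  moreover have "C + B = B + C" "- B + - C = - (B + C)" using assms by (auto intro!: eq_matI)
  ultimately show ?thesis using assms by (simp add: upper_unip_mult)
qed

lemma quadratic_expand:
  assumes B: "B \<in> sqm k"
  shows "(B + r \<cdot>\<^sub>m qm k) * qm k * (B + r \<cdot>\<^sub>m qm k) = B * qm k * B + (2 * r) \<cdot>\<^sub>m B + (r\<^sup>2) \<cdot>\<^sub>m qm k"
proof -
  have q: "qm k \<in> sqm k" "r \<cdot>\<^sub>m qm k \<in> sqm k" by auto
  have Bq: "B * qm k \<in> sqm k" "B * qm k * B \<in> sqm k" using B by (auto intro: mult_sqm)
  have "(B + r \<cdot>\<^sub>m qm k) * qm k = B * qm k + r \<cdot>\<^sub>m 1\<^sub>m (2 * k)"
    by (simp add: add_mult_distrib_mat[OF B q(2,1)] mult_smult_assoc_mat[OF q(1,1)] qm_sq)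
  also have "\<dots> * (B + r \<cdot>\<^sub>m qm k) = B * qm k * B + B * qm k * (r \<cdot>\<^sub>m qm k) + (r \<cdot>\<^sub>m B + r \<cdot>\<^sub>m (r \<cdot>\<^sub>m qm k))"
  proof -
    have 1: "r \<cdot>\<^sub>m 1\<^sub>m (2 * k) \<in> sqm k" by auto
    have Bq': "B + r \<cdot>\<^sub>m qm k \<in> sqm k" using B q by auto
    have "(B * qm k + r \<cdot>\<^sub>m 1\<^sub>m (2 * k)) * (B + r \<cdot>\<^sub>m qm k)
      = (B * qm k) * (B + r \<cdot>\<^sub>m qm k) + (r \<cdot>\<^sub>m 1\<^sub>m (2 * k)) * (B + r \<cdot>\<^sub>m qm k)"
      by (rule add_mult_distrib_mat[OF Bq(1) 1 Bq'])
    also have "(B * qm k) * (B + r \<cdot>\<^sub>m qm k) = B * qm k * B + B * qm k * (r \<cdot>\<^sub>m qm k)"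
      by (rule mult_add_distrib_mat[OF Bq(1) B q(2)])
    also have "(r \<cdot>\<^sub>m 1\<^sub>m (2 * k)) * (B + r \<cdot>\<^sub>m qm k) = r \<cdot>\<^sub>m (B + r \<cdot>\<^sub>m qm k)"
      using mult_smult_assoc_mat[of "1\<^sub>m (2*k)" "2*k" "2*k" "B + r \<cdot>\<^sub>m qm k" "2*k" r] Bq' left_mult_one_mat[OF Bq'] by simp
    also have "\<dots> = r \<cdot>\<^sub>m B + r \<cdot>\<^sub>m (r \<cdot>\<^sub>m qm k)"
      by (rule add_smult_distrib_left_mat[OF B q(2)])
    finally show ?thesis .
  qed
  also have "B * qm k * (r \<cdot>\<^sub>m qm k) = r \<cdot>\<^sub>m B"
    using mult_smult_distrib[OF Bq(1) q(1), of r] assoc_mult_mat[OF B q(1,1)] B by (simp add: qm_sq)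
  finally show ?thesis
    using B Bq carrier_matD[OF Bq(2)] carrier_matD[OF q(1)]
    by (auto intro!: eq_matI simp: algebra_simps power2_eq_square simp del: index_mult_mat)
qed

text \<open>Since \<open>q^2 = 1\<close>, the expression is \<open>B q B + 2 r B + r^2 q\<close>.
  Its values at \<open>r = 1\<close> and \<open>r = 0\<close> and the known direction
  \<open>q\<close> determine \<open>B\<close>.\<close>

lemma upper_dirs_from_quadratic:
  assumes B: "B \<in> sqm k" and Q: "\<And>r. (B + r \<cdot>\<^sub>m qm k) * qm k * (B + r \<cdot>\<^sub>m qm k) \<in> upper_dirs k"
  shows "B \<in> upper_dirs k"
proof -
  have Bq: "B * qm k * B \<in> sqm k" using B by (auto intro: mult_sqm)
  have 1: "B * qm k * B + 2 \<cdot>\<^sub>m B + qm k \<in> upper_dirs k"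
    using Q[of 1] unfolding quadratic_expand[OF B] by simp
  have 2: "B * qm k * B + 0 \<cdot>\<^sub>m B + 0 \<cdot>\<^sub>m qm k \<in> upper_dirs k"
    using Q[of 0] unfolding quadratic_expand[OF B] by simp
  have "(1/2) \<cdot>\<^sub>m ((B * qm k * B + 2 \<cdot>\<^sub>m B + qm k) + ((-1) \<cdot>\<^sub>m (B * qm k * B + 0 \<cdot>\<^sub>m B + 0 \<cdot>\<^sub>m qm k) + (-1) \<cdot>\<^sub>m qm k)) \<in> upper_dirs k"
    by (intro upper_dirs_smult upper_dirs_add 1 2 q_in_upper_dirs)
  moreover have "(1/2) \<cdot>\<^sub>m ((B * qm k * B + 2 \<cdot>\<^sub>m B + qm k) + ((-1) \<cdot>\<^sub>m (B * qm k * B + 0 \<cdot>\<^sub>m B + 0 \<cdot>\<^sub>m qm k) + (-1) \<cdot>\<^sub>m qm k)) = B"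
    using B carrier_matD[OF Bq] carrier_matD[OF block_carrier(1)[of k]]
    by (auto intro!: eq_matI simp: algebra_simps simp del: index_mult_mat)
  ultimately show ?thesis by simp
qed

lemma q_cancel:
  assumes "X \<in> sqm k"
  shows "qm k * (qm k * X * qm k) * qm k = X"
proof -
  have q: "qm k \<in> sqm k" by simp
  have "qm k * (qm k * X * qm k) * qm k = (qm k * qm k) * X * (qm k * qm k)"
    using assms q by (simp add: assoc_mult_mat[of _ "2*k" "2*k" _ "2*k" _ "2*k"] mult_sqm)
  then show ?thesis using assms by (simp add: qm_sq)
qed

lemma hexrep_bent:
  "hexrep k c (S5 # loop03 @ [S5]) = 1\<^sub>m (4 * k) + 1 \<cdot>\<^sub>m (upper_unip k (bd k c) * lower_nil k ((-4) \<cdot>\<^sub>m qm k) * upper_unip k (- bd k c))"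
proof -
  let ?w = "S5 # loop03 @ [S5]"
  have r: "run c ?w = c" by (rule run_even) simp
  have "hexrep k c ?w = upper_unip k (bd k c) * Th k (1, 0, -4, 1) * upper_unip k (- bd k c)"
    using hexrep_piece[of ?w False k c] unfolding quad_of_loops sn_loops r
    by (simp add: frame_def frame'_def del: hexrep.simps Th.simps sn.simps)
  also have "Th k (1, 0, -4, 1) = 1\<^sub>m (4 * k) + 1 \<cdot>\<^sub>m lower_nil k ((-4) \<cdot>\<^sub>m qm k)"
    by (simp add: Th_unipotent del: Th.simps)
  also have "upper_unip k (bd k c) * (1\<^sub>m (4 * k) + 1 \<cdot>\<^sub>m lower_nil k ((-4) \<cdot>\<^sub>m qm k)) * upper_unip k (- bd k c)
      = 1\<^sub>m (4 * k) + 1 \<cdot>\<^sub>m (upper_unip k (bd k c) * lower_nil k ((-4) \<cdot>\<^sub>m qm k) * upper_unip k (- bd k c))"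
    by (rule conj_one_plus) (auto simp: upper_unip_inverse)
  finally show ?thesis .
qed

text \<open>The parabolic loop through \<open>S5\<close> is bent by \<open>B\<close>, and
  conjugation by the translations with block \<open>r q\<close> replaces \<open>B\<close> by
  \<open>B + r q\<close>. A sandwich with \<open>q\<close> from below isolates the upper right
  block.\<close>

lemma bend_True_in_upper_dirs: "bend k True \<in> upper_dirs k"
proof (rule upper_dirs_from_quadratic)
  fix r :: real
  let ?m = "4 * k" and ?B = "bend k True" and ?Y = "(-4) \<cdot>\<^sub>m qm k"
  let ?B' = "?B + r \<cdot>\<^sub>m qm k"
  have b: "bd k base_tile = ?B" by (simp add: bd_def base_tile_def)
  have c: "?B \<in> sqm k" "?Y \<in> sqm k" "?B' \<in> sqm k" "r \<cdot>\<^sub>m qm k \<in> sqm k" "qm k \<in> sqm k" by auto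
  let ?N = "upper_unip k ?B * lower_nil k ?Y * upper_unip k (- ?B)"
  have Nc: "?N \<in> carrier_mat ?m ?m" by (auto intro!: mult_carrier_mat[of _ ?m ?m])
  have r0: "run base_tile (S5 # loop03 @ [S5]) = base_tile" by (rule run_even) simp
  have "1\<^sub>m ?m + ?N \<in> hexrep_group k"
    using hexrep_base_tile[OF r0, of k] hexrep_bent[of k base_tile] by (simp add: b del: hexrep.simps)
  moreover have "?N * ?N = 0\<^sub>m ?m ?m"
    by (intro conj_square_zero upper_unip_inverse upper_nil_nilpotent c) auto
  ultimately have N: "?N \<in> nilp ?m (hexrep_group k)"
    by (intro nilp_unipotent hexrep_group_carrier hexrep_group_mult hexrep_group_one Nc)
  have "- (r \<cdot>\<^sub>m qm k) = (- r) \<cdot>\<^sub>m qm k" by (auto intro!: eq_matI)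
  then have zneg: "upper_unip k (- (r \<cdot>\<^sub>m qm k)) \<in> zclosure ?m (hexrep_group k)" using upper_dirs_upper_unip[OF q_in_upper_dirs, of k "- r"] by simp
  have zpos: "upper_unip k (r \<cdot>\<^sub>m qm k) \<in> zclosure ?m (hexrep_group k)" by (rule upper_dirs_upper_unip[OF q_in_upper_dirs])
  have "upper_unip k (r \<cdot>\<^sub>m qm k) * ?N * upper_unip k (- (r \<cdot>\<^sub>m qm k)) \<in> nilp ?m (hexrep_group k)"
    by (rule nilp_conj[OF hexrep_group_carrier hexrep_group_mult zpos zneg upper_unip_inverse(1)[OF c(4)] N])
  then have "four_block_mat (?B' * ?Y) (- (?B' * ?Y * ?B')) ?Y (- (?Y * ?B')) \<in> nilp ?m (hexrep_group k)"
    unfolding bent_shift[OF c(1,4,2)] bent_blocks[OF c(3,2)] .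
  then have L: "qm k * (- (?B' * ?Y * ?B')) * qm k \<in> lower_dirs k"
    by (rule lower_dirs_sandwich[OF q_in_lower_dirs]) (use c in \<open>auto intro!: mult_sqm\<close>)
  \<comment> \<open>A second sandwich, from above, returns the direction to the upper block, and the
    factors \<open>q\<close> cancel in pairs.\<close>
  have "qm k * (qm k * (- (?B' * ?Y * ?B')) * qm k) * qm k \<in> upper_dirs k"
    by (rule upper_dirs_lower_dirs[OF q_in_upper_dirs L])
  moreover have d: "- (?B' * ?Y * ?B') \<in> sqm k" using c by (auto intro!: mult_sqm)
  ultimately have "- (?B' * ?Y * ?B') \<in> upper_dirs k" using q_cancel[OF d] by simp
  then have "(1/4) \<cdot>\<^sub>m (- (?B' * ?Y * ?B')) \<in> upper_dirs k" by (rule upper_dirs_smult)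
  moreover have "?B' * ?Y * ?B' = (-4) \<cdot>\<^sub>m (?B' * qm k * ?B')"
    using c by (simp add: mult_smult_distrib[OF c(3,5)] mult_smult_assoc_mat[OF mult_sqm[OF c(3,5)] c(3)])
  then have "(1/4) \<cdot>\<^sub>m (- (?B' * ?Y * ?B')) = ?B' * qm k * ?B'"
    by (auto intro!: eq_matI simp del: index_mult_mat)
  ultimately show "?B' * qm k * ?B' \<in> upper_dirs k" by simp
qed simp

abbreviation "T1 k \<equiv> Th k (side_quad S1)"

lemma T1_T1: "T1 k * T1 k = 1\<^sub>m (4 * k)"
proof -
  have "qmul (side_quad S1) (side_quad S1) = (1, 0, 0, 1)" by simp
  then show ?thesis by (simp only: Th_mult Th_one)
qed

text \<open>The reflection in \<open>S1\<close> exchanges the roles of the upper and the lower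
  block.\<close>

lemma T1_conj:
  assumes "a \<in> sqm k" "b \<in> sqm k" "c \<in> sqm k" "d \<in> sqm k"
  shows "T1 k * four_block_mat a b c d * T1 k =
    four_block_mat (qm k * d * qm k) (2 \<cdot>\<^sub>m (qm k * c * qm k)) ((1/2) \<cdot>\<^sub>m (qm k * b * qm k)) (qm k * a * qm k)"
proof -
  have q: "qm k \<in> sqm k" by simp
  have z: "0 \<cdot>\<^sub>m 1\<^sub>m (2 * k) = (0\<^sub>m (2*k) (2*k) :: real mat)" by (auto intro!: eq_matI)
  have T: "T1 k = four_block_mat (0\<^sub>m (2*k) (2*k)) (sqrt 2 \<cdot>\<^sub>m qm k) ((1 / sqrt 2) \<cdot>\<^sub>m qm k) (0\<^sub>m (2*k) (2*k))"
    by (simp add: z)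
  have s: "sqrt 2 \<cdot>\<^sub>m qm k \<in> sqm k" "(1 / sqrt 2) \<cdot>\<^sub>m qm k \<in> sqm k" by auto
  have e: "(x \<cdot>\<^sub>m qm k) * y * (z \<cdot>\<^sub>m qm k) = (x * z) \<cdot>\<^sub>m (qm k * y * qm k)" if "y \<in> sqm k" for x y z
    using smult_mult_smult[OF mult_sqm[OF q that] q, of x z] mult_smult_assoc_mat[OF q that] by simp
  show ?thesis
    unfolding T using assms s q carrier_matD[OF q]
    by (simp add: fb_mult[of _ k] zero_mult_simps[of _ k] mult_sqm e)
qed

lemma T1_upper_unip: 
  "T1 k * upper_unip k (r \<cdot>\<^sub>m qm k) * T1 k = lower_unip k ((r / 2) \<cdot>\<^sub>m qm k)"
proof -
  have q: "qm k \<in> sqm k" by simp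
  have "qm k * (r \<cdot>\<^sub>m qm k) * qm k = r \<cdot>\<^sub>m qm k"
    using mult_smult_assoc_mat[OF one_carrier_mat q, of r] q by (simp add: mult_smult_distrib[OF q q] qm_sq)
  moreover have "2 \<cdot>\<^sub>m (0\<^sub>m (2*k) (2*k)) = (0\<^sub>m (2*k) (2*k) :: real mat)" by (auto intro!: eq_matI)
  ultimately show ?thesis
    unfolding upper_unip_def lower_unip_def using T1_conj[of "1\<^sub>m (2*k)" k "r \<cdot>\<^sub>m qm k" "0\<^sub>m (2*k) (2*k)" "1\<^sub>m (2*k)"] q
    by (simp add: zero_mult_simps[OF q] qm_sq smult_smult_mat del: Th.simps side_quad.simps)
qed

lemma conj_involution_mult:
  assumes T: "T \<in> carrier_mat m m" "T * T = 1\<^sub>m m" and X: "X \<in> carrier_mat m m" and Y: "Y \<in> carrier_mat m m"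
  shows "(T * X * T) * (T * Y * T) = T * (X * Y) * (T :: real mat)"
proof -
  have c: "T * X \<in> carrier_mat m m" "Y * T \<in> carrier_mat m m" "T * Y \<in> carrier_mat m m" "X * Y \<in> carrier_mat m m"
    using T X Y by auto
  have "(T * X * T) * (T * Y * T) = T * X * (T * (T * Y * T))"
    using c T by (intro assoc_mult_mat[of _ m m _ m _ m]) auto
  also have "T * (T * Y * T) = T * (T * (Y * T))"
    using assoc_mult_mat[OF T(1) Y T(1)] by simp
  also have "\<dots> = T * T * (Y * T)"
    using c T by (intro assoc_mult_mat[symmetric, of _ m m _ m _ m]) auto
  also have "\<dots> = Y * T" using T(2) left_mult_one_mat[OF c(2)] by simp
  also have "T * X * (Y * T) = T * X * Y * T"
    using c T Y by (intro assoc_mult_mat[symmetric, of _ m m _ m _ m]) auto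
  also have "T * X * Y = T * (X * Y)"
    by (rule assoc_mult_mat[OF T(1) X Y])
  finally show ?thesis .
qed

text \<open>In the tile across \<open>S1\<close> the other bend is in force, and framing a loop
  there by \<open>S1\<close> makes it a word at the base tile. The letter \<open>S1\<close> alone is
  not closed, so its matrix serves for conjugation only: it takes the translations with block
  \<open>r q\<close> to lower unipotent elements of the closure.\<close>

lemma bend_False_in_upper_dirs: "bend k False \<in> upper_dirs k"
proof (rule upper_dirs_from_quadratic)
  fix r :: real
  let ?m = "4 * k" and ?B = "bend k False" and ?Y = "(-4) \<cdot>\<^sub>m qm k"
  let ?B' = "?B + r \<cdot>\<^sub>m qm k" and ?T = "T1 k"
  let ?c = "flip base_tile S1"
  have b: "bd k ?c = ?B" by (simp add: bd_def base_tile_def flip_def)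
  have c: "?B \<in> sqm k" "?Y \<in> sqm k" "?B' \<in> sqm k" "r \<cdot>\<^sub>m qm k \<in> sqm k" "qm k \<in> sqm k" by auto
  let ?w = "S5 # loop03 @ [S5]"
  let ?N = "upper_unip k ?B * lower_nil k ?Y * upper_unip k (- ?B)"
  have Nc: "?N \<in> carrier_mat ?m ?m" by (auto intro!: mult_carrier_mat[of _ ?m ?m])
  have Tc: "?T \<in> carrier_mat ?m ?m" by (rule Th_carrier)
  have r0: "run base_tile (S1 # ?w @ [S1]) = base_tile" by (rule run_even) simp
  have r1: "run ?c ?w = ?c" by (rule run_even) simp
  have E1: "hexrep k base_tile [S1] = ?T" "hexrep k ?c [S1] = ?T"
    using hexrep_piece[of "[S1]" True k] left_mult_one_mat[OF Tc] right_mult_one_mat[OF Tc]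
    by (simp_all add: frame_def frame'_def base_tile_def flip_def del: hexrep.simps Th.simps side_quad.simps)
  have "hexrep k base_tile (S1 # ?w @ [S1]) = ?T * (hexrep k ?c ?w * ?T)"
    using hexrep_append[of k base_tile "[S1]" "?w @ [S1]"] hexrep_append[of k ?c ?w "[S1]"] E1 r1 by (simp del: hexrep.simps Th.simps side_quad.simps)
  also have "\<dots> = ?T * (1\<^sub>m ?m + 1 \<cdot>\<^sub>m ?N) * ?T"
    unfolding hexrep_bent b using Tc Nc by (intro assoc_mult_mat[symmetric, of _ ?m ?m _ ?m _ ?m]) auto
  also have "\<dots> = 1\<^sub>m ?m + 1 \<cdot>\<^sub>m (?T * ?N * ?T)"
    by (rule conj_one_plus[OF Tc Tc Nc T1_T1])
  finally have "1\<^sub>m ?m + ?T * ?N * ?T \<in> hexrep_group k"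
    using hexrep_base_tile[OF r0, of k] by (simp del: hexrep.simps Th.simps side_quad.simps)
  moreover have "?N * ?N = 0\<^sub>m ?m ?m"
    by (rule conj_square_zero[OF upper_unip_carrier upper_unip_carrier upper_unip_inverse(2)[OF c(1)] upper_nil_lower_nil_carrier(2) upper_nil_nilpotent(2)[OF c(2)]])
  then have "?T * ?N * ?T * (?T * ?N * ?T) = 0\<^sub>m ?m ?m"
    by (rule conj_square_zero[OF Tc Tc T1_T1 Nc])
  moreover
  have TNc: "?T * ?N * ?T \<in> carrier_mat ?m ?m"
    by (rule mult_carrier_mat[OF mult_carrier_mat[OF Tc Nc] Tc])
  ultimately have nil: "?T * ?N * ?T \<in> nilp ?m (hexrep_group k)"
    by (intro nilp_unipotent hexrep_group_carrier hexrep_group_mult hexrep_group_one)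
  let ?Z = "upper_unip k (r \<cdot>\<^sub>m qm k)" and ?Z' = "upper_unip k (- (r \<cdot>\<^sub>m qm k))"
  have Zc: "?Z \<in> carrier_mat ?m ?m" "?Z' \<in> carrier_mat ?m ?m" by auto
  have neg: "- (r \<cdot>\<^sub>m qm k) = (- r) \<cdot>\<^sub>m qm k" by (auto intro!: eq_matI)
  have TZT: "?T * ?Z * ?T \<in> zclosure ?m (hexrep_group k)" "?T * ?Z' * ?T \<in> zclosure ?m (hexrep_group k)"
    unfolding neg T1_upper_unip by (intro lower_dirs_lower_unip q_in_lower_dirs)+
  have comp: "(?T * X * ?T) * (?T * Y * ?T) = ?T * (X * Y) * ?T"
    if X: "X \<in> carrier_mat ?m ?m" and Y: "Y \<in> carrier_mat ?m ?m" for X Y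
    by (rule conj_involution_mult[OF Tc T1_T1 X Y])
  have "(?T * ?Z * ?T) * (?T * ?Z' * ?T) = 1\<^sub>m ?m"
    unfolding comp[OF Zc] upper_unip_inverse(1)[OF c(4)] using right_mult_one_mat[OF Tc] T1_T1[of k] by (simp del: Th.simps side_quad.simps)
  from nilp_conj[OF hexrep_group_carrier hexrep_group_mult TZT this nil]
  have "(?T * ?Z * ?T) * (?T * ?N * ?T) * (?T * ?Z' * ?T) \<in> nilp ?m (hexrep_group k)" .
  also have "(?T * ?Z * ?T) * (?T * ?N * ?T) * (?T * ?Z' * ?T) = ?T * (?Z * ?N * ?Z') * ?T"
    unfolding comp[OF Zc(1) Nc] by (rule comp[OF mult_carrier_mat[OF Zc(1) Nc] Zc(2)])
  also have "?Z * ?N * ?Z' = four_block_mat (?B' * ?Y) (- (?B' * ?Y * ?B')) ?Y (- (?Y * ?B'))"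
    unfolding bent_shift[OF c(1,4,2)] bent_blocks[OF c(3,2)] ..
  finally have L: "?T * four_block_mat (?B' * ?Y) (- (?B' * ?Y * ?B')) ?Y (- (?Y * ?B')) * ?T \<in> nilp ?m (hexrep_group k)" .
  have d: "?B' * ?Y \<in> sqm k" "- (?B' * ?Y * ?B') \<in> sqm k" "- (?Y * ?B') \<in> sqm k" using c by (auto intro!: mult_sqm)
  \<comment> \<open>Conjugation by \<open>T1\<close> has moved the quadratic block to the lower
    left, so one sandwich from above is enough.\<close>
  have "qm k * ((1/2) \<cdot>\<^sub>m (qm k * (- (?B' * ?Y * ?B')) * qm k)) * qm k \<in> upper_dirs k"
    by (rule upper_dirs_sandwich[OF q_in_upper_dirs L[unfolded T1_conj[OF d(1,2) c(2) d(3)]]])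
       (use c d in \<open>auto intro!: mult_sqm smult_carrier_mat\<close>)
  moreover have "qm k * ((1/2) \<cdot>\<^sub>m (qm k * (- (?B' * ?Y * ?B')) * qm k)) * qm k = (1/2) \<cdot>\<^sub>m (- (?B' * ?Y * ?B'))"
  proof -
    have x: "qm k * (- (?B' * ?Y * ?B')) * qm k \<in> sqm k" using c d by (intro mult_sqm)
    show ?thesis
      using q_cancel[OF d(2)] mult_smult_distrib[OF c(5) x] mult_smult_assoc_mat[OF mult_sqm[OF c(5) x] c(5)] by simp
  qed
  ultimately have "(1/2) \<cdot>\<^sub>m ((1/2) \<cdot>\<^sub>m (- (?B' * ?Y * ?B'))) \<in> upper_dirs k" using upper_dirs_smult by simp
  moreover have "?B' * ?Y * ?B' = (-4) \<cdot>\<^sub>m (?B' * qm k * ?B')"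
    using c by (simp add: mult_smult_distrib[OF c(3,5)] mult_smult_assoc_mat[OF mult_sqm[OF c(3,5)] c(3)])
  then have "(1/2) \<cdot>\<^sub>m ((1/2) \<cdot>\<^sub>m (- (?B' * ?Y * ?B'))) = ?B' * qm k * ?B'"
    by (auto intro!: eq_matI simp del: index_mult_mat)
  ultimately show "?B' * qm k * ?B' \<in> upper_dirs k" by simp
qed simp

section \<open>From the two bends to all rank one directions\<close>

lemma sum_pick: "(a::nat) < m \<Longrightarrow> (\<Sum>l\<in>{0..<m}. (if l = a then f l else 0)) = (f a :: real)"
  by simp

lemma mat_mult_entry:
  assumes "X \<in> sqm k" "Y \<in> sqm k" "i < 2 * k" "j < 2 * k"
  shows "(X * Y) $$ (i, j) = (\<Sum>l\<in>{0..<2*k}. X $$ (i, l) * Y $$ (l, j))"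
  using assms by (auto simp: scalar_prod_def intro!: sum.cong)

lemma qm_conj_index:
  assumes "X \<in> sqm k" "i < 2 * k" "j < 2 * k"
  shows "(qm k * X * qm k) $$ (i, j) = X $$ (2 * k - 1 - i, 2 * k - 1 - j)"
proof -
  have l: "(qm k * X) $$ (i, j) = X $$ (2 * k - 1 - i, j)" if "i < 2 * k" "j < 2 * k" for i j
  proof -
    have "(qm k * X) $$ (i, j) = (\<Sum>l\<in>{0..<2*k}. if l = 2 * k - 1 - i then X $$ (l, j) else 0)"
      unfolding mat_mult_entry[OF block_carrier(1) assms(1) that] using that by (intro sum.cong) (auto simp: qm_def)
    then show ?thesis using that by (simp only: sum_pick)
  qed
  have "(qm k * X * qm k) $$ (i, j) = (\<Sum>l\<in>{0..<2*k}. if l = 2 * k - 1 - j then (qm k * X) $$ (i, l) else 0)"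
    unfolding mat_mult_entry[OF mult_sqm[OF block_carrier(1) assms(1)] block_carrier(1) assms(2,3)]
      using assms(2,3) by (intro sum.cong) (auto simp: qm_def)
  also have "\<dots> = (qm k * X) $$ (i, 2 * k - 1 - j)" using assms by (intro sum_pick) auto
  finally show ?thesis using l[of i "2 * k - 1 - j"] assms by simp
qed

lemma dm_conj_index:
  assumes "X \<in> sqm k" "i < 2 * k" "j < 2 * k"
  shows "(dm k * X * dm k) $$ (i, j) = (if i = 0 \<or> j = 0 then 0 else X $$ (2 * k - i, 2 * k - j))"
proof -
  have l: "(dm k * X) $$ (i, j) = (if i = 0 then 0 else X $$ (2 * k - i, j))" if "i < 2 * k" "j < 2 * k" for i j
  proof -
    have "(dm k * X) $$ (i, j) = (\<Sum>l\<in>{0..<2*k}. if l = 2 * k - i then X $$ (l, j) else 0)"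
      unfolding mat_mult_entry[OF block_carrier(3) assms(1) that] using that by (intro sum.cong) (auto simp: dm_def)
    then show ?thesis using that by auto
  qed
  have "(dm k * X * dm k) $$ (i, j) = (\<Sum>l\<in>{0..<2*k}. if l = 2 * k - j then (dm k * X) $$ (i, l) else 0)"
    unfolding mat_mult_entry[OF mult_sqm[OF block_carrier(3) assms(1)] block_carrier(3) assms(2,3)]
      using assms(2,3) by (intro sum.cong) (auto simp: dm_def)
  also have "\<dots> = (if j = 0 then 0 else (dm k * X) $$ (i, 2 * k - j))" using assms by auto
  finally show ?thesis using l[of i "2 * k - j"] assms by auto
qed

lemma tau_conj_index:
  assumes "X \<in> sqm k" "i < 2 * k" "j < 2 * k"
  shows "(tau k * X * tau k) $$ (i, j) = (if i < k then -1 else 1) * X $$ (i, j) * (if j < k then -1 else 1)"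
proof -
  have l: "(tau k * X) $$ (i, j) = (if i < k then -1 else 1) * X $$ (i, j)" if "i < 2 * k" "j < 2 * k" for i j
  proof -
    have "(tau k * X) $$ (i, j) = (\<Sum>l\<in>{0..<2*k}. if l = i then (if i < k then -1 else 1) * X $$ (l, j) else 0)"
      unfolding mat_mult_entry[OF block_carrier(2) assms(1) that] using that by (intro sum.cong) (auto simp: tau_def)
    then show ?thesis using that by (simp only: sum_pick)
  qed
  have "(tau k * X * tau k) $$ (i, j) =
      (\<Sum>l\<in>{0..<2*k}. if l = j then (tau k * X) $$ (i, l) * (if j < k then -1 else 1) else 0)"
    unfolding mat_mult_entry[OF mult_sqm[OF block_carrier(2) assms(1)] block_carrier(2) assms(2,3)]
      using assms(2,3) by (intro sum.cong) (auto simp: tau_def)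
  then show ?thesis using l[of i j] assms by (simp only: sum_pick)
qed

lemma tau_in_upper_dirs: "tau k \<in> upper_dirs k"
proof -
  have "(1/4) \<cdot>\<^sub>m bend k True \<in> upper_dirs k" by (rule upper_dirs_smult[OF bend_True_in_upper_dirs])
  moreover have "(1/4) \<cdot>\<^sub>m bend k True = tau k" by (auto simp: bend_def tau_def dm_def intro!: eq_matI)
  ultimately show ?thesis by simp
qed

lemma dm_in_upper_dirs: "dm k \<in> upper_dirs k"
proof -
  have "(1/2) \<cdot>\<^sub>m (bend k False + (-1) \<cdot>\<^sub>m bend k True) \<in> upper_dirs k"
    by (intro upper_dirs_smult upper_dirs_add bend_True_in_upper_dirs bend_False_in_upper_dirs)
  moreover have "(1/2) \<cdot>\<^sub>m (bend k False + (-1) \<cdot>\<^sub>m bend k True) = dm k"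
    by (auto simp: bend_def tau_def dm_def intro!: eq_matI)
  ultimately show ?thesis by simp
qed

text \<open>\<open>q X q\<close> is a lower direction, and a sandwich by \<open>Z\<close> returns to
  the upper ones. This quadratic operation generates everything that follows.\<close>

lemma upper_dirs_quad: "X \<in> upper_dirs k \<Longrightarrow> Z \<in> upper_dirs k \<Longrightarrow> Z * (qm k * X * qm k) * Z \<in> upper_dirs k"
  by (intro upper_dirs_lower_dirs lower_dirs_upper_dirs q_in_lower_dirs)

text \<open>A single antidiagonal of ones, \<open>a\<close> steps below that of \<open>qm\<close>;
  \<open>a = 0\<close> is \<open>qm\<close> and \<open>a = 1\<close> is \<open>dm\<close>.\<close>

definition hankel :: "nat \<Rightarrow> nat \<Rightarrow> real mat" where
  "hankel k a = Matrix.mat (2 * k) (2 * k) (\<lambda>(i, j). if i + j + 1 = 2 * k + a then 1 else 0)"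

lemma hankel_carrier [simp]: "hankel k a \<in> sqm k"
  by (simp add: hankel_def)

text \<open>With \<open>Z = dm\<close> the quadratic operation shifts on both sides and moves an
  antidiagonal by two steps, starting from \<open>qm\<close> and \<open>dm\<close>.\<close>

lemma hankel_in_upper_dirs: "hankel k a \<in> upper_dirs k"
proof (induction a rule: nat_less_induct)
  case (1 a)
  have "hankel k 0 = qm k" "hankel k 1 = dm k" by (auto simp: hankel_def qm_def dm_def intro!: eq_matI)
  moreover have "hankel k (b + 2) = dm k * (qm k * hankel k b * qm k) * dm k" for b
  proof (rule eq_matI)
    have c: "qm k * hankel k b * qm k \<in> sqm k" by (intro mult_sqm) auto
    fix i j assume "i < dim_row (dm k * (qm k * hankel k b * qm k) * dm k)" "j < dim_col (dm k * (qm k * hankel k b * qm k) * dm k)"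
    then have ij: "i < 2 * k" "j < 2 * k" using carrier_matD[OF block_carrier(3)[of k]] by auto
    show "hankel k (b + 2) $$ (i, j) = (dm k * (qm k * hankel k b * qm k) * dm k) $$ (i, j)"
      unfolding dm_conj_index[OF c ij]
      using ij qm_conj_index[of "hankel k b" k "2 * k - i" "2 * k - j"] by (auto simp: hankel_def)
  qed (auto simp: hankel_def dm_def)
  moreover consider "a = 0" | "a = 1" | "a = (a - 2) + 2" "a - 2 < a" by linarith
  ultimately show ?case
    using 1 q_in_upper_dirs[of k] dm_in_upper_dirs[of k] upper_dirs_quad[OF _ dm_in_upper_dirs, of "hankel k (a - 2)" k] by cases metis+
qed

definition rank_one :: "nat \<Rightarrow> (nat \<Rightarrow> real) \<Rightarrow> real mat" where
  "rank_one k x = Matrix.mat (2 * k) (2 * k) (\<lambda>(i, j). x i * x j)"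

lemma rank_one_carrier [simp]: "rank_one k x \<in> sqm k"
  by (simp add: rank_one_def)

text \<open>A corner matrix unit between two copies of a Hankel matrix with last column
  \<open>x\<close> gives \<open>x x^T\<close>. The unit comes from the last antidiagonal, which is a
  single entry; the operation with \<open>tau\<close> moves it to the opposite corner, where the two
  signs cancel.\<close>

lemma rank_one_in_upper_dirs:
  assumes k: "k \<ge> 1"
  shows "rank_one k x \<in> upper_dirs k"
proof -
  let ?e = "Matrix.mat (2 * k) (2 * k) (\<lambda>(i, j). if i = 0 \<and> j = 0 then 1 else 0) :: real mat"
  let ?n = "2 * k"
  have ec: "?e \<in> sqm k" by simp
  have e: "?e \<in> upper_dirs k"
  proof -
    have c: "qm k * hankel k (?n - 1) * qm k \<in> sqm k" by (intro mult_sqm) auto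
    have "tau k * (qm k * hankel k (?n - 1) * qm k) * tau k = ?e"
    proof (rule eq_matI)
      fix i j assume "i < dim_row ?e" "j < dim_col ?e"
      then have ij: "i < 2 * k" "j < 2 * k" by auto
      show "(tau k * (qm k * hankel k (?n - 1) * qm k) * tau k) $$ (i, j) = ?e $$ (i, j)"
        unfolding tau_conj_index[OF c ij] qm_conj_index[OF hankel_carrier ij]
        using ij k by (auto simp: hankel_def)
    qed (auto simp: tau_def)
    then show ?thesis using upper_dirs_quad[OF hankel_in_upper_dirs tau_in_upper_dirs, of k "?n - 1"] by simp
  qed
  \<comment> \<open>A Hankel matrix supported on and below the antidiagonal, cut off after
    \<open>m\<close> steps so that it can be built by induction. For \<open>m = 2 * k\<close> its
    last row and column are \<open>x\<close>.\<close>
  define Z where "Z m = Matrix.mat ?n ?n (\<lambda>(i, j). if i + j + 1 \<ge> ?n \<and> i + j + 1 - ?n < m then x (i + j + 1 - ?n) else 0)" for m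
  have ZU: "Z m \<in> upper_dirs k" for m
  proof (induction m)
    case 0
    have "0 \<cdot>\<^sub>m qm k \<in> upper_dirs k" by (rule upper_dirs_smult[OF q_in_upper_dirs])
    moreover have "0 \<cdot>\<^sub>m qm k = Z 0" by (auto simp: Z_def qm_def intro!: eq_matI)
    ultimately show ?case by simp
  next
    case (Suc m)
    have "Z m + x m \<cdot>\<^sub>m hankel k m \<in> upper_dirs k" by (intro upper_dirs_add upper_dirs_smult Suc hankel_in_upper_dirs)
    moreover have "Z m + x m \<cdot>\<^sub>m hankel k m = Z (Suc m)"
      by (rule eq_matI) (auto simp: Z_def hankel_def less_Suc_eq)
    ultimately show ?case by simp
  qed
  have Zc: "Z ?n \<in> sqm k" by (simp add: Z_def)
  have c: "qm k * ?e * qm k \<in> sqm k" by (intro mult_sqm) auto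
  have "Z ?n * (qm k * ?e * qm k) * Z ?n = rank_one k x"
  proof (rule eq_matI)
    fix i j assume "i < dim_row (rank_one k x)" "j < dim_col (rank_one k x)"
    then have ij: "i < 2 * k" "j < 2 * k" by (auto simp: rank_one_def)
    have m: "(Z ?n * (qm k * ?e * qm k)) $$ (i, l) = (if l = ?n - 1 then x i else 0)" if l: "l < ?n" for l
    proof -
      have "(Z ?n * (qm k * ?e * qm k)) $$ (i, l) = (\<Sum>p\<in>{0..<?n}. Z ?n $$ (i, p) * (qm k * ?e * qm k) $$ (p, l))"
        by (rule mat_mult_entry[OF Zc c ij(1) l])
      also have "\<dots> = (\<Sum>p\<in>{0..<?n}. if p = ?n - 1 then (if l = ?n - 1 then x i else 0) else 0)"
      proof (rule sum.cong)
        fix p assume "p \<in> {0..<?n}"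
        then have p: "p < ?n" by simp
        show "Z ?n $$ (i, p) * (qm k * ?e * qm k) $$ (p, l) = (if p = ?n - 1 then (if l = ?n - 1 then x i else 0) else 0)"
          unfolding qm_conj_index[OF ec p l] using p l ij k by (auto simp: Z_def)
      qed simp
      also have "\<dots> = (if l = ?n - 1 then x i else 0)" using k by (subst sum_pick) auto
      finally show ?thesis .
    qed
    have "(Z ?n * (qm k * ?e * qm k) * Z ?n) $$ (i, j) = (\<Sum>l\<in>{0..<?n}. (Z ?n * (qm k * ?e * qm k)) $$ (i, l) * Z ?n $$ (l, j))"
      by (rule mat_mult_entry[OF mult_sqm[OF Zc c] Zc ij])
    also have "\<dots> = (\<Sum>l\<in>{0..<?n}. if l = ?n - 1 then x i * Z ?n $$ (l, j) else 0)"
      proof (rule sum.cong)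
      fix l assume "l \<in> {0..<?n}"
      then have l: "l < ?n" by simp
      show "(Z ?n * (qm k * ?e * qm k)) $$ (i, l) * Z ?n $$ (l, j) = (if l = ?n - 1 then x i * Z ?n $$ (l, j) else 0)"
        unfolding m[OF l] by simp
    qed simp
    also have "\<dots> = x i * Z ?n $$ (?n - 1, j)" using k by (subst sum_pick) auto
    finally show "(Z ?n * (qm k * ?e * qm k) * Z ?n) $$ (i, j) = rank_one k x $$ (i, j)"
      using ij k by (auto simp: Z_def rank_one_def)
  qed (use Zc in \<open>auto simp: rank_one_def\<close>)
  then show ?thesis using upper_dirs_quad[OF e ZU[of ?n]] by simp
qed

lemma rank_one_in_lower_dirs:
  assumes k: "k \<ge> 1"
  shows "rank_one k x \<in> lower_dirs k"
proof -
  let ?y = "\<lambda>i. x (2 * k - 1 - i)"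
  have "qm k * rank_one k ?y * qm k = rank_one k x"
  proof (rule eq_matI)
    fix i j assume "i < dim_row (rank_one k x)" "j < dim_col (rank_one k x)"
    then have ij: "i < 2 * k" "j < 2 * k" by (auto simp: rank_one_def)
    show "(qm k * rank_one k ?y * qm k) $$ (i, j) = rank_one k x $$ (i, j)"
      unfolding qm_conj_index[OF rank_one_carrier ij] using ij by (auto simp: rank_one_def)
  qed (auto simp: rank_one_def qm_def)
  then show ?thesis using lower_dirs_upper_dirs[OF q_in_lower_dirs rank_one_in_upper_dirs[OF k, of ?y]] by simp
qed

section \<open>Transvections in the closure\<close>

lemma sf_unit_right:
  assumes "v \<in> carrier_vec (2 * n)"
  shows "j < n \<Longrightarrow> symplectic_form n v (unit_vec (2 * n) j) = - vec_index v (n + j)"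
    "j \<ge> n \<Longrightarrow> j < 2 * n \<Longrightarrow> symplectic_form n v (unit_vec (2 * n) j) = vec_index v (j - n)"
  using sf_swap[of n v "unit_vec (2 * n) j"] sf_unit[of j n v] sf_unit(2)[of "j - n" n v] by auto

text \<open>Write \<open>v = (x, z)\<close>. If \<open>Y x = z\<close>, the lower unipotent matrix
  of \<open>Y\<close> carries \<open>(x, 0)\<close> to \<open>v\<close>, hence conjugates the
  transvection along \<open>(x, 0)\<close>, which is upper unipotent with block
  \<open>c x x^T\<close>, to the one along \<open>v\<close>. The second sum is what the symmetry of
  \<open>Y\<close> provides.\<close>

lemma transvection_block:
  assumes v: "v \<in> carrier_vec (4 * k)" and Y: "Y \<in> sqm k"
    and Yx: "\<And>i. i < 2 * k \<Longrightarrow> (\<Sum>l\<in>{0..<2*k}. Y $$ (i, l) * vec_index v l) = vec_index v (2 * k + i)"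
      "\<And>i. i < 2 * k \<Longrightarrow> (\<Sum>l\<in>{0..<2*k}. vec_index v l * Y $$ (l, i)) = vec_index v (2 * k + i)"
  shows "lower_unip k Y * upper_unip k (c \<cdot>\<^sub>m rank_one k (vec_index v)) * lower_unip k (- Y) = transvection (2 * k) v c"
proof -
  let ?x = "vec_index v" and ?n = "2 * k"
  let ?z = "\<lambda>i. ?x (?n + i)"
  let ?B = "c \<cdot>\<^sub>m rank_one k ?x"
  have B: "?B \<in> sqm k" by simp
  have YB: "Y * ?B = Matrix.mat ?n ?n (\<lambda>(i, j). c * ?z i * ?x j)" (is "_ = ?YB")
  proof (rule eq_matI)
    fix i j assume "i < dim_row ?YB" "j < dim_col ?YB"
    then have ij: "i < ?n" "j < ?n" by auto
    then have "(Y * ?B) $$ (i, j) = (\<Sum>l\<in>{0..<2*k}. Y $$ (i, l) * ?x l) * (c * ?x j)"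
      using Y by (auto simp: scalar_prod_def rank_one_def sum_distrib_right intro!: sum.cong)
    then show "(Y * ?B) $$ (i, j) = ?YB $$ (i, j)" using ij Yx(1)[of i] by simp
  qed (use Y in \<open>auto simp: rank_one_def\<close>)
  have BY: "?B * Y = Matrix.mat ?n ?n (\<lambda>(i, j). c * ?x i * ?z j)" (is "_ = ?BY")
  proof (rule eq_matI)
    fix i j assume "i < dim_row ?BY" "j < dim_col ?BY"
    then have ij: "i < ?n" "j < ?n" by auto
    then have "(?B * Y) $$ (i, j) = (c * ?x i) * (\<Sum>l\<in>{0..<2*k}. ?x l * Y $$ (l, j))"
      using Y by (auto simp: scalar_prod_def rank_one_def sum_distrib_left intro!: sum.cong)
    then show "(?B * Y) $$ (i, j) = ?BY $$ (i, j)" using ij Yx(2)[of j] by simp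
  qed (use Y in \<open>auto simp: rank_one_def\<close>)
  have YBY: "?YB * Y = Matrix.mat ?n ?n (\<lambda>(i, j). c * ?z i * ?z j)" (is "_ = ?YBY")
  proof (rule eq_matI)
    fix i j assume "i < dim_row ?YBY" "j < dim_col ?YBY"
    then have ij: "i < ?n" "j < ?n" by auto
    then have "(?YB * Y) $$ (i, j) = (c * ?z i) * (\<Sum>l\<in>{0..<2*k}. ?x l * Y $$ (l, j))"
      using Y by (auto simp: scalar_prod_def sum_distrib_left intro!: sum.cong)
    then show "(?YB * Y) $$ (i, j) = ?YBY $$ (i, j)" using ij Yx(2)[of j] by simp
  qed (use Y in auto)
  have nY: "- Y \<in> sqm k" using Y by simp
  have neg: "A * (- Y) = - (A * Y)" if "A \<in> sqm k" for A
    using that Y by simp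
  have YBc: "?YB \<in> sqm k" by simp
  have "lower_unip k Y * upper_unip k ?B = four_block_mat (1\<^sub>m ?n) ?B Y (?YB + 1\<^sub>m ?n)"
    unfolding lower_unip_def upper_unip_def YB[symmetric] using B Y
    by (simp add: fb_mult[of _ k] zero_mult_simps[of _ k] mult_sqm)
  also have "\<dots> * lower_unip k (- Y) = four_block_mat (1\<^sub>m ?n + - ?BY) ?B (Y + (?YB + 1\<^sub>m ?n) * (- Y)) (?YB + 1\<^sub>m ?n)"
    unfolding lower_unip_def BY[symmetric] using B Y nY YBc neg[OF B]
    by (simp add: fb_mult[of _ k] zero_mult_simps[of _ k] mult_sqm)
  also have "(?YB + 1\<^sub>m ?n) * (- Y) = - ?YBY + - Y"
    using add_mult_distrib_mat[OF YBc one_carrier_mat nY] neg[OF YBc] YBY left_mult_one_mat[OF nY] by simp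
  finally have *: "lower_unip k Y * upper_unip k ?B * lower_unip k (- Y) =
    four_block_mat (1\<^sub>m ?n + - ?BY) ?B (Y + (- ?YBY + - Y)) (?YB + 1\<^sub>m ?n)" .
  show ?thesis
  proof (rule eq_matI)
    fix i j assume "i < dim_row (transvection ?n v c)" "j < dim_col (transvection ?n v c)"
    then have ij: "i < 4 * k" "j < 4 * k" by (auto simp: transvection_def)
    then show "(lower_unip k Y * upper_unip k ?B * lower_unip k (- Y)) $$ (i, j) = transvection ?n v c $$ (i, j)"
      unfolding * using v Y sf_unit_right[of v ?n j] by (auto simp: transvection_def rank_one_def)
  qed (unfold *, auto simp: transvection_def)
qed

lemma transvection_in_zclosure:
  assumes k: "k \<ge> 1" and v: "v \<in> carrier_vec (4 * k)"
  shows "transvection (2 * k) v c \<in> zclosure (4 * k) (hexrep_group k)"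
proof (cases "\<exists>i<2*k. vec_index v i \<noteq> 0")
  case False
  \<comment> \<open>With vanishing upper part the transvection is itself lower unipotent; the sign
    is that of the symplectic form.\<close>
  have "transvection (2 * k) v c = lower_unip k ((- c) \<cdot>\<^sub>m rank_one k (\<lambda>i. vec_index v (2 * k + i)))"
  proof (rule eq_matI)
    fix i j assume "i < dim_row (lower_unip k ((- c) \<cdot>\<^sub>m rank_one k (\<lambda>i. vec_index v (2 * k + i))))"
      "j < dim_col (lower_unip k ((- c) \<cdot>\<^sub>m rank_one k (\<lambda>i. vec_index v (2 * k + i))))"
    then have "i < 4 * k" "j < 4 * k" by (auto simp: lower_unip_def)
    then show "transvection (2 * k) v c $$ (i, j) = lower_unip k ((- c) \<cdot>\<^sub>m rank_one k (\<lambda>i. vec_index v (2 * k + i))) $$ (i, j)"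
      using v sf_unit_right[of v "2 * k" j] False by (auto simp: transvection_def lower_unip_def rank_one_def)
  qed (auto simp: transvection_def lower_unip_def)
  then show ?thesis using lower_dirs_lower_unip[OF rank_one_in_lower_dirs[OF k]] by simp
next
  case True
  let ?x = "vec_index v" and ?z = "\<lambda>i. vec_index v (2 * k + i)"
  define s where "s = (\<Sum>l\<in>{0..<2*k}. ?x l * ?x l)"
  define t where "t = (\<Sum>l\<in>{0..<2*k}. ?z l * ?x l)"
  obtain i where i: "i < 2 * k" "?x i \<noteq> 0" using True by blast
  then have "0 < ?x i * ?x i" by (metis not_real_square_gt_zero)
  also have "\<dots> \<le> s" unfolding s_def using i by (intro member_le_sum) auto
  finally have s: "s > 0" .
  \<comment> \<open>The symmetric matrix \<open>(x z^T + z x^T) / s - (t / s^2) x x^T\<close>, which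
    sends \<open>x\<close> to \<open>z\<close>. The mixed term is written by polarization in rank
    one matrices.\<close>
  define Y where "Y = (1 / s) \<cdot>\<^sub>m (rank_one k (\<lambda>i. ?x i + ?z i) + ((-1) \<cdot>\<^sub>m rank_one k ?x + (-1) \<cdot>\<^sub>m rank_one k ?z)) + (- t / s\<^sup>2) \<cdot>\<^sub>m rank_one k ?x"
  have Y: "Y \<in> lower_dirs k" unfolding Y_def by (intro lower_dirs_add lower_dirs_smult rank_one_in_lower_dirs k)
  have Yc: "Y \<in> sqm k" by (rule lower_dirs_carrier[OF Y])
  have Yi: "Y $$ (i, j) = (?x i * ?z j + ?z i * ?x j) / s - t / s\<^sup>2 * ?x i * ?x j" if "i < 2 * k" "j < 2 * k" for i j
    using that by (simp add: Y_def rank_one_def field_simps)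
  have Y1: "(\<Sum>l\<in>{0..<2*k}. Y $$ (i, l) * ?x l) = ?z i" if i: "i < 2 * k" for i
  proof -
    have "(\<Sum>l\<in>{0..<2*k}. Y $$ (i, l) * ?x l) =
      (\<Sum>l\<in>{0..<2*k}. ?x i / s * (?z l * ?x l) + ?z i / s * (?x l * ?x l) - t / s\<^sup>2 * ?x i * (?x l * ?x l))"
      using i s by (intro sum.cong refl) (auto simp: Yi field_simps power2_eq_square)
    also have "\<dots> = ?x i / s * t + ?z i / s * s - t / s\<^sup>2 * ?x i * s"
      unfolding s_def t_def by (simp add: sum.distrib sum_subtractf sum_distrib_left)
    also have "\<dots> = ?z i" using s by (simp add: field_simps power2_eq_square)
    finally show ?thesis .
  qed
  have Y2: "(\<Sum>l\<in>{0..<2*k}. ?x l * Y $$ (l, i)) = ?z i" if i: "i < 2 * k" for i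
  proof -
    have "(\<Sum>l\<in>{0..<2*k}. ?x l * Y $$ (l, i)) = (\<Sum>l\<in>{0..<2*k}. Y $$ (i, l) * ?x l)"
      using i by (intro sum.cong refl) (auto simp: Yi algebra_simps)
    then show ?thesis using Y1[OF i] by simp
  qed
  have l: "lower_unip k Y \<in> zclosure (4 * k) (hexrep_group k)" "lower_unip k (- Y) \<in> zclosure (4 * k) (hexrep_group k)"
  proof -
    have "- Y = (-1) \<cdot>\<^sub>m Y" by (auto intro!: eq_matI)
    then show "lower_unip k Y \<in> zclosure (4 * k) (hexrep_group k)" "lower_unip k (- Y) \<in> zclosure (4 * k) (hexrep_group k)"
      using lower_dirs_lower_unip[OF Y, of 1] lower_dirs_lower_unip[OF Y, of "-1"] by auto
  qed
  have z: "upper_unip k (c \<cdot>\<^sub>m rank_one k ?x) \<in> zclosure (4 * k) (hexrep_group k)" by (rule upper_dirs_upper_unip[OF rank_one_in_upper_dirs[OF k]])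
  show ?thesis
    using transvection_block[OF v Yc Y1 Y2, of c] 
      zclosure_mult[OF hexrep_group_carrier hexrep_group_mult zclosure_mult[OF hexrep_group_carrier hexrep_group_mult l(1) z] l(2)] by simp
qed

lemma hexrep_group_zariski_dense:
  assumes k: "k \<ge> 1"
  shows "zariski_dense_in (4 * k) (hexrep_group k) (carrier (Sp_real (2 * k)))"
proof (rule zariski_dense_inI)
  show "hexrep_group k \<subseteq> carrier (Sp_real (2 * k))"
    unfolding hexrep_group_def by (auto intro!: hexrep_Sp_real)
  show "carrier (Sp_real (2 * k)) \<subseteq> zclosure (4 * k) (hexrep_group k)"
  proof
    fix A assume "A \<in> carrier (Sp_real (2 * k))"
    then have "is_sp (2 * k) A" by (auto simp: Sp_real_def is_sp_def)
    moreover have "1\<^sub>m (2 * (2 * k)) \<in> zclosure (4 * k) (hexrep_group k)"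
      using hexrep_group_one[of k] zclosure_superset[OF hexrep_group_carrier[of k]] by auto
    moreover have "transvection (2 * k) v c \<in> zclosure (4 * k) (hexrep_group k)" if "v \<in> carrier_vec (2 * (2 * k))" for v c
      using transvection_in_zclosure[OF k, of v c] that by simp
    ultimately show "A \<in> zclosure (4 * k) (hexrep_group k)"
      using sp_in_G[where n = "2 * k" and G = "zclosure (4 * k) (hexrep_group k)", OF zclosure_mult[OF hexrep_group_carrier hexrep_group_mult]] by blast
  qed
qed

section \<open>Homotopy classes of paths as words\<close>

lemma simply_connected_chart: "simply_connected (chart i c)"
  by (simp add: contractible_chart contractible_imp_simply_connected)

lemma homotopic_paths_chart:
  assumes "path p" "path q" "path_image p \<subseteq> chart i c" "path_image q \<subseteq> chart i c"
    "pathstart q = pathstart p" "pathfinish q = pathfinish p"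
  shows "homotopic_paths hexsurf p q"
proof -
  have "homotopic_paths (chart i c) p q"
    using simply_connected_chart[of i c] assms
    unfolding simply_connected_eq_homotopic_paths by blast
  then show ?thesis
    by (rule homotopic_paths_subset) (simp add: chart_def)
qed

definition tile_ctr :: "(side \<Rightarrow> bool) \<Rightarrow> real^side" where
  "tile_ctr c = pos c 0 0"

lemma tile_ctr_nth [simp]: "tile_ctr c $ i = sg (c i)"
  by (simp add: tile_ctr_def pos_def)

lemma tile_ctr_hexsurf [simp]: "tile_ctr c \<in> hexsurf"
  by (simp add: tile_ctr_def pos_in_hexsurf)

lemma sigma_tile_ctr [simp]: "sigma (tile_ctr c) = c"
  by (auto simp: sigma_def sg_def)

lemma tile_ctr_chart [simp]: "tile_ctr c \<in> chart i c"
  by (simp add: chart_def chart_nbhd_def)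

text \<open>The path from the centre of the tile containing \<open>x\<close> to \<open>x\<close>.\<close>

definition tile_path :: "real^side \<Rightarrow> real \<Rightarrow> real^side" where
  "tile_path x t = pos (sigma x) (t * xu x) (t * xv x)"

lemma tile_path_sign:
  assumes "x \<in> hexsurf" "t \<in> {0..1}" "x $ j \<noteq> 0 \<or> t < 1"
  shows "0 < tile_path x t $ j * sg (sigma x j)"
proof -
  have "lin j (t * xu x) (t * xv x) > 0"
    using assms by (cases "t = 1") (auto simp: lin_scale hexsurf_lin intro!: add_pos_nonneg)
  then show ?thesis
    by (simp add: tile_path_def pos_def mult.assoc mult.commute)
qed

lemma tile_path_hexsurf:
  assumes "x \<in> hexsurf" "t \<in> {0..1}"
  shows "tile_path x t \<in> hexsurf"
  unfolding tile_path_def using assms by (intro pos_in_hexsurf) (simp add: lin_scale hexsurf_lin)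

lemma path_tile_path [simp]: "path (tile_path x)"
  unfolding path_def tile_path_def pos_def
proof (rule continuous_on_vec_lambda)
  show "continuous_on {0..1} (\<lambda>t. sg (sigma x j) * sqrt (lin j (t * xu x) (t * xv x)))" for j
    by (cases j) (auto intro!: continuous_intros)
qed

lemma tile_path_start [simp]: "pathstart (tile_path x) = tile_ctr (sigma x)"
  by (simp add: tile_path_def pathstart_def tile_ctr_def)

lemma tile_path_finish [simp]: "x \<in> hexsurf \<Longrightarrow> pathfinish (tile_path x) = x"
  by (simp add: tile_path_def pathfinish_def pos_sigma)

lemma tile_path_image_hexsurf: "x \<in> hexsurf \<Longrightarrow> path_image (tile_path x) \<subseteq> hexsurf"
  by (auto simp: path_image_def tile_path_hexsurf)

lemma tile_path_image_chart:
  assumes "x \<in> chart i c"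
  shows "path_image (tile_path x) \<subseteq> chart i c"
proof -
  have "tile_path x t \<in> chart i (sigma x)" if "t \<in> {0..1}" for t
  proof -
    have "x $ j \<noteq> 0" if "j \<noteq> i" "j \<noteq> nx i" for j
      using assms that by (auto simp: chart_def chart_nbhd_def)
    then show ?thesis
      using assms that tile_path_sign[of x t] tile_path_hexsurf[of x t] by (auto simp: chart_def chart_nbhd_def)
  qed
  then show ?thesis
    using chart_sigma[OF assms] by (auto simp: path_image_def)
qed

text \<open>The path crossing the midpoint of side \<open>i\<close> of the tile \<open>c\<close>.\<close>

fun pv :: "side \<Rightarrow> side" where
  "pv S0 = S5" | "pv S1 = S0" | "pv S2 = S1" | "pv S3 = S2" | "pv S4 = S3" | "pv S5 = S4"

lemma nx_pv [simp]: "nx (pv i) = i" "pv (nx i) = i"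
  by (cases i; simp)+

text \<open>The squares at the midpoint of side \<open>i\<close>, whose ends are the vertices with
  indices \<open>i\<close> and \<open>pv i\<close>. The path below interpolates the squares with
  parameter \<open>(1 - 2 t)^2\<close>, so that coordinate \<open>i\<close> is linear in
  \<open>t\<close> and changes sign at the midpoint.\<close>

definition md :: "side \<Rightarrow> side \<Rightarrow> real" where
  "md i j = (al i j + al (pv i) j) / 2"

lemma md_simps [simp]: "md i i = 0" "md i j \<ge> 0"
  using al_simps(2)[of "pv i"] by (simp_all add: md_def)

lemma md_pos: "j \<noteq> i \<Longrightarrow> md i j > 0"
  by (cases i; cases j; simp add: md_def al_def)

lemma md_rec: "md i j + md i (nx (nx j)) = 1 + md i (nx j)"
  using al_rec[of i j] al_rec[of "pv i" j] unfolding md_def by argo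

definition edge_path :: "(side \<Rightarrow> bool) \<Rightarrow> side \<Rightarrow> real \<Rightarrow> real^side" where
  "edge_path c i t = (\<chi> j. if j = i then sg (c i) * (1 - 2 * t)
     else sg (c j) * sqrt ((1 - (1 - 2 * t)\<^sup>2) * md i j + (1 - 2 * t)\<^sup>2))"

lemma edge_path_sq:
  assumes "t \<in> {0..1}"
  shows "(edge_path c i t $ j)\<^sup>2 = (1 - (1 - 2 * t)\<^sup>2) * md i j + (1 - 2 * t)\<^sup>2" (is "_ = ?a j")
    and "j \<noteq> i \<Longrightarrow> 0 < edge_path c i t $ j * sg (c j)"
proof -
  have s: "(1 - 2 * t)\<^sup>2 \<le> 1"
    using assms by (simp add: abs_square_le_1 abs_le_iff)
  then have nn: "?a j \<ge> 0" by simp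
  then show "(edge_path c i t $ j)\<^sup>2 = ?a j"
    by (simp add: edge_path_def power_mult_distrib)
  assume j: "j \<noteq> i"
  have "?a j > 0"
    using s md_pos[OF j] by (cases "(1 - 2 * t)\<^sup>2 = 0") (auto intro!: add_nonneg_pos)
  then show "0 < edge_path c i t $ j * sg (c j)"
    using j by (simp add: edge_path_def mult.assoc mult.commute)
qed

lemma edge_path_hexsurf: "t \<in> {0..1} \<Longrightarrow> edge_path c i t \<in> hexsurf"
proof -
  assume t: "t \<in> {0..1}"
  let ?s = "(1 - 2 * t)\<^sup>2"
  have s: "?s \<le> 1"
    using t by (simp add: abs_square_le_1 abs_le_iff)
  have "(1 - ?s) * md i j + ?s + ((1 - ?s) * md i (nx (nx j)) + ?s) = 1 + ((1 - ?s) * md i (nx j) + ?s)" for j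
  proof -
    have "(1 - ?s) * (md i j + md i (nx (nx j))) = (1 - ?s) * (1 + md i (nx j))"
      by (simp only: md_rec)
    then show ?thesis by (simp add: algebra_simps)
  qed
  then show ?thesis
    by (intro hexsurf_sqrtI[where a = "\<lambda>j. (1 - ?s) * md i j + ?s"])
       (use s in \<open>auto simp: edge_path_sq(1)[OF t]\<close>)
qed

lemma edge_path_image_chart:
  assumes "j = i \<or> j = nx i"
  shows "path_image (edge_path c j) \<subseteq> chart i c"
  using assms edge_path_hexsurf edge_path_sq(2) by (auto simp: path_image_def chart_def chart_nbhd_def)

lemma edge_path_image_hexsurf: "path_image (edge_path c i) \<subseteq> hexsurf"
  by (auto simp: path_image_def edge_path_hexsurf)

lemma path_edge_path [simp]: "path (edge_path c i)"
  unfolding path_def edge_path_def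
proof (rule continuous_on_vec_lambda)
  show "continuous_on {0..1} (\<lambda>t. if j = i then sg (c i) * (1 - 2 * t)
     else sg (c j) * sqrt ((1 - (1 - 2 * t)\<^sup>2) * md i j + (1 - 2 * t)\<^sup>2))" for j
    by (cases "j = i") (simp_all, auto intro!: continuous_intros)
qed

lemma edge_path_ends [simp]: "pathstart (edge_path c i) = tile_ctr c" "pathfinish (edge_path c i) = tile_ctr (flip c i)"
  unfolding Finite_Cartesian_Product.vec_eq_iff pathstart_def pathfinish_def
  by (auto simp: edge_path_def flip_apply)

fun word_path :: "(side \<Rightarrow> bool) \<Rightarrow> side list \<Rightarrow> real \<Rightarrow> real^side" where
  "word_path c [] = linepath (tile_ctr c) (tile_ctr c)"
| "word_path c (i # w) = edge_path c i +++ word_path (flip c i) w"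

lemma word_path_start [simp]: "pathstart (word_path c w) = tile_ctr c"
  by (cases w) auto

lemma word_path_finish [simp]: "pathfinish (word_path c w) = tile_ctr (run c w)"
  by (induction w arbitrary: c) auto

lemma path_word_path [simp]: "path (word_path c w)"
  by (induction w arbitrary: c) auto

lemma word_path_image_hexsurf: "path_image (word_path c w) \<subseteq> hexsurf"
  by (induction w arbitrary: c) (auto simp: path_image_join edge_path_image_hexsurf)

lemma word_path_image_chart: "set w \<subseteq> {i, nx i} \<Longrightarrow> path_image (word_path c w) \<subseteq> chart i c"
proof (induction w arbitrary: c)
  case (Cons j w)
  then have "j = i \<or> j = nx i" "path_image (word_path (flip c j) w) \<subseteq> chart i (flip c j)"
    by auto
  then show ?case
    using edge_path_image_chart[of j i c] by (auto simp: path_image_join)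
qed simp

lemma word_path_append: "homotopic_paths hexsurf (word_path c (u @ v)) (word_path c u +++ word_path (run c u) v)"
proof (induction u arbitrary: c)
  case Nil
  have "homotopic_paths hexsurf (linepath (tile_ctr c) (tile_ctr c) +++ word_path c v) (word_path c v)"
    by (rule homotopic_paths_lid') (simp_all add: word_path_image_hexsurf)
  then show ?case
    unfolding append_Nil run.simps word_path.simps(1) by (rule homotopic_paths_sym)
next
  case (Cons i u)
  have "homotopic_paths hexsurf (edge_path c i +++ word_path (flip c i) (u @ v))
      (edge_path c i +++ (word_path (flip c i) u +++ word_path (run (flip c i) u) v))"
    by (intro homotopic_paths_join Cons.IH) (simp_all add: edge_path_image_hexsurf)
  also have "homotopic_paths hexsurf \<dots> ((edge_path c i +++ word_path (flip c i) u) +++ word_path (run (flip c i) u) v)"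
    by (intro homotopic_paths_assoc) (simp_all add: edge_path_image_hexsurf word_path_image_hexsurf)
  finally show ?case by simp
qed

lemma word_path_homotopic_in_chart:
  assumes "set u \<subseteq> {i, nx i}" "set v \<subseteq> {i, nx i}" "run c u = run c v"
  shows "homotopic_paths hexsurf (word_path c u) (word_path c v)"
  by (rule homotopic_paths_chart[of _ _ i c]) (simp_all add: word_path_image_chart assms)

text \<open>Both sides of a defining relation run inside one contractible chart, where paths with
  common ends are homotopic.\<close>

lemma word_path_weq: "weq u v \<Longrightarrow> homotopic_paths hexsurf (word_path c u) (word_path c v)"
proof (induction arbitrary: c rule: weq.induct)
  case (refl w)
  then show ?case by (simp add: word_path_image_hexsurf)
next
  case (sym u v)
  show ?case by (rule homotopic_paths_sym[OF sym.IH])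
next
  case (trans u v w)
  show ?case by (rule homotopic_paths_trans[OF trans.IH])
next
  case (cancel i)
  show ?case
    by (rule word_path_homotopic_in_chart[of _ i]) (auto intro: weq_run[OF weq.cancel] simp del: run.simps)
next
  case (swap i)
  show ?case
    by (rule word_path_homotopic_in_chart[of _ i]) (auto intro: weq_run[OF weq.swap] simp del: run.simps)
next
  case (app u u' v v')
  have "homotopic_paths hexsurf (word_path c (u @ v)) (word_path c u +++ word_path (run c u) v)"
    by (rule word_path_append)
  also have "homotopic_paths hexsurf \<dots> (word_path c u' +++ word_path (run c u) v')"
    by (intro homotopic_paths_join app) simp
  also have "homotopic_paths hexsurf \<dots> (word_path c (u' @ v'))"
    using homotopic_paths_sym[OF word_path_append[of c u' v']] weq_run[OF app.hyps(1)] by simp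
  finally show ?case .
qed

text \<open>Arbitrary end points are connected to tile centres by \<open>tile_path\<close>, which
  makes the property compatible with concatenation.\<close>

definition has_word :: "(real \<Rightarrow> real^side) \<Rightarrow> bool" where
  "has_word p \<longleftrightarrow> path p \<and> path_image p \<subseteq> hexsurf \<and>
     (\<exists>w. run (sigma (pathstart p)) w = sigma (pathfinish p) \<and>
        homotopic_paths hexsurf (tile_path (pathstart p) +++ p) (word_path (sigma (pathstart p)) w +++ tile_path (pathfinish p)))"

lemma has_word_chart:
  assumes "path p" "path_image p \<subseteq> chart i c"
  shows "has_word p"
proof -
  have e: "pathstart p \<in> chart i c" "pathfinish p \<in> chart i c" "path_image p \<subseteq> hexsurf"
    using assms by (auto simp: chart_def)
  then have s: "pathstart p \<in> hexsurf" "pathfinish p \<in> hexsurf" by auto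
  let ?w = "dw (sigma (pathstart p)) (sigma (pathfinish p))"
  have "path_image (word_path (sigma (pathstart p)) ?w) \<subseteq> chart i c"
    using word_path_image_chart[OF set_dw_chart[OF e(1,2)], of "sigma (pathstart p)"] chart_sigma[OF e(1)] by simp
  then have "homotopic_paths hexsurf (tile_path (pathstart p) +++ p) (word_path (sigma (pathstart p)) ?w +++ tile_path (pathfinish p))"
    using assms s e tile_path_image_chart[OF e(1)] tile_path_image_chart[OF e(2)]
    by (intro homotopic_paths_chart[of _ _ i c]) (auto simp: path_image_join)
  then show ?thesis
    unfolding has_word_def using assms(1) e run_dw by blast
qed

lemma has_word_join:
  assumes "has_word p" "has_word q" "pathfinish p = pathstart q"
  shows "has_word (p +++ q)"
proof -
  obtain u v where p: "path p" "path_image p \<subseteq> hexsurf" and q: "path q" "path_image q \<subseteq> hexsurf"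
    and u: "run (sigma (pathstart p)) u = sigma (pathfinish p)"
     "homotopic_paths hexsurf (tile_path (pathstart p) +++ p) (word_path (sigma (pathstart p)) u +++ tile_path (pathfinish p))"
    and v: "run (sigma (pathstart q)) v = sigma (pathfinish q)"
     "homotopic_paths hexsurf (tile_path (pathstart q) +++ q) (word_path (sigma (pathstart q)) v +++ tile_path (pathfinish q))"
    using assms unfolding has_word_def by blast
  have s: "pathstart p \<in> hexsurf" "pathfinish p \<in> hexsurf" "pathstart q \<in> hexsurf" "pathfinish q \<in> hexsurf"
    using p q by auto
  note [simp] = s p q tile_path_image_hexsurf word_path_image_hexsurf assms(3) path_image_join
  let ?c = "sigma (pathstart p)"
  have "homotopic_paths hexsurf (tile_path (pathstart p) +++ (p +++ q)) ((tile_path (pathstart p) +++ p) +++ q)"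
    by (intro homotopic_paths_assoc) simp_all
  also have "homotopic_paths hexsurf \<dots> ((word_path ?c u +++ tile_path (pathfinish p)) +++ q)"
    by (intro homotopic_paths_join u) simp_all
  also have "homotopic_paths hexsurf \<dots> (word_path ?c u +++ (tile_path (pathstart q) +++ q))"
    using u(1) homotopic_paths_sym[OF homotopic_paths_assoc[of "word_path ?c u" hexsurf "tile_path (pathstart q)" q]]
    by simp
  also have "homotopic_paths hexsurf \<dots> (word_path ?c u +++ (word_path (sigma (pathstart q)) v +++ tile_path (pathfinish q)))"
    using u(1) by (intro homotopic_paths_join v) simp_all
  also have "homotopic_paths hexsurf \<dots> ((word_path ?c u +++ word_path (sigma (pathstart q)) v) +++ tile_path (pathfinish q))"
    using u(1) v(1) by (intro homotopic_paths_assoc) simp_all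
  also have "homotopic_paths hexsurf \<dots> (word_path ?c (u @ v) +++ tile_path (pathfinish q))"
    using u(1) v(1) homotopic_paths_sym[OF word_path_append[of ?c u v]]
    by (intro homotopic_paths_join) simp_all
  finally have "homotopic_paths hexsurf (tile_path (pathstart p) +++ (p +++ q)) (word_path ?c (u @ v) +++ tile_path (pathfinish q))" .
  moreover have "run ?c (u @ v) = sigma (pathfinish q)"
    using u(1) v(1) by (simp add: run_append)
  ultimately show ?thesis
    unfolding has_word_def by (intro conjI exI[of _ "u @ v"]) simp_all
qed

lemma has_word_homotopic:
  assumes "has_word p" "homotopic_paths hexsurf p q"
  shows "has_word q"
proof -
  have q: "path q" "path_image q \<subseteq> hexsurf" "pathstart q = pathstart p" "pathfinish q = pathfinish p"
    using assms(2) homotopic_paths_imp_path homotopic_paths_imp_subset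
      homotopic_paths_imp_pathstart homotopic_paths_imp_pathfinish by metis+
  have s: "pathstart p \<in> hexsurf"
    using assms(1) unfolding has_word_def by auto
  have "homotopic_paths hexsurf (tile_path (pathstart p) +++ q) (tile_path (pathstart p) +++ p)"
    using s q by (intro homotopic_paths_join homotopic_paths_sym[OF assms(2)]) (simp_all add: tile_path_image_hexsurf)
  then show ?thesis
    using assms(1) q unfolding has_word_def by (metis homotopic_paths_trans)
qed

text \<open>A Lebesgue number for the cover by charts.\<close>

lemma leb_hexsurf: "\<exists>e>0. \<forall>x\<in>hexsurf. \<exists>i c. ball x e \<inter> hexsurf \<subseteq> chart i c"
proof -
  have "hexsurf \<subseteq> \<Union>(range (\<lambda>(i, c). chart_nbhd i c))"
  proof
    fix x assume "x \<in> hexsurf"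
    then obtain i where "x \<in> chart i (sigma x)" by (rule ex_chart)
    then have "x \<in> (\<lambda>(i, c). chart_nbhd i c) (i, sigma x)" by (simp add: chart_def)
    then show "x \<in> \<Union>(range (\<lambda>(i, c). chart_nbhd i c))" by blast
  qed
  then obtain e where e: "e > 0" "\<And>x. x \<in> hexsurf \<Longrightarrow> \<exists>G \<in> range (\<lambda>(i, c). chart_nbhd i c). ball x e \<subseteq> G"
    by (rule Heine_Borel_lemma[OF compact_hexsurf]) (use open_chart_nbhd in auto)
  have "\<exists>i c. ball x e \<inter> hexsurf \<subseteq> chart i c" if "x \<in> hexsurf" for x
    using e(2)[OF that] by (auto simp: chart_def)
  then show ?thesis using e(1) by blast
qed

text \<open>The bisection principle \<open>Bolzano\<close> takes the place of an explicit
  subdivision: short subpaths stay in a chart, and adjacent subpaths are joined.\<close>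

lemma has_word_path:
  assumes p: "path p" "path_image p \<subseteq> hexsurf"
  shows "has_word p"
proof -
  obtain e where e: "e > 0" "\<And>x. x \<in> hexsurf \<Longrightarrow> \<exists>i c. ball x e \<inter> hexsurf \<subseteq> chart i c"
    using leb_hexsurf by blast
  have "uniformly_continuous_on {0..1} p"
    using p(1) by (simp add: path_def compact_uniformly_continuous)
  then obtain d where d: "d > 0" "\<And>s t. s \<in> {0..1} \<Longrightarrow> t \<in> {0..1} \<Longrightarrow> dist s t < d \<Longrightarrow> dist (p s) (p t) < e"
    unfolding uniformly_continuous_on_def using e(1) by (metis dist_commute)
  define P where "P a b \<longleftrightarrow> (0 \<le> a \<longrightarrow> a \<le> b \<longrightarrow> b \<le> 1 \<longrightarrow> has_word (subpath a b p))" for a b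
  have "P 0 1"
  proof (rule Bolzano)
    fix a b c :: real assume P: "P a b" "P b c" "a \<le> b" "b \<le> c"
    show "P a c" unfolding P_def
    proof (intro impI)
      assume "0 \<le> a" "a \<le> c" "c \<le> 1"
      then have "has_word (subpath a b p +++ subpath b c p)"
        using P by (intro has_word_join) (auto simp: P_def pathstart_def pathfinish_def subpath_def)
      moreover have "homotopic_paths hexsurf (subpath a b p +++ subpath b c p) (subpath a c p)"
        using \<open>0 \<le> a\<close> \<open>c \<le> 1\<close> P by (intro homotopic_join_subpaths p) auto
      ultimately show "has_word (subpath a c p)"
        by (rule has_word_homotopic)
    qed
  next
    fix x :: real assume "0 \<le> x" "x \<le> 1"
    have "P a b" if ab: "a \<le> x" "x \<le> b" "b - a < d" for a b
      unfolding P_def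
    proof (intro impI)
      assume *: "0 \<le> a" "a \<le> b" "b \<le> 1"
      have "p a \<in> hexsurf" using p(2) * by (auto simp: path_image_def)
      then obtain i c where ic: "ball (p a) e \<inter> hexsurf \<subseteq> chart i c" using e(2) by blast
      have "path_image (subpath a b p) \<subseteq> chart i c"
      proof -
        have "p t \<in> ball (p a) e \<inter> hexsurf" if "t \<in> {a..b}" for t
          using d(2)[of a t] that ab * p(2) by (auto simp: dist_real_def path_image_def)
        then show ?thesis using ic * by (auto simp: path_image_subpath)
      qed
      moreover have "path (subpath a b p)"
        using * p(1) by (intro path_subpath) auto
      ultimately show "has_word (subpath a b p)"
        using has_word_chart by blast
    qed
    then show "\<exists>d>0. \<forall>a b. a \<le> x \<and> x \<le> b \<and> b - a < d \<longrightarrow> P a b"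
      using d(1) by blast
  qed simp
  then show ?thesis by (simp add: P_def)
qed

lemma path_homotopic_word_path:
  assumes "path p" "path_image p \<subseteq> hexsurf" "pathstart p = tile_ctr c" "pathfinish p = tile_ctr c'"
  obtains w where "run c w = c'" "homotopic_paths hexsurf p (word_path c w)"
proof -
  obtain w where w: "run c w = c'" "homotopic_paths hexsurf (tile_path (tile_ctr c) +++ p) (word_path c w +++ tile_path (tile_ctr c'))"
    using has_word_path[OF assms(1,2)] assms(3,4) unfolding has_word_def by auto
  have tile_path: "homotopic_paths hexsurf (tile_path (tile_ctr a)) (linepath (tile_ctr a) (tile_ctr a))" for a
    using tile_path_image_chart[OF tile_ctr_chart[of a S0]]
    by (intro homotopic_paths_chart[of _ _ S0 a]) auto
  have "homotopic_paths hexsurf p (linepath (tile_ctr c) (tile_ctr c) +++ p)"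
    using assms by (intro homotopic_paths_sym[OF homotopic_paths_lid']) auto
  also have "homotopic_paths hexsurf \<dots> (tile_path (tile_ctr c) +++ p)"
    using assms by (intro homotopic_paths_join homotopic_paths_sym[OF tile_path]) auto
  also note w(2)
  also have "homotopic_paths hexsurf (word_path c w +++ tile_path (tile_ctr c')) (word_path c w +++ linepath (tile_ctr c') (tile_ctr c'))"
    using w(1) by (intro homotopic_paths_join tile_path) (auto simp: word_path_image_hexsurf)
  also have "homotopic_paths hexsurf \<dots> (word_path c w)"
    using w(1) by (intro homotopic_paths_rid') (auto simp: word_path_image_hexsurf)
  finally show thesis using that w(1) by blast
qed

text \<open>A holonomy-free description of the homotopy class of a path: a development assigns to each time
  a word recording the tiles crossed so far.\<close>

definition development :: "(real \<Rightarrow> real^side) \<Rightarrow> (real \<Rightarrow> side list) \<Rightarrow> bool" where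
  "development p g \<longleftrightarrow> (\<exists>d>0. \<forall>s\<in>{0..1}. \<forall>t\<in>{0..1}. \<bar>s - t\<bar> < d \<longrightarrow>
     weq (g t) (g s @ dw (sigma (p s)) (sigma (p t))))"

text \<open>The analogue of the uniqueness of lifts: over short intervals both developments change
  by the same word.\<close>

lemma development_unique:
  assumes "development p g" "development p g'" "weq (g 0) (g' 0)"
  shows "weq (g 1) (g' 1)"
proof -
  obtain d d' where d: "d > 0" "d' > 0"
    "\<And>s t. s \<in> {0..1} \<Longrightarrow> t \<in> {0..1} \<Longrightarrow> \<bar>s - t\<bar> < d \<Longrightarrow> weq (g t) (g s @ dw (sigma (p s)) (sigma (p t)))"
    "\<And>s t. s \<in> {0..1} \<Longrightarrow> t \<in> {0..1} \<Longrightarrow> \<bar>s - t\<bar> < d' \<Longrightarrow> weq (g' t) (g' s @ dw (sigma (p s)) (sigma (p t)))"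
    using assms(1,2) unfolding development_def by blast
  define P where "P a b \<longleftrightarrow> (0 \<le> a \<longrightarrow> a \<le> b \<longrightarrow> b \<le> 1 \<longrightarrow> weq (g a) (g' a) \<longrightarrow> weq (g b) (g' b))" for a b
  have "P 0 1"
  proof (rule Bolzano)
    fix x :: real assume "0 \<le> x" "x \<le> 1"
    have "P a b" if "a \<le> x" "x \<le> b" "b - a < min d d'" for a b
      unfolding P_def
    proof (intro impI)
      assume *: "0 \<le> a" "a \<le> b" "b \<le> 1" "weq (g a) (g' a)"
      have "weq (g b) (g a @ dw (sigma (p a)) (sigma (p b)))"
        using * that by (intro d) auto
      also have "weq \<dots> (g' a @ dw (sigma (p a)) (sigma (p b)))"
        by (intro weq.app * weq.refl)
      also have "weq \<dots> (g' b)"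
        using * that by (intro weq.sym[OF d(4)]) auto
      finally show "weq (g b) (g' b)" .
    qed
    then show "\<exists>d>0. \<forall>a b. a \<le> x \<and> x \<le> b \<and> b - a < d \<longrightarrow> P a b"
      using d(1,2) by (intro exI[of _ "min d d'"]) auto
  qed (auto simp: P_def)
  then show ?thesis using assms(3) by (simp add: P_def)
qed

lemma development_chart:
  assumes "path_image p \<subseteq> chart i c"
  shows "development p (\<lambda>t. dw (sigma (p 0)) (sigma (p t)))"
proof -
  have "p t \<in> chart i c" if "t \<in> {0..1}" for t
    using assms that by (auto simp: path_image_def)
  then show ?thesis
    unfolding development_def by (intro exI[of _ 1]) (auto intro!: weq.sym[OF dw_cocycle[of _ i c]])
qed

lemma path_local_chart:
  assumes p: "path p" "path_image p \<subseteq> hexsurf"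
  shows "\<exists>d>0. \<forall>s\<in>{0..1}. \<exists>i c. \<forall>t\<in>{0..1}. \<bar>s - t\<bar> < d \<longrightarrow> p t \<in> chart i c"
proof -
  obtain e where e: "e > 0" "\<And>x. x \<in> hexsurf \<Longrightarrow> \<exists>i c. ball x e \<inter> hexsurf \<subseteq> chart i c"
    using leb_hexsurf by blast
  have "uniformly_continuous_on {0..1} p"
    using p(1) by (simp add: path_def compact_uniformly_continuous)
  then obtain d where d: "d > 0" "\<And>s t. s \<in> {0..1} \<Longrightarrow> t \<in> {0..1} \<Longrightarrow> dist s t < d \<Longrightarrow> dist (p s) (p t) < e"
    unfolding uniformly_continuous_on_def using e(1) by (metis dist_commute)
  have "\<exists>i c. \<forall>t\<in>{0..1}. \<bar>s - t\<bar> < d \<longrightarrow> p t \<in> chart i c" if s: "s \<in> {0..1}" for s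
  proof -
    have "p s \<in> hexsurf" using p(2) s by (auto simp: path_image_def)
    then obtain i c where "ball (p s) e \<inter> hexsurf \<subseteq> chart i c" using e(2) by blast
    moreover have "p t \<in> hexsurf" if "t \<in> {0..1}" for t
      using p(2) that by (auto simp: path_image_def)
    ultimately show ?thesis
      using d(2)[OF s] by (intro exI[of _ i] exI[of _ c]) (auto simp: dist_real_def)
  qed
  then show ?thesis using d(1) by blast
qed

lemma development_join:
  assumes p: "path p" "path_image p \<subseteq> hexsurf" "development p g"
    and q: "path q" "path_image q \<subseteq> hexsurf" "development q h"
    and pq: "pathfinish p = pathstart q" "weq (h 0) []"
  shows "development (p +++ q) (\<lambda>t. if t \<le> 1/2 then g (2 * t) else g 1 @ h (2 * t - 1))"
proof -
  have r: "path (p +++ q)" "path_image (p +++ q) \<subseteq> hexsurf"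
    using p q pq by (auto simp: path_image_join)
  obtain e where e: "e > 0" "\<And>s. s \<in> {0..1} \<Longrightarrow> \<exists>i c. \<forall>t\<in>{0..1}. \<bar>s - t\<bar> < e \<longrightarrow> (p +++ q) t \<in> chart i c"
    using path_local_chart[OF r] by blast
  obtain d d' where d: "d > 0" "d' > 0"
    "\<And>s t. s \<in> {0..1} \<Longrightarrow> t \<in> {0..1} \<Longrightarrow> \<bar>s - t\<bar> < d \<Longrightarrow> weq (g t) (g s @ dw (sigma (p s)) (sigma (p t)))"
    "\<And>s t. s \<in> {0..1} \<Longrightarrow> t \<in> {0..1} \<Longrightarrow> \<bar>s - t\<bar> < d' \<Longrightarrow> weq (h t) (h s @ dw (sigma (q s)) (sigma (q t)))"
    using p(3) q(3) unfolding development_def by blast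
  let ?f = "\<lambda>t. if t \<le> 1/2 then g (2 * t) else g 1 @ h (2 * t - 1)"
  let ?r = "p +++ q"
  define D where "D = min e (min (d/2) (d'/2))"
  have mid: "?r (1/2) = p 1" "?r (1/2) = q 0"
    using pq(1) by (auto simp: joinpaths_def pathfinish_def pathstart_def)
  have lt: "weq (?f t) (?f s @ dw (sigma (?r s)) (sigma (?r t)))"
    if st: "s \<in> {0..1}" "t \<in> {0..1}" "\<bar>s - t\<bar> < D" and st': "s \<le> 1/2" "1/2 < t" for s t
  proof -
    obtain i c where ic: "\<And>t. t \<in> {0..1} \<Longrightarrow> \<bar>s - t\<bar> < e \<Longrightarrow> ?r t \<in> chart i c"
      using e(2)[OF st(1)] by blast
    have "weq (?f t) (g 1 @ (h 0 @ dw (sigma (q 0)) (sigma (q (2 * t - 1)))))"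
    proof -
      have "weq (h (2 * t - 1)) (h 0 @ dw (sigma (q 0)) (sigma (q (2 * t - 1))))"
        using st st' by (intro d(4)) (auto simp: D_def)
      then show ?thesis
        using st' by (simp add: weq.app)
    qed
    also have "weq \<dots> (g 1 @ ([] @ dw (sigma (q 0)) (sigma (q (2 * t - 1)))))"
      by (intro weq.app pq(2) weq.refl)
    also have "weq \<dots> ((g (2 * s) @ dw (sigma (p (2 * s))) (sigma (p 1))) @ dw (sigma (q 0)) (sigma (q (2 * t - 1))))"
    proof -
      have "weq (g 1) (g (2 * s) @ dw (sigma (p (2 * s))) (sigma (p 1)))"
        using st st' by (intro d(3)) (auto simp: D_def)
      from weq.app[OF this weq.refl] show ?thesis
        unfolding append_Nil .
    qed
    also have "\<dots> = ?f s @ (dw (sigma (?r s)) (sigma (?r (1/2))) @ dw (sigma (?r (1/2))) (sigma (?r t)))"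
      using st' mid by (simp add: joinpaths_def)
    also have "weq \<dots> (?f s @ dw (sigma (?r s)) (sigma (?r t)))"
      using st st' by (intro weq.app[OF weq.refl dw_cocycle[of _ i c]] ic) (auto simp: D_def)
    finally show ?thesis .
  qed
  have "weq (?f t) (?f s @ dw (sigma (?r s)) (sigma (?r t)))"
    if st: "s \<in> {0..1}" "t \<in> {0..1}" "\<bar>s - t\<bar> < D" for s t
  proof -
    have eq: "\<bar>2 * s - 2 * t\<bar> = 2 * \<bar>s - t\<bar>" by (simp add: abs_if)
    consider "s \<le> 1/2" "t \<le> 1/2" | "s > 1/2" "t > 1/2" | "s \<le> 1/2" "1/2 < t" | "t \<le> 1/2" "1/2 < s"
      by linarith
    then show ?thesis
    proof cases
      case 1
      then show ?thesis
        using st eq d(3)[of "2 * s" "2 * t"] by (auto simp: joinpaths_def D_def)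
    next
      case 2
      then have "weq (h (2 * t - 1)) (h (2 * s - 1) @ dw (sigma (q (2 * s - 1))) (sigma (q (2 * t - 1))))"
        using st eq by (intro d(4)) (auto simp: D_def)
      then show ?thesis
        using 2 by (simp add: joinpaths_def weq.app)
    next
      case 3
      then show ?thesis using lt st by blast
    next
      case 4
      then have "weq (?f s) (?f t @ dw (sigma (?r t)) (sigma (?r s)))"
        using lt[of t s] st by (simp add: abs_minus_commute)
      then have "weq (?f s @ dw (sigma (?r s)) (sigma (?r t)))
         ((?f t @ dw (sigma (?r t)) (sigma (?r s))) @ dw (sigma (?r s)) (sigma (?r t)))"
        by (intro weq.app weq.refl)
      also have "\<dots> = ?f t @ (dw (sigma (?r t)) (sigma (?r s)) @ dw (sigma (?r s)) (sigma (?r t)))"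
        by simp
      \<comment> \<open>Within a common chart the passages from \<open>t\<close> to \<open>s\<close>
        and back cancel, which reduces this case to the preceding one.\<close>
      also have "weq \<dots> (?f t @ [])"
      proof -
        obtain i c where ic: "\<And>t. t \<in> {0..1} \<Longrightarrow> \<bar>s - t\<bar> < e \<Longrightarrow> ?r t \<in> chart i c"
          using e(2)[OF st(1)] by blast
        have "?r s \<in> chart i c" "?r t \<in> chart i c"
          using st e(1) by (auto intro!: ic simp: D_def)
        then have "weq (dw (sigma (?r t)) (sigma (?r s)) @ dw (sigma (?r s)) (sigma (?r t))) []"
          using dw_cocycle[of "?r t" i c "?r s" "?r t"] by simp
        then show ?thesis by (intro weq.app weq.refl)
      qed
      finally show ?thesis by (simp add: weq.sym)
    qed
  qed
  moreover have "D > 0" using e d by (simp add: D_def)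
  ultimately show ?thesis unfolding development_def by blast
qed

text \<open>The development of a word path recovers the word, since the passage between the centres
  of two tiles sharing side \<open>i\<close> is recorded as \<open>[i]\<close>.\<close>

lemma development_word_path: "\<exists>g. development (word_path c w) g \<and> weq (g 0) [] \<and> weq (g 1) w"
proof (induction w arbitrary: c)
  case Nil
  have "development (word_path c []) (\<lambda>t. dw (sigma (word_path c [] 0)) (sigma (word_path c [] t)))"
    by (rule development_chart[of _ S0 c]) simp
  then show ?case by (intro exI conjI) (auto simp: linepath_def)
next
  case (Cons i w)
  let ?g = "\<lambda>t. dw (sigma (edge_path c i 0)) (sigma (edge_path c i t))"
  obtain h where h: "development (word_path (flip c i) w) h" "weq (h 0) []" "weq (h 1) w"
    using Cons by blast
  have "edge_path c i 0 = tile_ctr c" "edge_path c i 1 = tile_ctr (flip c i)"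
    using edge_path_ends[of c i] by (simp_all add: pathstart_def pathfinish_def)
  moreover have "dw c (flip c i) = [i]"
    by (cases i) (auto simp: dw_def flip_apply)
  ultimately have g: "?g 0 = []" "?g 1 = [i]" by simp_all
  let ?f = "\<lambda>t. if t \<le> 1/2 then ?g (2 * t) else ?g 1 @ h (2 * t - 1)"
  have "development (word_path c (i # w)) ?f"
    unfolding word_path.simps
    by (rule development_join[OF _ _ development_chart[of _ i c] _ _ h(1)])
       (simp_all add: edge_path_image_hexsurf word_path_image_hexsurf h(2) edge_path_image_chart)
  moreover have "weq (?f 0) []" using g by simp
  moreover have "weq (?f 1) (i # w)" using weq_Cons[OF h(3), of i] g by simp
  ultimately show ?case by (intro exI[of _ ?f] conjI)
qed

lemma development_cong:
  assumes "\<And>t. t \<in> {0..1} \<Longrightarrow> p t = q t" "development p k"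
  shows "development q k"
proof -
  obtain d where d: "d > 0" "\<And>s t. s \<in> {0..1} \<Longrightarrow> t \<in> {0..1} \<Longrightarrow> \<bar>s - t\<bar> < d \<Longrightarrow> weq (k t) (k s @ dw (sigma (p s)) (sigma (p t)))"
    using assms(2) unfolding development_def by blast
  have "weq (k t) (k s @ dw (sigma (q s)) (sigma (q t)))"
    if "s \<in> {0..1}" "t \<in> {0..1}" "\<bar>s - t\<bar> < d" for s t
    using d(2)[OF that] unfolding assms(1)[OF that(1)] assms(1)[OF that(2)] .
  then show ?thesis
    unfolding development_def using d(1) by blast
qed

text \<open>The monodromy argument: a development is carried along the homotopy by appending, at
  each time, the passage from one stage to the next. As the end points do not move, nothing is
  appended there.\<close>

lemma development_homotopic:
  assumes "homotopic_paths hexsurf p q" "development p g"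
  obtains g' where "development q g'" "weq (g' 0) (g 0)" "weq (g' 1) (g 1)"
proof -
  obtain h :: "real \<times> real \<Rightarrow> real^side" where h0: "continuous_on ({0..1} \<times> {0..1}) h"
    "h \<in> {0..1} \<times> {0..1} \<rightarrow> hexsurf" "\<forall>t\<in>{0..1}. h (0, t) = p t" "\<forall>t\<in>{0..1}. h (1, t) = q t"
    "\<forall>t\<in>{0..1}. pathstart (h \<circ> Pair t) = pathstart p \<and> pathfinish (h \<circ> Pair t) = pathfinish p"
    using assms(1) unfolding homotopic_paths by blast
  have h: "continuous_on ({0..1} \<times> {0..1}) h" "h ` ({0..1} \<times> {0..1}) \<subseteq> hexsurf"
    "\<And>t. t \<in> {0..1} \<Longrightarrow> h (0, t) = p t" "\<And>t. t \<in> {0..1} \<Longrightarrow> h (1, t) = q t"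
    "\<And>s. s \<in> {0..1} \<Longrightarrow> h (s, 0) = p 0" "\<And>s. s \<in> {0..1} \<Longrightarrow> h (s, 1) = p 1"
    using h0 by (auto simp: pathstart_def pathfinish_def)
  obtain e where e: "e > 0" "\<And>x. x \<in> hexsurf \<Longrightarrow> \<exists>i c. ball x e \<inter> hexsurf \<subseteq> chart i c"
    using leb_hexsurf by blast
  have "uniformly_continuous_on ({0..1} \<times> {0..1}) h"
    using h(1) by (intro compact_uniformly_continuous compact_Times) auto
  then obtain d where d: "d > 0" "\<And>y z. y \<in> {0..1} \<times> {0..1} \<Longrightarrow> z \<in> {0..1} \<times> {0..1} \<Longrightarrow> dist y z < d \<Longrightarrow> dist (h y) (h z) < e"
    unfolding uniformly_continuous_on_def using e(1) by (metis dist_commute)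
  have loc: "\<exists>i c. \<forall>s'\<in>{0..1}. \<forall>t'\<in>{0..1}. \<bar>s - s'\<bar> < d/2 \<longrightarrow> \<bar>t - t'\<bar> < d/2 \<longrightarrow> h (s', t') \<in> chart i c"
    if st: "s \<in> {0..1}" "t \<in> {0..1}" for s t
  proof -
    have "h (s, t) \<in> hexsurf" using h(2) st by blast
    then obtain i c where ic: "ball (h (s, t)) e \<inter> hexsurf \<subseteq> chart i c" using e(2) by blast
    have "h (s', t') \<in> chart i c" if "s' \<in> {0..1}" "t' \<in> {0..1}" "\<bar>s - s'\<bar> < d/2" "\<bar>t - t'\<bar> < d/2" for s' t'
    proof -
      have "dist (s, t) (s', t') \<le> \<bar>s - s'\<bar> + \<bar>t - t'\<bar>"
        by (simp add: dist_prod_def dist_real_def sqrt_sum_squares_le_sum_abs)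
      also have "\<dots> < d" using that by linarith
      finally have "dist (h (s, t)) (h (s', t')) < e"
        using that st by (intro d(2)) auto
      moreover have "h (s', t') \<in> hexsurf" using h(2) that by blast
      ultimately show ?thesis using ic by auto
    qed
    then show ?thesis by blast
  qed
  define A where "A s \<longleftrightarrow> (\<exists>g'. development (\<lambda>t. h (s, t)) g' \<and> weq (g' 0) (g 0) \<and> weq (g' 1) (g 1))" for s
  define P where "P a b \<longleftrightarrow> (0 \<le> a \<longrightarrow> a \<le> b \<longrightarrow> b \<le> 1 \<longrightarrow> A a \<longrightarrow> A b)" for a b
  have "P 0 1"
  proof (rule Bolzano)
    fix x :: real assume "0 \<le> x" "x \<le> 1"
    have "P a b" if ab: "a \<le> x" "x \<le> b" "b - a < d/2" for a b
      unfolding P_def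
    proof (intro impI)
      assume *: "0 \<le> a" "a \<le> b" "b \<le> 1" "A a"
      from *(4) obtain g' where g': "development (\<lambda>t. h (a, t)) g'" "weq (g' 0) (g 0)" "weq (g' 1) (g 1)"
        unfolding A_def by blast
      then obtain d' where d': "d' > 0" "\<And>s t. s \<in> {0..1} \<Longrightarrow> t \<in> {0..1} \<Longrightarrow> \<bar>s - t\<bar> < d' \<Longrightarrow>
          weq (g' t) (g' s @ dw (sigma (h (a, s))) (sigma (h (a, t))))"
        unfolding development_def by blast
      define k where "k t = g' t @ dw (sigma (h (a, t))) (sigma (h (b, t)))" for t
      have "weq (k t) (k s @ dw (sigma (h (b, s))) (sigma (h (b, t))))"
        if st: "s \<in> {0..1}" "t \<in> {0..1}" "\<bar>s - t\<bar> < min d' (d/2)" for s t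
      proof -
        obtain i c where ic: "\<And>s' t'. s' \<in> {0..1} \<Longrightarrow> t' \<in> {0..1} \<Longrightarrow> \<bar>a - s'\<bar> < d/2 \<Longrightarrow> \<bar>s - t'\<bar> < d/2 \<Longrightarrow> h (s', t') \<in> chart i c"
        proof -
          have "a \<in> {0..1}" using * by simp
          from loc[OF this st(1)] obtain i c where
            "\<forall>s'\<in>{0..1}. \<forall>t'\<in>{0..1}. \<bar>a - s'\<bar> < d/2 \<longrightarrow> \<bar>s - t'\<bar> < d/2 \<longrightarrow> h (s', t') \<in> chart i c"
            by blast
          then show thesis by (intro that[of i c]) blast
        qed
        have m: "h (a, s) \<in> chart i c" "h (a, t) \<in> chart i c" "h (b, s) \<in> chart i c" "h (b, t) \<in> chart i c"
          using * ab st d(1) by (auto intro!: ic)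
        let ?D = "\<lambda>s t s' t'. dw (sigma (h (s, t))) (sigma (h (s', t')))"
        have "weq (k t) ((g' s @ ?D a s a t) @ ?D a t b t)"
          unfolding k_def using st by (intro weq.app weq.refl d') auto
        also have "\<dots> = g' s @ (?D a s a t @ ?D a t b t)" by simp
        also have "weq \<dots> (g' s @ ?D a s b t)"
          using m by (intro weq.app[OF weq.refl dw_cocycle])
        also have "weq \<dots> (g' s @ (?D a s b s @ ?D b s b t))"
          using m by (intro weq.app[OF weq.refl weq.sym[OF dw_cocycle]])
        finally show ?thesis by (simp add: k_def)
      qed
      then have "development (\<lambda>t. h (b, t)) k"
        unfolding development_def using d(1) d'(1) by (intro exI[of _ "min d' (d/2)"]) auto
      moreover have "k 0 = g' 0" "k 1 = g' 1"
        using h(5,6) * by (simp_all add: k_def)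
      ultimately show "A b"
        unfolding A_def using g'(2,3) by (intro exI[of _ k]) simp
    qed
    then show "\<exists>d>0. \<forall>a b. a \<le> x \<and> x \<le> b \<and> b - a < d \<longrightarrow> P a b"
      using d(1) by (intro exI[of _ "d/2"]) auto
  qed (auto simp: P_def)
  then have P01: "A 0 \<Longrightarrow> A 1"
    unfolding P_def by simp
  have "development (\<lambda>t. h (0, t)) g"
    using h(3)[symmetric] assms(2) by (rule development_cong)
  then have "A 0"
    unfolding A_def by (intro exI[of _ g] conjI weq.refl)
  then have "A 1" by (rule P01)
  then obtain g' where g': "development (\<lambda>t. h (1, t)) g'" "weq (g' 0) (g 0)" "weq (g' 1) (g 1)"
    unfolding A_def by blast
  have "development q g'"
    using h(4) g'(1) by (rule development_cong)
  show thesis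
    by (rule that[OF \<open>development q g'\<close> g'(2,3)])
qed

text \<open>The development of \<open>word_path c u\<close>, carried over to
  \<open>word_path c v\<close>, still ends in \<open>u\<close>, while the direct development of the
  latter ends in \<open>v\<close>.\<close>

lemma homotopic_word_path_imp_weq:
  assumes "homotopic_paths hexsurf (word_path c u) (word_path c v)"
  shows "weq u v"
proof -
  from development_word_path[of c u]
  obtain g where g: "development (word_path c u) g" "weq (g 0) []" "weq (g 1) u"
    by blast
  obtain g' where g': "development (word_path c v) g'" "weq (g' 0) (g 0)" "weq (g' 1) (g 1)"
    by (rule development_homotopic[OF assms g(1)])
  from development_word_path[of c v]
  obtain k where k: "development (word_path c v) k" "weq (k 0) []" "weq (k 1) v"
    by blast
  have "weq (g' 0) (k 0)"
    by (rule weq.trans[OF weq.trans[OF g'(2) g(2)] weq.sym[OF k(2)]])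
  then have "weq (g' 1) (k 1)"
    by (rule development_unique[OF g'(1) k(1)])
  show "weq u v"
    by (rule weq.trans[OF weq.trans[OF weq.sym[OF g(3)] weq.sym[OF g'(3)]]
          weq.trans[OF \<open>weq (g' 1) (k 1)\<close> k(3)]])
qed

section \<open>Local orientations from planar charts\<close>

abbreviation "Cx \<equiv> (euclidean :: complex topology)"

lemma punctured_plane_equiv: "(-{0::complex}) homotopy_eqv (sphere (0::complex) 1)"
proof -
  have id: "homotopic_with_canon (\<lambda>x. True) (-{0::complex}) (-{0}) (id \<circ> sgn) id"
  proof (rule homotopic_with_linear)
    show "continuous_on (-{0::complex}) (id \<circ> sgn)" by (simp add: continuous_on_sgn continuous_on_id)
    fix x :: complex assume x: "x \<in> -{0}"
    show "closed_segment ((id \<circ> sgn) x) (id x) \<subseteq> -{0}"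
    proof
      fix y assume "y \<in> closed_segment ((id \<circ> sgn) x) (id x)"
      then obtain u where u: "0 \<le> u" "u \<le> 1" "y = (1 - u) *\<^sub>R sgn x + u *\<^sub>R x"
        by (auto simp: closed_segment_def)
      have "y = ((1 - u) / norm x + u) *\<^sub>R x"
        using u(3) by (simp add: sgn_div_norm algebra_simps divide_inverse)
      moreover have "(1 - u) / norm x + u > 0"
        using u x by (cases "u = 1") (auto intro!: add_pos_nonneg divide_pos_pos)
      ultimately show "y \<in> -{0}" using x by auto
    qed
  qed (auto simp: id_def)
  have "homotopic_with_canon (\<lambda>x. True) (sphere (0::complex) 1) (sphere 0 1) (sgn \<circ> id) id"
    by (rule homotopic_with_equal) (auto simp: sgn_div_norm intro!: continuous_intros)
  then show ?thesis
    using id unfolding homotopy_equivalent_space_def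
    by (intro exI[of _ sgn] exI[of _ id]) (auto simp: continuous_on_sgn norm_sgn continuous_on_id)
qed

lemma nsphere_1: "nsphere 1 homeomorphic_space top_of_set (sphere (0::complex) 1)"
proof -
    obtain f g where "homeomorphic_maps (nsphere (2 - Suc 0)) (top_of_set (sphere (0::complex) 1 \<inter> span Basis)) f g"
      using homeomorphic_maps_nsphere_euclidean_sphere[of "Basis :: complex set" 2, OF independent_Basis orthogonal_Basis DIM_complex _ norm_Basis]
      by auto
    then show "nsphere 1 homeomorphic_space top_of_set (sphere (0::complex) 1)"
      by (auto simp: homeomorphic_space_def)
qed

abbreviation "G2 \<equiv> relative_homology_group 2 Cx (-{0})"

text \<open>The plane is contractible, so its homology relative to the punctured plane is the
  reduced homology of the circle in one degree less.\<close>

lemma cyclic_G2: "cyclic_group G2"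
proof -
  have "G2 \<cong> reduced_homology_group 1 (subtopology Cx (-{0}))"
  proof -
    have "contractible (UNIV :: complex set)" by (rule convex_imp_contractible) simp
    then have "contractible_space Cx" using contractible_space_top_of_set[of "UNIV :: complex set"] by simp
    moreover have "topspace Cx \<inter> (-{0}) \<noteq> {}" using one_neq_zero by auto
    ultimately show ?thesis
      using isomorphic_group_relative_homology_of_contractible[of Cx "-{0}" 2] by simp
  qed
  also have "\<dots> \<cong> reduced_homology_group 1 (top_of_set (sphere (0::complex) 1))"
    using homotopy_equivalent_space_imp_isomorphic_reduced_homology_groups punctured_plane_equiv by blast
  also have "\<dots> \<cong> reduced_homology_group 1 (nsphere 1)"
    using homeomorphic_space_imp_isomorphic_reduced_homology_groups homeomorphic_space_sym nsphere_1 by blast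
  finally have "G2 \<cong> reduced_homology_group 1 (nsphere 1)" .
  then show ?thesis
    using isomorphic_group_cyclicity[of G2 "reduced_homology_group 1 (nsphere 1)"] cyclic_reduced_homology_group_nsphere[of 1 1] by simp
qed

text \<open>One generator fixed once and for all; the orientations given by different charts are
  compared through it.\<close>

definition g0 :: "complex chain set" where
  "g0 = (SOME g. g \<in> carrier G2 \<and> carrier G2 = generate G2 {g})"

lemma g0_generates: "g0 \<in> carrier G2" "carrier G2 = generate G2 {g0}"
proof -
  have "\<exists>g. g \<in> carrier G2 \<and> carrier G2 = generate G2 {g}"
    using cyclic_G2 unfolding cyclic_group_def
    by (metis carrier_subgroup_generated Int_insert_right Int_empty_right)
  from someI_ex[OF this] show "g0 \<in> carrier G2" "carrier G2 = generate G2 {g0}"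
    unfolding g0_def by auto
qed

definition planar_chart :: "'a topology \<Rightarrow> 'a set \<Rightarrow> ('a \<Rightarrow> complex) \<Rightarrow> bool" where
  "planar_chart X U f \<longleftrightarrow> openin X U \<and> open (f ` U) \<and> homeomorphic_map (subtopology X U) (top_of_set (f ` U)) f"

text \<open>The chart, translated so that \<open>y\<close> goes to 0, carries the local homology of
  \<open>U\<close> at \<open>y\<close> to that of the plane; \<open>psi\<close> below carries it to
  that of the surface, by excision.\<close>

definition phi :: "'a topology \<Rightarrow> 'a set \<Rightarrow> ('a \<Rightarrow> complex) \<Rightarrow> 'a \<Rightarrow> 'a chain set \<Rightarrow> complex chain set" where
  "phi X U f y = hom_induced 2 (subtopology X U) (U - {y}) Cx (-{0}) (\<lambda>z. f z - f y)"

definition psi :: "'a topology \<Rightarrow> 'a set \<Rightarrow> 'a \<Rightarrow> 'a chain set \<Rightarrow> 'a chain set" where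
  "psi X U y = hom_induced 2 (subtopology X U) (U - {y}) X (topspace X - {y}) id"

abbreviation "HU X U y \<equiv> relative_homology_group 2 (subtopology X U) (U - {y})"
abbreviation "HX X y \<equiv> relative_homology_group 2 X (topspace X - {y})"

lemma planar_chart_facts:
  assumes "planar_chart X U f"
  shows "openin X U" "U \<subseteq> topspace X" "topspace (subtopology X U) = U" "open (f ` U)" "inj_on f U"
    "continuous_map (subtopology X U) Cx f" "homeomorphic_map (subtopology X U) (top_of_set (f ` U)) f"
proof -
  show *: "openin X U" "open (f ` U)" "homeomorphic_map (subtopology X U) (top_of_set (f ` U)) f"
    using assms by (auto simp: planar_chart_def)
  show s: "U \<subseteq> topspace X" using *(1) by (rule openin_subset)
  then show t: "topspace (subtopology X U) = U" by auto
  show "inj_on f U" using homeomorphic_imp_injective_map[OF *(3)] t by simp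
  show "continuous_map (subtopology X U) Cx f"
    using homeomorphic_imp_continuous_map[OF *(3)] continuous_map_into_fulltopology by blast
qed

lemma planar_chart_diff:
  assumes "planar_chart X U f" "y \<in> U"
  shows "continuous_map (subtopology X U) Cx (\<lambda>z. f z - f y)" "(\<lambda>z. f z - f y) \<in> (U - {y}) \<rightarrow> -{0}"
proof -
  have "continuous_map Cx Cx (\<lambda>z. z - f y)" by (simp add: continuous_on_diff continuous_on_id)
  from continuous_map_compose[OF planar_chart_facts(6)[OF assms(1)] this]
  show "continuous_map (subtopology X U) Cx (\<lambda>z. f z - f y)" by (simp add: o_def)
  show "(\<lambda>z. f z - f y) \<in> (U - {y}) \<rightarrow> -{0}"
    using planar_chart_facts(5)[OF assms(1)] assms(2) by (simp add: Pi_iff inj_on_def) blast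
qed

lemma psi_iso:
  assumes "Hausdorff_space X" "openin X U" "y \<in> U"
  shows "psi X U y \<in> iso (HU X U y) (HX X y)"
proof -
  have U: "U \<subseteq> topspace X" using assms(2) by (rule openin_subset)
  have "closedin X {y}" using assms U by (auto intro: closedin_Hausdorff_singleton)
  then have o: "openin X (topspace X - {y})" by blast
  have "hom_induced 2 (subtopology X (topspace X - (topspace X - U))) (topspace X - {y} - (topspace X - U))
      (subtopology X (topspace X)) (topspace X - {y}) id
    \<in> iso (relative_homology_group 2 (subtopology X (topspace X - (topspace X - U))) (topspace X - {y} - (topspace X - U)))
          (relative_homology_group 2 (subtopology X (topspace X)) (topspace X - {y}))"
  proof (rule homology_excision_axiom)
    have "X closure_of (topspace X - U) = topspace X - U"
      by (rule closure_of_closedin) (use assms(2) in blast)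
    then show "X closure_of (topspace X - U) \<subseteq> X interior_of (topspace X - {y})"
      using interior_of_openin[OF o] assms(3) by auto
  qed auto
  moreover have "topspace X - (topspace X - U) = U" "topspace X - {y} - (topspace X - U) = U - {y}"
    using U by auto
  ultimately show ?thesis by (simp add: psi_def)
qed

lemma phi_iso:
  assumes f: "planar_chart X U f" and y: "y \<in> U"
  shows "phi X U f y \<in> iso (HU X U y) G2"
proof -
  note F = planar_chart_facts[OF f]
  let ?g = "\<lambda>z. z - f y" and ?XU = "subtopology X U"
  let ?W = "?g ` f ` U"
  have W: "open ?W" using open_translation_subtract[OF F(4)] .
  have g: "homeomorphic_map (top_of_set (f ` U)) (top_of_set ?W) ?g"
    unfolding homeomorphic_map_maps homeomorphic_maps_def
    by (intro exI[of _ "\<lambda>z. z + f y"]) (auto intro!: continuous_intros)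
  have h: "homeomorphic_map ?XU (top_of_set ?W) (?g \<circ> f)"
    by (rule homeomorphic_map_compose[OF F(7) g])
  have im: "(?g \<circ> f) ` (U - {y}) = ?W - {0}"
    using F(5) y by (auto simp: inj_on_def)
  have 1: "hom_induced 2 ?XU (U - {y}) (top_of_set ?W) (?W - {0}) (?g \<circ> f)
      \<in> iso (HU X U y) (relative_homology_group 2 (top_of_set ?W) (?W - {0}))"
    by (rule homeomorphic_map_relative_homology_iso[OF h _ im]) (use F(3) in auto)
  have "hom_induced 2 (subtopology Cx (UNIV - (- ?W))) (-{0} - (- ?W)) (subtopology Cx UNIV) (-{0}) id
    \<in> iso (relative_homology_group 2 (subtopology Cx (UNIV - (- ?W))) (-{0} - (- ?W)))
          (relative_homology_group 2 (subtopology Cx UNIV) (-{0}))"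
  proof (rule homology_excision_axiom)
    have "0 \<in> ?W" using y by auto
    moreover have "closure (- ?W) = - ?W" by (rule closure_closed[OF closed_Compl]) (use W in simp)
    moreover have "interior (-{0::complex}) = -{0}" by (rule interior_open) auto
    ultimately show "Cx closure_of (- ?W) \<subseteq> Cx interior_of (-{0})" by auto
  qed auto
  moreover have "UNIV - (- ?W) = ?W" "-{0} - (- ?W) = ?W - {0}" by auto
  ultimately have 2: "hom_induced 2 (top_of_set ?W) (?W - {0}) Cx (-{0}) id
      \<in> iso (relative_homology_group 2 (top_of_set ?W) (?W - {0})) G2" by simp
  have "hom_induced 2 ?XU (U - {y}) Cx (-{0}) (id \<circ> (?g \<circ> f)) =
    hom_induced 2 (top_of_set ?W) (?W - {0}) Cx (-{0}) id \<circ> hom_induced 2 ?XU (U - {y}) (top_of_set ?W) (?W - {0}) (?g \<circ> f)"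
    by (rule hom_induced_compose) (use homeomorphic_imp_continuous_map[OF h] im in auto)
  moreover have "id \<circ> (?g \<circ> f) = (\<lambda>z. f z - f y)" by auto
  ultimately show ?thesis
    unfolding phi_def using iso_set_trans[OF 1 2] by simp
qed

text \<open>The class at \<open>y\<close> that corresponds under \<open>f\<close>, by excision, to the generator \<open>g0\<close>.\<close>

definition local_ori :: "'a topology \<Rightarrow> 'a set \<Rightarrow> ('a \<Rightarrow> complex) \<Rightarrow> 'a \<Rightarrow> 'a chain set" where
  "local_ori X U f y = psi X U y (inv_into (carrier (HU X U y)) (phi X U f y) g0)"

lemma local_ori_eqI:
  assumes "planar_chart X U f" "y \<in> U" "u \<in> carrier (HU X U y)" "phi X U f y u = g0"
  shows "local_ori X U f y = psi X U y u"
proof -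
  have "inj_on (phi X U f y) (carrier (HU X U y))"
    using phi_iso[OF assms(1,2)] by (auto simp: iso_def bij_betw_def)
  then have "inv_into (carrier (HU X U y)) (phi X U f y) g0 = u"
    using assms(3,4) by (metis inv_into_f_f)
  then show ?thesis by (simp add: local_ori_def)
qed

lemma ex_local_class:
  assumes "planar_chart X U f" "y \<in> U"
  shows "\<exists>u\<in>carrier (HU X U y). phi X U f y u = g0"
proof -
  have "phi X U f y ` carrier (HU X U y) = carrier G2"
    using phi_iso[OF assms] by (auto simp: iso_def bij_betw_def)
  then show ?thesis using g0_generates(1) by (metis imageE)
qed

lemma local_ori_generates:
  assumes "Hausdorff_space X" "planar_chart X U f" "y \<in> U"
  shows "carrier (HX X y) = generate (HX X y) {local_ori X U f y}"
proof -
  obtain u where u: "u \<in> carrier (HU X U y)" "phi X U f y u = g0" using ex_local_class[OF assms(2,3)] by blast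
  have p: "psi X U y \<in> iso (HU X U y) (HX X y)" using psi_iso[OF assms(1) planar_chart_facts(1)[OF assms(2)] assms(3)] .
  have f: "phi X U f y \<in> iso (HU X U y) G2" by (rule phi_iso[OF assms(2,3)])
  interpret phi: group_hom "HU X U y" G2 "phi X U f y"
    using f by (auto simp: group_hom_def group_hom_axioms_def iso_def)
  interpret psi: group_hom "HU X U y" "HX X y" "psi X U y"
    using p by (auto simp: group_hom_def group_hom_axioms_def iso_def)
  have inj: "inj_on (phi X U f y) (carrier (HU X U y))" using f by (auto simp: iso_def bij_betw_def)
  have "phi X U f y ` generate (HU X U y) {u} = generate G2 {g0}"
    using phi.generate_img[of "{u}"] u by simp
  also have "\<dots> = phi X U f y ` carrier (HU X U y)"
    using f g0_generates(2) by (auto simp: iso_def bij_betw_def)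
  finally have "generate (HU X U y) {u} = carrier (HU X U y)"
    using inj_on_image_eq_iff[OF inj] phi.G.generate_incl[of "{u}"] u(1) by auto
  then have "psi X U y ` carrier (HU X U y) = generate (HX X y) {psi X U y u}"
    using psi.generate_img[of "{u}"] u by simp
  then show ?thesis
    using p local_ori_eqI[OF assms(2,3) u] by (auto simp: iso_def bij_betw_def)
qed

lemma planar_chart_subset:
  assumes "planar_chart X U f" "openin X V" "V \<subseteq> U"
  shows "planar_chart X V f"
proof -
  note F = planar_chart_facts[OF assms(1)]
  have "homeomorphic_map (subtopology (subtopology X U) V) (subtopology (top_of_set (f ` U)) (f ` V)) f"
    by (rule homeomorphic_map_subtopologies[OF F(7)]) (use assms(3) F in auto)
  then have h: "homeomorphic_map (subtopology X V) (top_of_set (f ` V)) f"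
    using assms(3) by (simp add: subtopology_subtopology inf.absorb2 image_mono)
  have "openin (subtopology X U) V" using assms by (simp add: openin_open_subtopology F(1))
  then have "openin (top_of_set (f ` U)) (f ` V)"
    using homeomorphic_imp_open_map[OF F(7)] by (simp add: open_map_def)
  then have "open (f ` V)" using openin_open_eq[OF F(4)] by blast
  then show ?thesis using assms h by (simp add: planar_chart_def)
qed

lemma continuous_map_mult:
  fixes f g :: "'a \<Rightarrow> 'b::real_normed_algebra"
  assumes "continuous_map X euclidean f" "continuous_map X euclidean g"
  shows "continuous_map X euclidean (\<lambda>x. f x * g x)"
  using assms by (simp add: continuous_map_atin tendsto_mult)

lemma homotopic_with_segment:
  assumes f: "continuous_map Y Cx f" "continuous_map Y Cx g" "S \<subseteq> topspace Y"
    and nz: "\<And>t z. 0 \<le> t \<Longrightarrow> t \<le> 1 \<Longrightarrow> z \<in> S \<Longrightarrow> (1 - of_real t) * f z + of_real t * g z \<noteq> 0"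
  shows "homotopic_with (\<lambda>h. h \<in> S \<rightarrow> -{0}) Y Cx f g"
proof (subst homotopic_with, goal_cases)
  case (1 h k)
  then have "h x = k x" if "x \<in> S" for x using that f(3) by blast
  then show ?case by (auto simp: Pi_iff)
next
  case 2
  let ?h = "\<lambda>p. (1 - of_real (fst p)) * f (snd p) + of_real (fst p) * g (snd p)"
  let ?P = "prod_topology (top_of_set {0..1::real}) Y"
  have s: "continuous_map ?P Cx (\<lambda>p. k (snd p))" if "continuous_map Y Cx k" for k
    using continuous_map_compose[OF continuous_map_snd that] by (simp add: o_def)
  have t: "continuous_map ?P Cx (\<lambda>p. k (fst p))" if "continuous_on {0..1} k" for k
    proof -
    have "continuous_map (top_of_set {0..1::real}) Cx k" using that by simp
    from continuous_map_compose[OF continuous_map_fst this] show ?thesis by (simp add: o_def)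
  qed
  have "continuous_map ?P Cx ?h"
  proof -
    have c: "continuous_on {0..1} (\<lambda>x::real. 1 - complex_of_real x)" "continuous_on {0..1} complex_of_real"
      by (intro continuous_intros)+
    show ?thesis
      by (rule continuous_map_add[OF continuous_map_mult[OF t[OF c(1)] s[OF f(1)]] continuous_map_mult[OF t[OF c(2)] s[OF f(2)]]])
  qed
  moreover have "?h (t, z) \<noteq> 0" if "t \<in> {0..1}" "z \<in> S" for t z
    using nz[of t z] that by auto
  ultimately show ?case by (intro exI[of _ ?h]) auto
qed

text \<open>Two charts give the same class at \<open>y\<close> if their translates are joined,
  through \<open>a\<close>, by straight homotopies that avoid 0 away from \<open>y\<close>. Both
  classes are computed in the smaller neighbourhood \<open>V\<close>.\<close>

lemma local_ori_homotopy:
  assumes f: "planar_chart X U f" "planar_chart X U' f'" and V: "openin X V" "V \<subseteq> U" "V \<subseteq> U'" "y \<in> V"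
    and a: "continuous_map (subtopology X V) Cx a"
    and nz: "\<And>t z. 0 \<le> t \<Longrightarrow> t \<le> 1 \<Longrightarrow> z \<in> V \<Longrightarrow> z \<noteq> y \<Longrightarrow> (1 - of_real t) * (f z - f y) + of_real t * a z \<noteq> 0"
      "\<And>t z. 0 \<le> t \<Longrightarrow> t \<le> 1 \<Longrightarrow> z \<in> V \<Longrightarrow> z \<noteq> y \<Longrightarrow> (1 - of_real t) * a z + of_real t * (f' z - f' y) \<noteq> 0"
  shows "local_ori X U f y = local_ori X U' f' y"
proof -
  have VX: "topspace (subtopology X V) = V" using openin_subset[OF V(1)] by auto
  have VV: "V - {y} \<subseteq> topspace (subtopology X V)" unfolding VX by blast
  have fV: "planar_chart X V f" "planar_chart X V f'" using planar_chart_subset f V by blast+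
  have "homotopic_with (\<lambda>h. h \<in> (V - {y}) \<rightarrow> -{0}) (subtopology X V) Cx (\<lambda>z. f z - f y) a"
    by (rule homotopic_with_segment[OF planar_chart_diff(1)[OF fV(1) V(4)] a VV]) (simp add: nz(1))
  moreover have "homotopic_with (\<lambda>h. h \<in> (V - {y}) \<rightarrow> -{0}) (subtopology X V) Cx a (\<lambda>z. f' z - f' y)"
    by (rule homotopic_with_segment[OF a planar_chart_diff(1)[OF fV(2) V(4)] VV]) (simp add: nz(2))
  ultimately have "homotopic_with (\<lambda>h. h \<in> (V - {y}) \<rightarrow> -{0}) (subtopology X V) Cx (\<lambda>z. f z - f y) (\<lambda>z. f' z - f' y)"
    by (rule homotopic_with_trans)
  then have eq: "phi X V f y = phi X V f' y"
    unfolding phi_def by (rule homology_homotopy_axiom)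
  obtain u where u: "u \<in> carrier (HU X V y)" "phi X V f y u = g0" using ex_local_class[OF fV(1) V(4)] by blast
  have *: "local_ori X W k y = psi X V y u" if k: "planar_chart X W k" "V \<subseteq> W" "phi X V k y u = g0" for W k
  proof -
    let ?u = "hom_induced 2 (subtopology X V) (V - {y}) (subtopology X W) (W - {y}) id u"
    have yW: "y \<in> W" using k V by auto
    have c: "continuous_map (subtopology X V) (subtopology X W) id" "id \<in> (V - {y}) \<rightarrow> (W - {y})"
      using k(2) openin_subset[OF V(1)] by (auto simp: continuous_map_in_subtopology continuous_map_from_subtopology)
    note k' = planar_chart_diff[OF k(1) yW]
    have "phi X W k y ?u = hom_induced 2 (subtopology X V) (V - {y}) Cx (-{0}) ((\<lambda>z. k z - k y) \<circ> id) u"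
      unfolding phi_def by (rule hom_induced_compose'[OF c k'])
    also have "\<dots> = g0" using k(3) by (simp add: phi_def)
    finally have "local_ori X W k y = psi X W y ?u"
      by (intro local_ori_eqI[OF k(1) yW hom_induced_carrier])
    also have "\<dots> = hom_induced 2 (subtopology X V) (V - {y}) X (topspace X - {y}) (id \<circ> id) u"
      unfolding psi_def
    proof (rule hom_induced_compose'[OF c])
      show "continuous_map (subtopology X W) X id" by (simp add: continuous_map_from_subtopology)
      show "id \<in> (W - {y}) \<rightarrow> (topspace X - {y})" using planar_chart_facts(2)[OF k(1)] by auto
    qed
    finally show ?thesis by (simp add: psi_def)
  qed
  show ?thesis using *[OF f(1) V(2)] *[OF f(2) V(3)] u(2) eq by simp
qed

lemma compactin_chain_support:
  assumes "singular_chain p X c"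
  shows "compactin X (\<Union>s\<in>Poly_Mapping.keys c. s ` standard_simplex p)"
proof (rule compactin_Union)
  fix K assume "K \<in> (\<lambda>s. s ` standard_simplex p) ` Poly_Mapping.keys c"
  then obtain s where s: "s \<in> Poly_Mapping.keys c" "K = s ` standard_simplex p" by blast
  then have "continuous_map (subtopology (powertop_real UNIV) (standard_simplex p)) X s"
    using assms by (auto simp: singular_chain_def singular_simplex_def)
  moreover have "compactin (subtopology (powertop_real UNIV) (standard_simplex p)) (standard_simplex p)"
    using compactin_standard_simplex by (simp add: compactin_subtopology)
  ultimately show "compactin X K" unfolding s(2) by (rule image_compactin[rotated])
qed auto

text \<open>The boundary of a relative cycle at \<open>x\<close> has compact support, hence misses a neighbourhood of \<open>x\<close>.\<close>

lemma local_ori_locally_constant: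
  assumes H: "Hausdorff_space X" and f: "planar_chart X U f" and x: "x \<in> U"
  shows "\<exists>V. openin X V \<and> x \<in> V \<and> V \<subseteq> U \<and> (\<exists>\<alpha> \<in> carrier (relative_homology_group 2 X (topspace X - V)).
     \<forall>y\<in>V. hom_induced 2 X (topspace X - V) X (topspace X - {y}) id \<alpha> = local_ori X U f y)"
proof -
  note F = planar_chart_facts[OF f]
  let ?XU = "subtopology X U"
  obtain u where u: "u \<in> carrier (HU X U x)" "phi X U f x u = g0" using ex_local_class[OF f x] by blast
  have "u \<in> carrier (relative_homology_group (int 2) ?XU (U - {x}))" using u(1) by simp
  then obtain c where c: "singular_relcycle 2 ?XU (U - {x}) c" "u = homologous_rel_set 2 ?XU (U - {x}) c"
    unfolding carrier_relative_homology_group by auto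
  have bc: "singular_chain 1 (subtopology ?XU (U - {x})) (chain_boundary 2 c)" and cc: "singular_chain 2 ?XU c"
    using c(1) by (auto simp: singular_relcycle)
  define K where "K = (\<Union>s\<in>Poly_Mapping.keys (chain_boundary 2 c). s ` standard_simplex 1)"
  have "compactin (subtopology ?XU (U - {x})) K" unfolding K_def by (rule compactin_chain_support[OF bc])
  then have K: "compactin ?XU K" "K \<subseteq> U - {x}" by (auto simp: compactin_subtopology)
  have "compactin Cx (f ` K)" by (rule image_compactin[OF K(1) F(6)])
  then have "closed (f ` K)" by (simp add: compact_imp_closed)
  then have "open (f ` U - f ` K)" using F(4) by blast
  moreover have "f x \<in> f ` U - f ` K" using x K(2) F(5) by (auto simp: inj_on_def)
  ultimately obtain r where r: "r > 0" "ball (f x) r \<subseteq> f ` U - f ` K" by (meson open_contains_ball)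
  define V where "V = {z \<in> U. f z \<in> ball (f x) r}"
  have VU: "V \<subseteq> U" "x \<in> V" using x r by (auto simp: V_def)
  have "openin ?XU {z \<in> topspace ?XU. f z \<in> ball (f x) r}"
    by (rule openin_continuous_map_preimage[OF F(6)]) simp
  then have "openin ?XU V" unfolding F(3) V_def .
  then have V: "openin X V" using openin_trans_full F(1) by blast
  have KV: "K \<inter> V = {}" using r(2) K(2) by (auto simp: V_def)
  have "singular_chain 1 (subtopology ?XU (U - V)) (chain_boundary 2 c)"
    using bc KV K(2) unfolding singular_chain_subtopology K_def by blast
  then have c': "singular_relcycle 2 ?XU (U - V) c" using cc by (auto simp: singular_relcycle)
  define a where "a = homologous_rel_set 2 ?XU (U - V) c"
  have a: "a \<in> carrier (relative_homology_group 2 ?XU (U - V))"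
    using c' carrier_relative_homology_group[of 2 ?XU "U - V"] by (auto simp: a_def)
  let ?r = "\<lambda>y. hom_induced 2 ?XU (U - V) ?XU (U - {y}) id"
  have rx: "?r x a = u"
  proof -
    have i: "id \<in> (U - V) \<rightarrow> (U - {x})" using VU(2) by auto
    have "chain_map 2 id c = c" using cc by (rule chain_map_id_gen) simp
    then show ?thesis
      using hom_induced_chain_map[OF continuous_map_id i c'] c(2) by (simp add: a_def)
  qed
  have ry: "phi X U f y (?r y a) = g0" if y: "y \<in> V" for y
  proof -
    have gen: "phi X U f y (?r y a) = hom_induced 2 ?XU (U - V) Cx (-{0}) (\<lambda>z. f z - f y) a" if y: "y \<in> V" for y
    proof -
      have "phi X U f y (?r y a) = hom_induced 2 ?XU (U - V) Cx (-{0}) ((\<lambda>z. f z - f y) \<circ> id) a"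
        unfolding phi_def
      proof (rule hom_induced_compose')
        show "continuous_map ?XU Cx (\<lambda>z. f z - f y)" "(\<lambda>z. f z - f y) \<in> (U - {y}) \<rightarrow> -{0}"
          using planar_chart_diff[OF f] y VU by blast+
        show "id \<in> (U - V) \<rightarrow> (U - {y})" using y by auto
      qed simp
      then show ?thesis by simp
    qed
    \<comment> \<open>The base point moves from \<open>x\<close> to \<open>y\<close>: the segment
      between their images stays in the ball by convexity, while points outside \<open>V\<close> are
      mapped outside the ball.\<close>
    have "homotopic_with (\<lambda>h. h \<in> (U - V) \<rightarrow> -{0}) ?XU Cx (\<lambda>z. f z - f x) (\<lambda>z. f z - f y)"
    proof (rule homotopic_with_segment)
      show "continuous_map ?XU Cx (\<lambda>z. f z - f x)" "continuous_map ?XU Cx (\<lambda>z. f z - f y)"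
        using planar_chart_diff(1)[OF f] y VU by blast+
      show "U - V \<subseteq> topspace ?XU" using F(3) by blast
      fix t :: real and z assume t: "0 \<le> t" "t \<le> 1" and z: "z \<in> U - V"
      show "(1 - of_real t) * (f z - f x) + of_real t * (f z - f y) \<noteq> 0"
      proof
        assume "(1 - of_real t) * (f z - f x) + of_real t * (f z - f y) = 0"
        then have "f z = (1 - t) *\<^sub>R f x + t *\<^sub>R f y" by (simp add: scaleR_conv_of_real algebra_simps)
        moreover have "f x \<in> ball (f x) r" "f y \<in> ball (f x) r" using y r by (auto simp: V_def)
        ultimately have "f z \<in> ball (f x) r"
          using convexD[OF convex_ball, of "f x" "f x" r "f y" "1 - t" t] t by simp
        then show False using z by (auto simp: V_def)
      qed
    qed
    then have "hom_induced 2 ?XU (U - V) Cx (-{0}) (\<lambda>z. f z - f x) = hom_induced 2 ?XU (U - V) Cx (-{0}) (\<lambda>z. f z - f y)"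
      by (rule homology_homotopy_axiom)
    then show ?thesis using gen[OF y] gen[OF VU(2)] rx u(2) by simp
  qed
  let ?a = "hom_induced 2 ?XU (U - V) X (topspace X - V) id a"
  have inc: "continuous_map ?XU X id" by (simp add: continuous_map_from_subtopology)
  have "hom_induced 2 X (topspace X - V) X (topspace X - {y}) id ?a = local_ori X U f y" if y: "y \<in> V" for y
  proof -
    have yU: "y \<in> U" using y VU by auto
    have i: "id \<in> (U - V) \<rightarrow> (topspace X - V)" "id \<in> (topspace X - V) \<rightarrow> (topspace X - {y})"
      "id \<in> (U - V) \<rightarrow> (U - {y})" "id \<in> (U - {y}) \<rightarrow> (topspace X - {y})"
      using y F(2) by auto
    have "hom_induced 2 X (topspace X - V) X (topspace X - {y}) id ?a
        = hom_induced 2 ?XU (U - V) X (topspace X - {y}) (id \<circ> id) a"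
      by (rule hom_induced_compose'[OF inc i(1) continuous_map_id i(2)])
    also have "\<dots> = psi X U y (?r y a)"
      unfolding psi_def by (rule hom_induced_compose'[symmetric, OF continuous_map_id i(3) inc i(4)])
    also have "\<dots> = local_ori X U f y"
      by (rule local_ori_eqI[OF f yU hom_induced_carrier ry[OF y], symmetric])
    finally show ?thesis .
  qed
  then have "\<exists>\<alpha> \<in> carrier (relative_homology_group 2 X (topspace X - V)).
     \<forall>y\<in>V. hom_induced 2 X (topspace X - V) X (topspace X - {y}) id \<alpha> = local_ori X U f y"
    by (intro bexI[of _ ?a] ballI hom_induced_carrier) auto
  then show ?thesis using V VU by blast
qed

lemma orientable_surfaceI:
  assumes H: "Hausdorff_space X" and cov: "\<And>x. x \<in> topspace X \<Longrightarrow> \<exists>i\<in>I. x \<in> U i"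
    and ch: "\<And>i. i \<in> I \<Longrightarrow> planar_chart X (U i) (f i)"
    and eq: "\<And>i j y. i \<in> I \<Longrightarrow> j \<in> I \<Longrightarrow> y \<in> U i \<Longrightarrow> y \<in> U j \<Longrightarrow> local_ori X (U i) (f i) y = local_ori X (U j) (f j) y"
  shows "orientable_surface X"
proof -
  define \<mu> where "\<mu> y = local_ori X (U (SOME i. i \<in> I \<and> y \<in> U i)) (f (SOME i. i \<in> I \<and> y \<in> U i)) y" for y
  have mu: "\<mu> y = local_ori X (U i) (f i) y" if "i \<in> I" "y \<in> U i" for i y
  proof -
    have "\<exists>i. i \<in> I \<and> y \<in> U i" using that by blast
    from someI_ex[OF this] show ?thesis unfolding \<mu>_def using eq that by blast
  qed
  show ?thesis
    unfolding orientable_surface_def Let_def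
  proof (intro exI[of _ \<mu>] conjI ballI)
    fix x assume "x \<in> topspace X"
    then obtain i where i: "i \<in> I" "x \<in> U i" using cov by blast
    show "carrier (HX X x) = generate (HX X x) {\<mu> x}"
      unfolding mu[OF i] by (rule local_ori_generates[OF H ch[OF i(1)] i(2)])
    obtain V \<alpha> where V: "openin X V" "x \<in> V" "V \<subseteq> U i" "\<alpha> \<in> carrier (relative_homology_group 2 X (topspace X - V))"
      "\<forall>y\<in>V. hom_induced 2 X (topspace X - V) X (topspace X - {y}) id \<alpha> = local_ori X (U i) (f i) y"
      using local_ori_locally_constant[OF H ch[OF i(1)] i(2)] by blast
    have "\<forall>y\<in>V. hom_induced 2 X (topspace X - V) X (topspace X - {y}) id \<alpha> = \<mu> y"
      using V(3,5) mu[OF i(1)] by auto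
    then show "\<exists>U. openin X U \<and> x \<in> U \<and>
            (\<exists>\<alpha> \<in> carrier (relative_homology_group 2 X (topspace X - U)).
               \<forall>y \<in> U. hom_induced 2 X (topspace X - U) X (topspace X - {y}) id \<alpha> = \<mu> y)"
      using V by blast
  qed
qed

section \<open>Orientability of the hexagonal surface\<close>

abbreviation "Xs \<equiv> top_of_set hexsurf"

text \<open>The squares of all coordinates, given the squares \<open>p\<close> and \<open>q\<close> of the coordinates \<open>i\<close> and \<open>nx i\<close>.\<close>

definition sq_ext :: "side \<Rightarrow> real \<Rightarrow> real \<Rightarrow> side \<Rightarrow> real" where
  "sq_ext i p q j = (if j = i then p else if j = nx i then q else if j = nx (nx i) then 1 + q - p
     else if j = nx (nx (nx i)) then 2 - p else if j = nx (nx (nx (nx i))) then 2 - q else 1 + p - q)"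

lemma sq_ext_rec: "sq_ext i p q j + sq_ext i p q (nx (nx j)) = 1 + sq_ext i p q (nx j)"
  by (cases i; cases j; simp add: sq_ext_def)

lemma sq_ext_hexsurf:
  assumes "x \<in> hexsurf"
  shows "(x $ j)\<^sup>2 = sq_ext i ((x $ i)\<^sup>2) ((x $ nx i)\<^sup>2) j"
  using assms unfolding hexsurf_def all_side mem_Collect_eq nx.simps
  by (elim conjE) (cases i; cases j; simp add: sq_ext_def)

text \<open>The sign by which the coordinates \<open>(x\<^sub>i, x\<^bsub>i+1\<^esub>)\<close> have to be corrected in order that all charts
  induce the same orientation.\<close>

definition chart_sign :: "side \<Rightarrow> (side \<Rightarrow> bool) \<Rightarrow> real" where
  "chart_sign i c = (\<Prod>j\<in>UNIV - {i, nx i}. sg (c j))"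

definition chart_coord :: "side \<Rightarrow> (side \<Rightarrow> bool) \<Rightarrow> real^side \<Rightarrow> complex" where
  "chart_coord i c x = Complex (x $ i) (chart_sign i c * x $ nx i)"

definition chart_inv :: "side \<Rightarrow> (side \<Rightarrow> bool) \<Rightarrow> complex \<Rightarrow> real^side" where
  "chart_inv i c z = (\<chi> j. if j = i then Re z else if j = nx i then chart_sign i c * Im z
     else sg (c j) * sqrt (sq_ext i ((Re z)\<^sup>2) ((Im z)\<^sup>2) j))"

definition chart_range :: "side \<Rightarrow> complex set" where
  "chart_range i = {z. \<forall>j. j \<noteq> i \<and> j \<noteq> nx i \<longrightarrow> 0 < sq_ext i ((Re z)\<^sup>2) ((Im z)\<^sup>2) j}"

lemma chart_sign_sq [simp]: "chart_sign i c * chart_sign i c = 1" "(chart_sign i c)\<^sup>2 = 1" "chart_sign i c \<noteq> 0" "chart_sign i c * (chart_sign i c * r) = r"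
proof -
  have "chart_sign i c * chart_sign i c = (\<Prod>j\<in>UNIV - {i, nx i}. sg (c j) * sg (c j))"
    unfolding chart_sign_def by (rule prod.distrib[symmetric])
  then show *: "chart_sign i c * chart_sign i c = 1" by simp
  then show "(chart_sign i c)\<^sup>2 = 1" "chart_sign i c \<noteq> 0" by (auto simp: power2_eq_square)
  show "chart_sign i c * (chart_sign i c * r) = r" using * by (simp flip: mult.assoc)
qed

lemma open_chart_range: "open (chart_range i)"
proof -
  have "open {z. j \<noteq> i \<and> j \<noteq> nx i \<longrightarrow> 0 < sq_ext i ((Re z)\<^sup>2) ((Im z)\<^sup>2) j}" for j
    unfolding sq_ext_def by (cases i; cases j; simp; intro open_Collect_less continuous_intros)
  moreover have "chart_range i = (\<Inter>j\<in>UNIV. {z. j \<noteq> i \<and> j \<noteq> nx i \<longrightarrow> 0 < sq_ext i ((Re z)\<^sup>2) ((Im z)\<^sup>2) j})"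
    by (auto simp: chart_range_def)
  ultimately show ?thesis by (simp add: open_INT)
qed

lemma nx_nx_neq [simp]: "nx i \<noteq> i" "i \<noteq> nx i" "nx (nx i) \<noteq> i" "i \<noteq> nx (nx i)"
  by (cases i; simp)+

lemma chart_homeomorphism: "homeomorphism (chart i c) (chart_range i) (chart_coord i c) (chart_inv i c)"
proof (rule homeomorphismI)
  show "continuous_on (chart i c) (chart_coord i c)"
    unfolding chart_coord_def complex_eq_iff by (intro continuous_on_Complex continuous_intros)
  show "continuous_on (chart_range i) (chart_inv i c)"
    unfolding chart_inv_def
  proof (rule continuous_on_vec_lambda)
    show "continuous_on (chart_range i) (\<lambda>z. if j = i then Re z else if j = nx i then chart_sign i c * Im z
      else sg (c j) * sqrt (sq_ext i ((Re z)\<^sup>2) ((Im z)\<^sup>2) j))" for j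
    proof (cases "j = i \<or> j = nx i")
      case True
      then show ?thesis by (cases "j = i") (auto intro!: continuous_intros)
    next
      case False
      then show ?thesis unfolding sq_ext_def
        by (cases i; cases j; simp; intro continuous_intros)
    qed
  qed
  show im: "chart_coord i c ` chart i c \<subseteq> chart_range i"
  proof
    fix z assume "z \<in> chart_coord i c ` chart i c"
    then obtain x where x: "x \<in> chart i c" "z = chart_coord i c x" by blast
    have "0 < sq_ext i ((Re z)\<^sup>2) ((Im z)\<^sup>2) j" if "j \<noteq> i" "j \<noteq> nx i" for j
    proof -
      have "x $ j \<noteq> 0" using x(1) that by (auto simp: chart_def chart_nbhd_def)
      then have "0 < (x $ j)\<^sup>2" by simp
      then show ?thesis
        using sq_ext_hexsurf[of x j i, symmetric] x by (simp add: chart_coord_def power_mult_distrib chart_def)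
    qed
    then show "z \<in> chart_range i" by (simp add: chart_range_def)
  qed
  show "chart_inv i c ` chart_range i \<subseteq> chart i c"
  proof
    fix x assume "x \<in> chart_inv i c ` chart_range i"
    then obtain z where z: "z \<in> chart_range i" "x = chart_inv i c z" by blast
    let ?a = "sq_ext i ((Re z)\<^sup>2) ((Im z)\<^sup>2)"
    have a: "?a j > 0" if "j \<noteq> i" "j \<noteq> nx i" for j using z(1) that by (simp add: chart_range_def)
    have a0: "?a i = (Re z)\<^sup>2" "?a (nx i) = (Im z)\<^sup>2" by (auto simp: sq_ext_def)
    have an: "?a j \<ge> 0" for j using a[of j] a0 by (cases "j = i \<or> j = nx i") auto
    have "x \<in> hexsurf"
      by (rule hexsurf_sqrtI[where a = ?a])
         (use an a0 in \<open>auto simp: sq_ext_rec z(2) chart_inv_def power_mult_distrib\<close>)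
    moreover have "0 < x $ j * sg (c j)" if "j \<noteq> i" "j \<noteq> nx i" for j
      using a[OF that] that by (simp add: z(2) chart_inv_def mult.assoc mult.commute)
    ultimately show "x \<in> chart i c" by (simp add: chart_def chart_nbhd_def)
  qed
  show "chart_inv i c (chart_coord i c x) = x" if "x \<in> chart i c" for x
  proof -
    have x: "x \<in> hexsurf" using that by (simp add: chart_def)
    have "sg (c j) * sqrt ((x $ j)\<^sup>2) = x $ j" if "j \<noteq> i" "j \<noteq> nx i" for j
      using \<open>x \<in> chart i c\<close> that by (cases "c j") (auto simp: chart_def chart_nbhd_def zero_less_mult_iff)
    then show ?thesis
      unfolding Finite_Cartesian_Product.vec_eq_iff
      using sq_ext_hexsurf[OF x, of _ i, symmetric] by (auto simp: chart_inv_def chart_coord_def power_mult_distrib)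
  qed
  show "chart_coord i c (chart_inv i c z) = z" if "z \<in> chart_range i" for z
    by (simp add: chart_coord_def chart_inv_def)
qed

lemma chart_image: "chart_coord i c ` chart i c = chart_range i"
  using chart_homeomorphism by (auto simp: homeomorphism_def)

lemma openin_chart: "openin Xs (chart i c)"
  unfolding chart_def using open_chart_nbhd by (auto simp: openin_open)

lemma subtopology_chart: "S \<subseteq> hexsurf \<Longrightarrow> subtopology Xs S = top_of_set S"
  by (simp add: subtopology_subtopology inf.absorb2)

lemma chart_hexsurf: "chart i c \<subseteq> hexsurf"
  by (auto simp: chart_def)

lemma planar_chart_chart: "planar_chart Xs (chart i c) (chart_coord i c)"
  unfolding planar_chart_def chart_image subtopology_chart[OF chart_hexsurf]
  using openin_chart open_chart_range chart_homeomorphism homeomorphic_maps_iff_homeomorphism homeomorphic_map_maps by blast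

lemma chart_coord_inj: "x \<in> chart i c \<Longrightarrow> y \<in> chart i c \<Longrightarrow> chart_coord i c x = chart_coord i c y \<Longrightarrow> x = y"
  using chart_homeomorphism[of i c] unfolding homeomorphism_def by metis

lemma chart_sign_step: "chart_sign i c * sg (c (nx (nx i))) = chart_sign (nx i) c * sg (c i)"
proof -
  let ?A = "UNIV - {i, nx i, nx (nx i)}"
  have "UNIV - {i, nx i} = insert (nx (nx i)) ?A" "UNIV - {nx i, nx (nx i)} = insert i ?A" by auto
  then have "chart_sign i c = sg (c (nx (nx i))) * (\<Prod>j\<in>?A. sg (c j))" "chart_sign (nx i) c = sg (c i) * (\<Prod>j\<in>?A. sg (c j))"
    unfolding chart_sign_def by simp_all
  then show ?thesis by (simp add: mult.commute)
qed

text \<open>On a circular arc in the open positive quadrant one coordinate grows when the other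
  decreases, so unless the points coincide the two sides of the last equation cannot
  balance.\<close>

lemma opposite_monotone:
  fixes p r P R t :: real
  assumes "p > 0" "r > 0" "P > 0" "R > 0" "p\<^sup>2 + r\<^sup>2 = P\<^sup>2 + R\<^sup>2" "0 \<le> t" "t \<le> 1"
    and e: "(1 - t) * (p - P) = t * (r - R)"
  shows "p = P"
proof -
  have less: False if "x < X" "Y < y" "(1 - s) * (x - X) = s * (y - Y)" "0 \<le> s" "s \<le> 1" for x X y Y s :: real
  proof -
    have "(1 - s) * (x - X) \<le> 0" using that(1,5) by (simp add: mult_nonneg_nonpos)
    moreover have "s * (y - Y) \<ge> 0" using that(2,4) by simp
    ultimately have "(1 - s) * (x - X) = 0" "s * (y - Y) = 0" using that(3) by linarith+
    then show False using that by auto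
  qed
  show ?thesis
  proof (rule ccontr)
    assume "p \<noteq> P"
    then consider "p < P" | "P < p" by linarith
    then show False
    proof cases
      case 1
      then have "p\<^sup>2 < P\<^sup>2" using assms by (simp add: power_strict_mono)
      then have "R\<^sup>2 < r\<^sup>2" using assms by linarith
      then have "R < r" using assms by (simp add: power2_less_imp_less)
      then show False using less[of p P R r t] 1 assms by simp
    next
      case 2
      then have "P\<^sup>2 < p\<^sup>2" using assms by (simp add: power_strict_mono)
      then have "r\<^sup>2 < R\<^sup>2" using assms by linarith
      then have "r < R" using assms by (simp add: power2_less_imp_less)
      moreover have "(1 - t) * (P - p) = t * (R - r)" using e by (simp add: algebra_simps)
      ultimately show False using less[of P p r R t] 2 assms by simp
    qed
  qed
qed

text \<open>Between neighbouring charts, \<open>x\<^sub>i\<close> is deformed into a multiple of \<open>x\<^bsub>i+2\<^esub>\<close> while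
  \<open>x\<^bsub>i+1\<^esub>\<close> is kept; the result differs from the second chart by a quarter turn.\<close>

lemma local_ori_step:
  assumes y: "y \<in> chart i c" "y \<in> chart (nx i) c"
  shows "local_ori Xs (chart i c) (chart_coord i c) y = local_ori Xs (chart (nx i) c) (chart_coord (nx i) c) y"
proof -
  let ?V = "chart i c \<inter> chart (nx i) c"
  \<comment> \<open>Multiplication by \<open>w\<close> is a quarter turn whose direction is given by
    the sign. The segment from \<open>w\<close> to 1 avoids 0, which yields the second
    homotopy.\<close>
  define w where "w = \<i> * of_real (chart_sign i c)"
  define a where "a z = w * (chart_coord (nx i) c z - chart_coord (nx i) c y)" for z
  have ww: "w\<^sup>2 = -1" by (simp add: w_def power_mult_distrib flip: of_real_power)
  have a: "Re (a z) = - chart_sign i c * chart_sign (nx i) c * (z $ nx (nx i) - y $ nx (nx i))" "Im (a z) = chart_sign i c * (z $ nx i - y $ nx i)" for z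
    by (simp_all add: a_def w_def chart_coord_def algebra_simps)
  have oo: "chart_sign i c * chart_sign (nx i) c = sg (c i) * sg (c (nx (nx i)))"
    using arg_cong[OF chart_sign_step[of i c], of "\<lambda>x. x * (chart_sign (nx i) c * sg (c (nx (nx i))))"] by (simp add: algebra_simps)
  show ?thesis
  proof (rule local_ori_homotopy[OF planar_chart_chart planar_chart_chart])
    show "openin Xs ?V" by (intro openin_Int openin_chart)
    show "y \<in> ?V" using y by simp
    show "continuous_map (subtopology Xs ?V) Cx a"
    proof -
      have V: "?V \<subseteq> hexsurf" using chart_hexsurf[of i c] by blast
      show ?thesis
        unfolding subtopology_chart[OF V] a_def chart_coord_def continuous_map_iff_continuous
        by (intro continuous_intros continuous_on_Complex)
    qed
    fix t :: real and z assume t: "0 \<le> t" "t \<le> 1" and z: "z \<in> ?V" "z \<noteq> y"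
    show "(1 - of_real t) * (chart_coord i c z - chart_coord i c y) + of_real t * a z \<noteq> 0"
    proof
      assume e: "(1 - of_real t) * (chart_coord i c z - chart_coord i c y) + of_real t * a z = 0"
      let ?s = "sg (c i)" and ?s' = "sg (c (nx (nx i)))"
      have "chart_sign i c * (z $ nx i - y $ nx i) = 0"
        using arg_cong[OF e, of Im] by (simp add: a chart_coord_def algebra_simps)
      then have e1: "z $ nx i = y $ nx i" by simp
      have e2: "(1 - t) * (z $ i - y $ i) = t * (?s * ?s' * (z $ nx (nx i) - y $ nx (nx i)))"
        using arg_cong[OF e, of Re] by (simp add: a oo chart_coord_def algebra_simps)
      have p: "?s * z $ i > 0" "?s * y $ i > 0" "?s' * z $ nx (nx i) > 0" "?s' * y $ nx (nx i) > 0"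
        using z y by (auto simp: chart_def chart_nbhd_def mult.commute)
      have "(z $ i)\<^sup>2 + (z $ nx (nx i))\<^sup>2 = (y $ i)\<^sup>2 + (y $ nx (nx i))\<^sup>2"
        using z y e1 by (auto simp: chart_def hexsurf_def)
      then have q: "(?s * z $ i)\<^sup>2 + (?s' * z $ nx (nx i))\<^sup>2 = (?s * y $ i)\<^sup>2 + (?s' * y $ nx (nx i))\<^sup>2"
        by (simp add: power_mult_distrib)
      have "(1 - t) * (?s * z $ i - ?s * y $ i) = t * (?s' * z $ nx (nx i) - ?s' * y $ nx (nx i))"
        using arg_cong[OF e2, of "\<lambda>x. ?s * x"] by (simp add: algebra_simps)
      from opposite_monotone[OF p(1,3,2,4) q t this] have "?s * z $ i = ?s * y $ i" .
      then have "z $ i = y $ i" by simp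
      then show False using chart_coord_inj[of z i c y] z y e1 by (simp add: chart_coord_def)
    qed
    have "(1 - of_real t) * a z + of_real t * (chart_coord (nx i) c z - chart_coord (nx i) c y)
        = ((1 - of_real t) * w + of_real t) * (chart_coord (nx i) c z - chart_coord (nx i) c y)"
      by (simp add: a_def algebra_simps)
    moreover have "(1 - of_real t) * w + of_real t \<noteq> 0"
    proof
      assume "(1 - of_real t) * w + of_real t = 0"
      from arg_cong[OF this, of Re] arg_cong[OF this, of Im] show False
        by (simp add: w_def)
    qed
    ultimately show "(1 - of_real t) * a z + of_real t * (chart_coord (nx i) c z - chart_coord (nx i) c y) \<noteq> 0"
      using chart_coord_inj[of z "nx i" c y] z y by auto
  qed auto
qed

lemma local_ori_cong:
  assumes "y \<in> chart i c"
  shows "local_ori Xs (chart i c) (chart_coord i c) y = local_ori Xs (chart i (sigma y)) (chart_coord i (sigma y)) y"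
proof -
  have "chart_sign i c = chart_sign i (sigma y)"
    unfolding chart_sign_def by (rule prod.cong) (use sigma_chart[OF assms] in auto)
  then have "chart_coord i c = chart_coord i (sigma y)" by (auto simp: chart_coord_def)
  then show ?thesis using chart_sigma[OF assms] by simp
qed

text \<open>Charts at vertices that are not neighbours meet only in open tiles. A point of an open
  tile lies in the charts of all six vertices, and these are compared one step at a time.\<close>

lemma local_ori_agree:
  assumes "y \<in> chart i c" "y \<in> chart j c'"
  shows "local_ori Xs (chart i c) (chart_coord i c) y = local_ori Xs (chart j c') (chart_coord j c') y"
proof -
  let ?s = "sigma y" and ?o = "\<lambda>k. local_ori Xs (chart k (sigma y)) (chart_coord k (sigma y)) y"
  have y: "y \<in> chart i ?s" "y \<in> chart j ?s" using assms chart_sigma by auto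
  have st: "?o k = ?o (nx k)" if "y \<in> chart k ?s" "y \<in> chart (nx k) ?s" for k
    by (rule local_ori_step[OF that])
  have "?o i = ?o j"
  proof (cases "j = i \<or> j = nx i \<or> i = nx j")
    case True
    then consider "j = i" | "j = nx i" | "i = nx j" by blast
    then show ?thesis
    proof cases
      case 2
      then show ?thesis using st[of i] y by simp
    next
      case 3
      then show ?thesis using st[of j] y by simp
    qed simp
  next
    case False
    have nz: "y $ l \<noteq> 0" for l
    proof (cases "l = i \<or> l = nx i")
      case True
      then have "l \<noteq> j \<and> l \<noteq> nx j" using False by (cases i; cases j; auto)
      then show ?thesis using y(2) by (auto simp: chart_def chart_nbhd_def)
    next
      case False
      then show ?thesis using y(1) by (auto simp: chart_def chart_nbhd_def)
    qed
    have "y \<in> chart k ?s" for k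
    proof -
      have "0 < y $ l * sg (?s l)" for l
        using nz[of l] by (simp add: sigma_def sg_def)
      then show ?thesis using y(1) by (simp add: chart_def chart_nbhd_def)
    qed
    then have "?o S0 = ?o S1" "?o S1 = ?o S2" "?o S2 = ?o S3" "?o S3 = ?o S4" "?o S4 = ?o S5"
      using st[of S0] st[of S1] st[of S2] st[of S3] st[of S4] by simp_all
    then show ?thesis by (cases i; cases j; simp)
  qed
  then show ?thesis unfolding local_ori_cong[OF assms(1)] local_ori_cong[OF assms(2)] .
qed

lemma orientable_hexsurf: "orientable_surface Xs"
proof -
  let ?U = "\<lambda>p. chart (fst p) (snd p)" and ?f = "\<lambda>p. chart_coord (fst p) (snd p)"
  have H: "Hausdorff_space Xs" by (intro Hausdorff_space_subtopology Hausdorff_space_euclidean)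
  have cov: "\<exists>p\<in>UNIV. x \<in> ?U p" if "x \<in> topspace Xs" for x
  proof -
    have "x \<in> hexsurf" using that by simp
    then obtain i where "x \<in> chart i (sigma x)" by (rule ex_chart)
    then show ?thesis by (intro bexI[of _ "(i, sigma x)"]) auto
  qed
  have ch: "planar_chart Xs (?U p) (?f p)" for p by (rule planar_chart_chart)
  have ag: "local_ori Xs (?U p) (?f p) y = local_ori Xs (?U q) (?f q) y" if "y \<in> ?U p" "y \<in> ?U q" for p q y
    by (rule local_ori_agree[OF that])
  show ?thesis
  proof (rule orientable_surfaceI[where I = UNIV and U = ?U and f = ?f])
    show "local_ori Xs (?U p) (?f p) y = local_ori Xs (?U q) (?f q) y" if "y \<in> ?U p" "y \<in> ?U q" for p q y
      by (rule ag[OF that])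
  qed (rule H cov ch; assumption)+
qed

section \<open>Genus of the hexagonal surface\<close>

lemma homeomorphic_Euclidean_space_2: "Cx homeomorphic_space Euclidean_space 2"
proof -
  obtain f :: "(nat \<Rightarrow> real) \<Rightarrow> complex" and g where "homeomorphic_maps (Euclidean_space DIM(complex)) euclidean f g"
    by (rule homeomorphic_maps_Euclidean_space_euclidean)
  then show ?thesis
    unfolding DIM_complex using homeomorphic_space_def homeomorphic_space_sym by blast
qed

lemma second_countable_euclidean: "second_countable (euclidean :: 'a::second_countable_topology topology)"
proof -
  obtain B :: "'a set set" where "countable B" "\<And>C. C \<in> B \<Longrightarrow> open C" "\<And>S. open S \<Longrightarrow> \<exists>U. U \<subseteq> B \<and> S = \<Union>U"
    by (rule univ_second_countable) blast
  then show ?thesis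
    unfolding second_countable_def
  proof (intro exI[of _ B] conjI ballI allI impI)
    fix U :: "'a set" and x assume "openin euclidean U \<and> x \<in> U"
    then obtain C where "C \<subseteq> B" "U = \<Union>C" "x \<in> U"
      using \<open>\<And>S. open S \<Longrightarrow> \<exists>U. U \<subseteq> B \<and> S = \<Union>U\<close> by (metis open_openin)
    then show "\<exists>V\<in>B. x \<in> V \<and> V \<subseteq> U" by blast
  qed simp_all
qed

lemma path_component_edge_path: "path_component hexsurf (tile_ctr c) (tile_ctr (flip c j))"
  unfolding path_component_def using edge_path_image_hexsurf[of c j] by (intro exI[of _ "edge_path c j"]) (auto simp: path_image_def)

lemma path_component_run:
  assumes "\<And>c j. path_component T (tile_ctr c) (tile_ctr (flip c j))" "\<And>c. tile_ctr c \<in> T"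
  shows "path_component T (tile_ctr c) (tile_ctr (run c w))"
proof (induction w arbitrary: c)
  case (Cons j w)
  then show ?case using path_component_trans[OF assms(1)[of c j] Cons[of "flip c j"]] by simp
qed (simp add: path_component_refl assms)

text \<open>Each point is joined to the centre of its tile, so connectedness is reduced to crossing
  from centre to neighbouring centre.\<close>

lemma path_connected_tiles:
  assumes "\<And>c j. path_component T (tile_ctr c) (tile_ctr (flip c j))" "\<And>c. tile_ctr c \<in> T"
    and "\<And>x. x \<in> T \<Longrightarrow> x \<in> hexsurf \<and> path_image (tile_path x) \<subseteq> T"
  shows "path_connected T"
proof -
  have 1: "path_component T (tile_ctr c) (tile_ctr c')" for c c'
    using path_component_run[OF assms(1,2), of c "dw c c'"] by simp
  have 2: "path_component T (tile_ctr (sigma x)) x" if "x \<in> T" for x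
    unfolding path_component_def using assms(3)[OF that] by (intro exI[of _ "tile_path x"]) auto
  have "path_component T x y" if "x \<in> T" "y \<in> T" for x y
    using path_component_trans[OF path_component_sym[OF 2[OF that(1)]] path_component_trans[OF 1 2[OF that(2)]]] .
  then show ?thesis by (simp add: path_connected_component)
qed

lemma path_connected_hexsurf: "path_connected hexsurf"
  by (rule path_connected_tiles) (auto simp: path_component_edge_path dest: tile_path_image_hexsurf)

lemma locally_Euclidean_hexsurf:
  assumes "x \<in> hexsurf"
  shows "\<exists>U. openin Xs U \<and> x \<in> U \<and> subtopology Xs U homeomorphic_space Euclidean_space 2"
proof -
  obtain i where x: "x \<in> chart i (sigma x)" using assms by (rule ex_chart)
  let ?f = "chart_coord i (sigma x)" and ?C = "chart i (sigma x)"
  have h: "homeomorphism ?C (chart_range i) ?f (chart_inv i (sigma x))" by (rule chart_homeomorphism)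
  have "?f x \<in> chart_range i" using x chart_image by blast
  then obtain r where r: "r > 0" "ball (?f x) r \<subseteq> chart_range i"
    using open_chart_range open_contains_ball by blast
  define U where "U = chart_inv i (sigma x) ` ball (?f x) r"
  have cC: "chart_inv i (sigma x) ` chart_range i = ?C" using h by (auto simp: homeomorphism_def)
  have US: "U \<subseteq> ?C" unfolding U_def using cC r(2) by blast
  have "homeomorphism (ball (?f x) r) U (chart_inv i (sigma x)) ?f"
    using homeomorphism_of_subsets[OF homeomorphism_symD[OF h] r(2) US] U_def by blast
  then have "U homeomorphic ball (?f x) r" using homeomorphism_symD homeomorphic_def by blast
  also have "ball (?f x) r homeomorphic (UNIV :: complex set)" by (rule homeomorphic_ball_UNIV[OF r(1)])
  finally have "top_of_set U homeomorphic_space Cx"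
    unfolding homeomorphic_space_iff_homeomorphic[symmetric] by simp
  then have "top_of_set U homeomorphic_space Euclidean_space 2"
    using homeomorphic_Euclidean_space_2 homeomorphic_space_trans by blast
  moreover have "subtopology Xs U = top_of_set U" by (intro subtopology_chart order_trans[OF US chart_hexsurf])
  moreover have "x \<in> U"
    unfolding U_def using r(1) h x by (auto simp: homeomorphism_def intro!: image_eqI[of _ _ "?f x"])
  moreover have "openin Xs U"
  proof -
    have "openin (top_of_set ?C) U"
      unfolding U_def by (rule homeomorphism_imp_open_map[OF homeomorphism_symD[OF h]])
        (use r(2) in \<open>auto intro: open_subset\<close>)
    then show ?thesis using openin_trans[of ?C U hexsurf] openin_chart by blast
  qed
  ultimately show ?thesis by (intro exI[of _ U]) simp
qed

lemma closed_connected_hexsurf: "closed_connected_surface Xs"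
  unfolding closed_connected_surface_def
proof (intro conjI ballI)
  show "topspace Xs \<noteq> {}" using tile_ctr_hexsurf[of "\<lambda>_. True"] by (metis empty_iff topspace_euclidean_subtopology)
  show "Hausdorff_space Xs" by (intro Hausdorff_space_subtopology Hausdorff_space_euclidean)
  show "second_countable Xs" by (intro second_countable_subtopology second_countable_euclidean)
  show "compact_space Xs" by (intro compact_space_subtopology) (simp add: compact_hexsurf)
  show "connected_space Xs"
    by (intro connected_space_subtopology) (simp add: path_connected_imp_connected path_connected_hexsurf)
  show "\<exists>U. openin Xs U \<and> x \<in> U \<and> subtopology Xs U homeomorphic_space Euclidean_space 2" if "x \<in> topspace Xs" for x
    using locally_Euclidean_hexsurf that by simp
qed

text \<open>Two of the eight circles on which the coordinate \<open>S0\<close> vanishes. On each,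
  the signs at \<open>S2\<close>, \<open>S3\<close> and \<open>S4\<close> are constant, and the
  coordinates \<open>S1\<close> and \<open>S5\<close> run through a unit circle.\<close>

definition zero_circle :: "bool \<Rightarrow> (real^side) set" where
  "zero_circle b = {x \<in> hexsurf. x $ S0 = 0 \<and> x $ S2 > 0 \<and> x $ S4 > 0 \<and> x $ S3 * sg b > 0}"

lemma hexsurf_S0:
  assumes "x \<in> hexsurf" "x $ S0 = 0"
  shows "(x $ S2)\<^sup>2 = 1 + (x $ S1)\<^sup>2" "(x $ S4)\<^sup>2 = 1 + (x $ S5)\<^sup>2" "(x $ S1)\<^sup>2 + (x $ S5)\<^sup>2 = 1" "(x $ S3)\<^sup>2 = 2"
  using assms unfolding hexsurf_def all_side mem_Collect_eq nx.simps by simp_all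

lemma zero_circle_sphere: "zero_circle b homeomorphic sphere (0::complex) 1"
proof -
  let ?f = "\<lambda>x. Complex (x $ S1) (x $ S5)"
  define g :: "complex \<Rightarrow> real^side" where "g z = (\<chi> j. case j of S0 \<Rightarrow> 0 | S1 \<Rightarrow> Re z | S2 \<Rightarrow> sqrt (1 + (Re z)\<^sup>2)
     | S3 \<Rightarrow> sg b * sqrt 2 | S4 \<Rightarrow> sqrt (1 + (Im z)\<^sup>2) | S5 \<Rightarrow> Im z)" for z
  have sph: "z \<in> sphere 0 1 \<longleftrightarrow> (Re z)\<^sup>2 + (Im z)\<^sup>2 = 1" for z :: complex
    by (simp add: cmod_def)
  have pos: "1 + r\<^sup>2 > 0" for r :: real by (simp add: add_pos_nonneg)
  have "homeomorphism (zero_circle b) (sphere 0 1) ?f g"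
  proof (rule homeomorphismI)
    show "continuous_on (zero_circle b) ?f" by (intro continuous_on_Complex continuous_intros)
    show "continuous_on (sphere 0 1) g"
      unfolding g_def
    proof (rule continuous_on_vec_lambda)
      show "continuous_on (sphere 0 1) (\<lambda>z. case j of S0 \<Rightarrow> 0 | S1 \<Rightarrow> Re z | S2 \<Rightarrow> sqrt (1 + (Re z)\<^sup>2)
         | S3 \<Rightarrow> sg b * sqrt 2 | S4 \<Rightarrow> sqrt (1 + (Im z)\<^sup>2) | S5 \<Rightarrow> Im z)" for j
        by (cases j; simp; intro continuous_intros)
    qed
    show "?f ` zero_circle b \<subseteq> sphere 0 1" unfolding image_subset_iff sph by (auto simp: zero_circle_def hexsurf_S0)
    show "g ` sphere 0 1 \<subseteq> zero_circle b"
    proof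
      fix x assume "x \<in> g ` sphere 0 1"
      then obtain z where z: "(Re z)\<^sup>2 + (Im z)\<^sup>2 = 1" "x = g z" unfolding image_iff Bex_def sph by blast
      have hexsurf: "x \<in> hexsurf" unfolding hexsurf_def all_side mem_Collect_eq nx.simps
        using z(1) by (simp add: z(2) g_def power_mult_distrib)
      have "x $ S0 = 0" "x $ S2 > 0" "x $ S4 > 0" "x $ S3 * sg b > 0"
        by (cases b; simp add: z(2) g_def pos)+
      then show "x \<in> zero_circle b" using hexsurf by (simp add: zero_circle_def)
    qed
    show "g (?f x) = x" if "x \<in> zero_circle b" for x
    proof -
      have x: "x \<in> hexsurf" "x $ S0 = 0" "x $ S2 > 0" "x $ S4 > 0" "x $ S3 * sg b > 0" using that by (auto simp: zero_circle_def)
      have "g (?f x) $ j = x $ j" for j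
      proof (cases j)
        case S2
        then show ?thesis using x(3) hexsurf_S0(1)[OF x(1,2), symmetric] by (simp add: g_def)
      next
        case S4
        then show ?thesis using x(4) hexsurf_S0(2)[OF x(1,2), symmetric] by (simp add: g_def)
      next
        case S3
        have "sqrt 2 = \<bar>x $ S3\<bar>" using hexsurf_S0(4)[OF x(1,2)] by (metis real_sqrt_abs)
        then show ?thesis using S3 x(5) by (cases b) (auto simp: g_def)
      qed (simp_all add: g_def x(2))
      then show ?thesis by (simp add: Finite_Cartesian_Product.vec_eq_iff)
    qed
    show "?f (g z) = z" if "z \<in> sphere 0 1" for z by (simp add: g_def)
  qed
  then show ?thesis using homeomorphic_def by blast
qed

lemma zero_circle_curve: "simple_closed_curve_in Xs (zero_circle b)"
proof -
  have s: "zero_circle b \<subseteq> hexsurf" by (auto simp: zero_circle_def)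
  have "top_of_set (zero_circle b) homeomorphic_space top_of_set (sphere (0::complex) 1)"
    using zero_circle_sphere by simp
  then show ?thesis
    unfolding simple_closed_curve_in_def subtopology_chart[OF s]
    using homeomorphic_space_trans[OF \<open>top_of_set (zero_circle b) homeomorphic_space top_of_set (sphere (0::complex) 1)\<close>
      homeomorphic_space_sym[THEN iffD1, OF nsphere_1]] s by simp
qed

definition cut_surf :: "(real^side) set" where
  "cut_surf = {x \<in> hexsurf. x $ S0 = 0 \<longrightarrow> \<not> (x $ S2 > 0 \<and> x $ S4 > 0)}"

lemma cut_surf_eq: "hexsurf - \<Union>{zero_circle True, zero_circle False} = cut_surf"
proof -
  have "x $ S3 \<noteq> 0" if "x \<in> hexsurf" "x $ S0 = 0" for x using hexsurf_S0(4)[OF that] by auto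
  then show ?thesis by (auto simp: cut_surf_def zero_circle_def less_le)
qed

lemma path_connected_cut_surf: "path_connected cut_surf"
proof (rule path_connected_tiles)
  show c: "tile_ctr c \<in> cut_surf" for c by (simp add: cut_surf_def)
  show "x \<in> hexsurf \<and> path_image (tile_path x) \<subseteq> cut_surf" if "x \<in> cut_surf" for x
  proof -
    have x: "x \<in> hexsurf" using that by (simp add: cut_surf_def)
    have "tile_path x t \<in> cut_surf" if t: "t \<in> {0..1}" for t
    proof (cases "t = 1")
      case True
      then show ?thesis using tile_path_finish[OF x] \<open>x \<in> cut_surf\<close> by (simp add: pathfinish_def)
    next
      case False
      then have "tile_path x t $ S0 \<noteq> 0" using tile_path_sign[OF x t, of S0] t by auto
      then show ?thesis using tile_path_hexsurf[OF x t] by (simp add: cut_surf_def)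
    qed
    then show ?thesis using x by (auto simp: path_image_def)
  qed
  have pc: "path_component cut_surf (tile_ctr c) (tile_ctr (flip c j))" if "j = S0 \<longrightarrow> \<not> c S2" for c j
  proof -
    have "edge_path c j t \<in> cut_surf" if t: "t \<in> {0..1}" for t
    proof (cases "j = S0")
      case True
      then have "\<not> edge_path c j t $ S2 > 0" using edge_path_sq(2)[OF t, of S2 S0 c] \<open>j = S0 \<longrightarrow> \<not> c S2\<close> by simp
      then show ?thesis using edge_path_hexsurf[OF t] by (simp add: cut_surf_def)
    next
      case False
      then have "edge_path c j t $ S0 \<noteq> 0" using edge_path_sq(2)[OF t, of S0 j c] by auto
      then show ?thesis using edge_path_hexsurf[OF t] by (simp add: cut_surf_def)
    qed
    then show ?thesis
      unfolding path_component_def by (intro exI[of _ "edge_path c j"]) (auto simp: path_image_def)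
  qed
  show "path_component cut_surf (tile_ctr c) (tile_ctr (flip c j))" for c j
  proof (cases "j = S0 \<and> c S2")
    case True
    \<comment> \<open>A way round the cut: \<open>S0\<close> is blocked only where \<open>S2\<close>
      and \<open>S4\<close> are positive, so \<open>S2\<close> is crossed before and after.\<close>
    have "path_component cut_surf (tile_ctr c) (tile_ctr (flip c S2))" by (rule pc) simp
    moreover have "path_component cut_surf (tile_ctr (flip c S2)) (tile_ctr (flip (flip c S2) S0))"
      by (rule pc) (use True in \<open>simp add: flip_apply\<close>)
    moreover have "path_component cut_surf (tile_ctr (flip (flip c S2) S0)) (tile_ctr (flip (flip (flip c S2) S0) S2))"
      by (rule pc) simp
    moreover have "flip (flip (flip c S2) S0) S2 = flip c S0"
      by (rule ext) (simp add: flip_apply)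
    ultimately show ?thesis using True path_component_trans by metis
  next
    case False
    then show ?thesis using pc by blast
  qed
qed

lemma genus_hexsurf: "surface_genus Xs \<ge> 2"
proof -
  let ?C = "{zero_circle True, zero_circle False}"
  have ne: "zero_circle True \<noteq> {}" using zero_circle_sphere[of True] by (auto simp: homeomorphic_empty)
  have d: "zero_circle True \<inter> zero_circle False = {}" by (auto simp: zero_circle_def)
  have "zero_circle True \<noteq> zero_circle False" using ne d by auto
  then have "card ?C = 2" by simp
  moreover have "connected_space (subtopology Xs (topspace Xs - \<Union>?C))"
  proof -
    have "topspace Xs - \<Union>?C = cut_surf" using cut_surf_eq by simp
    moreover have "cut_surf \<subseteq> hexsurf" by (auto simp: cut_surf_def)
    ultimately show ?thesis
      using subtopology_chart[of cut_surf] connected_space_subtopology[of euclidean cut_surf]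
        path_connected_imp_connected[OF path_connected_cut_surf] by simp
  qed
  moreover have "disjoint ?C" using d by (auto simp: disjoint_def)
  ultimately have "enat 2 \<le> surface_genus Xs"
    unfolding surface_genus_def by (intro SUP_upper2[of ?C]) (auto simp: zero_circle_curve)
  then show ?thesis by (simp add: numeral_eq_enat)
qed

section \<open>Transport to the real numbers\<close>

text \<open>A point is encoded by the indices of the basic open sets that contain it, and sets of
  natural numbers embed into the reals.\<close>

lemma ex_injection_real: "\<exists>f :: 'a::{second_countable_topology,t2_space} \<Rightarrow> real. inj f"
proof -
  obtain B :: "'a set set" where B: "countable B" "\<And>C. C \<in> B \<Longrightarrow> open C" "\<And>S. open S \<Longrightarrow> \<exists>U. U \<subseteq> B \<and> S = \<Union>U"
    by (rule univ_second_countable) blast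
  let ?h = "\<lambda>x. {n. n \<in> to_nat_on B ` {C \<in> B. x \<in> C}}"
  have "inj ?h"
  proof (rule injI)
    fix x y :: 'a assume e: "?h x = ?h y"
    show "x = y"
    proof (rule ccontr)
      assume "x \<noteq> y"
      then obtain U where U: "open U" "x \<in> U" "y \<notin> U" by (meson hausdorff disjoint_iff)
      then obtain C where C: "C \<in> B" "x \<in> C" "y \<notin> C" using B(3)[OF U(1)] by blast
      then have "to_nat_on B C \<in> ?h y" using e by blast
      then obtain D where "D \<in> B" "y \<in> D" "to_nat_on B C = to_nat_on B D" by blast
      then show False using C inj_on_to_nat_on[OF B(1)] by (auto dest: inj_onD)
    qed
  qed
  moreover obtain g :: "nat set \<Rightarrow> real" where "inj g"
    using nat_sets_eqpoll_reals by (auto simp: eqpoll_def bij_betw_def)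
  ultimately have "inj (g \<circ> ?h)" by (rule inj_compose[rotated])
  then show ?thesis by blast
qed

lemma ex_real_copy:
  fixes S :: "('a::{second_countable_topology,t2_space}) set"
  shows "\<exists>(Y :: real topology) f g. homeomorphic_maps (top_of_set S) Y f g"
proof -
  obtain f :: "'a \<Rightarrow> real" where f: "inj f" using ex_injection_real by blast
  let ?g = "inv_into UNIV f"
  let ?Y = "pullback_topology (f ` S) ?g (top_of_set S)"
  have "homeomorphic_maps (top_of_set S) ?Y f ?g"
    unfolding homeomorphic_maps_def
  proof (intro conjI ballI)
    show "continuous_map (top_of_set S) ?Y f"
    proof (rule continuous_map_pullback')
      show "continuous_map (top_of_set S) (top_of_set S) (?g \<circ> f)"
        using f by simp
    qed auto
    show "continuous_map ?Y (top_of_set S) ?g"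
      using continuous_map_pullback[of "top_of_set S" "top_of_set S" id "f ` S" "?g"] by simp
  qed (use f in \<open>auto simp: topspace_pullback_topology\<close>)
  then show ?thesis by blast
qed

lemma closed_connected_surface_homeomorphic:
  assumes h: "homeomorphic_maps X Y f g" and X: "closed_connected_surface X"
  shows "closed_connected_surface Y"
  unfolding closed_connected_surface_def
proof (intro conjI ballI)
  have XY: "X homeomorphic_space Y" using h homeomorphic_space_def by blast
  have m: "homeomorphic_map X Y f" using h homeomorphic_map_maps by blast
  note X' = X[unfolded closed_connected_surface_def]
  show "topspace Y \<noteq> {}" using X' homeomorphic_imp_surjective_map[OF m] by auto
  show "Hausdorff_space Y" using X' homeomorphic_Hausdorff_space[OF XY] by blast
  show "second_countable Y" using X' homeomorphic_space_second_countability[OF XY] by blast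
  show "compact_space Y" using X' homeomorphic_compact_space[OF XY] by blast
  show "connected_space Y" using X' homeomorphic_connected_space[OF XY] by blast
  fix y assume "y \<in> topspace Y"
  then obtain x where x: "x \<in> topspace X" "y = f x" using homeomorphic_imp_surjective_map[OF m] by blast
  then obtain U where U: "openin X U" "x \<in> U" "subtopology X U homeomorphic_space Euclidean_space 2" using X' by blast
  have "openin Y (f ` U)" using homeomorphic_imp_open_map[OF m] U(1) by (simp add: open_map_def)
  moreover have "homeomorphic_map (subtopology X U) (subtopology Y (f ` U)) f"
    by (rule homeomorphic_map_subtopologies[OF m])
      (use openin_subset[OF U(1)] homeomorphic_imp_surjective_map[OF m] in blast)
  then have "subtopology Y (f ` U) homeomorphic_space Euclidean_space 2"
    using U(3) homeomorphic_map_imp_homeomorphic_space homeomorphic_space_sym homeomorphic_space_trans by metis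
  ultimately show "\<exists>U. openin Y U \<and> y \<in> U \<and> subtopology Y U homeomorphic_space Euclidean_space 2"
    using x(2) U(2) by blast
qed

lemma surface_genus_homeomorphic:
  assumes h: "homeomorphic_maps X Y f g"
  shows "surface_genus X \<le> surface_genus Y"
  unfolding surface_genus_def
proof (rule SUP_mono)
  have m: "homeomorphic_map X Y f" using h homeomorphic_map_maps by blast
  have sur: "f ` topspace X = topspace Y" using homeomorphic_imp_surjective_map[OF m] .
  have inj: "inj_on f (topspace X)" using homeomorphic_imp_injective_map[OF m] .
  fix \<C> assume "\<C> \<in> {\<C>. finite \<C> \<and> disjoint \<C> \<and> (\<forall>C \<in> \<C>. simple_closed_curve_in X C) \<and>
                   connected_space (subtopology X (topspace X - \<Union>\<C>))}"
  then have C: "finite \<C>" "disjoint \<C>" "\<And>C. C \<in> \<C> \<Longrightarrow> simple_closed_curve_in X C"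
    "connected_space (subtopology X (topspace X - \<Union>\<C>))" by auto
  have sub: "C \<subseteq> topspace X" if "C \<in> \<C>" for C using C(3)[OF that] by (simp add: simple_closed_curve_in_def)
  have st: "homeomorphic_map (subtopology X S) (subtopology Y (f ` S)) f" if "S \<subseteq> topspace X" for S
    by (rule homeomorphic_map_subtopologies[OF m]) (use that sur in blast)
  let ?D = "(`) f ` \<C>"
  have "inj_on ((`) f) \<C>"
    using inj sub by (meson inj_on_image_eq_iff inj_onI)
  then have "card ?D = card \<C>" by (rule card_image)
  moreover have "disjoint ?D"
    unfolding disjoint_def
  proof (intro ballI impI)
    fix A B assume "A \<in> ?D" "B \<in> ?D" "A \<noteq> B"
    then obtain A' B' where ab: "A = f ` A'" "B = f ` B'" "A' \<in> \<C>" "B' \<in> \<C>" "A' \<noteq> B'" by blast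
    then have "A' \<inter> B' = {}" using C(2) by (auto simp: disjoint_def)
    then show "A \<inter> B = {}"
      using inj_on_image_Int[OF inj sub[OF ab(3)] sub[OF ab(4)]] ab by simp
  qed
  moreover have "simple_closed_curve_in Y D" if D: "D \<in> ?D" for D
  proof -
    obtain A where A: "D = f ` A" "A \<in> \<C>" using D by blast
    have "subtopology X A homeomorphic_space subtopology Y (f ` A)"
      using st[OF sub[OF A(2)]] homeomorphic_map_imp_homeomorphic_space by blast
    then show ?thesis
      using C(3)[OF A(2)] A sur unfolding simple_closed_curve_in_def
      by (metis homeomorphic_space_sym homeomorphic_space_trans image_mono)
  qed
  moreover have "connected_space (subtopology Y (topspace Y - \<Union>?D))"
  proof -
    have U: "\<Union>\<C> \<subseteq> topspace X" using sub by blast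
    have "topspace Y - \<Union>?D = f ` (topspace X - \<Union>\<C>)"
      using inj_on_image_set_diff[OF inj _ U, of "topspace X"] sur by (simp add: image_Union)
    then show ?thesis
      using C(4) st[of "topspace X - \<Union>\<C>"] homeomorphic_map_imp_homeomorphic_space homeomorphic_connected_space
      by (metis Diff_subset)
  qed
  ultimately show "\<exists>\<D>\<in>{\<C>. finite \<C> \<and> disjoint \<C> \<and> (\<forall>C \<in> \<C>. simple_closed_curve_in Y C) \<and>
                   connected_space (subtopology Y (topspace Y - \<Union>\<C>))}. enat (card \<C>) \<le> enat (card \<D>)"
    using C(1) by (intro bexI[of _ ?D]) auto
qed

lemma orientable_surface_homeomorphic:
  assumes h: "homeomorphic_maps X Y f g" and X: "orientable_surface X"
  shows "orientable_surface Y"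
proof -
  have m: "homeomorphic_map X Y f" using h homeomorphic_map_maps by blast
  have sur: "f ` topspace X = topspace Y" using homeomorphic_imp_surjective_map[OF m] .
  have inj: "inj_on f (topspace X)" using homeomorphic_imp_injective_map[OF m] .
  have c: "continuous_map X Y f" using homeomorphic_imp_continuous_map[OF m] .
  have gf: "g (f x) = x" if "x \<in> topspace X" for x using h that by (simp add: homeomorphic_maps_def)
  obtain \<mu> where mu: "\<And>x. x \<in> topspace X \<Longrightarrow> carrier (HX X x) = generate (HX X x) {\<mu> x}"
    "\<And>x. x \<in> topspace X \<Longrightarrow> \<exists>U. openin X U \<and> x \<in> U \<and> (\<exists>\<alpha> \<in> carrier (relative_homology_group 2 X (topspace X - U)).
               \<forall>y \<in> U. hom_induced 2 X (topspace X - U) X (topspace X - {y}) id \<alpha> = \<mu> y)"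
    using X unfolding orientable_surface_def Let_def by blast
  let ?F = "\<lambda>S. hom_induced 2 X (topspace X - S) Y (topspace Y - f ` S) f"
  define \<nu> where "\<nu> y = ?F {g y} (\<mu> (g y))" for y
  have im: "f ` (topspace X - S) = topspace Y - f ` S" if "S \<subseteq> topspace X" for S
    using inj_on_image_set_diff[OF inj _ that, of "topspace X"] sur by simp
  show ?thesis
    unfolding orientable_surface_def Let_def
  proof (intro exI[of _ \<nu>] conjI ballI)
    fix y assume "y \<in> topspace Y"
    then obtain x where x: "x \<in> topspace X" "y = f x" using sur by blast
    have nu: "\<nu> y = ?F {x} (\<mu> x)" by (simp add: \<nu>_def x gf)
    have iso: "?F {x} \<in> iso (HX X x) (HX Y y)"
      using homeomorphic_map_relative_homology_iso[OF m, of "topspace X - {x}" "topspace Y - f ` {x}" 2] im[of "{x}"] x by simp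
    interpret F: group_hom "HX X x" "HX Y y" "?F {x}"
      using iso by (auto simp: group_hom_def group_hom_axioms_def iso_def)
    have "\<mu> x \<in> carrier (HX X x)"
      unfolding mu(1)[OF x(1)] by (rule generate.incl) simp
    then have "?F {x} ` generate (HX X x) {\<mu> x} = generate (HX Y y) {\<nu> y}"
      using F.generate_img[of "{\<mu> x}"] nu by simp
    then show "carrier (HX Y y) = generate (HX Y y) {\<nu> y}"
      using mu(1)[OF x(1)] iso by (auto simp: iso_def bij_betw_def)
    obtain U \<alpha> where U: "openin X U" "x \<in> U" "\<alpha> \<in> carrier (relative_homology_group 2 X (topspace X - U))"
      "\<And>z. z \<in> U \<Longrightarrow> hom_induced 2 X (topspace X - U) X (topspace X - {z}) id \<alpha> = \<mu> z"
      using mu(2)[OF x(1)] by blast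
    have UX: "U \<subseteq> topspace X" using U(1) by (rule openin_subset)
    have "hom_induced 2 Y (topspace Y - f ` U) Y (topspace Y - {f z}) id (?F U \<alpha>) = \<nu> (f z)" if z: "z \<in> U" for z
    proof -
      have zX: "z \<in> topspace X" using z UX by blast
      have i1: "f \<in> (topspace X - U) \<rightarrow> (topspace Y - f ` U)" using im[OF UX] by blast
      have i2: "id \<in> (topspace Y - f ` U) \<rightarrow> (topspace Y - {f z})" using z by auto
      have i3: "id \<in> (topspace X - U) \<rightarrow> (topspace X - {z})" using z by auto
      have i4: "f \<in> (topspace X - {z}) \<rightarrow> (topspace Y - {f z})" using im[of "{z}"] zX by auto
      have "hom_induced 2 Y (topspace Y - f ` U) Y (topspace Y - {f z}) id (?F U \<alpha>)
        = hom_induced 2 X (topspace X - U) Y (topspace Y - {f z}) (id \<circ> f) \<alpha>"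
        by (rule hom_induced_compose'[OF c i1 continuous_map_id i2])
      also have "\<dots> = hom_induced 2 X (topspace X - U) Y (topspace Y - {f z}) (f \<circ> id) \<alpha>" by simp
      also have "\<dots> = hom_induced 2 X (topspace X - {z}) Y (topspace Y - {f z}) f (hom_induced 2 X (topspace X - U) X (topspace X - {z}) id \<alpha>)"
        by (rule hom_induced_compose'[OF continuous_map_id i3 c i4, symmetric])
      also have "\<dots> = \<nu> (f z)" unfolding U(4)[OF z] by (simp add: \<nu>_def gf[OF zX])
      finally show ?thesis .
    qed
    then have "\<forall>w\<in>f ` U. hom_induced 2 Y (topspace Y - f ` U) Y (topspace Y - {w}) id (?F U \<alpha>) = \<nu> w" by blast
    moreover have "openin Y (f ` U)" using homeomorphic_imp_open_map[OF m] U(1) by (simp add: open_map_def)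
    moreover have "y \<in> f ` U" using x U(2) by blast
    moreover have "?F U \<alpha> \<in> carrier (relative_homology_group 2 Y (topspace Y - f ` U))" by (rule hom_induced_carrier)
    ultimately show "\<exists>V. openin Y V \<and> y \<in> V \<and> (\<exists>\<alpha> \<in> carrier (relative_homology_group 2 Y (topspace Y - V)).
               \<forall>w \<in> V. hom_induced 2 Y (topspace Y - V) Y (topspace Y - {w}) id \<alpha> = \<nu> w)" by blast
  qed
qed

section \<open>The fundamental group\<close>

context
  fixes Y :: "real topology" and f :: "real^side \<Rightarrow> real" and g :: "real \<Rightarrow> real^side"
  assumes fg: "homeomorphic_maps Xs Y f g"
begin

definition "basept = f (tile_ctr base_tile)"

abbreviation "I01 \<equiv> top_of_set {0..1::real}"
abbreviation "loop_homotopic \<equiv> homotopic_with (\<lambda>r. r 0 = basept \<and> r 1 = basept) I01 Y"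

lemma fg_facts: "continuous_map Xs Y f" "continuous_map Y Xs g" "x \<in> hexsurf \<Longrightarrow> g (f x) = x" "y \<in> topspace Y \<Longrightarrow> f (g y) = y"
  "x \<in> hexsurf \<Longrightarrow> f x \<in> topspace Y" "basept \<in> topspace Y" "g basept = tile_ctr base_tile"
proof -
  show c: "continuous_map Xs Y f" "continuous_map Y Xs g" and gf: "x \<in> hexsurf \<Longrightarrow> g (f x) = x" 
    and "y \<in> topspace Y \<Longrightarrow> f (g y) = y" for x y
    using fg by (auto simp: homeomorphic_maps_def)
  show fs: "x \<in> hexsurf \<Longrightarrow> f x \<in> topspace Y" for x
    using continuous_map_image_subset_topspace[OF c(1)] by auto
  show "basept \<in> topspace Y" "g basept = tile_ctr base_tile" using fs[OF tile_ctr_hexsurf] gf[OF tile_ctr_hexsurf] by (auto simp: basept_def)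
qed

lemma loop_homotopic_sym: "loop_homotopic p q \<Longrightarrow> loop_homotopic q p"
  by (rule homotopic_with_symD)

lemma loop_homotopic_trans: "loop_homotopic p q \<Longrightarrow> loop_homotopic q r \<Longrightarrow> loop_homotopic p r"
  by (rule homotopic_with_trans)

lemma loop_homotopic_push:
  assumes "homotopic_paths hexsurf p q" "pathstart p = tile_ctr base_tile" "pathfinish p = tile_ctr base_tile"
  shows "loop_homotopic (f \<circ> p) (f \<circ> q)"
proof -
  have "homotopic_with_canon (\<lambda>r. pathstart r = pathstart p \<and> pathfinish r = pathfinish p) {0..1} hexsurf p q"
    using assms(1) by (simp add: homotopic_paths_def)
  then show ?thesis
    by (rule homotopic_with_compose_continuous_map_left[OF _ fg_facts(1)])
       (use assms in \<open>auto simp: pathstart_def pathfinish_def basept_def\<close>)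
qed

lemma loop_homotopic_pull:
  assumes "loop_homotopic p q"
  shows "homotopic_paths hexsurf (g \<circ> p) (g \<circ> q)"
proof -
  have "p 0 = basept \<and> p 1 = basept" using homotopic_with_imp_property[OF assms] by simp
  then show ?thesis
    unfolding homotopic_paths_def
    by (intro homotopic_with_compose_continuous_map_left[OF assms fg_facts(2)])
       (auto simp: pathstart_def pathfinish_def)
qed

text \<open>\<open>f \<circ> (g \<circ> p)\<close> agrees with \<open>p\<close> on the unit
  interval, outside of which \<open>p\<close> is arbitrary; hence a homotopy and not an
  equation.\<close>

lemma loop_homotopic_refl:
  assumes "pathin Y p" "p 0 = basept" "p 1 = basept"
  shows "loop_homotopic p p" "loop_homotopic (f \<circ> (g \<circ> p)) p"
proof -
  have c: "continuous_map I01 Y p" using assms(1) by (simp add: pathin_def)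
  show "loop_homotopic p p" using c assms by simp
  have fgp: "continuous_map I01 Y (f \<circ> (g \<circ> p))"
    using continuous_map_compose[OF c continuous_map_compose[OF fg_facts(2,1)]] by (simp add: o_assoc)
  have "p x \<in> topspace Y" if "x \<in> {0..1}" for x
    using continuous_map_image_subset_topspace[OF c] that by auto
  then show "loop_homotopic (f \<circ> (g \<circ> p)) p"
    using fgp assms fg_facts(4) by (intro homotopic_with_equal) (auto simp: fg_facts(6))
qed

lemma loop_homotopic_imp_pathin:
  assumes "loop_homotopic p q"
  shows "pathin Y p \<and> p 0 = basept \<and> p 1 = basept"
  using homotopic_with_imp_continuous_maps[OF assms] homotopic_with_imp_property[OF assms]
  by (simp add: pathin_def)

abbreviation "cls \<equiv> loop_class Y basept"
abbreviation "N w \<equiv> f \<circ> word_path base_tile w"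

lemma cls_eq:
  assumes "loop_homotopic p p" "loop_homotopic q q"
  shows "cls p = cls q \<longleftrightarrow> loop_homotopic p q"
proof
  assume "cls p = cls q"
  then show "loop_homotopic p q" using assms(2) by (auto simp: loop_class_def)
next
  assume pq: "loop_homotopic p q"
  show "cls p = cls q"
    unfolding loop_class_def using loop_homotopic_trans[OF pq] loop_homotopic_trans[OF loop_homotopic_sym[OF pq]] by (intro Collect_cong iffI)
qed

lemma N_facts:
  assumes "run base_tile w = base_tile"
  shows "loop_homotopic (N w) (N w)" "N w \<in> loops_at Y basept" "homotopic_paths hexsurf (g \<circ> N w) (word_path base_tile w)"
proof -
  have "homotopic_paths hexsurf (word_path base_tile w) (word_path base_tile w)" by (simp add: word_path_image_hexsurf)
  then show l: "loop_homotopic (N w) (N w)" by (rule loop_homotopic_push) (simp_all add: assms)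
  show "N w \<in> loops_at Y basept" using loop_homotopic_imp_pathin[OF l] by (simp add: loops_at_def)
  have im: "word_path base_tile w t \<in> hexsurf" if "t \<in> {0..1}" for t using word_path_image_hexsurf[of base_tile w] that by (auto simp: path_image_def)
  show "homotopic_paths hexsurf (g \<circ> N w) (word_path base_tile w)"
    by (rule homotopic_paths_eq[OF _ _ , THEN homotopic_paths_sym]) (use im in \<open>simp_all add: word_path_image_hexsurf fg_facts(3)\<close>)
qed

lemma cls_N_eq:
  assumes "run base_tile u = base_tile" "run base_tile v = base_tile"
  shows "cls (N u) = cls (N v) \<longleftrightarrow> weq u v"
proof -
  have "loop_homotopic (N u) (N v) \<longleftrightarrow> weq u v"
  proof
    assume "loop_homotopic (N u) (N v)"
    then have "homotopic_paths hexsurf (g \<circ> N u) (g \<circ> N v)" by (rule loop_homotopic_pull)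
    then have "homotopic_paths hexsurf (word_path base_tile u) (word_path base_tile v)"
      by (rule homotopic_paths_trans[OF homotopic_paths_trans[OF homotopic_paths_sym[OF N_facts(3)[OF assms(1)]]] N_facts(3)[OF assms(2)]])
    then show "weq u v" by (rule homotopic_word_path_imp_weq)
  next
    assume "weq u v"
    then have "homotopic_paths hexsurf (word_path base_tile u) (word_path base_tile v)" by (rule word_path_weq)
    then show "loop_homotopic (N u) (N v)" by (rule loop_homotopic_push) (simp_all add: assms)
  qed
  then show ?thesis using cls_eq N_facts(1) assms by blast
qed

lemma cls_carrier: "cls ` loops_at Y basept = {cls (N w) | w. run base_tile w = base_tile}"
proof
  show "{cls (N w) | w. run base_tile w = base_tile} \<subseteq> cls ` loops_at Y basept" using N_facts(2) by blast
  show "cls ` loops_at Y basept \<subseteq> {cls (N w) | w. run base_tile w = base_tile}"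
  proof
    fix A assume "A \<in> cls ` loops_at Y basept"
    then obtain p where p: "A = cls p" "pathin Y p" "p 0 = basept" "p 1 = basept" by (auto simp: loops_at_def)
    have lp: "loop_homotopic p p" "loop_homotopic (f \<circ> (g \<circ> p)) p" by (rule loop_homotopic_refl[OF p(2-4)])+
    have "homotopic_paths hexsurf (g \<circ> p) (g \<circ> p)" by (rule loop_homotopic_pull[OF lp(1)])
    then have gp: "path (g \<circ> p)" "path_image (g \<circ> p) \<subseteq> hexsurf" by simp_all
    have se: "pathstart (g \<circ> p) = tile_ctr base_tile" "pathfinish (g \<circ> p) = tile_ctr base_tile"
      using p fg_facts(7) by (simp_all add: pathstart_def pathfinish_def)
    obtain w where w: "run base_tile w = base_tile" "homotopic_paths hexsurf (g \<circ> p) (word_path base_tile w)"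
      by (rule path_homotopic_word_path[OF gp se])
    have "loop_homotopic (f \<circ> (g \<circ> p)) (N w)" by (rule loop_homotopic_push[OF w(2) se])
    then have "loop_homotopic p (N w)" by (rule loop_homotopic_trans[OF loop_homotopic_sym[OF lp(2)]])
    then have "cls p = cls (N w)" using cls_eq[OF lp(1) N_facts(1)[OF w(1)]] by blast
    then show "A \<in> {cls (N w) | w. run base_tile w = base_tile}" using p(1) w(1) by blast
  qed
qed

lemma concat_loop_join: "g \<circ> concat_loop p q = (g \<circ> p) +++ (g \<circ> q)"
  by (auto simp: concat_loop_def joinpaths_def fun_eq_iff)

lemma cls_mult:
  assumes "run base_tile u = base_tile" "run base_tile v = base_tile"
  shows "(\<Union>p\<in>cls (N u). \<Union>q\<in>cls (N v). cls (concat_loop p q)) = cls (N (u @ v))"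
proof -
  have uv: "run base_tile (u @ v) = base_tile" using assms by (simp add: run_append)
  have *: "cls (concat_loop p q) = cls (N (u @ v))" if pq: "p \<in> cls (N u)" "q \<in> cls (N v)" for p q
  proof -
    have p: "loop_homotopic p (N u)" and q: "loop_homotopic q (N v)"
      using pq[unfolded loop_class_def mem_Collect_eq] by (blast intro: loop_homotopic_sym)+
    have gp: "homotopic_paths hexsurf (g \<circ> p) (word_path base_tile u)"
      using homotopic_paths_trans[OF loop_homotopic_pull[OF p] N_facts(3)[OF assms(1)]] .
    have gq: "homotopic_paths hexsurf (g \<circ> q) (word_path base_tile v)"
      using homotopic_paths_trans[OF loop_homotopic_pull[OF q] N_facts(3)[OF assms(2)]] .
    have fin: "pathfinish (g \<circ> p) = pathstart (g \<circ> q)"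
      using loop_homotopic_imp_pathin[OF p] loop_homotopic_imp_pathin[OF q] by (simp add: pathstart_def pathfinish_def)
    have "homotopic_paths hexsurf (g \<circ> concat_loop p q) (word_path base_tile u +++ word_path base_tile v)"
      unfolding concat_loop_join by (rule homotopic_paths_join[OF gp gq fin])
    moreover have "homotopic_paths hexsurf (word_path base_tile (u @ v)) (word_path base_tile u +++ word_path base_tile v)"
      using word_path_append[of base_tile u v] assms by simp
    ultimately have h: "homotopic_paths hexsurf (g \<circ> concat_loop p q) (word_path base_tile (u @ v))"
      by (rule homotopic_paths_trans[OF _ homotopic_paths_sym])
    have ends: "concat_loop p q 0 = basept" "concat_loop p q 1 = basept"
      using loop_homotopic_imp_pathin[OF p] loop_homotopic_imp_pathin[OF q] by (simp_all add: concat_loop_def)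
    have se: "pathstart (g \<circ> concat_loop p q) = tile_ctr base_tile" "pathfinish (g \<circ> concat_loop p q) = tile_ctr base_tile"
      using ends fg_facts(7) by (simp_all add: pathstart_def pathfinish_def)
    have l: "loop_homotopic (f \<circ> (g \<circ> concat_loop p q)) (N (u @ v))" by (rule loop_homotopic_push[OF h se])
    have pt: "concat_loop p q t \<in> topspace Y" if t: "t \<in> {0..1}" for t
    proof -
      have "s \<in> {0..1} \<Longrightarrow> p s \<in> topspace Y" "s \<in> {0..1} \<Longrightarrow> q s \<in> topspace Y" for s
      proof -
        have "continuous_map I01 Y p" "continuous_map I01 Y q"
          using loop_homotopic_imp_pathin[OF p] loop_homotopic_imp_pathin[OF q] by (simp_all add: pathin_def)
        from this[THEN continuous_map_image_subset_topspace]
        show "s \<in> {0..1} \<Longrightarrow> p s \<in> topspace Y" "s \<in> {0..1} \<Longrightarrow> q s \<in> topspace Y" by auto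
      qed
      then show ?thesis using t by (auto simp: concat_loop_def)
    qed
    have "loop_homotopic (f \<circ> (g \<circ> concat_loop p q)) (concat_loop p q)"
    proof (rule homotopic_with_equal)
      show "continuous_map I01 Y (f \<circ> (g \<circ> concat_loop p q))"
        using loop_homotopic_imp_pathin[OF l] by (simp add: pathin_def)
    qed (use pt ends fg_facts(4,6) in auto)
    then have 1: "loop_homotopic (concat_loop p q) (N (u @ v))"
      by (rule loop_homotopic_trans[OF loop_homotopic_sym l])
    have "loop_homotopic (concat_loop p q) (concat_loop p q)"
      by (rule loop_homotopic_trans[OF 1 loop_homotopic_sym[OF 1]])
    from cls_eq[OF this N_facts(1)[OF uv]] 1 show ?thesis by blast
  qed
  have "N u \<in> cls (N u)" "N v \<in> cls (N v)" using N_facts(1) assms by (auto simp: loop_class_def)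
  then show ?thesis using * by blast
qed

text \<open>Both groups are the closed words modulo \<open>weq\<close>: on the side of matrices by
  faithfulness, on the side of loops by \<open>cls_N_eq\<close>. The isomorphism may therefore pick
  any word that represents a matrix.\<close>

lemma fundamental_group_iso:
  assumes k: "k \<ge> 1"
  shows "(Sp_int (2 * k))\<lparr>carrier := hexrep_group k\<rparr> \<cong> fundamental_group Y basept"
proof -
  have hexrep_eq: "hexrep k base_tile u = hexrep k base_tile v \<longleftrightarrow> weq u v" if r: "run base_tile u = base_tile" "run base_tile v = base_tile" for u v
  proof
    assume e: "hexrep k base_tile u = hexrep k base_tile v"
    \<comment> \<open>The reversed word represents the inverse, so injectivity reduces to the
      triviality of a single word.\<close>
    have "hexrep k base_tile (u @ rev v) = hexrep k base_tile (v @ rev v)" using e r by (simp add: hexrep_append)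
    also have "\<dots> = 1\<^sub>m (4 * k)" using hexrep_weq[OF weq_append_rev, of k base_tile v] by simp
    finally have "weq (u @ rev v) []" by (rule hexrep_faithful[OF k])
    then have "weq ((u @ rev v) @ v) ([] @ v)" by (rule weq.app) simp
    moreover have "weq (u @ (rev v @ v)) (u @ [])" by (rule weq.app[OF _ weq_rev_append]) simp
    ultimately show "weq u v" by (metis append.assoc append_Nil append_Nil2 weq.sym weq.trans)
  qed (rule hexrep_weq)
  define h where "h A = cls (N (SOME w. run base_tile w = base_tile \<and> hexrep k base_tile w = A))" for A
  have h: "h (hexrep k base_tile w) = cls (N w)" if w: "run base_tile w = base_tile" for w
  proof -
    have "\<exists>v. run base_tile v = base_tile \<and> hexrep k base_tile v = hexrep k base_tile w" using w by blast
    from someI_ex[OF this] show ?thesis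
      unfolding h_def using cls_N_eq hexrep_eq w by blast
  qed
  have mult: "x \<otimes>\<^bsub>(Sp_int (2 * k))\<lparr>carrier := hexrep_group k\<rparr>\<^esub> y = x * y" for x y
    by (simp add: Sp_int_def Sp_real_def)
  have "h \<in> iso ((Sp_int (2 * k))\<lparr>carrier := hexrep_group k\<rparr>) (fundamental_group Y basept)"
  proof (rule isoI)
    show "h \<in> hom ((Sp_int (2 * k))\<lparr>carrier := hexrep_group k\<rparr>) (fundamental_group Y basept)"
    proof (rule homI)
      fix x assume "x \<in> carrier ((Sp_int (2 * k))\<lparr>carrier := hexrep_group k\<rparr>)"
      then obtain u where u: "x = hexrep k base_tile u" "run base_tile u = base_tile" by (auto simp: hexrep_group_def)
      then show "h x \<in> carrier (fundamental_group Y basept)"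
        unfolding fundamental_group_def using cls_carrier h by auto
      fix y assume "y \<in> carrier ((Sp_int (2 * k))\<lparr>carrier := hexrep_group k\<rparr>)"
      then obtain v where v: "y = hexrep k base_tile v" "run base_tile v = base_tile" by (auto simp: hexrep_group_def)
      have uv: "run base_tile (u @ v) = base_tile" using u v by (simp add: run_append)
      have "x * y = hexrep k base_tile (u @ v)" using u v by (simp add: hexrep_append)
      then show "h (x \<otimes>\<^bsub>(Sp_int (2 * k))\<lparr>carrier := hexrep_group k\<rparr>\<^esub> y) = h x \<otimes>\<^bsub>fundamental_group Y basept\<^esub> h y"
        unfolding mult using h[OF uv] h[OF u(2)] h[OF v(2)] u v cls_mult[OF u(2) v(2)]
        by (simp add: fundamental_group_def del: hexrep.simps)
    qed
    show "bij_betw h (carrier ((Sp_int (2 * k))\<lparr>carrier := hexrep_group k\<rparr>)) (carrier (fundamental_group Y basept))"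
      unfolding bij_betw_def
    proof
      show "inj_on h (carrier ((Sp_int (2 * k))\<lparr>carrier := hexrep_group k\<rparr>))"
      proof (rule inj_onI)
        fix x y assume "x \<in> carrier ((Sp_int (2 * k))\<lparr>carrier := hexrep_group k\<rparr>)" "y \<in> carrier ((Sp_int (2 * k))\<lparr>carrier := hexrep_group k\<rparr>)"
        then obtain u v where uv: "x = hexrep k base_tile u" "run base_tile u = base_tile" "y = hexrep k base_tile v" "run base_tile v = base_tile"
          by (auto simp: hexrep_group_def)
        assume "h x = h y"
        then show "x = y" using h[OF uv(2)] h[OF uv(4)] uv cls_N_eq hexrep_eq by simp
      qed
      have "h ` hexrep_group k = {cls (N w) | w. run base_tile w = base_tile}"
      proof
        show "h ` hexrep_group k \<subseteq> {cls (N w) | w. run base_tile w = base_tile}" unfolding hexrep_group_def using h by blast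
        show "{cls (N w) | w. run base_tile w = base_tile} \<subseteq> h ` hexrep_group k"
        proof
          fix L assume "L \<in> {cls (N w) | w. run base_tile w = base_tile}"
          then obtain w where w: "run base_tile w = base_tile" "L = cls (N w)" by blast
          have "hexrep k base_tile w \<in> hexrep_group k" using w(1) by (rule hexrep_base_tile)
          then show "L \<in> h ` hexrep_group k" using h[OF w(1)] w(2) by (metis imageI)
        qed
      qed
      then show "h ` carrier ((Sp_int (2 * k))\<lparr>carrier := hexrep_group k\<rparr>) = carrier (fundamental_group Y basept)"
        by (simp add: fundamental_group_def cls_carrier)
    qed
  qed
  then show ?thesis by (rule is_isoI)
qed

end

lemma surface_group_hexrep_group:
  assumes k: "k \<ge> 1"
  shows "surface_group ((Sp_int (2 * k))\<lparr>carrier := hexrep_group k\<rparr>)"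
proof -
  obtain Y :: "real topology" and f g where fg: "homeomorphic_maps Xs Y f g" using ex_real_copy[of hexsurf] by blast
  show ?thesis
    unfolding surface_group_def
  proof (intro exI conjI)
    show "closed_connected_surface Y" by (rule closed_connected_surface_homeomorphic[OF fg closed_connected_hexsurf])
    show "orientable_surface Y" by (rule orientable_surface_homeomorphic[OF fg orientable_hexsurf])
    show "2 \<le> surface_genus Y" using genus_hexsurf surface_genus_homeomorphic[OF fg] by (rule order_trans)
    show "basept f \<in> topspace Y" by (rule fg_facts(6)[OF fg])
    show "(Sp_int (2 * k))\<lparr>carrier := hexrep_group k\<rparr> \<cong> fundamental_group Y (basept f)"
      by (rule fundamental_group_iso[OF fg k])
  qed
qed

lemma subgroup_hexrep_group: "subgroup (hexrep_group k) (Sp_int (2 * k))"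
proof
  show "hexrep_group k \<subseteq> carrier (Sp_int (2 * k))" unfolding hexrep_group_def using hexrep_Sp_int by blast
  show "x \<otimes>\<^bsub>Sp_int (2 * k)\<^esub> y \<in> hexrep_group k" if "x \<in> hexrep_group k" "y \<in> hexrep_group k" for x y
    using hexrep_group_mult[OF that] by (simp add: Sp_int_def Sp_real_def)
  show "\<one>\<^bsub>Sp_int (2 * k)\<^esub> \<in> hexrep_group k" using hexrep_group_one[of k] by (simp add: Sp_int_def Sp_real_def)
  fix x assume "x \<in> hexrep_group k"
  then obtain w where w: "x = hexrep k base_tile w" "run base_tile w = base_tile" by (auto simp: hexrep_group_def)
  have r: "run base_tile (rev w) = base_tile"
  proof -
    have "run base_tile (w @ rev w) = run base_tile []" by (rule weq_run[OF weq_append_rev])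
    then show ?thesis unfolding run_append w(2) by simp
  qed
  let ?y = "hexrep k base_tile (rev w)"
  have xy: "x * ?y = 1\<^sub>m (4 * k)" "?y * x = 1\<^sub>m (4 * k)"
    using hexrep_weq[OF weq_append_rev, of k base_tile w] hexrep_weq[OF weq_rev_append, of k base_tile w]
    unfolding hexrep_append w r by simp_all
  have mem: "x \<in> carrier (Sp_int (2 * k))" "?y \<in> carrier (Sp_int (2 * k))" using hexrep_Sp_int[OF w(2), of k] hexrep_Sp_int[OF r, of k] w(1) by simp_all
  have mult: "a \<otimes>\<^bsub>Sp_int (2 * k)\<^esub> b = a * b" and one: "\<one>\<^bsub>Sp_int (2 * k)\<^esub> = 1\<^sub>m (4 * k)" for a b
    by (simp_all add: Sp_int_def Sp_real_def)
  \<comment> \<open>The inverse is a definite description, so its uniqueness is checked directly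
    from the associativity of matrix multiplication.\<close>
  have "inv\<^bsub>Sp_int (2 * k)\<^esub> x = ?y"
    unfolding m_inv_def
  proof (rule the_equality)
    show "?y \<in> carrier (Sp_int (2 * k)) \<and> x \<otimes>\<^bsub>Sp_int (2 * k)\<^esub> ?y = \<one>\<^bsub>Sp_int (2 * k)\<^esub> \<and>
        ?y \<otimes>\<^bsub>Sp_int (2 * k)\<^esub> x = \<one>\<^bsub>Sp_int (2 * k)\<^esub>"
      using mem xy by (simp add: mult one)
    fix z assume z: "z \<in> carrier (Sp_int (2 * k)) \<and> x \<otimes>\<^bsub>Sp_int (2 * k)\<^esub> z = \<one>\<^bsub>Sp_int (2 * k)\<^esub> \<and>
        z \<otimes>\<^bsub>Sp_int (2 * k)\<^esub> x = \<one>\<^bsub>Sp_int (2 * k)\<^esub>"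
    then have "z \<in> carrier (Sp_int (2 * k))" "x * z = 1\<^sub>m (4 * k)" by (simp_all add: mult one)
    then have zc: "z \<in> carrier_mat (4 * k) (4 * k)" "x * z = 1\<^sub>m (4 * k)" by (simp_all add: Sp_int_def Sp_real_def)
    have xc: "x \<in> carrier_mat (4 * k) (4 * k)" "?y \<in> carrier_mat (4 * k) (4 * k)" using w(1) by simp_all
    have "z = (?y * x) * z" using left_mult_one_mat[OF zc(1)] by (simp add: xy)
    also have "\<dots> = ?y * (x * z)" by (rule assoc_mult_mat[OF xc(2,1) zc(1)])
    finally show "z = ?y" using right_mult_one_mat[OF xc(2)] zc(2) by simp
  qed
  then show "inv\<^bsub>Sp_int (2 * k)\<^esub> x \<in> hexrep_group k" using r by (auto simp: hexrep_group_def)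
qed

theorem theorem1p1:
  fixes k :: nat
  assumes "k \<ge> 1"
  shows "\<exists>H. subgroup H (Sp_int (2 * k)) \<and>
             surface_group ((Sp_int (2 * k))\<lparr>carrier := H\<rparr>) \<and>
             zariski_dense_in (4 * k) H (carrier (Sp_real (2 * k)))"
  using subgroup_hexrep_group surface_group_hexrep_group[OF assms] hexrep_group_zariski_dense[OF assms] by blast

end
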